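(* Let $D=(0,\infty)$, let $\eta$ be a finite Borel measure on $D$, and let $$\varphi(x,z)=-c(x)z^2+\int_{\mathbb{R}^\circ}(e^{izu}-1-izu)\,m(x,du),\qquad x\in D,\ z\in\mathbb{R},$$ where $c$ is a bounded non-negative Borel function on $D$ and $u^2m(x,du)$ is a bounded kernel from $D$ to $\mathbb{R}^\circ=\mathbb{R}\setminus\{0\}$. Let $W(ds,dx)$ be a white noise on $[0,\infty)\times D$ with covariance measure $2c(x)\,ds\,\eta(dx)$ and let $N(ds,du,dx)$ be a Poisson random measure on $[0,\infty)\times\mathbb{R}^\circ\times D$ with intensity $ds\,m(x,du)\,\eta(dx)$, defined on a complete probability space $(\Omega,\mathcal{F},\mathbf{P})$ and independent of each other; set $\tilde N(ds,du,dx)=N(ds,du,dx)-ds\,m(x,du)\,\eta(dx)$. Then for each $t\ge0$ the function $$Z^0_t(\omega,y):=\int_0^t\int_D p_{t-s}(x,y)\,W(\omega,ds,dx)+\int_0^t\int_{\mathbb{R}^\circ}\int_D u\,p_{t-s}(x,y)\,\tilde N(\omega,ds,du,dx)$$ is well-defined in the $L^2(\Omega\times D,\mathbf{P}\times\lambda)$ sense, and $\{Z^0_t:t\ge0\}$ is a Markov process with state space $L^2(D,\lambda)$, initial value zero and transition semigroup $(R_t)_{t\ge0}$ given by $$\int_{L^2(D,\lambda)}e^{i\langle h,f\rangle}R_t(g,dh)=\exp\Big\{i\langle g,P_tf\rangle+\int_0^t\eta(\varphi(P_sf))\,ds\Big\},\qquad f\in L^2(D,\lambda).$$ Moreover, $Z^0_t(\omega,y)$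 can be chosen as a function of $(t,\omega,y)$ belonging to $L^2([0,T]\times\Omega\times D,\lambda\times\mathbf{P}\times\lambda)$ for each $T>0$.
   Context: $\lambda$ denotes Lebesgue measure; $\langle\cdot,\cdot\rangle$ is the inner product of the real Hilbert space $L^2(D,\lambda)$. Let $g_t(x)=(2\pi t)^{-1/2}\exp\{-x^2/2t\}$ for $t>0$, $x\in\mathbb{R}$, and $p_t(x,y)=g_t(x-y)-g_t(x+y)$ for $t>0$, $x,y\in D$. $(P_t)_{t\ge0}$ is the transition semigroup of the absorbing barrier Brownian motion in $D$: $P_0f=f$ and $P_tf(x)=\int_0^\infty p_t(x,y)f(y)\,dy$ for $t>0$, $x\in D$. Notation: $\eta(\varphi(P_sf))=\int_D\varphi(x,P_sf(x))\,\eta(dx)$. "$u^2m(x,du)$ is a bounded kernel" means that $m(x,du)$ is a kernel with $\sup_{x\in D}\int_{\mathbb{R}^\circ}u^2m(x,du)<\infty$. A white noise with covariance measure $\sigma$ is a centered Gaussian random measure $W$ with $\mathbf{E}[W(A)W(B)]=\sigma(A\cap B)$. Stochastic integrals with respect to $W$ and $\tilde N$ are the usual $L^2$ integrals. *)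

theory Defs
  imports "HOL-Probability.Probability"
begin

section \<open>The Hilbert space \<open>L\<^sup>2(D, \<lambda>)\<close>, \<open>D = (0, \<infinity>)\<close>\<close>

definition lambda_D :: "real measure" where
  "lambda_D = restrict_space lborel {0<..}"

definition square_integrable :: "'a measure \<Rightarrow> ('a \<Rightarrow> real) \<Rightarrow> bool" where
  "square_integrable M f \<longleftrightarrow> f \<in> borel_measurable M \<and> integrable M (\<lambda>x. (f x)\<^sup>2)"

lemma square_integrable_zero [simp]: "square_integrable M (\<lambda>_. 0)"
  by (simp add: square_integrable_def)

lemma square_integrable_mult:
  assumes "square_integrable M f" "square_integrable M g"
  shows "integrable M (\<lambda>x. f x * g x)"
proof (rule Bochner_Integration.integrable_bound)
  show "integrable M (\<lambda>x. (f x)\<^sup>2 + (g x)\<^sup>2)"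
    using assms by (auto simp: square_integrable_def)
  show "(\<lambda>x. f x * g x) \<in> borel_measurable M"
    using assms by (auto simp: square_integrable_def)
  show "AE x in M. norm (f x * g x) \<le> norm ((f x)\<^sup>2 + (g x)\<^sup>2)"
  proof (rule AE_I2)
    fix x
    have "2 * \<bar>f x\<bar> * \<bar>g x\<bar> \<le> (f x)\<^sup>2 + (g x)\<^sup>2"
      using sum_squares_bound[of "\<bar>f x\<bar>" "\<bar>g x\<bar>"] by simp
    hence "2 * \<bar>f x * g x\<bar> \<le> (f x)\<^sup>2 + (g x)\<^sup>2"
      by (simp only: abs_mult mult.assoc)
    thus "norm (f x * g x) \<le> norm ((f x)\<^sup>2 + (g x)\<^sup>2)"
      unfolding real_norm_def by linarith
  qed
qed

lemma square_integrable_add [intro]: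
  assumes "square_integrable M f" "square_integrable M g"
  shows "square_integrable M (\<lambda>x. f x + g x)"
proof -
  have "integrable M (\<lambda>x. (f x)\<^sup>2 + (g x)\<^sup>2 + 2 * (f x * g x))"
    using assms square_integrable_mult[OF assms] by (auto simp: square_integrable_def)
  moreover have "(\<lambda>x. (f x + g x)\<^sup>2) = (\<lambda>x. (f x)\<^sup>2 + (g x)\<^sup>2 + 2 * (f x * g x))"
    by (auto simp: power2_sum)
  ultimately show ?thesis
    using assms by (auto simp: square_integrable_def)
qed

lemma square_integrable_scale [intro]:
  "square_integrable M f \<Longrightarrow> square_integrable M (\<lambda>x. r * f x)"
  by (auto simp: square_integrable_def power_mult_distrib)

definition L2_eq :: "(real \<Rightarrow> real) \<Rightarrow> (real \<Rightarrow> real) \<Rightarrow> bool" where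
  "L2_eq f g \<longleftrightarrow> square_integrable lambda_D f \<and> square_integrable lambda_D g
    \<and> (AE x in lambda_D. f x = g x)"

quotient_type L2D = "real \<Rightarrow> real" / partial: L2_eq
proof (rule part_equivpI)
  show "\<exists>f. L2_eq f f"
    by (rule exI[of _ "\<lambda>_. 0"]) (simp add: L2_eq_def)
  show "symp L2_eq"
    by (auto simp: symp_def L2_eq_def elim: AE_mp)
  show "transp L2_eq"
    unfolding transp_def L2_eq_def by (auto elim!: AE_mp)
qed

instantiation L2D :: real_inner
begin

lift_definition zero_L2D :: L2D is "\<lambda>_. 0"
  by (simp add: L2_eq_def)

lift_definition plus_L2D :: "L2D \<Rightarrow> L2D \<Rightarrow> L2D" is "\<lambda>f g x. f x + g x"
  by (auto simp: L2_eq_def elim!: AE_mp)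

lift_definition scaleR_L2D :: "real \<Rightarrow> L2D \<Rightarrow> L2D" is "\<lambda>r f x. r * f x"
  by (auto simp: L2_eq_def elim!: AE_mp)

definition uminus_L2D :: "L2D \<Rightarrow> L2D" where "- f = (-1) *\<^sub>R f" for f :: L2D

definition minus_L2D :: "L2D \<Rightarrow> L2D \<Rightarrow> L2D" where "f - g = f + - g" for f g :: L2D

lift_definition inner_L2D :: "L2D \<Rightarrow> L2D \<Rightarrow> real" is "\<lambda>f g. \<integral>x. f x * g x \<partial>lambda_D"
  by (rule integral_cong_AE) (auto simp: L2_eq_def square_integrable_def elim!: AE_mp)

definition norm_L2D :: "L2D \<Rightarrow> real" where "norm f = sqrt (inner f f)" for f :: L2D

definition sgn_L2D :: "L2D \<Rightarrow> L2D" where "sgn f = inverse (norm f) *\<^sub>R f" for f :: L2D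

definition dist_L2D :: "L2D \<Rightarrow> L2D \<Rightarrow> real" where "dist f g = norm (f - g)" for f g :: L2D

definition uniformity_L2D :: "(L2D \<times> L2D) filter" where
  "uniformity_L2D = (INF e\<in>{0<..}. principal {(x, y). dist x y < e})"

definition open_L2D :: "L2D set \<Rightarrow> bool" where
  "open_L2D U \<longleftrightarrow> (\<forall>x\<in>U. eventually (\<lambda>(x', y). x' = x \<longrightarrow> y \<in> U) uniformity)"

instance
proof
  fix a b c :: L2D and r s :: real
  show "a + b + c = a + (b + c)"
    by transfer (auto simp: L2_eq_def add.assoc)
  show comm: "a + b = b + a" for a b :: L2D
    by transfer (auto simp: L2_eq_def add.commute)
  show "0 + a = a"
    by transfer (auto simp: L2_eq_def)
  show "- a + a = 0"
    unfolding uminus_L2D_def by transfer (auto simp: L2_eq_def)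
  show "a - b = a + - b"
    by (fact minus_L2D_def)
  show "r *\<^sub>R (a + b) = r *\<^sub>R a + r *\<^sub>R b"
    by transfer (auto simp: L2_eq_def algebra_simps intro!: square_integrable_add square_integrable_scale)
  show "(r + s) *\<^sub>R a = r *\<^sub>R a + s *\<^sub>R a"
    by transfer (auto simp: L2_eq_def algebra_simps intro!: square_integrable_add square_integrable_scale)
  show "r *\<^sub>R s *\<^sub>R a = (r * s) *\<^sub>R a"
    by transfer (auto simp: L2_eq_def mult.assoc intro!: square_integrable_scale)
  show "1 *\<^sub>R a = a"
    by transfer (auto simp: L2_eq_def)
  show "dist a b = norm (a - b)" by (fact dist_L2D_def)
  show "sgn a = inverse (norm a) *\<^sub>R a" by (fact sgn_L2D_def)
  show "uniformity = (INF e\<in>{0<..}. principal {(x, y::L2D). dist x y < e})"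
    by (fact uniformity_L2D_def)
  show "open U \<longleftrightarrow> (\<forall>x\<in>U. \<forall>\<^sub>F (x', y) in uniformity. x' = x \<longrightarrow> y \<in> U)" for U :: "L2D set"
    by (fact open_L2D_def)
  show "inner a b = inner b a"
    by transfer (simp add: mult.commute)
  show "inner (a + b) c = inner a c + inner b c"
    by transfer (auto simp: L2_eq_def distrib_right square_integrable_mult)
  show "inner (r *\<^sub>R a) b = r * inner a b"
    by transfer (auto simp: mult.assoc)
  show "0 \<le> inner a a"
    by transfer simp
  show "inner a a = 0 \<longleftrightarrow> a = 0"
  proof transfer
    fix f assume "L2_eq f f"
    hence f: "square_integrable lambda_D f" by (simp add: L2_eq_def)
    have "(\<integral>x. f x * f x \<partial>lambda_D) = 0 \<longleftrightarrow> (AE x in lambda_D. f x * f x = 0)"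
      using square_integrable_mult[OF f f] by (intro integral_nonneg_eq_0_iff_AE) auto
    thus "(\<integral>x. f x * f x \<partial>lambda_D) = 0 \<longleftrightarrow> L2_eq f (\<lambda>_. 0)"
      using f by (simp add: L2_eq_def)
  qed
  show "norm a = sqrt (inner a a)" by (fact norm_L2D_def)
qed

end

text \<open>The class of a function; functions that are not square integrable are sent to \<open>0\<close>.\<close>

lift_definition L2_class :: "(real \<Rightarrow> real) \<Rightarrow> L2D" is
  "\<lambda>f. if square_integrable lambda_D f then f else (\<lambda>_. 0)"
  by (simp add: L2_eq_def)

lemma inner_L2_class:
  assumes "square_integrable lambda_D f" "square_integrable lambda_D g"
  shows "inner (L2_class f) (L2_class g) = (\<integral>x. f x * g x \<partial>lambda_D)"
  using assms by transfer simp

lemma L2_class_eq_iff: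
  assumes "square_integrable lambda_D f" "square_integrable lambda_D g"
  shows "L2_class f = L2_class g \<longleftrightarrow> (AE x in lambda_D. f x = g x)"
  using assms by transfer (simp add: L2_eq_def)

lemma L2_class_surj: "\<exists>f. square_integrable lambda_D f \<and> L2_class f = h"
  by transfer (auto simp: L2_eq_def)


section \<open>Absorbing barrier Brownian motion\<close>

definition gauss_kernel :: "real \<Rightarrow> real \<Rightarrow> real" where
  "gauss_kernel t x = exp (- x\<^sup>2 / (2 * t)) / sqrt (2 * pi * t)"

definition abm_density :: "real \<Rightarrow> real \<Rightarrow> real \<Rightarrow> real" where
  "abm_density t x y = gauss_kernel t (x - y) - gauss_kernel t (x + y)"

definition abm_semigroup :: "real \<Rightarrow> (real \<Rightarrow> real) \<Rightarrow> real \<Rightarrow> real" where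
  "abm_semigroup t f x =
    (if t = 0 then f x else (\<integral>y. abm_density t x y * f y \<partial>lambda_D))"


section \<open>Kernels, the function \<open>\<phi>\<close> and the control measures\<close>

text \<open>\<open>u\<^sup>2 m(x, du)\<close> is a bounded kernel from \<open>D\<close> to the punctured line; \<open>m x\<close> itself may be
  infinite.\<close>

definition square_bounded_kernel :: "(real \<Rightarrow> real measure) \<Rightarrow> bool" where
  "square_bounded_kernel m \<longleftrightarrow>
    (\<forall>x>0. sets (m x) = sets (restrict_space borel (- {0})))
    \<and> (\<forall>B \<in> sets (restrict_space borel (- {0})).
          (\<lambda>x. emeasure (m x) B) \<in> borel_measurable (restrict_space borel {0<..}))
    \<and> (\<exists>K::real. \<forall>x>0. (\<integral>\<^sup>+u. ennreal (u\<^sup>2) \<partial>m x) \<le> ennreal K)"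

definition phi :: "(real \<Rightarrow> real) \<Rightarrow> (real \<Rightarrow> real measure) \<Rightarrow> real \<Rightarrow> real \<Rightarrow> complex" where
  "phi c m x z = - complex_of_real (c x * z\<^sup>2)
    + (\<integral>u. (iexp (z * u) - 1 - \<i> * complex_of_real (z * u)) \<partial>m x)"

definition time_measure :: "real measure" where
  "time_measure = restrict_space lborel {0..}"

text \<open>\<open>2 c(x) ds \<eta>(dx)\<close> on pairs \<open>(s, x)\<close>.\<close>

definition noise_covariance :: "(real \<Rightarrow> real) \<Rightarrow> real measure \<Rightarrow> (real \<times> real) measure" where
  "noise_covariance c \<eta> = density (time_measure \<Otimes>\<^sub>M \<eta>) (\<lambda>(s, x). ennreal (2 * c x))"

text \<open>\<open>ds m(x, du) \<eta>(dx)\<close> on triples \<open>(s, u, x)\<close>.\<close>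

definition jump_intensity ::
    "(real \<Rightarrow> real measure) \<Rightarrow> real measure \<Rightarrow> (real \<times> real \<times> real) measure" where
  "jump_intensity m \<eta> =
    measure_of ({0..} \<times> (- {0}) \<times> {0<..})
      (sets (time_measure \<Otimes>\<^sub>M (restrict_space borel (- {0}) \<Otimes>\<^sub>M restrict_space borel {0<..})))
      (\<lambda>A. \<integral>\<^sup>+x. (\<integral>\<^sup>+u. (\<integral>\<^sup>+s. indicator A (s, u, x) \<partial>time_measure) \<partial>m x) \<partial>\<eta>)"


section \<open>Random measures and their \<open>L\<^sup>2\<close> integrals\<close>

definition gaussian_rv :: "'w measure \<Rightarrow> ('w \<Rightarrow> real) \<Rightarrow> bool" where
  "gaussian_rv M X \<longleftrightarrow> X \<in> borel_measurable M \<and>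
    (\<exists>\<mu>. (AE \<omega> in M. X \<omega> = \<mu>)
       \<or> (\<exists>\<sigma>>0. distributed M lborel X (\<lambda>x. ennreal (normal_density \<mu> \<sigma> x))))"

definition finite_measure_sets :: "'e measure \<Rightarrow> 'e set set" where
  "finite_measure_sets S = {A \<in> sets S. emeasure S A < \<infinity>}"

text \<open>A centered Gaussian random measure on the sets of finite \<open>S\<close>-measure. Joint Gaussianity is
  Gaussianity of all finite linear combinations; \<open>\<sigma>\<close>-additivity is in mean square.\<close>

definition white_noise :: "'w measure \<Rightarrow> 'e measure \<Rightarrow> ('e set \<Rightarrow> 'w \<Rightarrow> real) \<Rightarrow> bool" where
  "white_noise M S W \<longleftrightarrow>
    (\<forall>(n::nat) a A. (\<forall>i<n. A i \<in> finite_measure_sets S) \<longrightarrow>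
        gaussian_rv M (\<lambda>\<omega>. \<Sum>i<n. a i * W (A i) \<omega>))
    \<and> (\<forall>A \<in> finite_measure_sets S. (\<integral>\<omega>. W A \<omega> \<partial>M) = 0)
    \<and> (\<forall>A \<in> finite_measure_sets S. \<forall>B \<in> finite_measure_sets S.
        (\<integral>\<omega>. W A \<omega> * W B \<omega> \<partial>M) = measure S (A \<inter> B))
    \<and> (\<forall>A :: nat \<Rightarrow> 'e set. disjoint_family A \<and> range A \<subseteq> sets S
          \<and> (\<Union>i. A i) \<in> finite_measure_sets S \<longrightarrow>
        (\<lambda>n. \<integral>\<^sup>+\<omega>. ennreal ((W (\<Union>i. A i) \<omega> - (\<Sum>i<n. W (A i) \<omega>))\<^sup>2) \<partial>M) \<longlonglongrightarrow> 0)"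

definition poisson_random_measure :: "'w measure \<Rightarrow> 'e measure \<Rightarrow> ('w \<Rightarrow> 'e measure) \<Rightarrow> bool" where
  "poisson_random_measure M S N \<longleftrightarrow>
    (\<forall>\<omega> \<in> space M. sets (N \<omega>) = sets S)
    \<and> (\<forall>A \<in> sets S. (\<lambda>\<omega>. emeasure (N \<omega>) A) \<in> borel_measurable M)
    \<and> (\<forall>A \<in> sets S. emeasure S A < \<infinity> \<longrightarrow>
        (\<forall>k::nat. measure M {\<omega> \<in> space M. emeasure (N \<omega>) A = of_nat k}
          = exp (- measure S A) * measure S A ^ k / fact k))
    \<and> (\<forall>A \<in> sets S. emeasure S A = \<infinity> \<longrightarrow> (AE \<omega> in M. emeasure (N \<omega>) A = \<infinity>))
    \<and> (\<forall>A :: nat \<Rightarrow> 'e set. disjoint_family A \<and> range A \<subseteq> sets S \<longrightarrow>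
        prob_space.indep_vars M (\<lambda>_. borel) (\<lambda>i \<omega>. emeasure (N \<omega>) (A i)) UNIV)"

text \<open>\<open>N - S\<close>, used on sets of finite \<open>S\<close>-measure only; there \<open>N\<close> is almost surely finite.\<close>

definition compensated :: "'e measure \<Rightarrow> ('w \<Rightarrow> 'e measure) \<Rightarrow> 'e set \<Rightarrow> 'w \<Rightarrow> real" where
  "compensated S N A \<omega> = measure (N \<omega>) A - measure S A"

definition generated :: "'w measure \<Rightarrow> ('i \<Rightarrow> 'w \<Rightarrow> 'b::topological_space) \<Rightarrow> 'i set \<Rightarrow> 'w measure"
  where "generated M X I = sigma (space M) {X i -` B \<inter> space M |i B. i \<in> I \<and> B \<in> sets borel}"

definition simple_stoch_integral ::
    "'e measure \<Rightarrow> ('e set \<Rightarrow> 'w \<Rightarrow> real) \<Rightarrow> ('e \<Rightarrow> real) \<Rightarrow> 'w \<Rightarrow> real" where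
  "simple_stoch_integral S W f \<omega> = (\<Sum>r \<in> f ` space S. r * W (f -` {r} \<inter> space S) \<omega>)"

text \<open>\<open>X\<close> is a version of \<open>\<integral> f dW\<close>, where \<open>W\<close> is a random measure with orthogonal increments
  and control measure \<open>S\<close>: \<open>X\<close> is the \<open>L\<^sup>2(M)\<close> limit of the integrals of simple functions converging
  to \<open>f\<close> in \<open>L\<^sup>2(S)\<close>.\<close>

definition has_stoch_integral ::
    "'w measure \<Rightarrow> 'e measure \<Rightarrow> ('e set \<Rightarrow> 'w \<Rightarrow> real) \<Rightarrow> ('e \<Rightarrow> real) \<Rightarrow> ('w \<Rightarrow> real) \<Rightarrow> bool" where
  "has_stoch_integral M S W f X \<longleftrightarrow>
    square_integrable S f \<and> square_integrable M X \<and>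
    (\<exists>s :: nat \<Rightarrow> 'e \<Rightarrow> real.
        (\<forall>n. Bochner_Integration.simple_bochner_integrable S (s n))
      \<and> (\<lambda>n. \<integral>\<^sup>+e. ennreal ((f e - s n e)\<^sup>2) \<partial>S) \<longlonglongrightarrow> 0
      \<and> (\<lambda>n. \<integral>\<^sup>+\<omega>. ennreal ((X \<omega> - simple_stoch_integral S W (s n) \<omega>)\<^sup>2) \<partial>M) \<longlonglongrightarrow> 0)"


section \<open>The process \<open>Z\<^sup>0\<close>\<close>

text \<open>\<open>z\<close> represents \<open>Z\<^sup>0\<^sub>t\<close> in \<open>L\<^sup>2(\<Omega> \<times> D)\<close>: it is square integrable, and for almost every \<open>y\<close> its
  section at \<open>y\<close> is a version of the sum of the two stochastic integrals. The value of
  \<open>abm_density 0\<close> (which is \<open>0\<close>) enters only on the null set \<open>s = t\<close>.\<close>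

definition is_Z0 ::
    "'w measure \<Rightarrow> real measure \<Rightarrow> (real \<Rightarrow> real) \<Rightarrow> (real \<Rightarrow> real measure) \<Rightarrow>
     ((real \<times> real) set \<Rightarrow> 'w \<Rightarrow> real) \<Rightarrow> ('w \<Rightarrow> (real \<times> real \<times> real) measure) \<Rightarrow>
     real \<Rightarrow> ('w \<times> real \<Rightarrow> real) \<Rightarrow> bool" where
  "is_Z0 M \<eta> c m W N t z \<longleftrightarrow>
    square_integrable (M \<Otimes>\<^sub>M lambda_D) z \<and>
    (AE y in lambda_D. \<exists>X Y.
        has_stoch_integral M (noise_covariance c \<eta>) W
          (\<lambda>(s, x). indicator {0..t} s * abm_density (t - s) x y) X
      \<and> has_stoch_integral M (jump_intensity m \<eta>) (compensated (jump_intensity m \<eta>) N)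
          (\<lambda>(s, u, x). indicator {0..t} s * (u * abm_density (t - s) x y)) Y
      \<and> (AE \<omega> in M. z (\<omega>, y) = X \<omega> + Y \<omega>))"


section \<open>Markov processes\<close>

definition transition_semigroup ::
    "(real \<Rightarrow> 'b::topological_space \<Rightarrow> 'b measure) \<Rightarrow> bool" where
  "transition_semigroup R \<longleftrightarrow>
    (\<forall>t\<ge>0. R t \<in> borel \<rightarrow>\<^sub>M prob_algebra borel)
    \<and> (\<forall>g. R 0 g = return borel g)
    \<and> (\<forall>s\<ge>0. \<forall>t\<ge>0. \<forall>g. R (s + t) g = R s g \<bind> R t)"

text \<open>The Markov property with respect to the filtration generated by \<open>X\<close>.\<close>

definition markov_process ::
    "'w measure \<Rightarrow> (real \<Rightarrow> 'b::topological_space \<Rightarrow> 'b measure) \<Rightarrow> (real \<Rightarrow> 'w \<Rightarrow> 'b) \<Rightarrow> bool" where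
  "markov_process M R X \<longleftrightarrow>
    (\<forall>t\<ge>0. X t \<in> M \<rightarrow>\<^sub>M borel)
    \<and> (\<forall>s\<ge>0. \<forall>t\<ge>s. \<forall>B \<in> sets borel. AE \<omega> in M.
        real_cond_exp M (generated M X {0..s}) (\<lambda>\<omega>. indicator B (X t \<omega>)) \<omega>
          = measure (R (t - s) (X s \<omega>)) B)"

end

(* The stochastic integrals exist by the L2 isometry on step functions; approximating the kernel
   p_(t-s)(x,y) by combinations of rectangles makes them jointly measurable in (omega, y) and
   compatible with integration in y. Hence <Z_t, f> is the stochastic integral of P_(t-s) f, and
   since the noises are independent with known characteristic functions, the joint characteristic
   functional of (Z_(t_1), ..., Z_(t_n)) is explicit. Take for R_t(g, .) the law of P_t g + Z_t.
   The Chapman-Kolmogorov equation for R and the Markov property both compare two measures that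
   are determined by their characteristic functionals (L2 is separable), and both reduce to the
   semigroup property of P. Finally, t |-> Z_t is Hoelder continuous in L2, so that its values at
   dyadic times converge almost everywhere to a version which is measurable in (t, omega, y). *)
theory Submission imports Defs
begin

text \<open>Two constraints shape the construction. The field is given, for almost every fixed y, by
  two stochastic integrals, while its law is seen only through pairings with f in y. Both
  descriptions are therefore read off one approximating sequence of rectangle sums, for which
  exchanging the pairing with the noise is plain linearity. Secondly, uniqueness of laws starts from
  the real line, whereas the laws compared live on \<open>L2D\<close>, or on the product of \<Omega>
  with \<open>L2D\<close> where \<Omega> carries only the past. The comparison is therefore made
  through a vector space of real functionals generating the sigma-algebra. The Markov property
  becomes one identity of measures on that product, without recourse to independent increments: the
  exponents split because the integrands of the past vanish at noise times after s and
  \<open>phi\<close> vanishes at 0.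

  All estimates concern squared distances with values in [0, \<infinity>], so constants such as 2
  and 16 stem from crude triangle inequalities for squares. Time increments of the field have
  squared norm of order sqrt h only, which decides the mesh of the time grids at the end.\<close>

section \<open>Squared \<open>L\<^sup>2\<close> distances and step functions\<close>

text \<open>Squared \<open>L\<^sup>2\<close> distance as an extended nonnegative integral: its inequalities need no integrability
  side conditions.\<close>

definition L2d :: "'a measure \<Rightarrow> ('a \<Rightarrow> real) \<Rightarrow> ('a \<Rightarrow> real) \<Rightarrow> ennreal" where
  "L2d M f g = (\<integral>\<^sup>+x. ennreal ((f x - g x)\<^sup>2) \<partial>M)"

lemma L2d_commute: "L2d M f g = L2d M g f"
  by (simp add: L2d_def power2_commute)

lemma L2d_same [simp]: "L2d M f f = 0"
  by (simp add: L2d_def)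

lemma L2d_cong_AE:
  "AE x in M. f x = f' x \<Longrightarrow> AE x in M. g x = g' x \<Longrightarrow> L2d M f g = L2d M f' g'"
  unfolding L2d_def by (intro nn_integral_cong_AE) auto

lemma L2d_cong:
  "(\<And>x. x \<in> space M \<Longrightarrow> f x = f' x) \<Longrightarrow> (\<And>x. x \<in> space M \<Longrightarrow> g x = g' x) \<Longrightarrow> L2d M f g = L2d M f' g'"
  unfolding L2d_def by (intro nn_integral_cong) auto

lemma square_add_le: "((a::real) + b)\<^sup>2 \<le> 2 * a\<^sup>2 + 2 * b\<^sup>2"
proof -
  have "0 \<le> (a - b)\<^sup>2" by simp
  thus ?thesis by (simp add: power2_eq_square algebra_simps)
qed

lemma L2d_add:
  assumes [measurable]: "f \<in> borel_measurable M" "g \<in> borel_measurable M"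
    "f' \<in> borel_measurable M" "g' \<in> borel_measurable M"
  shows "L2d M (\<lambda>x. f x + f' x) (\<lambda>x. g x + g' x) \<le> 2 * L2d M f g + 2 * L2d M f' g'"
proof -
  have "L2d M (\<lambda>x. f x + f' x) (\<lambda>x. g x + g' x)
      \<le> (\<integral>\<^sup>+x. 2 * ennreal ((f x - g x)\<^sup>2) + 2 * ennreal ((f' x - g' x)\<^sup>2) \<partial>M)"
    unfolding L2d_def
  proof (rule nn_integral_mono)
    fix x
    have "(f x + f' x - (g x + g' x))\<^sup>2 = ((f x - g x) + (f' x - g' x))\<^sup>2"
      by (simp add: algebra_simps)
    also have "\<dots> \<le> 2 * (f x - g x)\<^sup>2 + 2 * (f' x - g' x)\<^sup>2" by (rule square_add_le)
    finally have "ennreal ((f x + f' x - (g x + g' x))\<^sup>2) \<le> ennreal (2 * (f x - g x)\<^sup>2 + 2 * (f' x - g' x)\<^sup>2)"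
      by (rule ennreal_leI)
    thus "ennreal ((f x + f' x - (g x + g' x))\<^sup>2) \<le> 2 * ennreal ((f x - g x)\<^sup>2) + 2 * ennreal ((f' x - g' x)\<^sup>2)"
      by (simp add: ennreal_plus ennreal_mult)
  qed
  also have "\<dots> = 2 * L2d M f g + 2 * L2d M f' g'"
    unfolding L2d_def by (subst nn_integral_add) (auto simp: nn_integral_cmult)
  finally show ?thesis .
qed

text \<open>Squaring the triangle inequality costs the factor 2. In exchange it holds for all
  measurable functions, infinite distances included.\<close>

lemma L2d_triangle:
  assumes [measurable]: "f \<in> borel_measurable M" "g \<in> borel_measurable M" "h \<in> borel_measurable M"
  shows "L2d M f h \<le> 2 * L2d M f g + 2 * L2d M g h"
proof -
  have "L2d M f h = L2d M (\<lambda>x. (f x - g x) + (g x - h x)) (\<lambda>x. 0 + 0)"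
    by (simp add: L2d_def)
  also have "\<dots> \<le> 2 * L2d M (\<lambda>x. f x - g x) (\<lambda>x. 0) + 2 * L2d M (\<lambda>x. g x - h x) (\<lambda>x. 0)"
    by (rule L2d_add) auto
  finally show ?thesis by (simp add: L2d_def)
qed

lemma L2d_scale: 
  assumes [measurable]: "f \<in> borel_measurable M" "g \<in> borel_measurable M"
  shows "L2d M (\<lambda>x. c * f x) (\<lambda>x. c * g x) = ennreal (c\<^sup>2) * L2d M f g"
proof -
  have "(c * f x - c * g x)\<^sup>2 = c\<^sup>2 * (f x - g x)\<^sup>2" for x
    by (metis power_mult_distrib right_diff_distrib)
  thus ?thesis
    by (simp add: L2d_def ennreal_mult nn_integral_cmult)
qed

lemma square_integrable_iff_L2d:
  "square_integrable M f \<longleftrightarrow> f \<in> borel_measurable M \<and> L2d M f (\<lambda>_. 0) < \<infinity>"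
  unfolding square_integrable_def L2d_def
  by (auto simp: integrable_iff_bounded)

lemma square_integrable_close:
  assumes "square_integrable M f" "g \<in> borel_measurable M" "L2d M f g < \<infinity>"
  shows "square_integrable M g"
proof -
  have "L2d M g (\<lambda>_. 0) \<le> 2 * L2d M g f + 2 * L2d M f (\<lambda>_. 0)"
    using assms by (intro L2d_triangle) (auto simp: square_integrable_iff_L2d)
  also have "\<dots> < \<infinity>"
    using assms by (auto simp: square_integrable_iff_L2d L2d_commute ennreal_mult_less_top)
  finally show ?thesis using assms by (auto simp: square_integrable_iff_L2d)
qed

lemma square_integrable_diff [intro]:
  assumes "square_integrable M f" "square_integrable M g"
  shows "square_integrable M (\<lambda>x. f x - g x)"
  using square_integrable_add[OF assms(1) square_integrable_scale[OF assms(2), of "-1"]] by simp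

lemma L2d_eq_integral:
  assumes "square_integrable M f" "square_integrable M g"
  shows "L2d M f g = ennreal (\<integral>x. (f x - g x)\<^sup>2 \<partial>M)"
  using square_integrable_diff[OF assms] unfolding L2d_def square_integrable_def
  by (intro nn_integral_eq_integral) auto

lemma L2d_eq_0_iff:
  assumes [measurable]: "f \<in> borel_measurable M" "g \<in> borel_measurable M"
  shows "L2d M f g = 0 \<longleftrightarrow> (AE x in M. f x = g x)"
  unfolding L2d_def by (subst nn_integral_0_iff_AE) (auto simp: power2_eq_square)

lemma square_integrable_cong_AE:
  assumes "square_integrable M f" "g \<in> borel_measurable M" "AE x in M. f x = g x"
  shows "square_integrable M g"
proof -
  have "L2d M f g = 0" using assms by (subst L2d_eq_0_iff) (auto simp: square_integrable_def)
  thus ?thesis using assms square_integrable_close by fastforce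
qed

section \<open>Convergence almost everywhere and completeness in squared distance\<close>

lemma tendsto_zero_ennreal_mult:
  fixes f :: "nat \<Rightarrow> ennreal"
  assumes "f \<longlonglongrightarrow> 0" "c < \<infinity>"
  shows "(\<lambda>n. c * f n) \<longlonglongrightarrow> 0"
  using ennreal_tendsto_cmult[of c f 0] assms by simp

lemma ennreal_tendsto_zero_le:
  fixes f :: "nat \<Rightarrow> ennreal"
  assumes "g \<longlonglongrightarrow> 0" "\<And>n. f n \<le> g n"
  shows "f \<longlonglongrightarrow> 0"
  by (rule tendsto_sandwich[OF _ _ tendsto_const assms(1)]) (auto simp: assms)

lemma L2d_tendsto_add:
  assumes [measurable]: "f \<in> borel_measurable M" "f' \<in> borel_measurable M"
    "\<And>n. g n \<in> borel_measurable M" "\<And>n. g' n \<in> borel_measurable M"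
  assumes "(\<lambda>n. L2d M f (g n)) \<longlonglongrightarrow> 0" "(\<lambda>n. L2d M f' (g' n)) \<longlonglongrightarrow> 0"
  shows "(\<lambda>n. L2d M (\<lambda>x. f x + f' x) (\<lambda>x. g n x + g' n x)) \<longlonglongrightarrow> 0"
proof (rule ennreal_tendsto_zero_le)
  have "(\<lambda>n. 2 * L2d M f (g n) + 2 * L2d M f' (g' n)) \<longlonglongrightarrow> 0 + 0"
    using assms by (intro tendsto_add tendsto_zero_ennreal_mult) auto
  thus "(\<lambda>n. 2 * L2d M f (g n) + 2 * L2d M f' (g' n)) \<longlonglongrightarrow> 0" by simp
qed (rule L2d_add; simp)

text \<open>With p = 2 ^ n and d the modulus of the n-th increment, d \<le> (1 / p + p * d^2) / 2.
  The increments are thus dominated by a geometric series plus the given one, and the sequence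
  telescopes.\<close>

lemma convergent_if_weighted_squares_summable:
  fixes a :: "nat \<Rightarrow> real"
  assumes "summable (\<lambda>n. 2 ^ n * (a (Suc n) - a n)\<^sup>2)"
  shows "convergent a"
proof -
  have "summable (\<lambda>n. (1/2) ^ n + 2 ^ n * (a (Suc n) - a n)\<^sup>2)"
    by (intro summable_add assms summable_geometric) auto
  hence "summable (\<lambda>n. a (Suc n) - a n)"
  proof (rule summable_comparison_test')
    fix n :: nat
    define d where "d = \<bar>a (Suc n) - a n\<bar>"
    define p :: real where "p = 2 ^ n"
    have p: "p > 0" by (simp add: p_def)
    have "0 \<le> (1 - p * d)\<^sup>2" by simp
    hence "2 * (p * d) \<le> 1 + p\<^sup>2 * d\<^sup>2" by (simp add: power2_eq_square algebra_simps)
    hence "d \<le> (1 + p\<^sup>2 * d\<^sup>2) / (2 * p)" using p by (simp add: field_simps)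
    also have "\<dots> = (1 / p + p * d\<^sup>2) / 2" using p by (simp add: field_simps power2_eq_square)
    also have "\<dots> \<le> 1 / p + p * d\<^sup>2"
    proof -
      have "0 \<le> 1 / p + p * d\<^sup>2" using p by simp
      thus ?thesis by argo
    qed
    finally show "norm (a (Suc n) - a n) \<le> (1/2) ^ n + 2 ^ n * (a (Suc n) - a n)\<^sup>2"
      by (simp add: d_def p_def power_one_over)
  qed
  hence "convergent (\<lambda>n. \<Sum>i<n. a (Suc i) - a i)"
    by (simp add: summable_iff_convergent)
  hence "convergent (\<lambda>n. a n - a 0)" by (simp add: sum_lessThan_telescope)
  hence "convergent (\<lambda>n. (a n - a 0) + a 0)" by (intro convergent_add convergent_const)
  thus ?thesis by simp
qed

text \<open>The weight 2 ^ n uses up only part of the decay: integrating the weighted squared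
  increments leaves C / 2 ^ n, which is summable. Almost everywhere the weighted series is therefore
  finite, and the whole sequence converges without passing to a subsequence.\<close>

lemma L2d_geometric_convergent:
  assumes [measurable]: "\<And>n. f n \<in> borel_measurable M"
    and C: "C < \<infinity>" and step: "\<And>n. L2d M (f n) (f (Suc n)) \<le> C * ennreal ((1/4) ^ n)"
  shows "AE x in M. convergent (\<lambda>n. f n x)"
proof -
  have "(\<integral>\<^sup>+x. (\<Sum>n. ennreal (2 ^ n * (f (Suc n) x - f n x)\<^sup>2)) \<partial>M)
      = (\<Sum>n. ennreal (2 ^ n) * L2d M (f n) (f (Suc n)))"
    by (subst nn_integral_suminf)
       (auto simp: ennreal_mult nn_integral_cmult L2d_commute[of M "f _" "f (Suc _)"] L2d_def[of M "f (Suc _)"])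
  also have "\<dots> \<le> (\<Sum>n. C * ennreal ((1/2) ^ n))"
  proof (intro suminf_le summableI)
    fix n
    have "ennreal (2 ^ n) * L2d M (f n) (f (Suc n)) \<le> ennreal (2 ^ n) * (C * ennreal ((1/4) ^ n))"
      by (intro mult_left_mono step) simp
    also have "\<dots> = C * ennreal (2 ^ n * (1/4) ^ n)"
      by (simp add: ennreal_mult mult_ac)
    also have "(2::real) ^ n * (1/4) ^ n = (1/2) ^ n"
      by (simp add: power_mult_distrib[symmetric])
    finally show "ennreal (2 ^ n) * L2d M (f n) (f (Suc n)) \<le> C * ennreal ((1/2) ^ n)" .
  qed
  also have "\<dots> = C * (\<Sum>n. ennreal ((1/2) ^ n))" by (rule ennreal_suminf_cmult)
  also have "(\<Sum>n. ennreal ((1/2) ^ n)) = ennreal (\<Sum>n. (1/2) ^ n)"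
    by (rule suminf_ennreal2) auto
  also have "C * \<dots> < \<infinity>" using C by (simp add: ennreal_mult_less_top)
  finally have "AE x in M. (\<Sum>n. ennreal (2 ^ n * (f (Suc n) x - f n x)\<^sup>2)) \<noteq> \<infinity>"
    by (intro nn_integral_PInf_AE) auto
  thus ?thesis
  proof eventually_elim
    case (elim x)
    have "summable (\<lambda>n. 2 ^ n * (f (Suc n) x - f n x)\<^sup>2)"
      using elim by (intro summable_suminf_not_top) auto
    thus ?case by (rule convergent_if_weighted_squares_summable)
  qed
qed

text \<open>Lower semicontinuity of the squared distance. The bound is required for large indices
  only, because a Cauchy estimate from index n on supplies it only beyond n.\<close>

lemma L2d_Fatou:
  assumes [measurable]: "\<And>n. f n \<in> borel_measurable M" "g \<in> borel_measurable M" "h \<in> borel_measurable M"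
    and conv: "AE x in M. (\<lambda>n. f n x) \<longlonglongrightarrow> g x"
    and bound: "eventually (\<lambda>m. L2d M h (f m) \<le> B) sequentially"
  shows "L2d M h g \<le> B"
proof -
  have "L2d M h g = (\<integral>\<^sup>+x. liminf (\<lambda>m. ennreal ((h x - f m x)\<^sup>2)) \<partial>M)"
    unfolding L2d_def using conv
  proof (intro nn_integral_cong_AE, eventually_elim)
    case (elim x)
    have "(\<lambda>m. ennreal ((h x - f m x)\<^sup>2)) \<longlonglongrightarrow> ennreal ((h x - g x)\<^sup>2)"
      by (intro tendsto_ennrealI tendsto_intros elim)
    from lim_imp_Liminf[OF _ this] show ?case by simp
  qed
  also have "\<dots> \<le> liminf (\<lambda>m. L2d M h (f m))"
    unfolding L2d_def by (rule nn_integral_liminf) auto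
  also have "\<dots> \<le> limsup (\<lambda>m. L2d M h (f m))" by (rule Liminf_le_Limsup) simp
  also have "\<dots> \<le> B" using bound by (rule Limsup_bounded)
  finally show ?thesis .
qed

text \<open>The limit is the pointwise \<open>lim\<close>, which is measurable even where the
  sequence diverges, and Fatou's lemma keeps the rate with the same constant \<open>C\<close>. The
  retained rate later yields convergence of almost every section.\<close>

lemma L2d_complete:
  assumes [measurable]: "\<And>n. f n \<in> borel_measurable M"
    and C: "C < \<infinity>" and cauchy: "\<And>n m. n \<le> m \<Longrightarrow> L2d M (f n) (f m) \<le> C * ennreal ((1/4) ^ n)"
  shows "\<exists>g \<in> borel_measurable M. (\<forall>n. L2d M (f n) g \<le> C * ennreal ((1/4) ^ n))"
proof -
  define g where "g x = lim (\<lambda>n. f n x)" for x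
  have [measurable]: "g \<in> borel_measurable M" unfolding g_def by measurable
  have "AE x in M. (\<lambda>n. f n x) \<longlonglongrightarrow> g x"
    using L2d_geometric_convergent[OF assms(1) C cauchy]
    unfolding g_def by (auto simp: convergent_LIMSEQ_iff)
  hence "L2d M (f n) g \<le> C * ennreal ((1/4) ^ n)" for n
    by (intro L2d_Fatou) (auto intro!: cauchy eventually_sequentiallyI[of n])
  thus ?thesis by (intro bexI[of _ g] allI) measurable
qed

text \<open>The integrals are summable, so the sum of the functions is finite almost everywhere and
  its terms tend to 0. It is applied to squared distances of sections and to pointwise squared
  errors.\<close>

lemma L2d_geometric_AE_tendsto:
  assumes [measurable]: "\<And>n. g n \<in> borel_measurable Y"
    and C: "C < \<infinity>" and bound: "\<And>n. (\<integral>\<^sup>+y. g n y \<partial>Y) \<le> C * ennreal ((1/4) ^ n)"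
  shows "AE y in Y. (\<lambda>n. g n y :: ennreal) \<longlonglongrightarrow> 0"
proof -
  have "(\<integral>\<^sup>+y. (\<Sum>n. g n y) \<partial>Y) = (\<Sum>n. \<integral>\<^sup>+y. g n y \<partial>Y)" by (rule nn_integral_suminf) auto
  also have "\<dots> \<le> (\<Sum>n. C * ennreal ((1/4) ^ n))" by (intro suminf_le bound summableI)
  also have "\<dots> = C * (\<Sum>n. ennreal ((1/4) ^ n))" by (rule ennreal_suminf_cmult)
  also have "(\<Sum>n. ennreal ((1/4) ^ n)) = ennreal (\<Sum>n. (1/4) ^ n)"
    by (rule suminf_ennreal2) auto
  also have "C * \<dots> < \<infinity>" using C by (simp add: ennreal_mult_less_top)
  finally have "AE y in Y. (\<Sum>n. g n y) \<noteq> \<infinity>"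
    by (intro nn_integral_PInf_AE) auto
  thus ?thesis
  proof eventually_elim
    case (elim y)
    have "g n y < \<infinity>" for n
      using elim ennreal_suminf_lessD[of "\<lambda>n. g n y" top n] by (auto simp: less_top)
    hence e: "g n y = ennreal (enn2real (g n y))" for n by (simp add: less_top)
    have "summable (\<lambda>n. enn2real (g n y))"
      using elim by (intro summable_suminf_not_top) (auto simp: e[symmetric])
    hence "(\<lambda>n. ennreal (enn2real (g n y))) \<longlonglongrightarrow> ennreal 0"
      by (intro tendsto_ennrealI summable_LIMSEQ_zero)
    thus ?case by (simp add: e[symmetric])
  qed
qed

text \<open>Lists may repeat coefficients and let the sets overlap. Addition is then concatenation
  and scaling is a map, with no refinement into disjoint pieces.\<close>

definition step_fun :: "(real \<times> 'a set) list \<Rightarrow> 'a \<Rightarrow> real" where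
  "step_fun xs x = (\<Sum>(a, A)\<leftarrow>xs. a * indicator A x)"

lemma step_fun_Nil [simp]: "step_fun [] = (\<lambda>_. 0)"
  and step_fun_Cons: "step_fun ((a, A) # xs) x = a * indicator A x + step_fun xs x"
  and step_fun_append: "step_fun (xs @ ys) x = step_fun xs x + step_fun ys x"
  by (auto simp: step_fun_def)

lemma step_fun_scale: "step_fun (map (map_prod ((*) c) id) xs) x = c * step_fun xs x"
  by (induction xs) (auto simp: step_fun_Cons algebra_simps)

lemma square_integrable_indicator:
  assumes "A \<in> sets M" "emeasure M A < \<infinity>"
  shows "square_integrable M (indicator A)"
proof -
  have "L2d M (indicator A) (\<lambda>_. 0) = (\<integral>\<^sup>+x. indicator A x \<partial>M)"
    unfolding L2d_def by (intro nn_integral_cong) (auto simp: indicator_def)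
  thus ?thesis using assms by (simp add: square_integrable_iff_L2d)
qed

lemma square_integrable_step_fun:
  "(\<And>a A. (a, A) \<in> set xs \<Longrightarrow> A \<in> sets M \<and> emeasure M A < \<infinity>) \<Longrightarrow> square_integrable M (step_fun xs)"
proof (induction xs)
  case (Cons p xs)
  obtain a A where p: "p = (a, A)" by (cases p)
  have "square_integrable M (indicator A)" "square_integrable M (step_fun xs)"
    using Cons.prems[of a A] Cons.IH Cons.prems unfolding p by (auto intro: square_integrable_indicator)
  thus ?case unfolding p step_fun_Cons[abs_def] by (intro square_integrable_add square_integrable_scale)
qed auto

section \<open>Density of step functions over an intersection-stable generator\<close>

context
  fixes M :: "'a measure" and G :: "'a set set" and E :: "nat \<Rightarrow> 'a set"
  assumes G: "Int_stable G" "sets M = sigma_sets (space M) G" "\<And>A. A \<in> G \<Longrightarrow> emeasure M A < \<infinity>"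
    and E: "range E \<subseteq> G" "incseq E" "(\<Union>k. E k) = space M"
begin

private lemma G_sub: "G \<subseteq> sets M" "G \<subseteq> Pow (space M)"
proof -
  show *: "G \<subseteq> sets M" using G(2) by (auto intro: sigma_sets.Basic)
  show "G \<subseteq> Pow (space M)" using * sets.sets_into_space by blast
qed

private lemma step_G: "set xs \<subseteq> UNIV \<times> G \<Longrightarrow> square_integrable M (step_fun xs)"
  by (rule square_integrable_step_fun) (use G_sub(1) G(3) in blast)

text \<open>The closure of the step functions over \<open>G\<close> in squared distance. As a
  predicate closed under sums, multiples and limits it can be carried through the induction over the
  sigma-algebra generated by \<open>G\<close>.\<close>

private definition Appr :: "('a \<Rightarrow> real) \<Rightarrow> bool" where
  "Appr f \<longleftrightarrow> f \<in> borel_measurable M \<and> (\<forall>e>0. \<exists>xs. set xs \<subseteq> UNIV \<times> G \<and> L2d M f (step_fun xs) < e)"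

private lemma Appr_meas: "Appr f \<Longrightarrow> f \<in> borel_measurable M"
  by (simp add: Appr_def)

private lemma Appr_lim:
  assumes f[measurable]: "\<And>n. Appr (f n)" and [measurable]: "g \<in> borel_measurable M" and lim: "(\<lambda>n. L2d M g (f n)) \<longlonglongrightarrow> 0"
  shows "Appr g"
  unfolding Appr_def
proof (intro conjI allI impI)
  fix e :: ennreal assume e: "e > 0"
  have [measurable]: "f n \<in> borel_measurable M" for n using f Appr_meas by auto
  \<comment> \<open>\<open>e\<close> may be infinite; a finite \<open>e'\<close> below it has
    quarters that add up again.\<close>
  obtain e' where e': "e' > 0" "e' < e" "e' < \<infinity>"
    using e dense[OF e] by (metis infinity_ennreal_def order_less_le_trans top_greatest)
  have e4: "e' / 4 > 0" "e' / 4 < \<infinity>" using e' 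
    by (auto simp: ennreal_zero_less_divide ennreal_divide_eq_top_iff less_top[symmetric])
  obtain n where n: "L2d M g (f n) < e' / 4"
    using order_tendstoD(2)[OF lim e4(1)] by (auto simp: eventually_sequentially)
  obtain xs where xs: "set xs \<subseteq> UNIV \<times> G" "L2d M (f n) (step_fun xs) < e' / 4"
    using f[of n] e4 unfolding Appr_def by blast
  have [measurable]: "step_fun xs \<in> borel_measurable M" using step_G[OF xs(1)] by (simp add: square_integrable_def)
  have "L2d M g (step_fun xs) \<le> 2 * L2d M g (f n) + 2 * L2d M (f n) (step_fun xs)"
    by (rule L2d_triangle) auto
  also have "\<dots> \<le> 2 * (e' / 4) + 2 * (e' / 4)"
    using n xs(2) by (intro add_mono mult_left_mono) auto
  also have "\<dots> = e'"
  proof -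
    obtain r where r: "e' = ennreal r" "r > 0" using e' by (cases e') auto
    have "e' / 4 = ennreal (r / 4)" using r by (metis divide_ennreal ennreal_numeral less_imp_le zero_less_numeral)
    moreover have "2 * ennreal (r/4) = ennreal (2 * (r/4))"
      using r by (metis ennreal_mult' ennreal_numeral zero_le_numeral)
    ultimately have "2 * (e'/4) = ennreal (r / 2)" by simp
    thus ?thesis using r by (simp flip: ennreal_plus)
  qed
  also have "\<dots> < e" by fact
  finally show "\<exists>xs. set xs \<subseteq> UNIV \<times> G \<and> L2d M g (step_fun xs) < e" using xs(1) by auto
qed fact

private lemma Appr_step: "set xs \<subseteq> UNIV \<times> G \<Longrightarrow> Appr (step_fun xs)"
  unfolding Appr_def using step_G by (auto simp: square_integrable_def intro!: exI[of _ xs])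

private lemma Appr_seq:
  assumes "Appr f" 
  shows "\<exists>xs. (\<forall>n. set (xs n) \<subseteq> UNIV \<times> G) \<and> (\<lambda>n. L2d M f (step_fun (xs n))) \<longlonglongrightarrow> 0"
proof -
  have "\<exists>xs. set xs \<subseteq> UNIV \<times> G \<and> L2d M f (step_fun xs) < ennreal (1 / Suc n)" for n
    using assms unfolding Appr_def by (simp add: ennreal_zero_less_one)
  then obtain xs where xs: "\<And>n. set (xs n) \<subseteq> UNIV \<times> G" "\<And>n. L2d M f (step_fun (xs n)) < ennreal (1 / Suc n)"
    by metis
  have "(\<lambda>n. L2d M f (step_fun (xs n))) \<longlonglongrightarrow> 0"
  proof (rule ennreal_tendsto_zero_le)
    show "(\<lambda>n. ennreal (1 / Suc n)) \<longlonglongrightarrow> 0"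
      using tendsto_ennrealI[OF LIMSEQ_inverse_real_of_nat] by (simp add: inverse_eq_divide)
  qed (use xs(2) less_imp_le in blast)
  thus ?thesis using xs by blast
qed

private lemma Appr_add:
  assumes "Appr f" "Appr g" shows "Appr (\<lambda>x. f x + g x)"
proof -
  note [measurable] = Appr_meas[OF assms(1)] Appr_meas[OF assms(2)]
  obtain xs ys where xs: "\<And>n. set (xs n) \<subseteq> UNIV \<times> G" "(\<lambda>n. L2d M f (step_fun (xs n))) \<longlonglongrightarrow> 0"
    and ys: "\<And>n. set (ys n) \<subseteq> UNIV \<times> G" "(\<lambda>n. L2d M g (step_fun (ys n))) \<longlonglongrightarrow> 0"
    using assms[THEN Appr_seq] by blast
  have [measurable]: "step_fun (xs n) \<in> borel_measurable M" "step_fun (ys n) \<in> borel_measurable M" for n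
    using step_G[OF xs(1)] step_G[OF ys(1)] by (auto simp: square_integrable_def)
  have "(\<lambda>n. L2d M (\<lambda>x. f x + g x) (\<lambda>x. step_fun (xs n) x + step_fun (ys n) x)) \<longlonglongrightarrow> 0"
    by (intro L2d_tendsto_add xs ys) auto
  moreover have "Appr (\<lambda>x. step_fun (xs n) x + step_fun (ys n) x)" for n
    unfolding step_fun_append[symmetric] using xs(1)[of n] ys(1)[of n] by (intro Appr_step) auto
  ultimately show ?thesis
    by (rule Appr_lim[rotated 2]) auto
qed

private lemma Appr_scale:
  assumes "Appr f" shows "Appr (\<lambda>x. c * f x)"
proof -
  note [measurable] = Appr_meas[OF assms(1)]
  obtain xs where xs: "\<And>n. set (xs n) \<subseteq> UNIV \<times> G" "(\<lambda>n. L2d M f (step_fun (xs n))) \<longlonglongrightarrow> 0"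
    using assms[THEN Appr_seq] by blast
  have [measurable]: "step_fun (xs n) \<in> borel_measurable M" for n
    using step_G[OF xs(1)] by (auto simp: square_integrable_def)
  have "(\<lambda>n. L2d M (\<lambda>x. c * f x) (\<lambda>x. c * step_fun (xs n) x)) \<longlonglongrightarrow> 0"
    by (subst L2d_scale) (auto intro!: tendsto_zero_ennreal_mult xs)
  moreover have "set (map (map_prod ((*) c) id) (xs n)) \<subseteq> UNIV \<times> G" for n
    using xs(1)[of n] by auto
  hence "Appr (\<lambda>x. c * step_fun (xs n) x)" for n
    unfolding step_fun_scale[symmetric] by (rule Appr_step)
  ultimately show ?thesis
    by (rule Appr_lim[rotated 2]) auto
qed

private lemma Appr_G: "A \<in> G \<Longrightarrow> Appr (indicator A)"
  using Appr_step[of "[(1, A)]"] by (simp add: step_fun_Cons[abs_def])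

private lemma Appr_sum: "finite I \<Longrightarrow> (\<And>i. i \<in> I \<Longrightarrow> Appr (f i)) \<Longrightarrow> Appr (\<lambda>x. \<Sum>i\<in>I. f i x)"
proof (induction I rule: finite_induct)
  case empty thus ?case using Appr_step[of "[]"] by simp
qed (simp add: Appr_add)

text \<open>Dynkin's argument. Intersecting with \<open>E k\<close> keeps all measures finite:
  complements are taken inside \<open>E k\<close>, and for disjoint unions the tails are dominated
  by the indicator of \<open>E k\<close> and vanish pointwise.\<close>

private lemma Appr_indicator:
  assumes "A \<in> sets M" shows "Appr (indicator (A \<inter> E k))"
proof -
  have "A \<in> sigma_sets (space M) G" using assms G by simp
  with G(1) G_sub(2) show ?thesis
  proof (induction rule: sigma_sets_induct_disjoint)
    case (basic A)
    thus ?case using G(1) E(1) by (intro Appr_G) (blast dest: Int_stableD)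
  next
    case empty
    thus ?case using Appr_step[of "[]"] by simp
  next
    case (compl A)
    have "Appr (\<lambda>x. indicator (E k) x + (-1) * indicator (A \<inter> E k) x)"
      using E by (intro Appr_add Appr_scale compl Appr_G) auto
    moreover have "(\<lambda>x. indicator (E k) x + (-1) * indicator (A \<inter> E k) x :: real) = indicator ((space M - A) \<inter> E k)"
      using E(3) by (auto simp: indicator_def fun_eq_iff)
    ultimately show ?case by simp
  next
    case (union A)
    have [measurable]: "A i \<in> sets M" "E k \<in> sets M" for i using union(2) G(2) G_sub(1) E(1) by blast+
    have "L2d M (indicator ((\<Union>i. A i) \<inter> E k)) (\<lambda>x. \<Sum>i<n. indicator (A i \<inter> E k) x)
         = (\<integral>\<^sup>+x. indicator ((\<Union>i. A i) \<inter> E k - (\<Union>i<n. A i)) x \<partial>M)" for n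
      unfolding L2d_def
    proof (intro nn_integral_cong)
      fix x
      have "(\<Sum>i<n. indicator (A i \<inter> E k) x) = (indicator (\<Union>i<n. A i \<inter> E k) x :: real)"
        using union(1) by (intro indicator_UN_disjoint[symmetric]) (auto simp: disjoint_family_on_def)
      thus "ennreal ((indicator ((\<Union>i. A i) \<inter> E k) x - (\<Sum>i<n. indicator (A i \<inter> E k) x))\<^sup>2)
          = indicator ((\<Union>i. A i) \<inter> E k - (\<Union>i<n. A i)) x"
        by (auto simp: indicator_def split: if_splits)
    qed
    moreover have "(\<lambda>n. \<integral>\<^sup>+x. indicator ((\<Union>i. A i) \<inter> E k - (\<Union>i<n. A i)) x \<partial>M) \<longlonglongrightarrow> (\<integral>\<^sup>+x. 0 \<partial>M)"
    proof (rule nn_integral_dominated_convergence[where w="indicator (E k)"])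
      show "(\<integral>\<^sup>+ x. indicator (E k) x \<partial>M) < \<infinity>" using G(3) E(1) by auto
      show "AE x in M. (\<lambda>i. indicator ((\<Union>i. A i) \<inter> E k - (\<Union>i<i. A i)) x :: ennreal) \<longlonglongrightarrow> 0"
      proof (rule AE_I2, rule tendsto_eventually)
        fix x
        show "\<forall>\<^sub>F n in sequentially. indicator ((\<Union>i. A i) \<inter> E k - (\<Union>i<n. A i)) x = (0::ennreal)"
        proof (cases "x \<in> (\<Union>i. A i)")
          case True
          then obtain i where "x \<in> A i" by auto
          thus ?thesis by (intro eventually_sequentiallyI[of "Suc i"]) (auto simp: indicator_def)
        qed auto
      qed
    qed (auto simp: indicator_def)
    ultimately have "(\<lambda>n. L2d M (indicator ((\<Union>i. A i) \<inter> E k)) (\<lambda>x. \<Sum>i<n. indicator (A i \<inter> E k) x)) \<longlonglongrightarrow> 0"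
      by simp
    thus ?case by (rule Appr_lim[rotated 2]) (auto intro!: Appr_sum union)
  qed
qed

text \<open>Simple functions with |F i| \<le> 2 |f| converge to f and are cut off to
  \<open>E i\<close>. The squared error is dominated by 9 f^2, where 9 = (1 + 2)^2.\<close>

lemma L2_dense_step_fun:
  assumes f: "square_integrable M f" and e: "e > 0"
  shows "\<exists>xs. set xs \<subseteq> UNIV \<times> G \<and> L2d M f (step_fun xs) < e"
proof -
  have fm[measurable]: "f \<in> borel_measurable M" using f by (simp add: square_integrable_def)
  have [measurable]: "E k \<in> sets M" for k using G_sub(1) E(1) by blast
  from borel_measurable_implies_sequence_metric[OF fm, of 0]
  obtain F where F: "\<And>i. simple_function M (F i)"
    "\<And>x. x \<in> space M \<Longrightarrow> (\<lambda>i. F i x) \<longlonglongrightarrow> f x"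
    "\<And>i x. x \<in> space M \<Longrightarrow> norm (F i x) \<le> 2 * norm (f x)"
    unfolding norm_conv_dist by blast
  have [measurable]: "F i \<in> borel_measurable M" for i using F(1) by (rule borel_measurable_simple_function)
  have A: "Appr (\<lambda>x. F i x * indicator (E i) x)" for i
  proof -
    have "Appr (\<lambda>x. \<Sum>r\<in>F i ` space M. r * indicator (F i -` {r} \<inter> space M \<inter> E i) x)"
      by (intro Appr_sum Appr_scale Appr_indicator simple_functionD(1)[OF F(1)]) measurable
    moreover have "(\<Sum>r\<in>F i ` space M. r * indicator (F i -` {r} \<inter> space M \<inter> E i) x) = F i x * indicator (E i) x" for x
    proof (cases "x \<in> space M")
      case True
      have "(\<Sum>r\<in>F i ` space M. r * indicator (F i -` {r} \<inter> space M \<inter> E i) x)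
         = (\<Sum>r\<in>F i ` space M. if r = F i x then r * indicator (E i) x else 0)"
        using True by (intro sum.cong) (auto simp: indicator_def)
      also have "\<dots> = F i x * indicator (E i) x" using True simple_functionD(1)[OF F(1)] by (simp add: sum.delta')
      finally show ?thesis .
    next
      case False
      hence "x \<notin> E i" using E(3) by auto
      thus ?thesis by simp
    qed
    ultimately show ?thesis by (simp cong: measurable_cong_simp)
  qed
  have "(\<lambda>i. L2d M f (\<lambda>x. F i x * indicator (E i) x)) \<longlonglongrightarrow> (\<integral>\<^sup>+x. 0 \<partial>M)"
    unfolding L2d_def
  proof (rule nn_integral_dominated_convergence[where w="\<lambda>x. ennreal (9 * (f x)\<^sup>2)"])
    show "AE x in M. ennreal ((f x - F i x * indicator (E i) x)\<^sup>2) \<le> ennreal (9 * (f x)\<^sup>2)" for i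
    proof (rule AE_I2, rule ennreal_leI)
      fix x assume x: "x \<in> space M"
      have "\<bar>f x - F i x * indicator (E i) x\<bar> \<le> 3 * \<bar>f x\<bar>"
        using F(3)[OF x, of i] by (auto simp: indicator_def)
      hence "\<bar>f x - F i x * indicator (E i) x\<bar>\<^sup>2 \<le> (3 * \<bar>f x\<bar>)\<^sup>2" by (intro power_mono) auto
      thus "(f x - F i x * indicator (E i) x)\<^sup>2 \<le> 9 * (f x)\<^sup>2" by (simp add: power_mult_distrib)
    qed
    show "(\<integral>\<^sup>+ x. ennreal (9 * (f x)\<^sup>2) \<partial>M) < \<infinity>"
    proof -
      have "(\<integral>\<^sup>+ x. ennreal (9 * (f x)\<^sup>2) \<partial>M) = 9 * L2d M f (\<lambda>_. 0)"
        unfolding L2d_def by (subst nn_integral_cmult[symmetric]) (auto simp: ennreal_mult')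
      thus ?thesis using f by (simp add: square_integrable_iff_L2d ennreal_mult_less_top)
    qed
    show "AE x in M. (\<lambda>i. ennreal ((f x - F i x * indicator (E i) x)\<^sup>2)) \<longlonglongrightarrow> 0"
    proof (rule AE_I2)
      fix x assume x: "x \<in> space M"
      then obtain k where "x \<in> E k" using E(3) by auto
      hence "eventually (\<lambda>i. indicator (E i) x = (1::real)) sequentially"
        using E(2) by (intro eventually_sequentiallyI[of k]) (auto simp: incseq_def indicator_def)
      hence "(\<lambda>i. indicator (E i) x :: real) \<longlonglongrightarrow> 1" by (rule tendsto_eventually)
      hence "(\<lambda>i. (f x - F i x * indicator (E i) x)\<^sup>2) \<longlonglongrightarrow> (f x - f x * 1)\<^sup>2"
        by (intro tendsto_intros F(2) x)
      from tendsto_ennrealI[OF this] show "(\<lambda>i. ennreal ((f x - F i x * indicator (E i) x)\<^sup>2)) \<longlonglongrightarrow> 0" by simp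
    qed
  qed auto
  hence "(\<lambda>i. L2d M f (\<lambda>x. F i x * indicator (E i) x)) \<longlonglongrightarrow> 0" by simp
  hence "Appr f" by (rule Appr_lim[OF A, rotated]) simp
  thus ?thesis using e unfolding Appr_def by auto
qed

end

section \<open>Separability of \<open>L\<^sup>2(D, \<lambda>)\<close>\<close>

lemma space_lambda_D [simp]: "space lambda_D = {0<..}"
  and sets_lambda_D: "sets lambda_D = sets (restrict_space borel {0<..})"
  by (auto simp: lambda_D_def space_restrict_space sets_restrict_space)

lemma measurable_lambda_D: "f \<in> borel_measurable borel \<Longrightarrow> f \<in> borel_measurable lambda_D"
  by (simp add: lambda_D_def measurable_restrict_space1)

lemma id_measurable_lambda_D: "(\<lambda>x. x) \<in> measurable lambda_D borel"
  by (rule measurable_lambda_D) simp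

lemma sigma_finite_lambda_D: "sigma_finite_measure lambda_D"
  unfolding lambda_D_def by (rule sigma_finite_measure_restrict_space) (auto intro: lborel.sigma_finite_measure_axioms)

interpretation lambda_D: sigma_finite_measure lambda_D by (rule sigma_finite_lambda_D)

lemma emeasure_lambda_D: "A \<subseteq> {0<..} \<Longrightarrow> emeasure lambda_D A = emeasure lborel A"
  unfolding lambda_D_def by (rule emeasure_restrict_space) auto

lemma emeasure_Ioo_finite: "emeasure lborel {0<..<b::real} < top"
  using emeasure_lborel_Ioo[of 0 b] by (cases "0 \<le> b") auto

lemma emeasure_lambda_D_Ioo_finite: "emeasure lambda_D {0<..<b::real} < top"
  by (subst emeasure_lambda_D) (auto simp: emeasure_Ioo_finite)

lemma L2_class_add:
  "square_integrable lambda_D f \<Longrightarrow> square_integrable lambda_D g \<Longrightarrow>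
    L2_class (\<lambda>x. f x + g x) = L2_class f + L2_class g"
  by transfer (auto simp: L2_eq_def)

lemma L2_class_scale:
  "square_integrable lambda_D f \<Longrightarrow> L2_class (\<lambda>x. r * f x) = r *\<^sub>R L2_class f"
  by transfer (auto simp: L2_eq_def)

lemma L2_class_0 [simp]: "L2_class (\<lambda>_. 0) = 0"
  by transfer (auto simp: L2_eq_def)

lemma L2_class_diff:
  assumes "square_integrable lambda_D f" "square_integrable lambda_D g"
  shows "L2_class (\<lambda>x. f x - g x) = L2_class f - L2_class g"
  using L2_class_add[OF assms(1) square_integrable_scale[OF assms(2), of "-1"]] L2_class_scale[OF assms(2), of "-1"]
  by simp

lemma L2_class_not: "\<not> square_integrable lambda_D f \<Longrightarrow> L2_class f = 0"
  by transfer (auto simp: L2_eq_def)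

lemma norm_L2_class_diff:
  assumes "square_integrable lambda_D f" "square_integrable lambda_D g"
  shows "ennreal ((norm (L2_class f - L2_class g))\<^sup>2) = L2d lambda_D f g"
proof -
  have "(norm (L2_class f - L2_class g))\<^sup>2 = inner (L2_class (\<lambda>x. f x - g x)) (L2_class (\<lambda>x. f x - g x))"
    by (simp add: L2_class_diff[OF assms] power2_norm_eq_inner)
  also have "\<dots> = (\<integral>x. (f x - g x)\<^sup>2 \<partial>lambda_D)"
    by (simp add: inner_L2_class square_integrable_diff assms power2_eq_square)
  finally show ?thesis by (simp add: L2d_eq_integral assms)
qed

lemma L2_class_obtain:
  obtains f where "square_integrable lambda_D f" "L2_class f = h"
  using L2_class_surj by blast

text \<open>All intervals start at 0, so that the family is closed under intersection; the case q
  \<le> 0 contributes the empty set.\<close>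

definition rat_intervals :: "real set set" where
  "rat_intervals = range (\<lambda>q::rat. {0<..<real_of_rat q})"

lemma sets_lambda_D_rat_intervals: "sets lambda_D = sigma_sets (space lambda_D) rat_intervals"
proof -
  have sub: "rat_intervals \<subseteq> Pow {0<..}" by (auto simp: rat_intervals_def)
  let ?N = "sigma {0<..} rat_intervals"
  have "(\<lambda>x. x) \<in> borel_measurable ?N"
  proof (rule borel_measurableI_less)
    fix a :: real
    have "{x \<in> space ?N. x < a} = (\<Union>q\<in>{q. real_of_rat q < a}. {0<..<real_of_rat q})"
    proof (intro set_eqI iffI)
      fix x assume "x \<in> {x \<in> space ?N. x < a}"
      hence x: "0 < x" "x < a" using sub by (auto simp: space_measure_of)
      then obtain q where "x < real_of_rat q" "real_of_rat q < a" using of_rat_dense by blast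
      thus "x \<in> (\<Union>q\<in>{q. real_of_rat q < a}. {0<..<real_of_rat q})" using x by auto
    qed (use sub in \<open>auto simp: space_measure_of\<close>)
    also have "\<dots> \<in> sets ?N"
      using sub by (intro sets.countable_UN') (auto simp: rat_intervals_def intro!: sigma_sets.Basic)
    finally show "{x \<in> space ?N. x < a} \<in> sets ?N" .
  qed
  hence 1: "{0<..} \<inter> A \<in> sets ?N" if "A \<in> sets borel" for A
  proof -
    have "(\<lambda>x. x) -` A \<inter> space ?N \<in> sets ?N" by (rule measurable_sets) (fact \<open>(\<lambda>x. x) \<in> borel_measurable ?N\<close>, fact that)
    thus ?thesis using sub by (simp add: space_measure_of Int_commute)
  qed
  have "sets lambda_D \<subseteq> sets ?N"
    unfolding sets_lambda_D sets_restrict_space by (rule image_subsetI) (rule 1)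
  moreover have "sets ?N \<subseteq> sets lambda_D"
  proof -
    have "rat_intervals \<subseteq> sets lambda_D"
      by (auto simp: rat_intervals_def sets_lambda_D sets_restrict_space)
    from sets.sigma_sets_subset[OF this] show ?thesis using sub by simp
  qed
  ultimately show ?thesis using sub by simp
qed

lemma step_fun_rat_dense:
  assumes "square_integrable lambda_D f" "e > 0"
  shows "\<exists>xs. set xs \<subseteq> UNIV \<times> rat_intervals \<and> L2d lambda_D f (step_fun xs) < e"
proof (rule L2_dense_step_fun[where E="\<lambda>k. {0<..<real k}"])
  show "Int_stable rat_intervals"
  proof (rule Int_stableI)
    fix A B assume "A \<in> rat_intervals" "B \<in> rat_intervals"
    then obtain p q where "A = {0<..<real_of_rat p}" "B = {0<..<real_of_rat q}" by (auto simp: rat_intervals_def)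
    moreover have "{0<..<real_of_rat p} \<inter> {0<..<real_of_rat q} = {0<..<real_of_rat (min p q)}"
      by (auto simp: min_def of_rat_less_eq)
    ultimately show "A \<inter> B \<in> rat_intervals" unfolding rat_intervals_def by auto
  qed
  show "emeasure lambda_D A < \<infinity>" if "A \<in> rat_intervals" for A
    using that by (auto simp: rat_intervals_def emeasure_lambda_D_Ioo_finite)
  show "range (\<lambda>k. {0<..<real k}) \<subseteq> rat_intervals"
  proof
    fix A assume "A \<in> range (\<lambda>k. {0<..<real k})"
    then obtain k where "A = {0<..<real k}" by auto
    hence "A = {0<..<real_of_rat (of_nat k)}" by simp
    thus "A \<in> rat_intervals" unfolding rat_intervals_def by blast
  qed
  show "incseq (\<lambda>k. {0<..<real k})" by (auto simp: incseq_def)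
  show "(\<Union>k. {0<..<real k}) = space lambda_D" using reals_Archimedean2 by auto
qed (use assms sets_lambda_D_rat_intervals in auto)

text \<open>A countable family, as it is indexed by lists of pairs of rationals: a coefficient and a
  right endpoint.\<close>

definition L2D_rat :: "(rat \<times> rat) list \<Rightarrow> L2D" where
  "L2D_rat xs = (\<Sum>(r, q)\<leftarrow>xs. real_of_rat r *\<^sub>R L2_class (indicator {0<..<real_of_rat q}))"

lemma rat_interval_sq: "A \<in> rat_intervals \<Longrightarrow> square_integrable lambda_D (indicator A)"
  by (rule square_integrable_indicator)
     (auto simp: rat_intervals_def emeasure_lambda_D_Ioo_finite sets_lambda_D sets_restrict_space)

lemma L2D_rat_dense_step:
  assumes "set xs \<subseteq> UNIV \<times> rat_intervals" "e > 0"
  shows "square_integrable lambda_D (step_fun xs) \<and> (\<exists>ys. norm (L2_class (step_fun xs) - L2D_rat ys) < e)"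
  using assms
proof (induction xs arbitrary: e)
  case Nil
  thus ?case by (auto intro!: exI[of _ "[]"] simp: L2D_rat_def)
next
  case (Cons p xs)
  then obtain a q where p: "p = (a, {0<..<real_of_rat q})" by (auto simp: rat_intervals_def)
  define v where "v = L2_class (indicator {0<..<real_of_rat q})"
  have sq: "square_integrable lambda_D (indicator {0<..<real_of_rat q})"
    by (rule rat_interval_sq) (auto simp: rat_intervals_def)
  have xs: "square_integrable lambda_D (step_fun xs)" using Cons by auto
  obtain ys where ys: "norm (L2_class (step_fun xs) - L2D_rat ys) < e / 2"
    using Cons.IH[of "e/2"] Cons.prems by auto
  \<comment> \<open>A coefficient error of this size contributes at most e / 2 to the norm; the
    summand 1 covers v = 0.\<close>
  have "e / (2 * (norm v + 1)) > 0" using Cons.prems by (simp add: add_nonneg_pos)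
  then obtain r where r: "a < real_of_rat r" "real_of_rat r < a + e / (2 * (norm v + 1))"
    using of_rat_dense[of a "a + e / (2 * (norm v + 1))"] by auto
  have "\<bar>a - real_of_rat r\<bar> * norm v \<le> (e / (2 * (norm v + 1))) * norm v"
    using r by (intro mult_right_mono) auto
  also have "\<dots> = e / 2 * (norm v / (norm v + 1))" by simp
  also have "\<dots> \<le> e / 2 * 1" using Cons.prems norm_ge_zero[of v] by (intro mult_left_mono) (simp_all add: divide_le_eq del: norm_ge_zero)
  also have "\<dots> = e / 2" by simp
  finally have 1: "\<bar>a - real_of_rat r\<bar> * norm v \<le> e / 2" .
  have eq: "L2_class (step_fun (p # xs)) = a *\<^sub>R v + L2_class (step_fun xs)"
    unfolding p step_fun_Cons[abs_def] v_def using sq xs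
    by (subst L2_class_add) (auto simp: L2_class_scale)
  have "L2_class (step_fun (p # xs)) - L2D_rat ((r, q) # ys)
      = (a - real_of_rat r) *\<^sub>R v + (L2_class (step_fun xs) - L2D_rat ys)"
    by (simp add: eq L2D_rat_def v_def algebra_simps)
  also have "norm \<dots> \<le> \<bar>a - real_of_rat r\<bar> * norm v + norm (L2_class (step_fun xs) - L2D_rat ys)"
    by (rule norm_triangle_le) simp
  also have "\<dots> < e" using 1 ys by linarith
  finally have "norm (L2_class (step_fun (p # xs)) - L2D_rat ((r, q) # ys)) < e" .
  moreover have "square_integrable lambda_D (step_fun (p # xs))"
    unfolding p step_fun_Cons[abs_def] using sq xs by auto
  ultimately show ?case by blast
qed

lemma L2D_rat_dense:
  assumes "e > 0" shows "\<exists>ys. norm (h - L2D_rat ys) < e"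
proof -
  obtain f where f: "square_integrable lambda_D f" "L2_class f = h" by (rule L2_class_obtain)
  obtain xs where xs: "set xs \<subseteq> UNIV \<times> rat_intervals" "L2d lambda_D f (step_fun xs) < ennreal ((e/2)\<^sup>2)"
    using step_fun_rat_dense[OF f(1), of "ennreal ((e/2)\<^sup>2)"] assms by auto
  obtain ys where ys: "square_integrable lambda_D (step_fun xs)" "norm (L2_class (step_fun xs) - L2D_rat ys) < e / 2"
    using L2D_rat_dense_step[OF xs(1), of "e/2"] assms by auto
  have "ennreal ((norm (h - L2_class (step_fun xs)))\<^sup>2) < ennreal ((e/2)\<^sup>2)"
    using xs(2) norm_L2_class_diff[OF f(1) ys(1)] f(2) by simp
  hence "(norm (h - L2_class (step_fun xs)))\<^sup>2 < (e/2)\<^sup>2" by (simp add: ennreal_less_iff)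
  hence "norm (h - L2_class (step_fun xs)) < e / 2"
    using assms by (intro power_less_imp_less_base[of _ 2 "e/2"]) auto
  hence "norm ((h - L2_class (step_fun xs)) + (L2_class (step_fun xs) - L2D_rat ys)) < e"
    using ys(2) norm_triangle_ineq[of "h - L2_class (step_fun xs)" "L2_class (step_fun xs) - L2D_rat ys"] by linarith
  thus ?thesis by auto
qed

definition L2D_basis :: "L2D set set" where
  "L2D_basis = range (\<lambda>(ys, n). ball (L2D_rat ys) (1 / real (Suc n)))"

lemma countable_L2D_basis: "countable L2D_basis"
  unfolding L2D_basis_def by (rule countable_image) simp

lemma topological_basis_L2D_basis: "topological_basis L2D_basis"
proof (rule topological_basisI)
  fix U x assume U: "open (U :: L2D set)" "x \<in> U"
  then obtain e where e: "e > 0" "ball x e \<subseteq> U" by (meson openE)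
  obtain n where n: "1 / real (Suc n) < e / 2" using e(1) nat_approx_posE[of "e/2"] by auto
  obtain ys where ys: "norm (x - L2D_rat ys) < 1 / real (Suc n)" using L2D_rat_dense[of "1 / real (Suc n)" x] by auto
  have "ball (L2D_rat ys) (1 / real (Suc n)) \<subseteq> ball x e"
  proof
    fix z assume "z \<in> ball (L2D_rat ys) (1 / real (Suc n))"
    hence "dist (L2D_rat ys) z < e / 2" using n by simp
    moreover have "dist x (L2D_rat ys) < e / 2" using ys n by (simp add: dist_norm)
    ultimately have "dist x z < e" using dist_triangle[of x z "L2D_rat ys"] by linarith
    thus "z \<in> ball x e" by simp
  qed
  moreover have "x \<in> ball (L2D_rat ys) (1 / real (Suc n))" using ys by (simp add: dist_norm norm_minus_commute)
  ultimately show "\<exists>B\<in>L2D_basis. x \<in> B \<and> B \<subseteq> U" 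
    using e(2) unfolding L2D_basis_def by (intro bexI[of _ "ball (L2D_rat ys) (1 / real (Suc n))"]) auto
qed (auto simp: L2D_basis_def)

text \<open>Second countability makes sums and inner products of measurable
  \<open>L2D\<close>-valued functions measurable.\<close>

instance L2D :: second_countable_topology
proof
  show "\<exists>B::L2D set set. countable B \<and> open = generate_topology B"
    using countable_L2D_basis topological_basis_imp_subbasis[OF topological_basis_L2D_basis] by blast
qed

text \<open>Closed balls are intersections of countably many half-spaces: one direction is
  Cauchy-Schwarz, the other tests x against a sequence from the dense family tending to x. Norms
  thus become measurable as soon as inner products are.\<close>

lemma norm_le_iff_inner_L2D_rat:
  assumes "r \<ge> 0"
  shows "norm x \<le> r \<longleftrightarrow> (\<forall>ys. inner x (L2D_rat ys) \<le> r * norm (L2D_rat ys))"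
proof safe
  fix ys assume "norm x \<le> r"
  hence "norm x * norm (L2D_rat ys) \<le> r * norm (L2D_rat ys)" by (intro mult_right_mono) auto
  thus "inner x (L2D_rat ys) \<le> r * norm (L2D_rat ys)" using norm_cauchy_schwarz[of x "L2D_rat ys"] by linarith
next
  assume *: "\<forall>ys. inner x (L2D_rat ys) \<le> r * norm (L2D_rat ys)"
  have "\<exists>ys. norm (x - L2D_rat ys) < 1 / Suc n" for n using L2D_rat_dense[of "1 / Suc n" x] by simp
  then obtain ys where ys: "\<And>n. norm (x - L2D_rat (ys n)) < 1 / Suc n" by metis
  have "(\<lambda>n. x - L2D_rat (ys n)) \<longlonglongrightarrow> 0"
    by (rule Lim_null_comparison[OF _ LIMSEQ_inverse_real_of_nat])
       (use ys in \<open>auto simp: inverse_eq_divide intro!: always_eventually less_imp_le\<close>)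
  hence "(\<lambda>n. x - (x - L2D_rat (ys n))) \<longlonglongrightarrow> x - 0" by (intro tendsto_intros)
  hence lim: "(\<lambda>n. L2D_rat (ys n)) \<longlonglongrightarrow> x" by simp
  have "(\<lambda>n. inner x (L2D_rat (ys n))) \<longlonglongrightarrow> inner x x" "(\<lambda>n. r * norm (L2D_rat (ys n))) \<longlonglongrightarrow> r * norm x"
    by (intro tendsto_intros lim)+
  hence "inner x x \<le> r * norm x" using * by (intro LIMSEQ_le) auto
  hence "norm x * norm x \<le> r * norm x" by (simp add: power2_norm_eq_inner[symmetric] power2_eq_square)
  thus "norm x \<le> r" using assms by (cases "norm x = 0") (auto simp: mult_le_cancel_right)
qed

text \<open>Weak measurability suffices by separability: norms of differences are measurable through
  countably many inner products, and every open set is a countable union of balls around the points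
  \<open>L2D_rat ys\<close>.\<close>

lemma borel_measurable_L2D_I:
  assumes "\<And>f. square_integrable lambda_D f \<Longrightarrow> (\<lambda>\<omega>. inner (h \<omega>) (L2_class f)) \<in> borel_measurable N"
  shows "h \<in> borel_measurable N"
proof (rule borel_measurableI)
  have m: "(\<lambda>\<omega>. inner (h \<omega>) d) \<in> borel_measurable N" for d
  proof -
    obtain f where f: "square_integrable lambda_D f" "L2_class f = d" by (rule L2_class_obtain)
    show ?thesis using assms[OF f(1)] unfolding f(2) .
  qed
  have *: "(\<lambda>\<omega>. norm (h \<omega> - d)) \<in> borel_measurable N" for d
    unfolding borel_measurable_iff_le
  proof
    fix r :: real
    show "{\<omega> \<in> space N. norm (h \<omega> - d) \<le> r} \<in> sets N"
    proof (cases "r \<ge> 0")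
      case True
      have "{\<omega> \<in> space N. norm (h \<omega> - d) \<le> r}
         = {\<omega> \<in> space N. \<forall>ys. inner (h \<omega>) (L2D_rat ys) - inner d (L2D_rat ys) \<le> r * norm (L2D_rat ys)}"
        using norm_le_iff_inner_L2D_rat[OF True] by (auto simp: inner_diff_left)
      also have "\<dots> \<in> sets N"
        by (intro sets.sets_Collect_countable_All borel_measurable_le borel_measurable_diff m borel_measurable_const)
      finally show ?thesis .
    next
      case False
      hence "\<not> norm (h \<omega> - d) \<le> r" for \<omega> using norm_ge_zero[of "h \<omega> - d"] by linarith
      thus ?thesis by simp
    qed
  qed
  fix U assume "open (U :: L2D set)"
  then obtain B where B: "B \<subseteq> L2D_basis" "\<Union>B = U"
    using topological_basis_L2D_basis by (auto simp: topological_basis_def)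
  have "h -` U \<inter> space N = (\<Union>b\<in>B. h -` b \<inter> space N)" using B by auto
  also have "\<dots> \<in> sets N"
  proof (intro sets.countable_UN'')
    show "countable B" using B(1) countable_L2D_basis countable_subset by blast
    fix b assume "b \<in> B"
    then obtain ys n where b: "b = ball (L2D_rat ys) (1 / real (Suc n))" using B(1) by (auto simp: L2D_basis_def)
    have "h -` b \<inter> space N = {\<omega> \<in> space N. norm (h \<omega> - L2D_rat ys) < 1 / real (Suc n)}"
      by (auto simp: b dist_norm norm_minus_commute)
    also have "\<dots> \<in> sets N" by (intro borel_measurable_less * borel_measurable_const)
    finally show "h -` b \<inter> space N \<in> sets N" .
  qed
  finally show "h -` U \<inter> space N \<in> sets N" .
qed

lemma borel_measurable_L2_class:
  assumes [measurable]: "z \<in> borel_measurable (N \<Otimes>\<^sub>M lambda_D)"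
  shows "(\<lambda>\<omega>. L2_class (\<lambda>y. z (\<omega>, y))) \<in> borel_measurable N"
proof (rule borel_measurable_L2D_I)
  fix f assume f: "square_integrable lambda_D f"
  have [measurable]: "f \<in> borel_measurable lambda_D" using f by (simp add: square_integrable_def)
  \<comment> \<open>\<open>L2_class\<close> sends a section that is not square integrable to 0, so
    the inner product is the integral only where the section has finite norm.\<close>
  have "(\<lambda>\<omega>. if L2d lambda_D (\<lambda>y. z (\<omega>, y)) (\<lambda>_. 0) < \<infinity> then \<integral>y. z (\<omega>, y) * f y \<partial>lambda_D else 0) \<in> borel_measurable N"
    unfolding L2d_def
    by (intro measurable_If borel_measurable_const lambda_D.borel_measurable_lebesgue_integral
        borel_measurable_less lambda_D.borel_measurable_nn_integral) measurable
  moreover have "(if L2d lambda_D (\<lambda>y. z (\<omega>, y)) (\<lambda>_. 0) < \<infinity> then \<integral>y. z (\<omega>, y) * f y \<partial>lambda_D else 0)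
     = inner (L2_class (\<lambda>y. z (\<omega>, y))) (L2_class f)" if "\<omega> \<in> space N" for \<omega>
  proof -
    have [measurable]: "(\<lambda>y. z (\<omega>, y)) \<in> borel_measurable lambda_D" using that by measurable
    show ?thesis using f by (auto simp: inner_L2_class square_integrable_iff_L2d L2_class_not)
  qed
  ultimately show "(\<lambda>\<omega>. inner (L2_class (\<lambda>y. z (\<omega>, y))) (L2_class f)) \<in> borel_measurable N"
    by (simp cong: measurable_cong)
qed

section \<open>Measures determined by characteristic functionals\<close>

lemma iexp_add: "iexp (a + b) = iexp a * iexp b"
  by (simp add: exp_add distrib_left)

text \<open>The value of the characteristic function at 0 is the total mass, so both measures have
  the same mass r. For r > 0 Levy's theorem applies to the normalised measures; for r = 0 both
  vanish.\<close>

lemma Levy_uniqueness_finite: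
  fixes \<mu> \<nu> :: "real measure"
  assumes "finite_measure \<mu>" "finite_measure \<nu>" and sets: "sets \<mu> = sets borel" "sets \<nu> = sets borel"
    and cf: "\<And>u. (\<integral>x. iexp (u * x) \<partial>\<mu>) = (\<integral>x. iexp (u * x) \<partial>\<nu>)"
  shows "\<mu> = \<nu>"
proof -
  interpret \<mu>: finite_measure \<mu> by fact
  interpret \<nu>: finite_measure \<nu> by fact
  have sp: "space \<mu> = UNIV" "space \<nu> = UNIV"
    using sets_eq_imp_space_eq[OF sets(1)] sets_eq_imp_space_eq[OF sets(2)] by simp_all
  define r where "r = measure \<mu> UNIV"
  have "complex_of_real (measure \<mu> UNIV) = complex_of_real (measure \<nu> UNIV)"
    using cf[of 0] sp by simp
  hence r: "measure \<nu> UNIV = r" by (simp add: r_def)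
  show ?thesis
  proof (cases "r = 0")
    case True
    have "emeasure \<mu> UNIV = 0" "emeasure \<nu> UNIV = 0"
      using r True by (auto simp: r_def \<mu>.emeasure_eq_measure \<nu>.emeasure_eq_measure)
    hence "emeasure \<mu> A = 0" "emeasure \<nu> A = 0" for A
      using emeasure_space[of \<mu> A] emeasure_space[of \<nu> A] sp by auto
    thus ?thesis by (intro measure_eqI) (auto simp: sets)
  next
    case False
    hence r0: "r > 0" using zero_less_measure_iff r_def by (simp add: order_less_le)
    define P where "P = density \<mu> (\<lambda>_. ennreal (1 / r))"
    define Q where "Q = density \<nu> (\<lambda>_. ennreal (1 / r))"
    have P: "real_distribution P"
    proof (rule real_distribution.intro)
      show "prob_space P"
        using r0 sp sets by (intro prob_spaceI)
          (simp add: P_def emeasure_density_const \<mu>.emeasure_eq_measure r_def[symmetric] ennreal_mult'[symmetric])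
    qed (auto simp: real_distribution_axioms_def P_def sets sp)
    have Q: "real_distribution Q"
    proof (rule real_distribution.intro)
      show "prob_space Q"
        using r0 sp sets by (intro prob_spaceI)
          (simp add: Q_def emeasure_density_const \<nu>.emeasure_eq_measure r ennreal_mult'[symmetric])
    qed (auto simp: real_distribution_axioms_def Q_def sets sp)
    have m: "(\<lambda>x. iexp (u * x)) \<in> borel_measurable \<mu>" "(\<lambda>x. iexp (u * x)) \<in> borel_measurable \<nu>" for u
      unfolding measurable_cong_sets[OF sets(1) refl] measurable_cong_sets[OF sets(2) refl] by measurable
    have "char P = char Q"
      unfolding char_def P_def Q_def
      by (rule ext, subst (1 2) integral_density) (use m r0 cf in \<open>auto simp: scaleR_conv_of_real\<close>)
    hence PQ: "P = Q" by (rule Levy_uniqueness[OF P Q])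
    show ?thesis
    proof (rule measure_eqI)
      show "sets \<mu> = sets \<nu>" by (simp add: sets)
      fix A assume A: "A \<in> sets \<mu>"
      hence "ennreal (1/r) * emeasure \<mu> A = ennreal (1/r) * emeasure \<nu> A"
        using PQ sets by (simp add: P_def Q_def emeasure_density_const[symmetric])
      hence "ennreal r * (ennreal (1/r) * emeasure \<mu> A) = ennreal r * (ennreal (1/r) * emeasure \<nu> A)" by simp
      moreover have "ennreal r * (ennreal (1/r) * x) = x" for x
      proof -
        have "ennreal r * ennreal (1/r) = 1" using r0 by (simp add: ennreal_mult'[symmetric])
        thus ?thesis by (metis mult.assoc mult_1)
      qed
      ultimately show "emeasure \<mu> A = emeasure \<nu> A" by metis
    qed
  qed
qed

section \<open>Uniqueness from one dimension, iterated over finitely many functionals\<close>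

context
  fixes \<mu> \<nu> :: "'a measure" and LL :: "('a \<Rightarrow> real) set"
  assumes fin: "finite_measure \<mu>" "finite_measure \<nu>"
    and sets_eq: "sets \<mu> = sets \<nu>"
    and meas: "\<And>h. h \<in> LL \<Longrightarrow> h \<in> borel_measurable \<mu>"
    and LL_add: "\<And>h h'. h \<in> LL \<Longrightarrow> h' \<in> LL \<Longrightarrow> (\<lambda>x. h x + h' x) \<in> LL"
    and LL_scale: "\<And>h r. h \<in> LL \<Longrightarrow> (\<lambda>x. r * h x) \<in> LL"
    and cf: "\<And>h. h \<in> LL \<Longrightarrow> (\<integral>x. iexp (h x) \<partial>\<mu>) = (\<integral>x. iexp (h x) \<partial>\<nu>)"
begin

private lemma meas': "h \<in> LL \<Longrightarrow> h \<in> borel_measurable \<nu>"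
  using meas measurable_cong_sets[OF sets_eq refl] by blast

text \<open>Adds one more condition, that g lies in B, to a weight w for which the weighted
  characteristic functionals agree. For a bounded nonnegative factor \<phi> the laws of g under the
  densities w * \<phi> are finite measures on the line; once their characteristic functions agree,
  so do the integrals of w * \<phi> over the event that g lies in B.\<close>

private lemma weighted_cf_step:
  assumes w[measurable]: "w \<in> borel_measurable \<mu>" and w01: "\<And>x. 0 \<le> w x \<and> w x \<le> (1::real)"
    and eq: "\<And>h. h \<in> LL \<Longrightarrow> (\<integral>x. w x * iexp (h x) \<partial>\<mu>) = (\<integral>x. w x * iexp (h x) \<partial>\<nu>)"
    and g: "g \<in> LL" and B[measurable]: "B \<in> sets borel" and h: "h \<in> LL"
  shows "(\<integral>x. complex_of_real (w x * indicator B (g x)) * iexp (h x) \<partial>\<mu>) = (\<integral>x. complex_of_real (w x * indicator B (g x)) * iexp (h x) \<partial>\<nu>)"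
proof -
  interpret \<mu>: finite_measure \<mu> by (rule fin)
  interpret \<nu>: finite_measure \<nu> by (rule fin)
  have [measurable]: "g \<in> borel_measurable \<mu>" "h \<in> borel_measurable \<mu>" "g \<in> borel_measurable \<nu>"
    "h \<in> borel_measurable \<nu>" "w \<in> borel_measurable \<nu>"
    using meas meas' g h w measurable_cong_sets[OF sets_eq refl] by blast+
  have key: "(\<integral>x. w x * \<phi> x * indicator B (g x) \<partial>\<mu>) = (\<integral>x. w x * \<phi> x * indicator B (g x) \<partial>\<nu>)"
    if [measurable]: "\<phi> \<in> borel_measurable \<mu>" and \<phi>: "\<And>x. 0 \<le> \<phi> x \<and> \<phi> x \<le> 2"
      and e: "\<And>u. (\<integral>x. complex_of_real (w x * \<phi> x) * iexp (u * g x) \<partial>\<mu>) = (\<integral>x. complex_of_real (w x * \<phi> x) * iexp (u * g x) \<partial>\<nu>)"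
    for \<phi> :: "'a \<Rightarrow> real"
  proof -
    have [measurable]: "\<phi> \<in> borel_measurable \<nu>" using that(1) measurable_cong_sets[OF sets_eq refl] by blast
    have bd: "0 \<le> w x * \<phi> x" "w x * \<phi> x \<le> 2" for x
      using mult_mono[of "w x" 1 "\<phi> x" 2] w01[of x] \<phi>[of x] by auto
    define P where "P = distr (density \<mu> (\<lambda>x. ennreal (w x * \<phi> x))) borel g"
    define Q where "Q = distr (density \<nu> (\<lambda>x. ennreal (w x * \<phi> x))) borel g"
    have "(\<integral>\<^sup>+x. ennreal (w x * \<phi> x) \<partial>\<mu>) \<le> (\<integral>\<^sup>+x. 2 \<partial>\<mu>)" 
      using bd by (intro nn_integral_mono) (metis ennreal_leI ennreal_numeral zero_le_numeral)
    also have "\<dots> < \<infinity>" by (simp add: ennreal_mult_less_top less_top[symmetric] ennreal_mult_eq_top_iff)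
    finally have fP: "finite_measure P" unfolding P_def
      by (intro finite_measure.finite_measure_distr finite_measureI) (auto simp: emeasure_density cong: nn_integral_cong)
    have "(\<integral>\<^sup>+x. ennreal (w x * \<phi> x) \<partial>\<nu>) \<le> (\<integral>\<^sup>+x. 2 \<partial>\<nu>)" 
      using bd by (intro nn_integral_mono) (metis ennreal_leI ennreal_numeral zero_le_numeral)
    also have "\<dots> < \<infinity>" by (simp add: ennreal_mult_less_top less_top[symmetric] ennreal_mult_eq_top_iff)
    finally have fQ: "finite_measure Q" unfolding Q_def
      by (intro finite_measure.finite_measure_distr finite_measureI) (auto simp: emeasure_density cong: nn_integral_cong)
    have "P = Q"
    proof (rule Levy_uniqueness_finite[OF fP fQ])
      fix u
      show "(\<integral>x. iexp (u * x) \<partial>P) = (\<integral>x. iexp (u * x) \<partial>Q)"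
        unfolding P_def Q_def using bd e[of u]
        by (subst (1 2) integral_distr; (subst (1 2) integral_density)?; auto simp: scaleR_conv_of_real)
    qed (auto simp: P_def Q_def)
    hence "(\<integral>x. indicator B x \<partial>P) = (\<integral>x. indicator B x \<partial>Q :: real)" by simp
    thus ?thesis
      unfolding P_def Q_def using bd
      by (subst (asm) (1 2) integral_distr; (subst (asm) (1 2) integral_density)?; auto)
  qed
  have intb: "integrable \<mu> f" if [measurable]: "f \<in> borel_measurable \<mu>" and "\<And>x. norm (f x) \<le> 2" for f :: "'a \<Rightarrow> 'c::{banach, second_countable_topology}"
    using that by (intro \<mu>.integrable_const_bound[of _ 2]) auto
  have intb': "integrable \<nu> f" if [measurable]: "f \<in> borel_measurable \<nu>" and "\<And>x. norm (f x) \<le> 2" for f :: "'a \<Rightarrow> 'c::{banach, second_countable_topology}"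
    using that by (intro \<nu>.integrable_const_bound[of _ 2]) auto
  have LLu: "(\<lambda>x. a * h x + u * g x) \<in> LL" for a u
    using g h by (intro LL_add LL_scale)
  have LLug: "(\<lambda>x. u * g x) \<in> LL" for u using g by (intro LL_scale)
  have wn: "\<bar>w x\<bar> \<le> 2" for x using w01[of x] by auto
  have e0: "(\<integral>x. complex_of_real (w x) * iexp (u * g x) \<partial>\<mu>) = (\<integral>x. complex_of_real (w x) * iexp (u * g x) \<partial>\<nu>)" for u
    by (rule eq[OF LLug])
  \<comment> \<open>Euler's formula expresses the weighted exponential through exponentials of u *
    g, u * g + h and u * g - h, all in \<open>LL\<close>; the added 1 keeps the weight
    nonnegative.\<close>
  have cosE: "complex_of_real (w x * (1 + cos (h x))) * iexp (u * g x)
      = w x * iexp (u * g x) + (w x * iexp (1 * h x + u * g x) + 1 * (w x * iexp (-1 * h x + u * g x))) / 2" for x u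
  proof -
    define E E' G where "E = iexp (h x)" and "E' = iexp (- h x)" and "G = iexp (u * g x)"
    have e: "iexp (1 * h x + u * g x) = E * G" "iexp (-1 * h x + u * g x) = E' * G"
      unfolding E_def E'_def G_def iexp_add[symmetric] by simp_all
    have c: "complex_of_real (cos (h x)) = (E + E') / 2"
      by (simp add: E_def E'_def cos_of_real[symmetric] cos_exp_eq)
    show ?thesis
      unfolding e G_def[symmetric] unfolding of_real_mult of_real_add of_real_1 c
      by (simp add: algebra_simps add_divide_distrib)
  qed
  have sinE: "complex_of_real (w x * (1 + sin (h x))) * iexp (u * g x)
      = w x * iexp (u * g x) + (w x * iexp (1 * h x + u * g x) + (-1) * (w x * iexp (-1 * h x + u * g x))) / (2 * \<i>)" for x u
  proof -
    define E E' G where "E = iexp (h x)" and "E' = iexp (- h x)" and "G = iexp (u * g x)"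
    have e: "iexp (1 * h x + u * g x) = E * G" "iexp (-1 * h x + u * g x) = E' * G"
      unfolding E_def E'_def G_def iexp_add[symmetric] by simp_all
    have s: "complex_of_real (sin (h x)) = (E - E') / (2 * \<i>)"
      by (simp add: E_def E'_def sin_of_real[symmetric] sin_exp_eq)
    show ?thesis
      unfolding e G_def[symmetric] unfolding of_real_mult of_real_add of_real_1 s
      by (simp add: algebra_simps diff_divide_distrib)
  qed
  have i1: "integrable \<mu> (\<lambda>x. complex_of_real (w x) * iexp (u * g x))" "integrable \<nu> (\<lambda>x. complex_of_real (w x) * iexp (u * g x))" for u
    using wn by (auto intro!: intb intb' simp: norm_mult)
  have i2: "integrable \<mu> (\<lambda>x. complex_of_real (w x) * iexp (a * h x + u * g x))" "integrable \<nu> (\<lambda>x. complex_of_real (w x) * iexp (a * h x + u * g x))" for a u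
    using wn by (auto intro!: intb intb' simp: norm_mult)
  have comb: "(\<integral>x. fa x + (fb x + k * fc x) / d \<partial>\<mu>) = (\<integral>x. fa x + (fb x + k * fc x) / d \<partial>\<nu>)"
    if "integrable \<mu> fa" "integrable \<nu> fa" "integrable \<mu> fb" "integrable \<nu> fb" "integrable \<mu> fc" "integrable \<nu> fc"
      "integral\<^sup>L \<mu> fa = integral\<^sup>L \<nu> fa" "integral\<^sup>L \<mu> fb = integral\<^sup>L \<nu> fb" "integral\<^sup>L \<mu> fc = integral\<^sup>L \<nu> fc"
    for fa fb fc :: "'a \<Rightarrow> complex" and k d
    using that by simp
  have k1: "(\<integral>x. w x * 1 * indicator B (g x) \<partial>\<mu>) = (\<integral>x. w x * 1 * indicator B (g x) \<partial>\<nu>)"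
    by (rule key) (use e0 in auto)
  have k2: "(\<integral>x. w x * (1 + cos (h x)) * indicator B (g x) \<partial>\<mu>) = (\<integral>x. w x * (1 + cos (h x)) * indicator B (g x) \<partial>\<nu>)"
  proof (rule key)
    fix x show "0 \<le> 1 + cos (h x) \<and> 1 + cos (h x) \<le> 2" using cos_ge_minus_one[of "h x"] cos_le_one[of "h x"] by linarith
  next
    fix u show "(\<integral>x. complex_of_real (w x * (1 + cos (h x))) * iexp (u * g x) \<partial>\<mu>) = (\<integral>x. complex_of_real (w x * (1 + cos (h x))) * iexp (u * g x) \<partial>\<nu>)"
      unfolding cosE by (rule comb[OF i1 i2 i2 e0 eq[OF LLu] eq[OF LLu]])
  qed measurable
  have k3: "(\<integral>x. w x * (1 + sin (h x)) * indicator B (g x) \<partial>\<mu>) = (\<integral>x. w x * (1 + sin (h x)) * indicator B (g x) \<partial>\<nu>)"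
  proof (rule key)
    fix x show "0 \<le> 1 + sin (h x) \<and> 1 + sin (h x) \<le> 2" using sin_ge_minus_one[of "h x"] sin_le_one[of "h x"] by linarith
  next
    fix u show "(\<integral>x. complex_of_real (w x * (1 + sin (h x))) * iexp (u * g x) \<partial>\<mu>) = (\<integral>x. complex_of_real (w x * (1 + sin (h x))) * iexp (u * g x) \<partial>\<nu>)"
      unfolding sinE by (rule comb[OF i1 i2 i2 e0 eq[OF LLu] eq[OF LLu]])
  qed measurable
  have wB: "\<bar>w x * indicator B (g x)\<bar> \<le> 1" for x using w01[of x] by (auto simp: indicator_def)
  have b1: "\<bar>w x * indicator B (g x) * y\<bar> \<le> 2" if "\<bar>y\<bar> \<le> 1" for x y
    using mult_mono[OF wB[of x] that] by (simp add: abs_mult)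
  have int\<mu>: "integrable \<mu> (\<lambda>x. w x * indicator B (g x) * f x)" if "f \<in> borel_measurable \<mu>" "\<And>x. \<bar>f x\<bar> \<le> 1" for f
    using that b1 by (intro intb) (auto simp del: abs_mult)
  have int\<nu>: "integrable \<nu> (\<lambda>x. w x * indicator B (g x) * f x)" if "f \<in> borel_measurable \<nu>" "\<And>x. \<bar>f x\<bar> \<le> 1" for f
    using that b1 by (intro intb') (auto simp del: abs_mult)
  have i\<mu>: "integrable \<mu> (\<lambda>x. w x * indicator B (g x))" "integrable \<mu> (\<lambda>x. w x * indicator B (g x) * cos (h x))"
     "integrable \<mu> (\<lambda>x. w x * indicator B (g x) * sin (h x))"
    using int\<mu>[of "\<lambda>_. 1"] int\<mu>[of "\<lambda>x. cos (h x)"] int\<mu>[of "\<lambda>x. sin (h x)"] by auto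
  have i\<nu>: "integrable \<nu> (\<lambda>x. w x * indicator B (g x))" "integrable \<nu> (\<lambda>x. w x * indicator B (g x) * cos (h x))"
     "integrable \<nu> (\<lambda>x. w x * indicator B (g x) * sin (h x))"
    using int\<nu>[of "\<lambda>_. 1"] int\<nu>[of "\<lambda>x. cos (h x)"] int\<nu>[of "\<lambda>x. sin (h x)"] by auto
  have ex: "w x * (1 + y) * indicator B (g x) = w x * indicator B (g x) + w x * indicator B (g x) * y" for x y
    by (simp add: algebra_simps)
  \<comment> \<open>Subtracting the identity for the constant factor 1 leaves the cosine alone; the
    sine is obtained in the same way.\<close>
  have c: "(\<integral>x. w x * indicator B (g x) * cos (h x) \<partial>\<mu>) = (\<integral>x. w x * indicator B (g x) * cos (h x) \<partial>\<nu>)"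
    using k1 k2 i\<mu> i\<nu> by (simp add: ex)
  have s: "(\<integral>x. w x * indicator B (g x) * sin (h x) \<partial>\<mu>) = (\<integral>x. w x * indicator B (g x) * sin (h x) \<partial>\<nu>)"
    using k1 k3 i\<mu> i\<nu> by (simp add: ex)
  have "complex_of_real (w x * indicator B (g x)) * iexp (h x)
      = complex_of_real (w x * indicator B (g x) * cos (h x)) + \<i> * complex_of_real (w x * indicator B (g x) * sin (h x))" for x
    by (simp add: cis_conv_exp[symmetric] cis.code complex_eq_iff Complex_eq)
  thus ?thesis using c s i\<mu> i\<nu> by (simp add: of_real_mult[symmetric] del: of_real_mult)
qed

text \<open>Measurability and the bounds 0 and 1 are part of the induction because each new
  condition needs them for the weight built so far.\<close>

private lemma weighted_cf:
  assumes "set gs \<subseteq> LL \<times> sets borel" "h \<in> LL"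
  shows "(\<integral>x. (\<Prod>(g, B)\<leftarrow>gs. indicator B (g x) :: real) * iexp (h x) \<partial>\<mu>)
       = (\<integral>x. (\<Prod>(g, B)\<leftarrow>gs. indicator B (g x) :: real) * iexp (h x) \<partial>\<nu>)
     \<and> (\<lambda>x. \<Prod>(g, B)\<leftarrow>gs. indicator B (g x) :: real) \<in> borel_measurable \<mu>
     \<and> (\<forall>x. 0 \<le> (\<Prod>(g, B)\<leftarrow>gs. indicator B (g x) :: real) \<and> (\<Prod>(g, B)\<leftarrow>gs. indicator B (g x) :: real) \<le> 1)"
  using assms
proof (induction gs arbitrary: h)
  case Nil
  thus ?case using cf by auto
next
  case (Cons p gs)
  obtain g B where p: "p = (g, B)" by (cases p)
  have g: "g \<in> LL" and B[measurable]: "B \<in> sets borel" using Cons.prems by (auto simp: p)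
  have [measurable]: "g \<in> borel_measurable \<mu>" using meas g .
  define w where "w x = (\<Prod>(g, B)\<leftarrow>gs. indicator B (g x) :: real)" for x
  have w: "w \<in> borel_measurable \<mu>" "\<And>x. 0 \<le> w x \<and> w x \<le> 1"
    "\<And>h. h \<in> LL \<Longrightarrow> (\<integral>x. w x * iexp (h x) \<partial>\<mu>) = (\<integral>x. w x * iexp (h x) \<partial>\<nu>)"
    using Cons unfolding w_def by auto
  have "(\<integral>x. complex_of_real (w x * indicator B (g x)) * iexp (h x) \<partial>\<mu>) = (\<integral>x. complex_of_real (w x * indicator B (g x)) * iexp (h x) \<partial>\<nu>)"
    by (rule weighted_cf_step) (use w g B Cons.prems in auto)
  moreover have "(\<Prod>(g, B)\<leftarrow>p # gs. indicator B (g x) :: real) = w x * indicator B (g x)" for x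
    by (simp add: p w_def)
  moreover have "(\<lambda>x. w x * indicator B (g x)) \<in> borel_measurable \<mu>" using w(1) by measurable
  ultimately show ?case using w(2) by (auto simp: indicator_def)
qed

text \<open>Fourier inversion in finitely many variables is reduced to one variable by integrating out
  the coordinates one at a time, against the nonnegative weights \<open>1\<close>, \<open>1 + cos h\<close> and \<open>1 + sin h\<close>.\<close>

lemma measure_eqI_characteristic_functional:
  assumes gen: "sets \<mu> = sigma_sets \<Omega> {g -` B \<inter> \<Omega> |g B. g \<in> K \<and> B \<in> sets borel}" and K: "K \<subseteq> LL"
    and ne: "(\<lambda>_. 0) \<in> LL"
  shows "\<mu> = \<nu>"
proof -
  interpret \<mu>: finite_measure \<mu> by (rule fin)
  interpret \<nu>: finite_measure \<nu> by (rule fin)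
  \<comment> \<open>Cylinders given by finitely many conditions: concatenating lists intersects
    them, and the empty list gives the whole space.\<close>
  define cyl where "cyl gs = {x \<in> \<Omega>. \<forall>(g, B) \<in> set gs. g x \<in> B}" for gs :: "(('a \<Rightarrow> real) \<times> real set) list"
  define \<C> where "\<C> = cyl ` {gs. set gs \<subseteq> K \<times> sets borel}"
  have sp: "space \<mu> = \<Omega>"
  proof
    show "\<Omega> \<subseteq> space \<mu>" using sets.sets_into_space[of \<Omega> \<mu>] by (simp add: gen sigma_sets_top)
    have "space \<mu> \<in> sigma_sets \<Omega> {g -` B \<inter> \<Omega> |g B. g \<in> K \<and> B \<in> sets borel}" using gen sets.top[of \<mu>] by simp
    from sigma_sets_into_sp[OF _ this] show "space \<mu> \<subseteq> \<Omega>" by auto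
  qed
  have cylm: "cyl gs \<in> sets \<mu>" if "set gs \<subseteq> K \<times> sets borel" for gs
    using that
  proof (induction gs)
    case Nil thus ?case using sp by (auto simp: cyl_def)
  next
    case (Cons p gs)
    obtain g B where p: "p = (g, B)" by (cases p)
    have "g -` B \<inter> space \<mu> \<in> sets \<mu>"
      using Cons.prems K meas by (intro measurable_sets[of _ _ borel]) (auto simp: p)
    moreover have "cyl (p # gs) = (g -` B \<inter> space \<mu>) \<inter> cyl gs" by (auto simp: cyl_def p sp)
    ultimately show ?case using Cons by auto
  qed
  have ind: "(\<Prod>(g, B)\<leftarrow>gs. indicator B (g x) :: real) = indicator (cyl gs) x" if "x \<in> \<Omega>" for gs x
    using that by (induction gs) (auto simp: cyl_def indicator_def)
  show ?thesis
  proof (rule measure_eqI_generator_eq[where E=\<C> and \<Omega>=\<Omega> and A="\<lambda>_. \<Omega>"])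
    show "Int_stable \<C>"
    proof (rule Int_stableI)
      fix A B assume "A \<in> \<C>" "B \<in> \<C>"
      then obtain gs hs where "A = cyl gs" "set gs \<subseteq> K \<times> sets borel" "B = cyl hs" "set hs \<subseteq> K \<times> sets borel"
        by (auto simp: \<C>_def)
      moreover have "cyl gs \<inter> cyl hs = cyl (gs @ hs)" by (auto simp: cyl_def)
      ultimately show "A \<inter> B \<in> \<C>" unfolding \<C>_def by auto
    qed
    show "\<C> \<subseteq> Pow \<Omega>" by (auto simp: \<C>_def cyl_def)
    show "sets \<mu> = sigma_sets \<Omega> \<C>"
    proof
      have "g -` B \<inter> \<Omega> \<in> \<C>" if "g \<in> K" "B \<in> sets borel" for g B
        unfolding \<C>_def by (rule image_eqI[of _ _ "[(g, B)]"]) (use that in \<open>auto simp: cyl_def\<close>)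
      thus "sets \<mu> \<subseteq> sigma_sets \<Omega> \<C>" unfolding gen by (intro sigma_sets_mono') auto
      show "sigma_sets \<Omega> \<C> \<subseteq> sets \<mu>"
        using sets.sigma_sets_subset[of \<C> \<mu>] cylm sp by (auto simp: \<C>_def)
    qed
    thus "sets \<nu> = sigma_sets \<Omega> \<C>" using sets_eq by simp
    show "range (\<lambda>_. \<Omega>) \<subseteq> \<C>"
      unfolding \<C>_def by (auto intro!: image_eqI[of _ _ "[]"] simp: cyl_def)
    show "emeasure \<mu> \<Omega> \<noteq> \<infinity>" by simp
    fix X assume "X \<in> \<C>"
    then obtain gs where gs: "X = cyl gs" "set gs \<subseteq> K \<times> sets borel" by (auto simp: \<C>_def)
    have sp': "space \<nu> = \<Omega>" using sp sets_eq_imp_space_eq[OF sets_eq] by simp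
    have Xm: "X \<in> sets \<mu>" "X \<in> sets \<nu>" using cylm[OF gs(2)] gs(1) sets_eq by auto
    \<comment> \<open>At the zero functional the weighted characteristic functional is the measure
      of the cylinder.\<close>
    have "(\<integral>x. (\<Prod>(g, B)\<leftarrow>gs. indicator B (g x) :: real) * iexp 0 \<partial>\<mu>)
       = (\<integral>x. (\<Prod>(g, B)\<leftarrow>gs. indicator B (g x) :: real) * iexp 0 \<partial>\<nu>)"
      using weighted_cf[of gs "\<lambda>_. 0"] gs(2) K ne by blast
    hence "(\<integral>x. (\<Prod>(g, B)\<leftarrow>gs. indicator B (g x) :: real) \<partial>\<mu>) = (\<integral>x. (\<Prod>(g, B)\<leftarrow>gs. indicator B (g x) :: real) \<partial>\<nu>)"
      by simp
    moreover have "(\<integral>x. (\<Prod>(g, B)\<leftarrow>gs. indicator B (g x) :: real) \<partial>\<mu>) = (\<integral>x. indicator X x \<partial>\<mu>)"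
      by (rule Bochner_Integration.integral_cong) (use ind gs(1) sp in auto)
    moreover have "(\<integral>x. (\<Prod>(g, B)\<leftarrow>gs. indicator B (g x) :: real) \<partial>\<nu>) = (\<integral>x. indicator X x \<partial>\<nu>)"
      by (rule Bochner_Integration.integral_cong) (use ind gs(1) sp' in auto)
    ultimately have "measure \<mu> X = measure \<nu> X"
      using sets.sets_into_space[OF Xm(1)] sets.sets_into_space[OF Xm(2)] by (simp add: Int_absorb2)
    thus "emeasure \<mu> X = emeasure \<nu> X" by (simp add: \<mu>.emeasure_eq_measure \<nu>.emeasure_eq_measure)
  qed auto
qed

end

section \<open>Integrals against orthogonal random measures\<close>

lemma pair_sigma_finite_lambda_D: "sigma_finite_measure N \<Longrightarrow> pair_sigma_finite N lambda_D"
  by (simp add: pair_sigma_finite_def sigma_finite_lambda_D)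

lemma L2d_pair:
  assumes "sigma_finite_measure N" and [measurable]: "F \<in> borel_measurable (N \<Otimes>\<^sub>M lambda_D)" "G \<in> borel_measurable (N \<Otimes>\<^sub>M lambda_D)"
  shows "L2d (N \<Otimes>\<^sub>M lambda_D) F G = (\<integral>\<^sup>+y. L2d N (\<lambda>e. F (e, y)) (\<lambda>e. G (e, y)) \<partial>lambda_D)"
    and "L2d (N \<Otimes>\<^sub>M lambda_D) F G = (\<integral>\<^sup>+e. L2d lambda_D (\<lambda>y. F (e, y)) (\<lambda>y. G (e, y)) \<partial>N)"
    and "(\<lambda>y. L2d N (\<lambda>e. F (e, y)) (\<lambda>e. G (e, y))) \<in> borel_measurable lambda_D"
    and "(\<lambda>e. L2d lambda_D (\<lambda>y. F (e, y)) (\<lambda>y. G (e, y))) \<in> borel_measurable N"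
proof -
  interpret pair_sigma_finite N lambda_D using assms(1) by (rule pair_sigma_finite_lambda_D)
  have m: "(\<lambda>p. ennreal ((F p - G p)\<^sup>2)) \<in> borel_measurable (N \<Otimes>\<^sub>M lambda_D)" by measurable
  show "L2d (N \<Otimes>\<^sub>M lambda_D) F G = (\<integral>\<^sup>+y. L2d N (\<lambda>e. F (e, y)) (\<lambda>e. G (e, y)) \<partial>lambda_D)"
    unfolding L2d_def using nn_integral_snd[OF m] by simp
  show "L2d (N \<Otimes>\<^sub>M lambda_D) F G = (\<integral>\<^sup>+e. L2d lambda_D (\<lambda>y. F (e, y)) (\<lambda>y. G (e, y)) \<partial>N)"
    unfolding L2d_def using lambda_D.nn_integral_fst[OF m] by simp
  show "(\<lambda>e. L2d lambda_D (\<lambda>y. F (e, y)) (\<lambda>y. G (e, y))) \<in> borel_measurable N"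
    unfolding L2d_def using lambda_D.borel_measurable_nn_integral_fst[OF m] by simp
  have "(\<lambda>(y, e). ennreal ((F (e, y) - G (e, y))\<^sup>2)) \<in> borel_measurable (lambda_D \<Otimes>\<^sub>M N)" by measurable
  from M1.borel_measurable_nn_integral_fst[OF this] show "(\<lambda>y. L2d N (\<lambda>e. F (e, y)) (\<lambda>e. G (e, y))) \<in> borel_measurable lambda_D"
    unfolding L2d_def by simp
qed

lemma square_integrable_sections:
  assumes "sigma_finite_measure N" "square_integrable (N \<Otimes>\<^sub>M lambda_D) F"
  shows "AE e in N. square_integrable lambda_D (\<lambda>y. F (e, y))"
    and "AE y in lambda_D. square_integrable N (\<lambda>e. F (e, y))"
proof -
  have [measurable]: "F \<in> borel_measurable (N \<Otimes>\<^sub>M lambda_D)" using assms by (simp add: square_integrable_def)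
  have fin: "L2d (N \<Otimes>\<^sub>M lambda_D) F (\<lambda>_. 0) < \<infinity>" using assms by (simp add: square_integrable_iff_L2d)
  note L = L2d_pair[OF assms(1) \<open>F \<in> _\<close>, of "\<lambda>_. 0"]
  have "AE e in N. L2d lambda_D (\<lambda>y. F (e, y)) (\<lambda>_. 0) \<noteq> \<infinity>"
    using fin L by (intro nn_integral_PInf_AE) auto
  thus "AE e in N. square_integrable lambda_D (\<lambda>y. F (e, y))"
    using AE_space by eventually_elim (auto simp: square_integrable_iff_L2d less_top intro!: measurable_Pair2[of F])
  have "AE y in lambda_D. L2d N (\<lambda>e. F (e, y)) (\<lambda>_. 0) \<noteq> \<infinity>"
    using fin L by (intro nn_integral_PInf_AE) auto
  thus "AE y in lambda_D. square_integrable N (\<lambda>e. F (e, y))"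
    using AE_space by eventually_elim (auto simp: square_integrable_iff_L2d less_top intro!: measurable_Pair1[of F])
qed

text \<open>Cauchy-Schwarz in y for almost every e. Pairing with f is thus continuous from the
  product space to the noise space, which carries the stochastic Fubini identity from rectangle sums
  to their limits.\<close>

lemma L2d_project:
  assumes N: "sigma_finite_measure N" and F: "square_integrable (N \<Otimes>\<^sub>M lambda_D) F" "square_integrable (N \<Otimes>\<^sub>M lambda_D) G"
    and f: "square_integrable lambda_D f"
  shows "L2d N (\<lambda>e. \<integral>y. F (e, y) * f y \<partial>lambda_D) (\<lambda>e. \<integral>y. G (e, y) * f y \<partial>lambda_D)
    \<le> ennreal ((norm (L2_class f))\<^sup>2) * L2d (N \<Otimes>\<^sub>M lambda_D) F G"
proof -
  have [measurable]: "F \<in> borel_measurable (N \<Otimes>\<^sub>M lambda_D)" "G \<in> borel_measurable (N \<Otimes>\<^sub>M lambda_D)"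
    using F by (simp_all add: square_integrable_def)
  note L = L2d_pair[OF N \<open>F \<in> _\<close> \<open>G \<in> _\<close>]
  have "L2d N (\<lambda>e. \<integral>y. F (e, y) * f y \<partial>lambda_D) (\<lambda>e. \<integral>y. G (e, y) * f y \<partial>lambda_D)
     \<le> (\<integral>\<^sup>+e. ennreal ((norm (L2_class f))\<^sup>2) * L2d lambda_D (\<lambda>y. F (e, y)) (\<lambda>y. G (e, y)) \<partial>N)"
    unfolding L2d_def[of N]
  proof (rule nn_integral_mono_AE)
    show "AE e in N. ennreal (((\<integral>y. F (e, y) * f y \<partial>lambda_D) - (\<integral>y. G (e, y) * f y \<partial>lambda_D))\<^sup>2)
      \<le> ennreal ((norm (L2_class f))\<^sup>2) * L2d lambda_D (\<lambda>y. F (e, y)) (\<lambda>y. G (e, y))"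
      using square_integrable_sections(1)[OF N F(1)] square_integrable_sections(1)[OF N F(2)]
    proof eventually_elim
      case (elim e)
      let ?u = "L2_class (\<lambda>y. F (e, y))" and ?v = "L2_class (\<lambda>y. G (e, y))"
      have "((\<integral>y. F (e, y) * f y \<partial>lambda_D) - (\<integral>y. G (e, y) * f y \<partial>lambda_D))\<^sup>2 = (inner (?u - ?v) (L2_class f))\<^sup>2"
        using elim f by (simp add: inner_L2_class inner_diff_left)
      also have "\<dots> \<le> inner (?u - ?v) (?u - ?v) * inner (L2_class f) (L2_class f)"
        by (rule Cauchy_Schwarz_ineq)
      also have "\<dots> = (norm (L2_class f))\<^sup>2 * (norm (?u - ?v))\<^sup>2" by (simp add: power2_norm_eq_inner)
      finally have "ennreal (((\<integral>y. F (e, y) * f y \<partial>lambda_D) - (\<integral>y. G (e, y) * f y \<partial>lambda_D))\<^sup>2)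
        \<le> ennreal ((norm (L2_class f))\<^sup>2) * ennreal ((norm (?u - ?v))\<^sup>2)"
        by (simp add: ennreal_mult[symmetric] ennreal_leI)
      thus ?case using norm_L2_class_diff[OF elim] by simp
    qed
  qed
  also have "\<dots> = ennreal ((norm (L2_class f))\<^sup>2) * L2d (N \<Otimes>\<^sub>M lambda_D) F G"
    using L by (subst nn_integral_cmult) auto
  finally show ?thesis .
qed

lemma square_integrable_project:
  assumes N: "sigma_finite_measure N" and F: "square_integrable (N \<Otimes>\<^sub>M lambda_D) F"
    and f: "square_integrable lambda_D f"
  shows "square_integrable N (\<lambda>e. \<integral>y. F (e, y) * f y \<partial>lambda_D)"
proof -
  have [measurable]: "F \<in> borel_measurable (N \<Otimes>\<^sub>M lambda_D)" "f \<in> borel_measurable lambda_D"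
    using F f by (simp_all add: square_integrable_def)
  have "(\<lambda>e. \<integral>y. F (e, y) * f y \<partial>lambda_D) \<in> borel_measurable N"
    by (rule lambda_D.borel_measurable_lebesgue_integral) measurable
  moreover have "L2d N (\<lambda>e. \<integral>y. F (e, y) * f y \<partial>lambda_D) (\<lambda>e. \<integral>y. 0 * f y \<partial>lambda_D)
    \<le> ennreal ((norm (L2_class f))\<^sup>2) * L2d (N \<Otimes>\<^sub>M lambda_D) F (\<lambda>_. 0)"
    by (rule L2d_project[OF N F _ f]) simp
  moreover have "\<dots> < \<infinity>" using F by (simp add: square_integrable_iff_L2d ennreal_mult_less_top)
  ultimately show ?thesis by (simp add: square_integrable_iff_L2d)
qed

section \<open>Rectangle sums on the product of the noise space with \<open>D\<close>\<close>

definition rect_fun :: "(real \<times> 'e set \<times> real set) list \<Rightarrow> 'e \<times> real \<Rightarrow> real" where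
  "rect_fun rs = (\<lambda>(e, y). \<Sum>(a, A, B)\<leftarrow>rs. a * indicator A e * indicator B y)"

text \<open>Rectangles with sides of finite measure form an intersection-stable generator of the
  product sigma-algebra, so the density of step functions applies; the approximating step functions
  are then rewritten as rectangle sums.\<close>

lemma rect_dense:
  assumes S: "sigma_finite_measure S" and F: "square_integrable (S \<Otimes>\<^sub>M lambda_D) F" and e: "e > 0"
  shows "\<exists>rs. set rs \<subseteq> UNIV \<times> finite_measure_sets S \<times> finite_measure_sets lambda_D
    \<and> L2d (S \<Otimes>\<^sub>M lambda_D) F (rect_fun rs) < e"
proof -
  interpret sigma_finite_measure S by fact
  let ?P = "S \<Otimes>\<^sub>M lambda_D"
  define G where "G = {A \<times> B |A B. A \<in> finite_measure_sets S \<and> B \<in> finite_measure_sets lambda_D}"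
  obtain A where A: "range A \<subseteq> sets S" "(\<Union>i. A i) = space S" "\<And>i::nat. emeasure S (A i) \<noteq> \<infinity>" "incseq A"
    using sigma_finite_incseq by metis
  have Af: "A k \<in> finite_measure_sets S" for k using A by (auto simp: finite_measure_sets_def less_top)
  define B where "B k = {0<..<real k}" for k
  have Bf: "B k \<in> finite_measure_sets lambda_D" for k
    by (auto simp: finite_measure_sets_def B_def emeasure_lambda_D_Ioo_finite sets_lambda_D sets_restrict_space)
  have Bi: "incseq B" and BU: "(\<Union>k. B k) = {0<..}"
    using reals_Archimedean2 by (auto simp: B_def incseq_def)
  have fmI: "C \<inter> C' \<in> finite_measure_sets Q" if "C \<in> finite_measure_sets Q" "C' \<in> sets Q" for C C' and Q :: "'x measure"
    using that emeasure_mono[of "C \<inter> C'" C Q] by (auto simp: finite_measure_sets_def intro: le_less_trans)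
  have "\<exists>xs. set xs \<subseteq> UNIV \<times> G \<and> L2d ?P F (step_fun xs) < e"
  proof (rule L2_dense_step_fun[where E="\<lambda>k. A k \<times> B k"])
    show "Int_stable G"
    proof (rule Int_stableI)
      fix X Y assume "X \<in> G" "Y \<in> G"
      then obtain C D C' D' where "X = C \<times> D" "Y = C' \<times> D'"
        "C \<in> finite_measure_sets S" "D \<in> finite_measure_sets lambda_D" 
        "C' \<in> finite_measure_sets S" "D' \<in> finite_measure_sets lambda_D" unfolding G_def by blast
      moreover have "C \<times> D \<inter> C' \<times> D' = (C \<inter> C') \<times> (D \<inter> D')" by auto
      moreover have "C \<inter> C' \<in> finite_measure_sets S" "D \<inter> D' \<in> finite_measure_sets lambda_D"
        using calculation by (auto intro!: fmI) (auto simp: finite_measure_sets_def)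
      ultimately show "X \<inter> Y \<in> G" unfolding G_def by (intro CollectI exI[of _ "C \<inter> C'"] exI[of _ "D \<inter> D'"]) auto
    qed
    have Gs: "G \<subseteq> sets ?P" by (auto simp: G_def finite_measure_sets_def)
    show "sets ?P = sigma_sets (space ?P) G"
    proof
      show "sigma_sets (space ?P) G \<subseteq> sets ?P" by (rule sets.sigma_sets_subset[OF Gs])
      have "C \<times> D \<in> sigma_sets (space ?P) G" if "C \<in> sets S" "D \<in> sets lambda_D" for C D
      proof -
        \<comment> \<open>A rectangle whose sides may have infinite measure is exhausted by
          rectangles with finite sides.\<close>
        have e: "C \<times> D = (\<Union>k. (A k \<inter> C) \<times> (B k \<inter> D))"
        proof (intro set_eqI iffI)
          fix p assume "p \<in> C \<times> D"
          hence p: "fst p \<in> C" "snd p \<in> D" by auto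
          hence "fst p \<in> space S" "snd p \<in> {0<..}"
            using sets.sets_into_space[OF that(1)] sets.sets_into_space[OF that(2)] by auto
          then obtain i j where "fst p \<in> A i" "snd p \<in> B j"
            using A(2) BU by (metis UN_E)
          hence "fst p \<in> A (max i j)" "snd p \<in> B (max i j)"
            using A(4) Bi unfolding incseq_def by (meson max.cobounded1 max.cobounded2 subsetD)+
          thus "p \<in> (\<Union>k. (A k \<inter> C) \<times> (B k \<inter> D))" using p by (auto intro!: exI[of _ "max i j"] simp: mem_Times_iff)
        qed auto
        have g: "(A k \<inter> C) \<times> (B k \<inter> D) \<in> G" for k
          unfolding G_def using fmI[OF Af that(1)] fmI[OF Bf that(2)] by blast
        show ?thesis unfolding e by (rule sigma_sets.Union) (rule sigma_sets.Basic, rule g)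
      qed
      hence "{a \<times> b |a b. a \<in> sets S \<and> b \<in> sets lambda_D} \<subseteq> sigma_sets (space S \<times> space lambda_D) G"
        unfolding space_pair_measure by blast
      from sigma_sets_mono[OF this] show "sets ?P \<subseteq> sigma_sets (space ?P) G"
        unfolding sets_pair_measure space_pair_measure .
    qed
    show "emeasure ?P X < \<infinity>" if X: "X \<in> G" for X
    proof -
      obtain C D where "X = C \<times> D" "C \<in> finite_measure_sets S" "D \<in> finite_measure_sets lambda_D"
        using X unfolding G_def by blast
      thus ?thesis by (auto simp: finite_measure_sets_def lambda_D.emeasure_pair_measure_Times ennreal_mult_less_top)
    qed
    show "range (\<lambda>k. A k \<times> B k) \<subseteq> G" unfolding G_def using Af Bf by auto
    show "incseq (\<lambda>k. A k \<times> B k)"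
      using incseqD[OF A(4)] incseqD[OF Bi] by (intro incseq_SucI Sigma_mono) auto
    show "(\<Union>k. A k \<times> B k) = space ?P"
    proof (intro set_eqI iffI)
      fix p assume "p \<in> space ?P"
      hence p: "fst p \<in> space S" "snd p \<in> {0<..}" by (auto simp: space_pair_measure)
      then obtain i j where "fst p \<in> A i" "snd p \<in> B j"
        using A(2) BU by (metis UN_E)
      hence "fst p \<in> A (max i j)" "snd p \<in> B (max i j)"
        using A(4) Bi unfolding incseq_def by (meson max.cobounded1 max.cobounded2 subsetD)+
      thus "p \<in> (\<Union>k. A k \<times> B k)" by (auto intro!: exI[of _ "max i j"] simp: mem_Times_iff)
    next
      fix p assume "p \<in> (\<Union>k. A k \<times> B k)"
      thus "p \<in> space ?P" using A(2) BU by (auto simp: space_pair_measure)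
    qed
  qed (use F e in auto)
  then obtain xs where xs: "set xs \<subseteq> UNIV \<times> G" "L2d ?P F (step_fun xs) < e" by blast
  have "\<exists>rs. set rs \<subseteq> UNIV \<times> finite_measure_sets S \<times> finite_measure_sets lambda_D \<and> step_fun xs = rect_fun rs"
    using xs(1)
  proof (induction xs)
    case Nil
    show ?case by (rule exI[of _ "[]"]) (auto simp: rect_fun_def)
  next
    case (Cons p xs)
    then obtain rs where rs: "set rs \<subseteq> UNIV \<times> finite_measure_sets S \<times> finite_measure_sets lambda_D" "step_fun xs = rect_fun rs" by auto
    from Cons.prems obtain a C D where "p = (a, C \<times> D)" "C \<in> finite_measure_sets S" "D \<in> finite_measure_sets lambda_D"
      unfolding G_def by auto
    thus ?case using rs
      by (intro exI[of _ "(a, C, D) # rs"]) (auto simp: rect_fun_def fun_eq_iff step_fun_Cons indicator_times)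
  qed
  thus ?thesis using xs(2) by auto
qed

section \<open>The isometry for noises with orthogonal increments\<close>

locale orth_noise = prob_space M for M :: "'w measure" +
  fixes S :: "'e measure" and W :: "'e set \<Rightarrow> 'w \<Rightarrow> real"
  assumes sigma_finite_S: "sigma_finite_measure S"
    and W_sq: "A \<in> finite_measure_sets S \<Longrightarrow> square_integrable M (W A)"
    and W_cov: "A \<in> finite_measure_sets S \<Longrightarrow> B \<in> finite_measure_sets S \<Longrightarrow>
      (\<integral>\<omega>. W A \<omega> * W B \<omega> \<partial>M) = measure S (A \<inter> B)"
begin

definition valid :: "(real \<times> 'e set) list \<Rightarrow> bool" where
  "valid xs \<longleftrightarrow> set xs \<subseteq> UNIV \<times> finite_measure_sets S"

definition step_int :: "(real \<times> 'e set) list \<Rightarrow> 'w \<Rightarrow> real" where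
  "step_int xs \<omega> = (\<Sum>(a, A)\<leftarrow>xs. a * W A \<omega>)"

lemma valid_Nil [simp]: "valid []" and valid_Cons: "valid ((a, A) # xs) \<longleftrightarrow> A \<in> finite_measure_sets S \<and> valid xs"
  and valid_append: "valid (xs @ ys) \<longleftrightarrow> valid xs \<and> valid ys"
  and valid_scale: "valid (map (map_prod ((*) c) id) xs) \<longleftrightarrow> valid xs"
  by (auto simp: valid_def)

lemma step_int_Nil [simp]: "step_int [] = (\<lambda>_. 0)"
  and step_int_Cons: "step_int ((a, A) # xs) \<omega> = a * W A \<omega> + step_int xs \<omega>"
  and step_int_append: "step_int (xs @ ys) \<omega> = step_int xs \<omega> + step_int ys \<omega>"
  by (auto simp: step_int_def)

lemma step_int_scale: "step_int (map (map_prod ((*) c) id) xs) \<omega> = c * step_int xs \<omega>"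
  by (induction xs) (auto simp: step_int_Cons algebra_simps)

lemma step_int_sq: "valid xs \<Longrightarrow> square_integrable M (step_int xs)"
proof (induction xs)
  case (Cons p xs)
  obtain a A where p: "p = (a, A)" by (cases p)
  show ?case using Cons W_sq[of A] unfolding p step_int_Cons[abs_def]
    by (intro square_integrable_add square_integrable_scale) (auto simp: valid_Cons)
qed auto

lemma step_fun_sq: "valid xs \<Longrightarrow> square_integrable S (step_fun xs)"
  by (rule square_integrable_step_fun) (auto simp: valid_def finite_measure_sets_def)

lemma step_int_meas: "valid xs \<Longrightarrow> step_int xs \<in> borel_measurable M"
  using step_int_sq by (auto simp: square_integrable_def)

lemma step_fun_meas: "valid xs \<Longrightarrow> step_fun xs \<in> borel_measurable S"
  using step_fun_sq by (auto simp: square_integrable_def)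

lemma step_int_cov_W:
  assumes "valid xs" and B: "B \<in> finite_measure_sets S"
  shows "(\<integral>\<omega>. step_int xs \<omega> * W B \<omega> \<partial>M) = (\<integral>e. step_fun xs e * indicator B e \<partial>S)"
  using assms(1)
proof (induction xs)
  case (Cons p xs)
  obtain a A where p: "p = (a, A)" by (cases p)
  have A: "A \<in> finite_measure_sets S" and xs: "valid xs" using Cons.prems by (auto simp: p valid_Cons)
  have iB: "square_integrable S (indicator B)" and iA: "square_integrable S (indicator A)"
    using A B by (auto intro!: square_integrable_indicator simp: finite_measure_sets_def)
  have "(\<integral>\<omega>. step_int (p # xs) \<omega> * W B \<omega> \<partial>M) = (\<integral>\<omega>. a * (W A \<omega> * W B \<omega>) + step_int xs \<omega> * W B \<omega> \<partial>M)"
    by (simp add: p step_int_Cons algebra_simps)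
  also have "\<dots> = a * measure S (A \<inter> B) + (\<integral>e. step_fun xs e * indicator B e \<partial>S)"
    using square_integrable_mult[OF W_sq[OF A] W_sq[OF B]] square_integrable_mult[OF step_int_sq[OF xs] W_sq[OF B]]
    by (simp add: W_cov[OF A B] Cons.IH[OF xs])
  also have "measure S (A \<inter> B) = (\<integral>e. indicator A e * indicator B e \<partial>S)"
  proof -
    have "(\<integral>e. indicator A e * indicator B e \<partial>S) = (\<integral>e. indicator (A \<inter> B) e \<partial>S :: real)"
      by (intro Bochner_Integration.integral_cong) (auto simp: indicator_def)
    also have "\<dots> = measure S ((A \<inter> B) \<inter> space S)" by simp
    also have "(A \<inter> B) \<inter> space S = A \<inter> B"
      using A sets.sets_into_space[of A S] by (auto simp: finite_measure_sets_def)
    finally show ?thesis by simp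
  qed
  also have "a * (\<integral>e. indicator A e * indicator B e \<partial>S) + (\<integral>e. step_fun xs e * indicator B e \<partial>S)
      = (\<integral>e. a * (indicator A e * indicator B e) + step_fun xs e * indicator B e \<partial>S)"
    using square_integrable_mult[OF iA iB] square_integrable_mult[OF step_fun_sq[OF xs] iB] by simp
  also have "\<dots> = (\<integral>e. step_fun (p # xs) e * indicator B e \<partial>S)"
    by (simp add: p step_fun_Cons algebra_simps)
  finally show ?case .
qed auto

lemma step_int_cov:
  assumes xs: "valid xs" and ys: "valid ys"
  shows "(\<integral>\<omega>. step_int xs \<omega> * step_int ys \<omega> \<partial>M) = (\<integral>e. step_fun xs e * step_fun ys e \<partial>S)"
  using ys
proof (induction ys)
  case (Cons p ys)
  obtain a A where p: "p = (a, A)" by (cases p)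
  have A: "A \<in> finite_measure_sets S" and ys: "valid ys" using Cons.prems by (auto simp: p valid_Cons)
  have iA: "square_integrable S (indicator A)"
    using A by (auto intro!: square_integrable_indicator simp: finite_measure_sets_def)
  have "(\<integral>\<omega>. step_int xs \<omega> * step_int (p # ys) \<omega> \<partial>M) = (\<integral>\<omega>. a * (step_int xs \<omega> * W A \<omega>) + step_int xs \<omega> * step_int ys \<omega> \<partial>M)"
    by (simp add: p step_int_Cons algebra_simps)
  also have "\<dots> = a * (\<integral>e. step_fun xs e * indicator A e \<partial>S) + (\<integral>e. step_fun xs e * step_fun ys e \<partial>S)"
    using square_integrable_mult[OF step_int_sq[OF xs] W_sq[OF A]] square_integrable_mult[OF step_int_sq[OF xs] step_int_sq[OF ys]]
    by (simp add: step_int_cov_W[OF xs A] Cons.IH[OF ys])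
  also have "\<dots> = (\<integral>e. a * (step_fun xs e * indicator A e) + step_fun xs e * step_fun ys e \<partial>S)"
    using square_integrable_mult[OF step_fun_sq[OF xs] iA] square_integrable_mult[OF step_fun_sq[OF xs] step_fun_sq[OF ys]]
    by simp
  also have "\<dots> = (\<integral>e. step_fun xs e * step_fun (p # ys) e \<partial>S)"
    by (simp add: p step_fun_Cons algebra_simps)
  finally show ?case .
qed auto

text \<open>The difference of two lists is again a list, so the covariance identity gives the
  distance. Consequently lists with the same step function have almost surely the same integral,
  which includes almost sure additivity of \<open>W\<close>.\<close>

lemma step_isometry:
  assumes xs: "valid xs" and ys: "valid ys"
  shows "L2d M (step_int xs) (step_int ys) = L2d S (step_fun xs) (step_fun ys)"
proof -
  define zs where "zs = xs @ map (map_prod ((*) (-1)) id) ys"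
  have zs: "valid zs" using xs ys by (simp add: zs_def valid_append valid_scale)
  have 1: "step_int zs \<omega> = step_int xs \<omega> - step_int ys \<omega>" for \<omega>
    by (simp add: zs_def step_int_append step_int_scale)
  have 2: "step_fun zs e = step_fun xs e - step_fun ys e" for e
    by (simp add: zs_def step_fun_append step_fun_scale)
  have "L2d M (step_int xs) (step_int ys) = ennreal (\<integral>\<omega>. step_int zs \<omega> * step_int zs \<omega> \<partial>M)"
    by (simp add: L2d_eq_integral step_int_sq xs ys 1 power2_eq_square)
  also have "\<dots> = L2d S (step_fun xs) (step_fun ys)"
    by (simp add: step_int_cov[OF zs zs] L2d_eq_integral step_fun_sq xs ys 2 power2_eq_square)
  finally show ?thesis .
qed

lemma simple_bochner_integrable_step_fun:
  "valid xs \<Longrightarrow> Bochner_Integration.simple_bochner_integrable S (step_fun xs)"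
proof (induction xs)
  case Nil
  show ?case by (rule simple_bochner_integrable.intros) auto
next
  case (Cons p xs)
  obtain a A where p: "p = (a, A)" by (cases p)
  have A: "A \<in> sets S" "emeasure S A < \<infinity>" and xs: "valid xs"
    using Cons.prems by (auto simp: p valid_Cons finite_measure_sets_def)
  have "Bochner_Integration.simple_bochner_integrable S (\<lambda>e. a * indicator A e)"
  proof (rule simple_bochner_integrable.intros)
    show "simple_function S (\<lambda>e. a * indicator A e)" using A by auto
    have "emeasure S {y \<in> space S. a * indicator A y \<noteq> 0} \<le> emeasure S A"
      using A by (intro emeasure_mono) (auto simp: indicator_def)
    thus "emeasure S {y \<in> space S. a * indicator A y \<noteq> 0} \<noteq> \<infinity>" using A(2) by auto
  qed
  from simple_bochner_integrable_compose2[OF _ this Cons.IH[OF xs], of "(+)"]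
  show ?case unfolding p step_fun_Cons[abs_def] by simp
qed

text \<open>The value 0 is left out of the list: its level set may have infinite measure, where
  \<open>W\<close> is not controlled, and its term is 0 in any case.\<close>

lemma simple_stoch_integral_list:
  assumes "Bochner_Integration.simple_bochner_integrable S s"
  shows "\<exists>xs. valid xs \<and> step_int xs = simple_stoch_integral S W s \<and> (\<forall>e \<in> space S. step_fun xs e = s e)"
proof -
  have s: "simple_function S s" "emeasure S {y \<in> space S. s y \<noteq> 0} \<noteq> \<infinity>"
    using assms by (auto elim: simple_bochner_integrable.cases)
  note [measurable] = borel_measurable_simple_function[OF s(1)]
  have fin: "finite (s ` space S)" by (rule simple_functionD(1)[OF s(1)])
  then obtain l where l: "set l = s ` space S - {0}" "distinct l"
    using finite_distinct_list[of "s ` space S - {0}"] by auto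
  define xs where "xs = map (\<lambda>r. (r, s -` {r} \<inter> space S)) l"
  have "s -` {r} \<inter> space S \<in> finite_measure_sets S" if "r \<noteq> 0" for r
  proof -
    have "emeasure S (s -` {r} \<inter> space S) \<le> emeasure S {y \<in> space S. s y \<noteq> 0}"
      using that by (intro emeasure_mono) auto
    thus ?thesis using s(2) unfolding finite_measure_sets_def by (auto simp: less_top intro: le_less_trans)
  qed
  hence "valid xs" using l by (auto simp: valid_def xs_def)
  moreover have "step_int xs = simple_stoch_integral S W s"
  proof
    fix \<omega>
    have "step_int xs \<omega> = (\<Sum>r\<in>set l. r * W (s -` {r} \<inter> space S) \<omega>)"
      using l(2) by (simp add: step_int_def xs_def sum_list_distinct_conv_sum_set comp_def)
    also have "\<dots> = simple_stoch_integral S W s \<omega>"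
      unfolding simple_stoch_integral_def l(1) using fin by (intro sum.mono_neutral_left) auto
    finally show "step_int xs \<omega> = simple_stoch_integral S W s \<omega>" .
  qed
  moreover have "step_fun xs e = s e" if "e \<in> space S" for e
  proof -
    have "step_fun xs e = (\<Sum>r\<in>set l. r * indicator (s -` {r} \<inter> space S) e)"
      using l(2) by (simp add: step_fun_def xs_def sum_list_distinct_conv_sum_set comp_def)
    also have "\<dots> = (\<Sum>r\<in>s ` space S. r * indicator (s -` {r} \<inter> space S) e)"
      unfolding l(1) using fin by (intro sum.mono_neutral_left) auto
    also have "\<dots> = (\<Sum>r\<in>s ` space S. if r = s e then r else 0)"
      using that by (intro sum.cong) (auto simp: indicator_def)
    also have "\<dots> = s e" using fin that by (simp add: sum.delta')
    finally show ?thesis .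
  qed
  ultimately show ?thesis by auto
qed

text \<open>A list and the level sets of its step function are two representations of one function,
  so the isometry makes the integrals agree almost surely, though not pointwise.\<close>

lemma simple_stoch_integral_step_fun:
  assumes "valid xs"
  shows "AE \<omega> in M. simple_stoch_integral S W (step_fun xs) \<omega> = step_int xs \<omega>"
proof -
  obtain ys where ys: "valid ys" "step_int ys = simple_stoch_integral S W (step_fun xs)"
    "\<forall>e \<in> space S. step_fun ys e = step_fun xs e"
    using simple_stoch_integral_list[OF simple_bochner_integrable_step_fun[OF assms]] by blast
  have "L2d M (step_int ys) (step_int xs) = L2d S (step_fun xs) (step_fun xs)"
    unfolding step_isometry[OF ys(1) assms] using ys(3) by (intro L2d_cong) auto
  thus ?thesis
    using L2d_eq_0_iff[OF step_int_meas[OF ys(1)] step_int_meas[OF assms]] by (simp add: ys(2))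
qed

text \<open>Lists replace simple functions as approximants, since sums, slices in y and pairings
  with f act on lists directly.\<close>

lemma has_stoch_integral_iff:
  "has_stoch_integral M S W f X \<longleftrightarrow> square_integrable S f \<and> square_integrable M X \<and>
    (\<exists>xs. (\<forall>n. valid (xs n)) \<and> (\<lambda>n. L2d S f (step_fun (xs n))) \<longlonglongrightarrow> 0
      \<and> (\<lambda>n. L2d M X (step_int (xs n))) \<longlonglongrightarrow> 0)" (is "_ \<longleftrightarrow> _ \<and> _ \<and> ?R")
proof -
  have "(\<exists>s :: nat \<Rightarrow> 'e \<Rightarrow> real.
        (\<forall>n. Bochner_Integration.simple_bochner_integrable S (s n))
      \<and> (\<lambda>n. L2d S f (s n)) \<longlonglongrightarrow> 0
      \<and> (\<lambda>n. L2d M X (simple_stoch_integral S W (s n))) \<longlonglongrightarrow> 0) \<longleftrightarrow> ?R" (is "?L \<longleftrightarrow> _")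
  proof
    assume ?L
    then obtain s where s: "\<And>n::nat. Bochner_Integration.simple_bochner_integrable S (s n)"
      "(\<lambda>n. L2d S f (s n)) \<longlonglongrightarrow> 0" "(\<lambda>n. L2d M X (simple_stoch_integral S W (s n))) \<longlonglongrightarrow> 0" by blast
    obtain xs where xs: "\<And>n. valid (xs n)" "\<And>n. step_int (xs n) = simple_stoch_integral S W (s n)"
      "\<And>n e. e \<in> space S \<Longrightarrow> step_fun (xs n) e = s n e"
      using simple_stoch_integral_list[OF s(1)] by metis
    have "L2d S f (step_fun (xs n)) = L2d S f (s n)" for n by (rule L2d_cong) (auto simp: xs)
    thus ?R using s xs by (intro exI[of _ xs]) simp
  next
    assume ?R
    then obtain xs where xs: "\<And>n. valid (xs n)" "(\<lambda>n. L2d S f (step_fun (xs n))) \<longlonglongrightarrow> 0"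
      "(\<lambda>n. L2d M X (step_int (xs n))) \<longlonglongrightarrow> 0" by blast
    have "L2d M X (simple_stoch_integral S W (step_fun (xs n))) = L2d M X (step_int (xs n))" for n
      using simple_stoch_integral_step_fun[OF xs(1)] by (intro L2d_cong_AE) auto
    thus ?L using xs by (intro exI[of _ "\<lambda>n. step_fun (xs n)"]) (auto intro: simple_bochner_integrable_step_fun)
  qed
  thus ?thesis unfolding has_stoch_integral_def L2d_def by simp
qed

lemma has_stoch_integral_sq:
  "has_stoch_integral M S W f X \<Longrightarrow> square_integrable S f" "has_stoch_integral M S W f X \<Longrightarrow> square_integrable M X"
  by (auto simp: has_stoch_integral_def)

text \<open>The step isometry is carried through two approximating sequences. The factor 16 is 4 *
  4: the middle term of two nested triangle inequalities gets the factor 4, once on the side of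
  \<open>M\<close> and once on the side of \<open>S\<close>; the outer terms vanish in the
  limit.\<close>

lemma has_stoch_integral_bound:
  assumes "has_stoch_integral M S W f X" "has_stoch_integral M S W g Y"
  shows "L2d M X Y \<le> 16 * L2d S f g"
proof -
  obtain xs where xs: "\<And>n. valid (xs n)" "(\<lambda>n. L2d S f (step_fun (xs n))) \<longlonglongrightarrow> 0"
    "(\<lambda>n. L2d M X (step_int (xs n))) \<longlonglongrightarrow> 0" using assms(1) unfolding has_stoch_integral_iff by blast
  obtain ys where ys: "\<And>n. valid (ys n)" "(\<lambda>n. L2d S g (step_fun (ys n))) \<longlonglongrightarrow> 0"
    "(\<lambda>n. L2d M Y (step_int (ys n))) \<longlonglongrightarrow> 0" using assms(2) unfolding has_stoch_integral_iff by blast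
  have m [measurable]: "X \<in> borel_measurable M" "Y \<in> borel_measurable M" "f \<in> borel_measurable S" "g \<in> borel_measurable S"
    using assms has_stoch_integral_sq by (auto simp: square_integrable_def)
  note [measurable] = step_int_meas[OF xs(1)] step_int_meas[OF ys(1)] step_fun_meas[OF xs(1)] step_fun_meas[OF ys(1)]
  have q4: "L2d N a d \<le> 2 * L2d N a b + (4 * L2d N b c + 4 * L2d N c d)"
    if [measurable]: "a \<in> borel_measurable N" "b \<in> borel_measurable N" "c \<in> borel_measurable N" "d \<in> borel_measurable N" 
    for N :: "'z measure" and a b c d
  proof -
    have "L2d N a d \<le> 2 * L2d N a b + 2 * L2d N b d" by (rule L2d_triangle) auto
    also have "L2d N b d \<le> 2 * L2d N b c + 2 * L2d N c d" by (rule L2d_triangle) auto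
    finally show ?thesis by (simp add: distrib_left add_left_mono mult_left_mono mult.assoc[symmetric])
  qed
  have "L2d M X Y \<le> 2 * L2d M X (step_int (xs n)) + (4 * (2 * L2d S (step_fun (xs n)) f + (4 * L2d S f g + 4 * L2d S g (step_fun (ys n)))) + 4 * L2d M (step_int (ys n)) Y)" for n
  proof -
    have "L2d M X Y \<le> 2 * L2d M X (step_int (xs n)) + (4 * L2d M (step_int (xs n)) (step_int (ys n)) + 4 * L2d M (step_int (ys n)) Y)"
      by (rule q4) auto
    also have "L2d M (step_int (xs n)) (step_int (ys n)) = L2d S (step_fun (xs n)) (step_fun (ys n))"
      by (rule step_isometry[OF xs(1) ys(1)])
    also have "\<dots> \<le> 2 * L2d S (step_fun (xs n)) f + (4 * L2d S f g + 4 * L2d S g (step_fun (ys n)))"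
      by (rule q4) auto
    finally show ?thesis by (simp add: add_left_mono add_right_mono mult_left_mono)
  qed
  moreover have "(\<lambda>n. 2 * L2d M X (step_int (xs n)) + (4 * (2 * L2d S (step_fun (xs n)) f + (4 * L2d S f g + 4 * L2d S g (step_fun (ys n)))) + 4 * L2d M (step_int (ys n)) Y))
    \<longlonglongrightarrow> 2 * 0 + (4 * (2 * 0 + (4 * L2d S f g + 4 * 0)) + 4 * 0)"
    using xs(2,3) ys(2,3)
    by (intro tendsto_add ennreal_tendsto_cmult tendsto_const) (simp_all add: L2d_commute)
  ultimately have "L2d M X Y \<le> 2 * 0 + (4 * (2 * 0 + (4 * L2d S f g + 4 * 0)) + 4 * 0)"
    by (intro LIMSEQ_le_const) auto
  thus ?thesis by (simp add: mult.assoc[symmetric])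
qed

lemma has_stoch_integral_unique:
  assumes "has_stoch_integral M S W f X" "has_stoch_integral M S W g Y" "AE e in S. f e = g e"
  shows "AE \<omega> in M. X \<omega> = Y \<omega>"
proof -
  have "L2d S f g = L2d S g g" using assms(3) by (intro L2d_cong_AE) auto
  hence "L2d M X Y = 0" using has_stoch_integral_bound[OF assms(1,2)] by simp
  thus ?thesis using has_stoch_integral_sq(2)[OF assms(1)] has_stoch_integral_sq(2)[OF assms(2)]
    by (subst (asm) L2d_eq_0_iff) (auto simp: square_integrable_def)
qed

lemma has_stoch_integral_add:
  assumes "has_stoch_integral M S W f X" "has_stoch_integral M S W g Y"
  shows "has_stoch_integral M S W (\<lambda>e. f e + g e) (\<lambda>\<omega>. X \<omega> + Y \<omega>)"
proof -
  obtain xs where xs: "\<And>n. valid (xs n)" "(\<lambda>n. L2d S f (step_fun (xs n))) \<longlonglongrightarrow> 0"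
    "(\<lambda>n. L2d M X (step_int (xs n))) \<longlonglongrightarrow> 0" using assms(1) unfolding has_stoch_integral_iff by blast
  obtain ys where ys: "\<And>n. valid (ys n)" "(\<lambda>n. L2d S g (step_fun (ys n))) \<longlonglongrightarrow> 0"
    "(\<lambda>n. L2d M Y (step_int (ys n))) \<longlonglongrightarrow> 0" using assms(2) unfolding has_stoch_integral_iff by blast
  note sq = has_stoch_integral_sq[OF assms(1)] has_stoch_integral_sq[OF assms(2)]
  have m: "X \<in> borel_measurable M" "Y \<in> borel_measurable M" "f \<in> borel_measurable S" "g \<in> borel_measurable S"
    using sq by (auto simp: square_integrable_def)
  have "(\<lambda>n. L2d S (\<lambda>e. f e + g e) (\<lambda>e. step_fun (xs n) e + step_fun (ys n) e)) \<longlonglongrightarrow> 0"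
    "(\<lambda>n. L2d M (\<lambda>\<omega>. X \<omega> + Y \<omega>) (\<lambda>\<omega>. step_int (xs n) \<omega> + step_int (ys n) \<omega>)) \<longlonglongrightarrow> 0"
    by (intro L2d_tendsto_add m xs ys step_fun_meas step_int_meas)+
  thus ?thesis unfolding has_stoch_integral_iff using xs(1) ys(1) sq
    by (auto intro!: exI[of _ "\<lambda>n. xs n @ ys n"] simp: step_fun_append[abs_def] step_int_append[abs_def] valid_append)
qed

lemma has_stoch_integral_zero: "has_stoch_integral M S W (\<lambda>_. 0) (\<lambda>_. 0)"
  unfolding has_stoch_integral_iff by (auto intro!: exI[of _ "\<lambda>_. []"])

lemma has_stoch_integral_sum:
  assumes "finite I" "\<And>i. i \<in> I \<Longrightarrow> has_stoch_integral M S W (f i) (X i)"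
  shows "has_stoch_integral M S W (\<lambda>e. \<Sum>i\<in>I. f i e) (\<lambda>\<omega>. \<Sum>i\<in>I. X i \<omega>)"
  using assms by (induction I rule: finite_induct) (auto intro: has_stoch_integral_add has_stoch_integral_zero)

section \<open>Integrals depending on a parameter, and stochastic Fubini\<close>

definition rect_int :: "(real \<times> 'e set \<times> real set) list \<Rightarrow> 'w \<times> real \<Rightarrow> real" where
  "rect_int rs = (\<lambda>(\<omega>, y). \<Sum>(a, A, B)\<leftarrow>rs. a * W A \<omega> * indicator B y)"

definition valid_rect :: "(real \<times> 'e set \<times> real set) list \<Rightarrow> bool" where
  "valid_rect rs \<longleftrightarrow> set rs \<subseteq> UNIV \<times> finite_measure_sets S \<times> finite_measure_sets lambda_D"

definition slice :: "(real \<times> 'e set \<times> real set) list \<Rightarrow> real \<Rightarrow> (real \<times> 'e set) list" where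
  "slice rs y = map (\<lambda>(a, A, B). (a * indicator B y, A)) rs"

definition proj :: "(real \<times> 'e set \<times> real set) list \<Rightarrow> (real \<Rightarrow> real) \<Rightarrow> (real \<times> 'e set) list" where
  "proj rs f = map (\<lambda>(a, A, B). (a * (\<integral>y. indicator B y * f y \<partial>lambda_D), A)) rs"

text \<open>Freezing y turns a rectangle list into an ordinary list, and does so simultaneously for
  integrand and integral.\<close>

lemma slice:
  "valid_rect rs \<Longrightarrow> valid (slice rs y)"
  "step_fun (slice rs y) = (\<lambda>e. rect_fun rs (e, y))"
  "step_int (slice rs y) = (\<lambda>\<omega>. rect_int rs (\<omega>, y))"
  by (auto simp: valid_def valid_rect_def slice_def step_fun_def step_int_def rect_fun_def rect_int_def fun_eq_iff
      comp_def case_prod_unfold mult_ac)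

lemma rect_meas:
  assumes "valid_rect rs"
  shows "rect_fun rs \<in> borel_measurable (S \<Otimes>\<^sub>M lambda_D)" "rect_int rs \<in> borel_measurable (M \<Otimes>\<^sub>M lambda_D)"
proof -
  have "rect_fun rs \<in> borel_measurable (S \<Otimes>\<^sub>M lambda_D) \<and> rect_int rs \<in> borel_measurable (M \<Otimes>\<^sub>M lambda_D)"
    using assms
  proof (induction rs)
    case (Cons p rs)
    obtain a A B where p: "p = (a, A, B)" by (cases p)
    have [measurable]: "A \<in> sets S" "B \<in> sets lambda_D" "W A \<in> borel_measurable M" and v: "valid_rect rs"
      using Cons.prems W_sq[of A] by (auto simp: p valid_rect_def finite_measure_sets_def square_integrable_def)
    have [measurable]: "rect_fun rs \<in> borel_measurable (S \<Otimes>\<^sub>M lambda_D)" "rect_int rs \<in> borel_measurable (M \<Otimes>\<^sub>M lambda_D)"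
      using Cons.IH[OF v] by auto
    have "rect_fun (p # rs) = (\<lambda>z. a * indicator A (fst z) * indicator B (snd z) + rect_fun rs z)"
      "rect_int (p # rs) = (\<lambda>z. a * W A (fst z) * indicator B (snd z) + rect_int rs z)"
      by (auto simp: rect_fun_def rect_int_def p)
    thus ?case by simp
  qed (auto simp: rect_fun_def rect_int_def)
  thus "rect_fun rs \<in> borel_measurable (S \<Otimes>\<^sub>M lambda_D)" "rect_int rs \<in> borel_measurable (M \<Otimes>\<^sub>M lambda_D)" by auto
qed

lemma rect_isometry:
  assumes "valid_rect rs" "valid_rect rs'"
  shows "L2d (M \<Otimes>\<^sub>M lambda_D) (rect_int rs) (rect_int rs') = L2d (S \<Otimes>\<^sub>M lambda_D) (rect_fun rs) (rect_fun rs')"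
proof -
  have "L2d M (\<lambda>\<omega>. rect_int rs (\<omega>, y)) (\<lambda>\<omega>. rect_int rs' (\<omega>, y)) = L2d S (\<lambda>e. rect_fun rs (e, y)) (\<lambda>e. rect_fun rs' (e, y))" for y
    using step_isometry[OF slice(1)[OF assms(1)] slice(1)[OF assms(2)], of y y] by (simp add: slice)
  thus ?thesis
    by (simp add: L2d_pair(1)[OF sigma_finite_S] L2d_pair(1)[OF sigma_finite_measure_axioms] rect_meas assms)
qed

text \<open>The stochastic Fubini identity for rectangle sums: pairing with f only changes the
  coefficients of the list, so integrand and integral are transformed in the same way.\<close>

lemma proj:
  assumes "valid_rect rs" and f: "square_integrable lambda_D f"
  shows "valid (proj rs f)" "step_fun (proj rs f) = (\<lambda>e. \<integral>y. rect_fun rs (e, y) * f y \<partial>lambda_D)"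
    "step_int (proj rs f) = (\<lambda>\<omega>. \<integral>y. rect_int rs (\<omega>, y) * f y \<partial>lambda_D)"
proof -
  show "valid (proj rs f)" using assms(1) by (auto simp: valid_def valid_rect_def proj_def)
  have "(\<forall>e. integrable lambda_D (\<lambda>y. rect_fun rs (e, y) * f y) \<and> step_fun (proj rs f) e = (\<integral>y. rect_fun rs (e, y) * f y \<partial>lambda_D))
    \<and> (\<forall>\<omega>. integrable lambda_D (\<lambda>y. rect_int rs (\<omega>, y) * f y) \<and> step_int (proj rs f) \<omega> = (\<integral>y. rect_int rs (\<omega>, y) * f y \<partial>lambda_D))"
    using assms(1)
  proof (induction rs)
    case Nil
    show ?case by (simp add: proj_def rect_fun_def rect_int_def)
  next
    case (Cons p rs)
    obtain a A B where p: "p = (a, A, B)" by (cases p)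
    have B: "B \<in> sets lambda_D" "emeasure lambda_D B < \<infinity>" and v: "valid_rect rs"
      using Cons.prems by (auto simp: p valid_rect_def finite_measure_sets_def)
    have i: "integrable lambda_D (\<lambda>y. indicator B y * f y)"
      by (rule square_integrable_mult[OF square_integrable_indicator[OF B] f])
    have 1: "rect_fun (p # rs) (e, y) * f y = (a * indicator A e) * (indicator B y * f y) + rect_fun rs (e, y) * f y"
      "rect_int (p # rs) (\<omega>, y) * f y = (a * W A \<omega>) * (indicator B y * f y) + rect_int rs (\<omega>, y) * f y" for e y \<omega>
      by (simp_all add: rect_fun_def rect_int_def p algebra_simps)
    have 2: "proj (p # rs) f = (a * (\<integral>y. indicator B y * f y \<partial>lambda_D), A) # proj rs f"
      by (simp add: proj_def p)
    define J where "J = (\<integral>y. indicator B y * f y \<partial>lambda_D)"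
    have 3: "a * J * indicator A e = (a * indicator A e) * J" "a * J * W A \<omega> = (a * W A \<omega>) * J" for e \<omega> by simp_all
    show ?case unfolding 1 2 step_fun_Cons step_int_Cons J_def[symmetric] 3 using i Cons.IH[OF v] by (simp add: J_def)
  qed
  thus "step_fun (proj rs f) = (\<lambda>e. \<integral>y. rect_fun rs (e, y) * f y \<partial>lambda_D)"
    "step_int (proj rs f) = (\<lambda>\<omega>. \<integral>y. rect_int rs (\<omega>, y) * f y \<partial>lambda_D)" by auto
qed

text \<open>The rectangle integrals are Cauchy by the isometry, and their limit inherits two
  properties from the same sequence: almost every section in y is a version of the integral, and
  pairing with f commutes with integration against the noise.\<close>

lemma param_stoch_integral_exists:
  assumes F: "square_integrable (S \<Otimes>\<^sub>M lambda_D) F"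
  shows "\<exists>z. square_integrable (M \<Otimes>\<^sub>M lambda_D) z
    \<and> (AE y in lambda_D. has_stoch_integral M S W (\<lambda>e. F (e, y)) (\<lambda>\<omega>. z (\<omega>, y)))
    \<and> (\<forall>f. square_integrable lambda_D f \<longrightarrow>
        has_stoch_integral M S W (\<lambda>e. \<integral>y. F (e, y) * f y \<partial>lambda_D) (\<lambda>\<omega>. \<integral>y. z (\<omega>, y) * f y \<partial>lambda_D))"
proof -
  have Fm[measurable]: "F \<in> borel_measurable (S \<Otimes>\<^sub>M lambda_D)" using F by (simp add: square_integrable_def)
  let ?P = "S \<Otimes>\<^sub>M lambda_D" and ?Q = "M \<Otimes>\<^sub>M lambda_D"
  \<comment> \<open>The rate 1 / 4 ^ n makes the sections converge along the full sequence for
    almost every y, so that one sequence serves almost all y.\<close>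
  have "\<exists>rs. valid_rect rs \<and> L2d ?P F (rect_fun rs) < ennreal ((1/4) ^ n)" for n
    using rect_dense[OF sigma_finite_S F, of "ennreal ((1/4) ^ n)"] by (auto simp: valid_rect_def)
  then obtain rs where rs: "\<And>n. valid_rect (rs n)" "\<And>n. L2d ?P F (rect_fun (rs n)) < ennreal ((1/4) ^ n)" by metis
  note m[measurable] = rect_meas[OF rs(1)]
  have "L2d ?Q (rect_int (rs n)) (rect_int (rs k)) \<le> 4 * ennreal ((1/4) ^ n)" if "n \<le> k" for n k
  proof -
    have "L2d ?Q (rect_int (rs n)) (rect_int (rs k)) = L2d ?P (rect_fun (rs n)) (rect_fun (rs k))"
      by (rule rect_isometry[OF rs(1) rs(1)])
    also have "\<dots> \<le> 2 * L2d ?P (rect_fun (rs n)) F + 2 * L2d ?P F (rect_fun (rs k))"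
      by (rule L2d_triangle) auto
    also have "\<dots> \<le> 2 * ennreal ((1/4) ^ n) + 2 * ennreal ((1/4) ^ n)"
    proof (intro add_mono mult_left_mono)
      show "L2d ?P (rect_fun (rs n)) F \<le> ennreal ((1/4) ^ n)" using rs(2)[of n] by (simp add: L2d_commute)
      have "ennreal ((1/4) ^ k) \<le> ennreal ((1/4) ^ n)" using that by (intro ennreal_leI power_decreasing) auto
      with rs(2)[of k] show "L2d ?P F (rect_fun (rs k)) \<le> ennreal ((1/4) ^ n)" by (meson less_imp_le order_trans)
    qed auto
    also have "\<dots> = 4 * ennreal ((1/4) ^ n)" by (simp add: distrib_right[symmetric])
    finally show ?thesis .
  qed
  from L2d_complete[OF m(2) _ this]
  obtain z where z[measurable]: "z \<in> borel_measurable ?Q" and zr: "\<And>n. L2d ?Q (rect_int (rs n)) z \<le> 4 * ennreal ((1/4) ^ n)"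
    by auto
  have lim1: "(\<lambda>n. ennreal ((1/4) ^ n)) \<longlonglongrightarrow> 0"
    using tendsto_ennrealI[OF LIMSEQ_power_zero[of "1/4::real"]] by simp
  have sqr: "square_integrable ?P (rect_fun (rs n))" for n
    using F m(1) rs(2)[of n] by (intro square_integrable_close[OF F]) (auto intro: less_trans)
  have sqi: "square_integrable ?Q (rect_int (rs n))" for n
  proof -
    have "rect_int [] = (\<lambda>_. 0)" "(rect_fun [] :: 'e \<times> real \<Rightarrow> real) = (\<lambda>_. 0)" by (auto simp: rect_int_def rect_fun_def)
    hence "L2d ?Q (rect_int (rs n)) (\<lambda>_. 0) = L2d ?P (rect_fun (rs n)) (\<lambda>_. 0)"
      using rect_isometry[OF rs(1)[of n], of "[]"] by (simp add: valid_rect_def)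
    thus ?thesis using sqr[of n] m(2) by (simp add: square_integrable_iff_L2d)
  qed
  have sqz: "square_integrable ?Q z"
    by (rule square_integrable_close[OF sqi[of 0]]) (use zr[of 0] in \<open>auto intro: le_less_trans\<close>)
  have A1: "AE y in lambda_D. (\<lambda>n. L2d S (\<lambda>e. F (e, y)) (\<lambda>e. rect_fun (rs n) (e, y))) \<longlonglongrightarrow> 0"
    by (rule L2d_geometric_AE_tendsto[where C=1])
       (use L2d_pair[OF sigma_finite_S Fm m(1)] rs(2) in \<open>auto intro: less_imp_le\<close>)
  have A2: "AE y in lambda_D. (\<lambda>n. L2d M (\<lambda>\<omega>. z (\<omega>, y)) (\<lambda>\<omega>. rect_int (rs n) (\<omega>, y))) \<longlonglongrightarrow> 0"
    by (rule L2d_geometric_AE_tendsto[where C=4])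
       (use L2d_pair[OF sigma_finite_measure_axioms z m(2)] zr in \<open>auto simp: L2d_commute[of _ z]\<close>)
  have "AE y in lambda_D. has_stoch_integral M S W (\<lambda>e. F (e, y)) (\<lambda>\<omega>. z (\<omega>, y))"
    using A1 A2 square_integrable_sections(2)[OF sigma_finite_S F] square_integrable_sections(2)[OF sigma_finite_measure_axioms sqz]
  proof eventually_elim
    case (elim y)
    thus ?case unfolding has_stoch_integral_iff
      by (auto intro!: exI[of _ "\<lambda>n. slice (rs n) y"] simp: slice rs(1))
  qed
  moreover have "has_stoch_integral M S W (\<lambda>e. \<integral>y. F (e, y) * f y \<partial>lambda_D) (\<lambda>\<omega>. \<integral>y. z (\<omega>, y) * f y \<partial>lambda_D)"
    if f: "square_integrable lambda_D f" for f
  proof -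
    have B1: "(\<lambda>n. L2d S (\<lambda>e. \<integral>y. F (e, y) * f y \<partial>lambda_D) (\<lambda>e. \<integral>y. rect_fun (rs n) (e, y) * f y \<partial>lambda_D)) \<longlonglongrightarrow> 0"
    proof (rule ennreal_tendsto_zero_le)
      show "(\<lambda>n. ennreal ((norm (L2_class f))\<^sup>2) * ennreal ((1/4) ^ n)) \<longlonglongrightarrow> 0"
        by (intro tendsto_zero_ennreal_mult lim1) simp
      fix n
      have "L2d S (\<lambda>e. \<integral>y. F (e, y) * f y \<partial>lambda_D) (\<lambda>e. \<integral>y. rect_fun (rs n) (e, y) * f y \<partial>lambda_D)
        \<le> ennreal ((norm (L2_class f))\<^sup>2) * L2d ?P F (rect_fun (rs n))"
        by (rule L2d_project[OF sigma_finite_S F sqr f])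
      also have "\<dots> \<le> ennreal ((norm (L2_class f))\<^sup>2) * ennreal ((1/4) ^ n)"
        using rs(2)[of n] by (intro mult_left_mono) auto
      finally show "L2d S (\<lambda>e. \<integral>y. F (e, y) * f y \<partial>lambda_D) (\<lambda>e. \<integral>y. rect_fun (rs n) (e, y) * f y \<partial>lambda_D)
        \<le> ennreal ((norm (L2_class f))\<^sup>2) * ennreal ((1/4) ^ n)" .
    qed
    have B2: "(\<lambda>n. L2d M (\<lambda>e. \<integral>y. z (e, y) * f y \<partial>lambda_D) (\<lambda>e. \<integral>y. rect_int (rs n) (e, y) * f y \<partial>lambda_D)) \<longlonglongrightarrow> 0"
    proof (rule ennreal_tendsto_zero_le)
      show "(\<lambda>n. ennreal ((norm (L2_class f))\<^sup>2) * (4 * ennreal ((1/4) ^ n))) \<longlonglongrightarrow> 0"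
        by (intro tendsto_zero_ennreal_mult lim1) simp_all
      fix n
      have "L2d M (\<lambda>e. \<integral>y. z (e, y) * f y \<partial>lambda_D) (\<lambda>e. \<integral>y. rect_int (rs n) (e, y) * f y \<partial>lambda_D)
        \<le> ennreal ((norm (L2_class f))\<^sup>2) * L2d ?Q z (rect_int (rs n))"
        by (rule L2d_project[OF sigma_finite_measure_axioms sqz sqi f])
      also have "\<dots> \<le> ennreal ((norm (L2_class f))\<^sup>2) * (4 * ennreal ((1/4) ^ n))"
        using zr[of n] by (intro mult_left_mono) (auto simp: L2d_commute)
      finally show "L2d M (\<lambda>e. \<integral>y. z (e, y) * f y \<partial>lambda_D) (\<lambda>e. \<integral>y. rect_int (rs n) (e, y) * f y \<partial>lambda_D)
        \<le> ennreal ((norm (L2_class f))\<^sup>2) * (4 * ennreal ((1/4) ^ n))" .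
    qed
    show ?thesis unfolding has_stoch_integral_iff
      using square_integrable_project[OF sigma_finite_S F f] square_integrable_project[OF sigma_finite_measure_axioms sqz f] B1 B2
      by (auto intro!: exI[of _ "\<lambda>n. proj (rs n) f"] simp: proj[OF rs(1) f])
  qed
  ultimately show ?thesis using sqz by blast
qed

end

section \<open>Characteristic functions of the noises\<close>

lemma norm_iexp_diff_le: "cmod (iexp a - iexp b) \<le> \<bar>a - b\<bar>"
proof -
  have "iexp a - iexp b = iexp b * (iexp (a - b) - 1)"
    by (simp add: algebra_simps flip: exp_add)
  hence "cmod (iexp a - iexp b) = cmod (iexp (a - b) - 1)" by (simp add: norm_mult)
  also have "\<dots> \<le> \<bar>a - b\<bar>" using iexp_approx1[of "a - b" 0] by simp
  finally show ?thesis .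
qed

lemma L2d_real_tendsto:
  assumes "square_integrable S f" "\<And>n. square_integrable S (g n)" "(\<lambda>n. L2d S f (g n)) \<longlonglongrightarrow> 0"
  shows "(\<lambda>n. \<integral>x. (f x - g n x)\<^sup>2 \<partial>S) \<longlonglongrightarrow> 0"
proof -
  have "(\<lambda>n. ennreal (\<integral>x. (f x - g n x)\<^sup>2 \<partial>S)) \<longlonglongrightarrow> ennreal 0"
    using assms by (simp add: L2d_eq_integral)
  thus ?thesis by (subst (asm) tendsto_ennreal_iff) auto
qed

text \<open>Nonnegativity of the variance of |Y|.\<close>

lemma (in prob_space) expectation_abs_le_sqrt:
  assumes "square_integrable M Y"
  shows "integrable M Y" "(\<integral>\<omega>. \<bar>Y \<omega>\<bar> \<partial>M) \<le> sqrt (\<integral>\<omega>. (Y \<omega>)\<^sup>2 \<partial>M)"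
proof -
  have sq: "integrable M (\<lambda>\<omega>. (Y \<omega>)\<^sup>2)" and [measurable]: "Y \<in> borel_measurable M"
    using assms by (auto simp: square_integrable_def)
  show i: "integrable M Y" by (rule square_integrable_imp_integrable) (use sq in auto)
  have "0 \<le> variance (\<lambda>\<omega>. \<bar>Y \<omega>\<bar>)" by (rule variance_positive)
  also have "\<dots> = (\<integral>\<omega>. (Y \<omega>)\<^sup>2 \<partial>M) - (\<integral>\<omega>. \<bar>Y \<omega>\<bar> \<partial>M)\<^sup>2"
    using sq i by (subst variance_eq) auto
  finally show "(\<integral>\<omega>. \<bar>Y \<omega>\<bar> \<partial>M) \<le> sqrt (\<integral>\<omega>. (Y \<omega>)\<^sup>2 \<partial>M)" by (intro real_le_rsqrt) simp
qed

text \<open>\<open>iexp\<close> has Lipschitz constant 1, and on a probability space the mean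
  distance is at most the L2 distance.\<close>

lemma (in prob_space) expectation_iexp_tendsto:
  assumes X: "square_integrable M X" "\<And>n. square_integrable M (Y n)" and lim: "(\<lambda>n. L2d M X (Y n)) \<longlonglongrightarrow> 0"
  shows "(\<lambda>n. \<integral>\<omega>. iexp (Y n \<omega>) \<partial>M) \<longlonglongrightarrow> (\<integral>\<omega>. iexp (X \<omega>) \<partial>M)"
proof -
  have [measurable]: "X \<in> borel_measurable M" "Y n \<in> borel_measurable M" for n
    using X by (simp_all add: square_integrable_def)
  have i: "integrable M (\<lambda>\<omega>. iexp (X \<omega>))" "integrable M (\<lambda>\<omega>. iexp (Y n \<omega>))" for n
    by (auto intro!: integrable_const_bound[of _ 1])
  have L: "(\<lambda>n. sqrt (\<integral>\<omega>. (X \<omega> - Y n \<omega>)\<^sup>2 \<partial>M)) \<longlonglongrightarrow> sqrt 0"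
    by (intro tendsto_intros L2d_real_tendsto X lim)
  have "norm ((\<integral>\<omega>. iexp (Y n \<omega>) \<partial>M) - (\<integral>\<omega>. iexp (X \<omega>) \<partial>M)) \<le> sqrt (\<integral>\<omega>. (X \<omega> - Y n \<omega>)\<^sup>2 \<partial>M)" for n
  proof -
    have d: "square_integrable M (\<lambda>\<omega>. X \<omega> - Y n \<omega>)" using X by auto
    have "norm ((\<integral>\<omega>. iexp (Y n \<omega>) \<partial>M) - (\<integral>\<omega>. iexp (X \<omega>) \<partial>M)) = norm (\<integral>\<omega>. iexp (Y n \<omega>) - iexp (X \<omega>) \<partial>M)"
      using i by simp
    also have "\<dots> \<le> (\<integral>\<omega>. \<bar>X \<omega> - Y n \<omega>\<bar> \<partial>M)"
    proof (intro order.trans[OF integral_norm_bound] integral_mono)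
      show "norm (iexp (Y n \<omega>) - iexp (X \<omega>)) \<le> \<bar>X \<omega> - Y n \<omega>\<bar>" for \<omega>
        using norm_iexp_diff_le[of "Y n \<omega>" "X \<omega>"] by (simp only: abs_minus_commute)
    qed (use i expectation_abs_le_sqrt(1)[OF d] in auto)
    also have "\<dots> \<le> sqrt (\<integral>\<omega>. (X \<omega> - Y n \<omega>)\<^sup>2 \<partial>M)" by (rule expectation_abs_le_sqrt(2)[OF d])
    finally show ?thesis .
  qed
  hence "(\<lambda>n. (\<integral>\<omega>. iexp (Y n \<omega>) \<partial>M) - (\<integral>\<omega>. iexp (X \<omega>) \<partial>M)) \<longlonglongrightarrow> 0"
    by (intro Lim_null_comparison[OF always_eventually L[unfolded real_sqrt_zero]] allI)
  thus ?thesis by (rule LIM_zero_cancel)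
qed

text \<open>The common features of the Gaussian and the jump exponent: quadratic growth makes their
  integrals finite for square integrable integrands, and the local Lipschitz bound makes these
  integrals continuous in L2.\<close>

definition quadratic_exponent :: "(real \<Rightarrow> complex) \<Rightarrow> bool" where
  "quadratic_exponent \<psi> \<longleftrightarrow> \<psi> \<in> borel_measurable borel \<and> \<psi> 0 = 0 \<and>
    (\<forall>a b. cmod (\<psi> a - \<psi> b) \<le> \<bar>a - b\<bar> * (\<bar>a\<bar> + \<bar>b\<bar>))"

lemma quadratic_exponent_bound: "quadratic_exponent \<psi> \<Longrightarrow> cmod (\<psi> a) \<le> a\<^sup>2"
  unfolding quadratic_exponent_def by (metis abs_0 add.right_neutral diff_zero power2_abs power2_eq_square)

lemma quadratic_exponent_integrable:
  assumes "quadratic_exponent \<psi>" "square_integrable S f"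
  shows "integrable S (\<lambda>x. \<psi> (f x))"
proof (rule Bochner_Integration.integrable_bound)
  show "integrable S (\<lambda>x. (f x)\<^sup>2)" using assms by (simp add: square_integrable_def)
  show "(\<lambda>x. \<psi> (f x)) \<in> borel_measurable S"
    using assms by (auto simp: square_integrable_def quadratic_exponent_def)
qed (use quadratic_exponent_bound[OF assms(1)] in auto)

text \<open>The difference is at most |a - b| * (|a - b| + 2 |b|), and the mixed term is split with
  weight \<epsilon> into a multiple of (a - b)^2 and a small multiple of b^2. This relies on
  integrable squares alone, as \<open>S\<close> may be infinite.\<close>

lemma quadratic_exponent_integral_tendsto:
  assumes \<psi>: "quadratic_exponent \<psi>" and f: "square_integrable S f" "\<And>n. square_integrable S (g n)"
    and lim: "(\<lambda>n. L2d S f (g n)) \<longlonglongrightarrow> 0"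
  shows "(\<lambda>n. \<integral>x. \<psi> (g n x) \<partial>S) \<longlonglongrightarrow> (\<integral>x. \<psi> (f x) \<partial>S)"
proof (rule LIMSEQ_I)
  fix r :: real assume r: "r > 0"
  define B where "B = (\<integral>x. (f x)\<^sup>2 \<partial>S)"
  have B: "B \<ge> 0" by (simp add: B_def)
  \<comment> \<open>Chosen so that \<epsilon> times the squared norm of f stays below r / 2; the
    summand 1 covers B = 0.\<close>
  define \<epsilon> where "\<epsilon> = r / (2 * (B + 1))"
  have \<epsilon>: "\<epsilon> > 0" "\<epsilon> * B < r / 2"
    using r B by (auto simp: \<epsilon>_def field_simps) 
  have "(\<lambda>n. (1 + 1/\<epsilon>) * (\<integral>x. (f x - g n x)\<^sup>2 \<partial>S)) \<longlonglongrightarrow> (1 + 1/\<epsilon>) * 0"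
    by (intro tendsto_intros L2d_real_tendsto f lim)
  hence "eventually (\<lambda>n. (1 + 1/\<epsilon>) * (\<integral>x. (f x - g n x)\<^sup>2 \<partial>S) < r / 2) sequentially"
    using r by (intro order_tendstoD(2)[of _ 0]) auto
  then obtain n0 where n0: "\<And>n. n \<ge> n0 \<Longrightarrow> (1 + 1/\<epsilon>) * (\<integral>x. (f x - g n x)\<^sup>2 \<partial>S) < r / 2"
    by (auto simp: eventually_sequentially)
  have "norm ((\<integral>x. \<psi> (g n x) \<partial>S) - (\<integral>x. \<psi> (f x) \<partial>S)) < r" if "n \<ge> n0" for n
  proof -
    have i: "integrable S (\<lambda>x. (f x - g n x)\<^sup>2)" "integrable S (\<lambda>x. (f x)\<^sup>2)"
      using square_integrable_diff[OF f] f by (auto simp: square_integrable_def)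
    note j = quadratic_exponent_integrable[OF \<psi> f(1)] quadratic_exponent_integrable[OF \<psi> f(2)[of n]]
    have "norm ((\<integral>x. \<psi> (g n x) \<partial>S) - (\<integral>x. \<psi> (f x) \<partial>S)) = norm (\<integral>x. \<psi> (g n x) - \<psi> (f x) \<partial>S)"
      using j by simp
    also have "\<dots> \<le> (\<integral>x. (1 + 1/\<epsilon>) * (f x - g n x)\<^sup>2 + \<epsilon> * (f x)\<^sup>2 \<partial>S)"
    proof (intro order.trans[OF integral_norm_bound] integral_mono)
      fix x
      define a b where "a = g n x" and "b = f x"
      have "norm (\<psi> a - \<psi> b) \<le> \<bar>a - b\<bar> * (\<bar>a\<bar> + \<bar>b\<bar>)" using \<psi> by (simp add: quadratic_exponent_def)
      also have "\<dots> \<le> \<bar>a - b\<bar> * (\<bar>a - b\<bar> + 2 * \<bar>b\<bar>)" by (intro mult_left_mono) auto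
      also have "\<dots> = (a - b)\<^sup>2 + 2 * (\<bar>a - b\<bar> * \<bar>b\<bar>)" by (simp add: power2_eq_square[symmetric] distrib_left)
      also have "2 * (\<bar>a - b\<bar> * \<bar>b\<bar>) \<le> 1/\<epsilon> * (a - b)\<^sup>2 + \<epsilon> * b\<^sup>2"
      proof -
        have "0 \<le> (\<bar>a - b\<bar> - \<epsilon> * \<bar>b\<bar>)\<^sup>2 / \<epsilon>" using \<epsilon> by simp
        also have "\<dots> = 1/\<epsilon> * \<bar>a - b\<bar>\<^sup>2 + \<epsilon> * \<bar>b\<bar>\<^sup>2 - 2 * (\<bar>a - b\<bar> * \<bar>b\<bar>)"
          using \<epsilon> by (simp add: field_simps power2_eq_square)
        finally show ?thesis by simp
      qed
      finally show "norm (\<psi> (g n x) - \<psi> (f x)) \<le> (1 + 1/\<epsilon>) * (f x - g n x)\<^sup>2 + \<epsilon> * (f x)\<^sup>2"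
        by (simp add: a_def b_def distrib_right power2_commute)
    qed (use i j in auto)
    also have "\<dots> = (1 + 1/\<epsilon>) * (\<integral>x. (f x - g n x)\<^sup>2 \<partial>S) + \<epsilon> * B"
      using i by (simp add: B_def)
    also have "\<dots> < r" using n0[OF that] \<epsilon>(2) by linarith
    finally show ?thesis .
  qed
  thus "\<exists>no. \<forall>n\<ge>no. norm ((\<integral>x. \<psi> (g n x) \<partial>S) - (\<integral>x. \<psi> (f x) \<partial>S)) < r" by blast
qed

text \<open>Logarithm of the characteristic function of a standard normal variable.\<close>

definition gauss_exponent :: "real \<Rightarrow> complex" where
  "gauss_exponent a = complex_of_real (- (a\<^sup>2 / 2))"

text \<open>Logarithm of the characteristic function of a Poisson variable of parameter 1 minus its
  mean.\<close>

definition levy_exponent :: "real \<Rightarrow> complex" where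
  "levy_exponent a = iexp a - 1 - \<i> * complex_of_real a"

lemma quadratic_exponent_gauss: "quadratic_exponent gauss_exponent"
  unfolding quadratic_exponent_def
proof (intro conjI allI)
  show "gauss_exponent \<in> borel_measurable borel" unfolding gauss_exponent_def by measurable
  fix a b :: real
  have "gauss_exponent a - gauss_exponent b = complex_of_real ((b\<^sup>2 - a\<^sup>2) / 2)"
    by (simp add: gauss_exponent_def diff_divide_distrib)
  hence "cmod (gauss_exponent a - gauss_exponent b) = \<bar>(b\<^sup>2 - a\<^sup>2) / 2\<bar>"
    by (simp only: norm_of_real)
  also have "\<dots> = \<bar>a\<^sup>2 - b\<^sup>2\<bar> / 2" by (simp add: abs_minus_commute)
  also have "\<bar>a\<^sup>2 - b\<^sup>2\<bar> = \<bar>a - b\<bar> * \<bar>a + b\<bar>"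
    unfolding abs_mult[symmetric] by (rule arg_cong[of _ _ abs]) (simp add: power2_eq_square algebra_simps)
  also have "\<bar>a - b\<bar> * \<bar>a + b\<bar> / 2 \<le> \<bar>a - b\<bar> * \<bar>a + b\<bar>" by simp
  also have "\<dots> \<le> \<bar>a - b\<bar> * (\<bar>a\<bar> + \<bar>b\<bar>)" by (intro mult_left_mono) auto
  finally show "cmod (gauss_exponent a - gauss_exponent b) \<le> \<bar>a - b\<bar> * (\<bar>a\<bar> + \<bar>b\<bar>)" .
qed (simp add: gauss_exponent_def)

text \<open>Mean value inequality on the interval of radius |a| + |b| around 0: the derivative at x
  has modulus |exp(i x) - 1| \<le> |x|.\<close>

lemma quadratic_exponent_levy: "quadratic_exponent levy_exponent"
  unfolding quadratic_exponent_def
proof (intro conjI allI)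
  show "levy_exponent \<in> borel_measurable borel" unfolding levy_exponent_def by measurable
  fix a b :: real
  define S where "S = {x::real. \<bar>x\<bar> \<le> \<bar>a\<bar> + \<bar>b\<bar>}"
  have S: "convex S"
  proof -
    have "S = {-(\<bar>a\<bar> + \<bar>b\<bar>)..\<bar>a\<bar> + \<bar>b\<bar>}" by (auto simp: S_def abs_le_iff)
    thus ?thesis by simp
  qed
  have "norm (levy_exponent a - levy_exponent b) \<le> (\<bar>a\<bar> + \<bar>b\<bar>) * norm (a - b)"
  proof (rule differentiable_bound[OF S])
    fix x assume x: "x \<in> S"
    have "((\<lambda>z. exp (\<i> * z) - 1 - \<i> * z) has_field_derivative \<i> * (iexp x - 1)) (at (of_real x))"
      by (auto intro!: derivative_eq_intros simp: algebra_simps)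
    from has_vector_derivative_real_field[OF this, of S]
    show "(levy_exponent has_derivative (\<lambda>h. of_real h * (\<i> * (iexp x - 1)))) (at x within S)"
      by (simp add: levy_exponent_def[abs_def] has_vector_derivative_def scaleR_conv_of_real)
    have "norm (of_real h * (\<i> * (iexp x - 1))) \<le> (\<bar>a\<bar> + \<bar>b\<bar>) * norm h" for h :: real
    proof -
      have "cmod (iexp x - 1) \<le> \<bar>a\<bar> + \<bar>b\<bar>" using norm_iexp_diff_le[of x 0] x by (simp add: S_def)
      hence "cmod (iexp x - 1) * \<bar>h\<bar> \<le> (\<bar>a\<bar> + \<bar>b\<bar>) * \<bar>h\<bar>" by (intro mult_right_mono) auto
      thus ?thesis by (simp add: norm_mult mult.commute)
    qed
    thus "onorm (\<lambda>h. of_real h * (\<i> * (iexp x - 1))) \<le> \<bar>a\<bar> + \<bar>b\<bar>" by (intro onorm_le)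
  qed (auto simp: S_def)
  thus "cmod (levy_exponent a - levy_exponent b) \<le> \<bar>a - b\<bar> * (\<bar>a\<bar> + \<bar>b\<bar>)" by (simp add: mult.commute)
qed (simp add: levy_exponent_def)

section \<open>Gaussian noise\<close>

context prob_space
begin

text \<open>A Gaussian variable may be degenerate, that is almost surely constant; this case has no
  density and is treated separately.\<close>

lemma gaussian_rv_sq:
  assumes "gaussian_rv M X" shows "square_integrable M X"
proof -
  have [measurable]: "X \<in> borel_measurable M" using assms by (simp add: gaussian_rv_def)
  obtain \<mu> where "(AE \<omega> in M. X \<omega> = \<mu>) \<or> (\<exists>\<sigma>>0. distributed M lborel X (\<lambda>x. ennreal (normal_density \<mu> \<sigma> x)))"
    using assms unfolding gaussian_rv_def by blast
  thus ?thesis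
  proof
    assume *: "AE \<omega> in M. X \<omega> = \<mu>"
    have "square_integrable M (\<lambda>_. \<mu>)" by (simp add: square_integrable_def)
    thus ?thesis by (rule square_integrable_cong_AE) (use * in auto)
  next
    assume "\<exists>\<sigma>>0. distributed M lborel X (\<lambda>x. ennreal (normal_density \<mu> \<sigma> x))"
    then obtain \<sigma> where \<sigma>: "\<sigma> > 0" and D: "distributed M lborel X (\<lambda>x. ennreal (normal_density \<mu> \<sigma> x))" by auto
    have "integrable lborel (\<lambda>x. normal_density \<mu> \<sigma> x * (x - \<mu>)\<^sup>2)" by (rule integrable_normal_moment[OF \<sigma>])
    hence "integrable M (\<lambda>\<omega>. (X \<omega> - \<mu>)\<^sup>2)" 
      by (subst (asm) distributed_integrable[OF D]) auto
    hence "square_integrable M (\<lambda>\<omega>. X \<omega> - \<mu>)" by (simp add: square_integrable_def)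
    from square_integrable_add[OF this, of "\<lambda>_. \<mu>"] show ?thesis by (simp add: square_integrable_def)
  qed
qed

lemma gaussian_rv_cf:
  assumes X: "gaussian_rv M X" and E: "expectation X = 0"
  shows "(\<integral>\<omega>. iexp (X \<omega>) \<partial>M) = exp (complex_of_real (- ((\<integral>\<omega>. (X \<omega>)\<^sup>2 \<partial>M) / 2)))"
proof -
  have [measurable]: "X \<in> borel_measurable M" using X by (simp add: gaussian_rv_def)
  obtain \<mu> where "(AE \<omega> in M. X \<omega> = \<mu>) \<or> (\<exists>\<sigma>>0. distributed M lborel X (\<lambda>x. ennreal (normal_density \<mu> \<sigma> x)))"
    using X unfolding gaussian_rv_def by blast
  thus ?thesis
  proof
    assume *: "AE \<omega> in M. X \<omega> = \<mu>"
    hence "expectation X = expectation (\<lambda>_. \<mu>)" by (intro integral_cong_AE) auto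
    hence "\<mu> = 0" using E by (simp add: prob_space)
    hence *: "AE \<omega> in M. X \<omega> = 0" using * by simp
    have "(\<integral>\<omega>. iexp (X \<omega>) \<partial>M) = (\<integral>\<omega>. 1 \<partial>M)" using * by (intro integral_cong_AE) auto
    moreover have "(\<integral>\<omega>. (X \<omega>)\<^sup>2 \<partial>M) = (\<integral>\<omega>. 0 \<partial>M)" using * by (intro integral_cong_AE) auto
    ultimately show ?thesis by (simp add: prob_space)
  next
    assume "\<exists>\<sigma>>0. distributed M lborel X (\<lambda>x. ennreal (normal_density \<mu> \<sigma> x))"
    then obtain \<sigma> where \<sigma>: "\<sigma> > 0" and D: "distributed M lborel X (\<lambda>x. ennreal (normal_density \<mu> \<sigma> x))" by auto
    have \<mu>: "\<mu> = 0" using normal_distributed_expectation[OF \<sigma> D] E by simp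
    have V: "(\<integral>\<omega>. (X \<omega>)\<^sup>2 \<partial>M) = \<sigma>\<^sup>2" using normal_distributed_variance[OF \<sigma> D] E by simp
    have D': "distributed M lborel (\<lambda>\<omega>. X \<omega> / \<sigma>) (\<lambda>x. ennreal (std_normal_density x))"
      using D normal_standard_normal_convert[OF \<sigma>, of X \<mu>] by (simp add: \<mu>)
    have "(\<integral>\<omega>. iexp (X \<omega>) \<partial>M) = (\<integral>\<omega>. iexp (\<sigma> * (X \<omega> / \<sigma>)) \<partial>M)" using \<sigma> by simp
    also have "\<dots> = (\<integral>x. iexp (\<sigma> * x) \<partial>distr M lborel (\<lambda>\<omega>. X \<omega> / \<sigma>))"
      by (subst integral_distr) auto
    also have "distr M lborel (\<lambda>\<omega>. X \<omega> / \<sigma>) = std_normal_distribution"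
      using D' by (simp add: distributed_def)
    also have "(\<integral>x. iexp (\<sigma> * x) \<partial>std_normal_distribution) = char std_normal_distribution \<sigma>"
      by (simp add: char_def)
    also have "\<dots> = complex_of_real (exp (- (\<sigma>\<^sup>2) / 2))" by (simp add: char_std_normal_distribution)
    finally show ?thesis by (simp add: V exp_of_real[symmetric])
  qed
qed

end

text \<open>Links the list form of a step integral with the indexed linear combinations in the
  definition of \<open>white_noise\<close>.\<close>

lemma step_sum_nth: "(\<Sum>(a, A)\<leftarrow>xs. a * G A) = (\<Sum>i<length xs. fst (xs ! i) * (G (snd (xs ! i)) :: real))"
  by (simp add: sum_list_sum_nth case_prod_unfold atLeast0LessThan)

locale gauss_noise = prob_space M for M :: "'w measure" +
  fixes S :: "'e measure" and W :: "'e set \<Rightarrow> 'w \<Rightarrow> real"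
  assumes sf: "sigma_finite_measure S" and W: "white_noise M S W"
begin

lemma gauss_W: 
  assumes "set xs \<subseteq> UNIV \<times> finite_measure_sets S"
  shows "gaussian_rv M (\<lambda>\<omega>. \<Sum>(a, A)\<leftarrow>xs. a * W A \<omega>)"
proof -
  have "snd (xs ! i) \<in> finite_measure_sets S" if "i < length xs" for i
    using assms nth_mem[OF that] by (cases "xs ! i") auto
  thus ?thesis using W unfolding white_noise_def step_sum_nth by simp
qed

sublocale orth_noise M S W
proof (intro orth_noise.intro orth_noise_axioms.intro)
  show "prob_space M" by (rule prob_space_axioms)
  show "sigma_finite_measure S" by (rule sf)
  fix A assume A: "A \<in> finite_measure_sets S"
  show "square_integrable M (W A)"
    using gaussian_rv_sq[OF gauss_W[of "[(1, A)]"]] A by simp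
  fix B assume "B \<in> finite_measure_sets S"
  thus "(\<integral>\<omega>. W A \<omega> * W B \<omega> \<partial>M) = measure S (A \<inter> B)"
    using W A unfolding white_noise_def by blast
qed

lemma step_int_expectation: "valid xs \<Longrightarrow> (\<integral>\<omega>. step_int xs \<omega> \<partial>M) = 0"
proof (induction xs)
  case (Cons p xs)
  obtain a A where p: "p = (a, A)" by (cases p)
  have A: "A \<in> finite_measure_sets S" and xs: "valid xs" using Cons.prems by (auto simp: p valid_Cons)
  have "(\<integral>\<omega>. W A \<omega> \<partial>M) = 0" using W A unfolding white_noise_def by blast
  moreover have "integrable M (W A)" "integrable M (step_int xs)"
    using expectation_abs_le_sqrt(1) W_sq[OF A] step_int_sq[OF xs] by auto
  ultimately show ?case unfolding p step_int_Cons using Cons.IH[OF xs] by simp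
qed simp

text \<open>The law of a centred Gaussian variable is determined by its variance, which the
  covariance identity computes as the integral of the squared step function.\<close>

lemma step_cf:
  assumes "valid xs"
  shows "(\<integral>\<omega>. iexp (step_int xs \<omega>) \<partial>M) = exp (\<integral>e. gauss_exponent (step_fun xs e) \<partial>S)"
proof -
  have g: "gaussian_rv M (step_int xs)"
    unfolding step_int_def[abs_def] using assms by (intro gauss_W) (simp add: valid_def)
  have "(\<integral>\<omega>. (step_int xs \<omega>)\<^sup>2 \<partial>M) = (\<integral>e. (step_fun xs e)\<^sup>2 \<partial>S)"
    using step_int_cov[OF assms assms] by (simp add: power2_eq_square)
  moreover have "(\<integral>e. gauss_exponent (step_fun xs e) \<partial>S) = complex_of_real (- ((\<integral>e. (step_fun xs e)\<^sup>2 \<partial>S) / 2))"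
    unfolding gauss_exponent_def by (subst integral_complex_of_real) simp
  ultimately show ?thesis using gaussian_rv_cf[OF g step_int_expectation[OF assms]] by simp
qed

end

section \<open>Poisson noise\<close>

lemma exp_series_real: "(\<lambda>k. x ^ k / fact k) sums exp (x::real)"
  using exp_converges[of x] by (simp add: divide_inverse mult.commute)

lemma poisson_sums_1:
  fixes l :: real
  shows "(\<lambda>k. exp (- l) * l ^ k / fact k) sums 1"
  using sums_mult[OF exp_series_real[of l], of "exp (-l)"] by (simp add: exp_minus)

lemma poisson_sums_k:
  fixes l :: real
  shows "(\<lambda>k. exp (- l) * l ^ k / fact k * real k) sums l"
proof -
  have "exp (- l) * l ^ Suc k / fact (Suc k) * real (Suc k) = l * (exp (- l) * l ^ k / fact k)" for k
  proof -
    have "fact (Suc k) = real (Suc k) * fact k" by simp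
    thus ?thesis by (simp add: divide_simps del: fact_Suc of_nat_Suc)
  qed
  hence "(\<lambda>k. exp (- l) * l ^ Suc k / fact (Suc k) * real (Suc k)) sums (l * 1)"
    using sums_mult[OF poisson_sums_1[of l], of l] by (simp only:)
  thus ?thesis by (subst (asm) sums_Suc_iff) simp
qed

lemma poisson_sums_k2:
  fixes l :: real
  shows "(\<lambda>k. exp (- l) * l ^ k / fact k * (real k)\<^sup>2) sums (l\<^sup>2 + l)"
proof -
  have "exp (- l) * l ^ Suc k / fact (Suc k) * (real (Suc k))\<^sup>2 
    = l * (exp (- l) * l ^ k / fact k * real k) + l * (exp (- l) * l ^ k / fact k)" for k
  proof -
    have "fact (Suc k) = real (Suc k) * fact k" by simp
    hence "exp (- l) * l ^ Suc k / fact (Suc k) * (real (Suc k))\<^sup>2 = l * (exp (- l) * l ^ k / fact k) * real (Suc k)"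
      by (simp add: divide_simps power2_eq_square del: fact_Suc of_nat_Suc)
    thus ?thesis by (simp add: algebra_simps add_divide_distrib)
  qed
  moreover have "(\<lambda>k. l * (exp (- l) * l ^ k / fact k * real k) + l * (exp (- l) * l ^ k / fact k)) sums (l * l + l * 1)"
    by (intro sums_add sums_mult poisson_sums_k poisson_sums_1)
  ultimately have "(\<lambda>k. exp (- l) * l ^ Suc k / fact (Suc k) * (real (Suc k))\<^sup>2) sums (l * l + l * 1)"
    by (simp only:)
  thus ?thesis by (subst (asm) sums_Suc_iff) (simp add: power2_eq_square)
qed

lemma poisson_sums_var:
  fixes l :: real
  shows "(\<lambda>k. exp (- l) * l ^ k / fact k * (real k - l)\<^sup>2) sums l"
proof -
  have "exp (- l) * l ^ k / fact k * (real k - l)\<^sup>2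
    = exp (- l) * l ^ k / fact k * (real k)\<^sup>2 - 2 * l * (exp (- l) * l ^ k / fact k * real k) + l\<^sup>2 * (exp (- l) * l ^ k / fact k)" for k
    by (simp add: power2_diff algebra_simps)
  moreover have "(\<lambda>k. exp (- l) * l ^ k / fact k * (real k)\<^sup>2 - 2 * l * (exp (- l) * l ^ k / fact k * real k) + l\<^sup>2 * (exp (- l) * l ^ k / fact k))
    sums ((l\<^sup>2 + l) - 2 * l * l + l\<^sup>2 * 1)"
    by (intro sums_add sums_diff sums_mult poisson_sums_k poisson_sums_k2 poisson_sums_1)
  ultimately show ?thesis by (simp add: power2_eq_square)
qed

text \<open>Absorbing \<open>iexp r\<close> into the k-th power turns the sum into the exponential
  series at l * iexp r.\<close>

lemma poisson_sums_iexp: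
  fixes l r :: real
  shows "(\<lambda>k. (exp (- l) * l ^ k / fact k) *\<^sub>R iexp (r * (real k - l))) sums exp (l * levy_exponent r)"
proof -
  have "(\<lambda>k. (exp (- complex_of_real l) * iexp (- r * l)) * ((l * iexp r) ^ k / fact k)) sums
     ((exp (- complex_of_real l) * iexp (- r * l)) * exp (l * iexp r))"
    using exp_converges[of "l * iexp r"] by (intro sums_mult) (simp add: scaleR_conv_of_real divide_inverse mult.commute)
  moreover have "(exp (- complex_of_real l) * iexp (- r * l)) * ((l * iexp r) ^ k / fact k)
      = (exp (- l) * l ^ k / fact k) *\<^sub>R iexp (r * (real k - l))" for k
  proof -
    have "iexp (r * (real k - l)) = iexp (- r * l) * iexp r ^ k"
      unfolding exp_of_nat_mult[symmetric] exp_add[symmetric] by (simp add: algebra_simps)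
    thus ?thesis by (simp add: scaleR_conv_of_real power_mult_distrib exp_of_real[symmetric] field_simps)
  qed
  moreover have "(exp (- complex_of_real l) * iexp (- r * l)) * exp (l * iexp r) = exp (l * levy_exponent r)"
    unfolding exp_add[symmetric] levy_exponent_def by (simp add: algebra_simps)
  ultimately show ?thesis by simp
qed

locale poisson_noise = prob_space M for M :: "'w measure" +
  fixes S :: "'e measure" and N :: "'w \<Rightarrow> 'e measure"
  assumes sf: "sigma_finite_measure S" and N: "poisson_random_measure M S N"
begin

abbreviation C where "C \<equiv> compensated S N"

lemma N_meas [measurable]: "A \<in> sets S \<Longrightarrow> (\<lambda>\<omega>. emeasure (N \<omega>) A) \<in> borel_measurable M"
  using N by (simp add: poisson_random_measure_def)

lemma C_meas [measurable]: "A \<in> sets S \<Longrightarrow> C A \<in> borel_measurable M"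
  unfolding compensated_def[abs_def] measure_def
  by (intro borel_measurable_diff borel_measurable_const borel_measurable_enn2real N_meas)

lemma N_prob:
  assumes "A \<in> finite_measure_sets S"
  shows "measure M {\<omega> \<in> space M. emeasure (N \<omega>) A = of_nat k} = exp (- measure S A) * measure S A ^ k / fact k"
  using N assms unfolding poisson_random_measure_def finite_measure_sets_def by blast

text \<open>The Poisson weights sum to 1, so almost surely the mass is a natural number, in
  particular finite.\<close>

lemma N_nat:
  assumes A: "A \<in> finite_measure_sets S"
  shows "AE \<omega> in M. \<exists>k::nat. emeasure (N \<omega>) A = of_nat k"
proof -
  have As[measurable]: "A \<in> sets S" using A by (simp add: finite_measure_sets_def)
  let ?E = "\<lambda>k::nat. {\<omega> \<in> space M. emeasure (N \<omega>) A = of_nat k}"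
  have "(\<lambda>k. measure M (?E k)) sums measure M (\<Union>k. ?E k)"
    by (intro finite_measure_UNION) (auto simp: disjoint_family_on_def)
  hence "measure M (\<Union>k. ?E k) = 1"
    unfolding N_prob[OF A] using poisson_sums_1 sums_unique2 by blast
  hence "AE \<omega> in M. \<omega> \<in> (\<Union>k. ?E k)" by (subst (asm) prob_eq_1) auto
  thus ?thesis by eventually_elim auto
qed

text \<open>Reduces the expectation of a function of the compensated mass to a series over the
  number of points; absolute convergence of the series supplies integrability.\<close>

lemma poisson_integral:
  fixes g :: "real \<Rightarrow> 'b::{banach, second_countable_topology}"
  assumes A: "A \<in> finite_measure_sets S" and g[measurable]: "g \<in> borel_measurable borel"
    and s: "(\<lambda>k. (exp (- measure S A) * measure S A ^ k / fact k) *\<^sub>R g (real k - measure S A)) sums v"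
    and ns: "summable (\<lambda>k. (exp (- measure S A) * measure S A ^ k / fact k) * norm (g (real k - measure S A)))"
  shows "integrable M (\<lambda>\<omega>. g (C A \<omega>))" "(\<integral>\<omega>. g (C A \<omega>) \<partial>M) = v"
proof -
  have As[measurable]: "A \<in> sets S" using A by (simp add: finite_measure_sets_def)
  define l where "l = measure S A"
  define p where "p k = exp (- l) * l ^ k / fact k" for k
  have p0: "p k \<ge> 0" for k by (simp add: p_def l_def)
  \<comment> \<open>A count defined everywhere: the mass of \<open>A\<close> if that is a natural
    number, and 0 on the remaining null set.\<close>
  define K where "K \<omega> = (SOME k::nat. emeasure (N \<omega>) A = of_nat k \<or> (\<forall>j. emeasure (N \<omega>) A \<noteq> of_nat j) \<and> k = 0)" for \<omega>
  have Kw: "emeasure (N \<omega>) A = of_nat (K \<omega>) \<or> (\<forall>j. emeasure (N \<omega>) A \<noteq> of_nat j) \<and> K \<omega> = 0" for \<omega>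
    unfolding K_def by (rule someI_ex) blast
  have Keq: "K -` {k} \<inter> space M = (if k = 0 then {\<omega> \<in> space M. emeasure (N \<omega>) A = 0 \<or> (\<forall>j::nat. emeasure (N \<omega>) A \<noteq> of_nat j)}
      else {\<omega> \<in> space M. emeasure (N \<omega>) A = of_nat k})" for k
  proof -
    have "K \<omega> = k \<longleftrightarrow> emeasure (N \<omega>) A = of_nat k \<or> k = 0 \<and> (\<forall>j::nat. emeasure (N \<omega>) A \<noteq> of_nat j)" for \<omega>
      using Kw[of \<omega>] by (metis of_nat_eq_iff)
    thus ?thesis by (cases "k = 0") (simp_all add: vimage_def set_eq_iff conj_commute)
  qed
  have K[measurable]: "K \<in> measurable M (count_space UNIV)"
    unfolding measurable_count_space_eq2_countable
  proof safe
    define E where "E \<omega> = emeasure (N \<omega>) A" for \<omega>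
    have [measurable]: "E \<in> borel_measurable M" unfolding E_def by (rule N_meas[OF As])
    fix k
    have "{\<omega> \<in> space M. E \<omega> = 0 \<or> (\<forall>j::nat. E \<omega> \<noteq> of_nat j)} \<in> events" "{\<omega> \<in> space M. E \<omega> = of_nat k} \<in> events"
      by measurable
    thus "K -` {k} \<inter> space M \<in> sets M" unfolding Keq E_def[symmetric] by simp
  qed auto
  have KAE: "AE \<omega> in M. C A \<omega> = real (K \<omega>) - l"
    using N_nat[OF A]
  proof eventually_elim
    case (elim \<omega>)
    hence "emeasure (N \<omega>) A = of_nat (K \<omega>)" using Kw[of \<omega>] by auto
    thus ?case by (simp add: compensated_def measure_def l_def)
  qed
  have D: "distr M (count_space UNIV) K = density (count_space UNIV) (\<lambda>k. ennreal (p k))"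
  proof (rule measure_eqI_countable[where A=UNIV])
    fix k :: nat
    have "emeasure (distr M (count_space UNIV) K) {k} = emeasure M (K -` {k} \<inter> space M)"
      by (subst emeasure_distr) auto
    also have "\<dots> = emeasure M {\<omega> \<in> space M. emeasure (N \<omega>) A = of_nat k}"
    proof (rule emeasure_eq_AE)
      show "AE \<omega> in M. \<omega> \<in> K -` {k} \<inter> space M \<longleftrightarrow> \<omega> \<in> {\<omega> \<in> space M. emeasure (N \<omega>) A = of_nat k}"
        using N_nat[OF A] AE_space
      proof eventually_elim
        case (elim \<omega>)
        hence "emeasure (N \<omega>) A = of_nat (K \<omega>)" using Kw[of \<omega>] by auto
        thus ?case using elim by auto
      qed
      show "{\<omega> \<in> space M. emeasure (N \<omega>) A = of_nat k} \<in> events"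
        using N_meas[OF As] by (intro borel_measurable_eq borel_measurable_const)
    qed measurable
    also have "\<dots> = ennreal (p k)" using N_prob[OF A, of k] by (simp add: emeasure_eq_measure p_def l_def)
    finally show "emeasure (distr M (count_space UNIV) K) {k} = emeasure (density (count_space UNIV) (\<lambda>k. ennreal (p k))) {k}"
      by (simp add: emeasure_density nn_integral_count_space_indicator[symmetric])
  qed auto

  have "integrable (count_space UNIV) (\<lambda>k. p k *\<^sub>R g (real k - l))"
    unfolding integrable_count_space_nat_iff using ns p0 by (simp add: p_def l_def)
  hence "integrable (distr M (count_space UNIV) K) (\<lambda>k. g (real k - l))"
    unfolding D using p0 by (subst integrable_density) auto
  hence i': "integrable M (\<lambda>\<omega>. g (real (K \<omega>) - l))" by (subst (asm) integrable_distr_eq) auto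
  show "integrable M (\<lambda>\<omega>. g (C A \<omega>))"
    by (rule integrable_cong_AE_imp[OF i']) (use KAE in \<open>auto elim: eventually_mono\<close>)
  have "(\<integral>\<omega>. g (C A \<omega>) \<partial>M) = (\<integral>\<omega>. g (real (K \<omega>) - l) \<partial>M)"
    by (rule integral_cong_AE) (use KAE in \<open>auto elim: eventually_mono\<close>)
  also have "\<dots> = (\<integral>k. g (real k - l) \<partial>distr M (count_space UNIV) K)" by (subst integral_distr) auto
  also have "\<dots> = (\<integral>k. p k *\<^sub>R g (real k - l) \<partial>count_space UNIV)"
    unfolding D using p0 by (subst integral_density) auto
  also have "\<dots> = (\<Sum>k. p k *\<^sub>R g (real k - l))"
    using ns p0 by (intro integral_count_space_nat) (simp add: integrable_count_space_nat_iff p_def l_def)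
  also have "\<dots> = v" using s by (simp add: p_def l_def sums_iff)
  finally show "(\<integral>\<omega>. g (C A \<omega>) \<partial>M) = v" .
qed

lemma C_var:
  assumes A: "A \<in> finite_measure_sets S"
  shows "square_integrable M (C A)" "(\<integral>\<omega>. (C A \<omega>)\<^sup>2 \<partial>M) = measure S A"
proof -
  have As: "A \<in> sets S" using A by (simp add: finite_measure_sets_def)
  note P = poisson_integral[OF A, of "\<lambda>x. x\<^sup>2" "measure S A"]
  note sm = poisson_sums_var[of "measure S A"]
  show "square_integrable M (C A)" "(\<integral>\<omega>. (C A \<omega>)\<^sup>2 \<partial>M) = measure S A"
    unfolding square_integrable_def using P sm sums_summable[OF sm] C_meas[OF As] by auto
qed

lemma C_expectation:
  assumes A: "A \<in> finite_measure_sets S"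
  shows "(\<integral>\<omega>. C A \<omega> \<partial>M) = 0"
proof -
  let ?l = "measure S A"
  let ?p = "\<lambda>k. exp (- ?l) * ?l ^ k / fact k"
  have s: "(\<lambda>k. ?p k * (real k - ?l)) sums 0"
  proof -
    have "(\<lambda>k. ?p k * real k - ?l * ?p k) sums (?l - ?l * 1)"
      by (intro sums_diff sums_mult poisson_sums_k poisson_sums_1)
    thus ?thesis by (simp add: algebra_simps diff_divide_distrib)
  qed
  have "summable (\<lambda>k. ?p k * \<bar>real k - ?l\<bar>)"
  proof (rule summable_comparison_test')
    show "summable (\<lambda>k. ?p k * real k + ?l * ?p k)"
      using poisson_sums_k poisson_sums_1 by (intro summable_add summable_mult) (auto dest: sums_summable)
    fix k :: nat
    have "\<bar>real k - ?l\<bar> \<le> real k + ?l" using measure_nonneg[of S A] by linarith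
    hence "?p k * \<bar>real k - ?l\<bar> \<le> ?p k * (real k + ?l)" by (intro mult_left_mono) auto
    also have "\<dots> = ?p k * real k + ?l * ?p k" unfolding distrib_left by simp
    finally show "norm (?p k * \<bar>real k - ?l\<bar>) \<le> ?p k * real k + ?l * ?p k" by (simp add: abs_mult)
  qed
  thus ?thesis using poisson_integral(2)[OF A, of "\<lambda>x. x" 0] s by simp
qed

lemma C_cf:
  assumes A: "A \<in> finite_measure_sets S"
  shows "(\<integral>\<omega>. iexp (r * C A \<omega>) \<partial>M) = exp (measure S A * levy_exponent r)"
  using poisson_integral(2)[OF A, of "\<lambda>x. iexp (r * x)"] poisson_sums_iexp[of "measure S A" r]
    sums_summable[OF poisson_sums_1[of "measure S A"]] by simp

lemma C_indep:
  fixes F :: "nat \<Rightarrow> 'e set"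
  assumes "disjoint_family F" "range F \<subseteq> sets S"
    and f: "\<And>i. f i \<in> borel_measurable borel"
  shows "indep_vars (\<lambda>_. borel) (\<lambda>i \<omega>. f i (C (F i) \<omega>)) J"
proof -
  have "indep_vars (\<lambda>_. borel) (\<lambda>i \<omega>. emeasure (N \<omega>) (F i)) UNIV"
    using N assms unfolding poisson_random_measure_def by blast
  hence "indep_vars (\<lambda>_. borel) (\<lambda>i \<omega>. f i (enn2real (emeasure (N \<omega>) (F i)) - measure S (F i))) UNIV"
    by (rule indep_vars_compose2[where Y="\<lambda>i x. f i (enn2real x - measure S (F i))"]) (use f in measurable)
  thus ?thesis unfolding compensated_def measure_def by (rule indep_vars_subset) auto
qed

lemma C_cov_disjoint:
  assumes A: "A \<in> finite_measure_sets S" and B: "B \<in> finite_measure_sets S" and d: "A \<inter> B = {}"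
  shows "(\<integral>\<omega>. C A \<omega> * C B \<omega> \<partial>M) = 0"
proof -
  \<comment> \<open>Independence is given for sequences of disjoint sets, so the pair is padded with
    empty sets.\<close>
  define F :: "nat \<Rightarrow> 'e set" where "F i = (if i = 0 then A else if i = 1 then B else {})" for i
  have F: "disjoint_family F" "range F \<subseteq> sets S"
    using A B d by (auto simp: F_def disjoint_family_on_def finite_measure_sets_def)
  have "indep_vars (\<lambda>_. borel) (\<lambda>i \<omega>. C (F i) \<omega>) {0, 1}"
    by (rule C_indep[OF F]) simp
  moreover have "integrable M (C (F i))" if "i \<in> {0, 1}" for i
    using that A B by (auto simp: F_def intro!: expectation_abs_le_sqrt(1) C_var)
  ultimately have "(\<integral>\<omega>. (\<Prod>i\<in>{0,1}. C (F i) \<omega>) \<partial>M) = (\<Prod>i\<in>{0,1}. \<integral>\<omega>. C (F i) \<omega> \<partial>M)"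
    by (intro indep_vars_lebesgue_integral) auto
  thus ?thesis using C_expectation[OF A] by (simp add: F_def)
qed

text \<open>Additivity of \<open>measure\<close> may fail where a mass is infinite, since infinite
  mass has \<open>measure\<close> 0; almost surely both masses are finite.\<close>

lemma C_additive:
  assumes A: "A \<in> finite_measure_sets S" and B: "B \<in> finite_measure_sets S" and d: "A \<inter> B = {}"
  shows "AE \<omega> in M. C (A \<union> B) \<omega> = C A \<omega> + C B \<omega>"
proof -
  have s: "A \<in> sets S" "B \<in> sets S" "emeasure S A < \<infinity>" "emeasure S B < \<infinity>"
    using A B by (auto simp: finite_measure_sets_def)
  have 1: "measure S (A \<union> B) = measure S A + measure S B"
    using s d by (intro measure_Union) auto
  show ?thesis using N_nat[OF A] N_nat[OF B] AE_space
  proof eventually_elim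
    case (elim \<omega>)
    have "sets (N \<omega>) = sets S" using N elim unfolding poisson_random_measure_def by blast
    hence "measure (N \<omega>) (A \<union> B) = measure (N \<omega>) A + measure (N \<omega>) B"
      using s d elim by (intro measure_Union) auto
    thus ?case by (simp add: compensated_def 1)
  qed
qed

text \<open>Splitting A and B along their intersection leaves the variance on the intersection; the
  three cross terms are covariances over disjoint sets and vanish.\<close>

sublocale orth_noise M S C
proof (intro orth_noise.intro orth_noise_axioms.intro)
  show "prob_space M" by (rule prob_space_axioms)
  show "sigma_finite_measure S" by (rule sf)
  fix A assume A: "A \<in> finite_measure_sets S"
  show "square_integrable M (C A)" by (rule C_var[OF A])
  fix B assume B: "B \<in> finite_measure_sets S"
  have fm: "X \<in> finite_measure_sets S" if "X \<in> sets S" "X \<subseteq> Y" "Y \<in> finite_measure_sets S" for X Y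
    using that emeasure_mono[of X Y S] by (auto simp: finite_measure_sets_def intro: le_less_trans)
  have s: "A \<in> sets S" "B \<in> sets S" using A B by (auto simp: finite_measure_sets_def)
  have I: "A \<inter> B \<in> finite_measure_sets S" and A': "A - B \<in> finite_measure_sets S" and B': "B - A \<in> finite_measure_sets S"
    using s by (auto intro: fm[OF _ _ A] fm[OF _ _ B])
  have cA: "AE \<omega> in M. C A \<omega> = C (A \<inter> B) \<omega> + C (A - B) \<omega>"
  proof -
    have "A \<inter> B \<union> (A - B) = A" "A \<inter> B \<inter> (A - B) = {}" by blast+
    thus ?thesis using C_additive[OF I A'] by simp
  qed
  have cB: "AE \<omega> in M. C B \<omega> = C (A \<inter> B) \<omega> + C (B - A) \<omega>"
  proof -
    have "A \<inter> B \<union> (B - A) = B" "A \<inter> B \<inter> (B - A) = {}" by blast+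
    thus ?thesis using C_additive[OF I B'] by simp
  qed
  have [measurable]: "A \<in> sets S" "B \<in> sets S" using s by auto
  have "(\<integral>\<omega>. C A \<omega> * C B \<omega> \<partial>M) = (\<integral>\<omega>. (C (A \<inter> B) \<omega> + C (A - B) \<omega>) * (C (A \<inter> B) \<omega> + C (B - A) \<omega>) \<partial>M)"
    using cA cB by (intro integral_cong_AE) auto
  also have "\<dots> = (\<integral>\<omega>. (C (A \<inter> B) \<omega>)\<^sup>2 + (C (A \<inter> B) \<omega> * C (B - A) \<omega> + (C (A - B) \<omega> * C (A \<inter> B) \<omega> + C (A - B) \<omega> * C (B - A) \<omega>)) \<partial>M)"
    by (simp add: algebra_simps power2_eq_square)
  also have "\<dots> = measure S (A \<inter> B) + ((\<integral>\<omega>. C (A \<inter> B) \<omega> * C (B - A) \<omega> \<partial>M) + ((\<integral>\<omega>. C (A - B) \<omega> * C (A \<inter> B) \<omega> \<partial>M) + (\<integral>\<omega>. C (A - B) \<omega> * C (B - A) \<omega> \<partial>M)))"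
    using C_var[OF I] square_integrable_mult[OF C_var(1)[OF I] C_var(1)[OF B']]
      square_integrable_mult[OF C_var(1)[OF A'] C_var(1)[OF I]] square_integrable_mult[OF C_var(1)[OF A'] C_var(1)[OF B']]
    by (simp add: square_integrable_def)
  also have "(\<integral>\<omega>. C (A \<inter> B) \<omega> * C (B - A) \<omega> \<partial>M) = 0" by (rule C_cov_disjoint[OF I B']) auto
  also have "(\<integral>\<omega>. C (A - B) \<omega> * C (A \<inter> B) \<omega> \<partial>M) = 0" by (rule C_cov_disjoint[OF A' I]) auto
  also have "(\<integral>\<omega>. C (A - B) \<omega> * C (B - A) \<omega> \<partial>M) = 0" by (rule C_cov_disjoint[OF A' B']) auto
  finally show "(\<integral>\<omega>. C A \<omega> * C B \<omega> \<partial>M) = measure S (A \<inter> B)" by simp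
qed

text \<open>Independence turns the expectation into a product. At each point at most one indicator
  is 1 and \<open>levy_exponent\<close> vanishes at 0, so the sum of the exponents is the exponent
  of the sum.\<close>

lemma disjoint_cf:
  fixes F :: "nat \<Rightarrow> 'e set"
  assumes d: "disjoint_family F" and F: "\<And>i. F i \<in> finite_measure_sets S"
  shows "(\<integral>\<omega>. iexp (\<Sum>i<n. a i * C (F i) \<omega>) \<partial>M) = exp (\<integral>e. levy_exponent (\<Sum>i<n. a i * indicator (F i) e) \<partial>S)"
proof -
  have Fs: "range F \<subseteq> sets S" using F by (auto simp: finite_measure_sets_def)
  have iv: "indep_vars (\<lambda>_. borel) (\<lambda>i \<omega>. iexp (a i * C (F i) \<omega>)) {..<n}"
    by (rule C_indep[OF d Fs, of "\<lambda>i x. iexp (a i * x)"]) measurable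
  have "(\<integral>\<omega>. iexp (\<Sum>i<n. a i * C (F i) \<omega>) \<partial>M) = (\<integral>\<omega>. (\<Prod>i<n. iexp (a i * C (F i) \<omega>)) \<partial>M)"
    by (simp add: exp_sum sum_distrib_left)
  also have "\<dots> = (\<Prod>i<n. \<integral>\<omega>. iexp (a i * C (F i) \<omega>) \<partial>M)"
    using Fs by (intro indep_vars_lebesgue_integral iv) (auto intro!: integrable_const_bound[of _ 1])
  also have "\<dots> = (\<Prod>i<n. exp (measure S (F i) * levy_exponent (a i)))"
    by (simp only: C_cf[OF F])
  also have "\<dots> = exp (\<Sum>i<n. measure S (F i) * levy_exponent (a i))" by (simp add: exp_sum)
  also have "(\<Sum>i<n. measure S (F i) * levy_exponent (a i)) = (\<integral>e. (\<Sum>i<n. indicator (F i) e *\<^sub>R levy_exponent (a i)) \<partial>S)"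
  proof -
    have "integrable S (\<lambda>e. indicator (F i) e *\<^sub>R levy_exponent (a i))" for i
      using F[of i] by (auto simp: finite_measure_sets_def)
    moreover have "(\<integral>e. indicator (F i) e *\<^sub>R levy_exponent (a i) \<partial>S) = measure S (F i) * levy_exponent (a i)" for i
      using F[of i] by (simp add: finite_measure_sets_def scaleR_conv_of_real)
    ultimately show ?thesis by (subst Bochner_Integration.integral_sum) auto
  qed
  also have "(\<integral>e. (\<Sum>i<n. indicator (F i) e *\<^sub>R levy_exponent (a i)) \<partial>S) = (\<integral>e. levy_exponent (\<Sum>i<n. a i * indicator (F i) e) \<partial>S)"
  proof (rule Bochner_Integration.integral_cong[OF refl])
    fix e
    show "(\<Sum>i<n. indicator (F i) e *\<^sub>R levy_exponent (a i)) = levy_exponent (\<Sum>i<n. a i * indicator (F i) e)"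
    proof (cases "\<exists>i<n. e \<in> F i")
      case True
      then obtain j where j: "j < n" "e \<in> F j" by blast
      have z: "indicator (F i) e = (if i = j then 1 else 0 :: real)" for i
        using j d by (auto simp: disjoint_family_on_def indicator_def)
      have "(\<Sum>i<n. indicator (F i) e *\<^sub>R levy_exponent (a i)) = (\<Sum>i<n. if i = j then levy_exponent (a i) else 0)"
        "(\<Sum>i<n. a i * indicator (F i) e) = (\<Sum>i<n. if i = j then a i else 0)"
        by (intro sum.cong; simp add: z)+
      thus ?thesis using j(1) by simp
    next
      case False
      hence "indicator (F i) e = (0::real)" if "i < n" for i using that by (auto simp: indicator_def)
      thus ?thesis by (simp add: levy_exponent_def)
    qed
  qed
  finally show ?thesis .
qed

text \<open>The sets of a list may overlap, whereas independence concerns disjoint ones. The list is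
  therefore replaced by the level sets of its nonzero values, with almost surely the same
  integral.\<close>

lemma step_cf:
  assumes "valid xs"
  shows "(\<integral>\<omega>. iexp (step_int xs \<omega>) \<partial>M) = exp (\<integral>e. levy_exponent (step_fun xs e) \<partial>S)"
proof -
  define s where "s = step_fun xs"
  have sb: "Bochner_Integration.simple_bochner_integrable S s"
    unfolding s_def by (rule simple_bochner_integrable_step_fun[OF assms])
  have s: "simple_function S s" "emeasure S {y \<in> space S. s y \<noteq> 0} \<noteq> \<infinity>"
    using sb by (auto elim: simple_bochner_integrable.cases)
  have fin: "finite (s ` space S)" by (rule simple_functionD(1)[OF s(1)])
  note [measurable] = borel_measurable_simple_function[OF s(1)]
  obtain l where l: "set l = s ` space S - {0}" "distinct l"
    using fin finite_distinct_list[of "s ` space S - {0}"] by auto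
  define F where "F i = (if i < length l then s -` {l ! i} \<inter> space S else {})" for i
  define n where "n = length l"
  have Ff: "F i \<in> finite_measure_sets S" for i
  proof (cases "i < length l")
    case True
    hence "l ! i \<noteq> 0" using l nth_mem[OF True] by auto
    hence "emeasure S (s -` {l ! i} \<inter> space S) \<le> emeasure S {y \<in> space S. s y \<noteq> 0}"
      by (intro emeasure_mono) auto
    thus ?thesis using s(2) True unfolding finite_measure_sets_def F_def by (auto simp: less_top intro: le_less_trans)
  qed (simp add: F_def finite_measure_sets_def)
  have "disjoint_family F"
    using l(2) by (auto simp: disjoint_family_on_def F_def distinct_conv_nth)
  hence cf: "(\<integral>\<omega>. iexp (\<Sum>i<n. l ! i * C (F i) \<omega>) \<partial>M) = exp (\<integral>e. levy_exponent (\<Sum>i<n. l ! i * indicator (F i) e) \<partial>S)"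
    by (intro disjoint_cf Ff)
  have sumF: "(\<Sum>i<n. l ! i * H (F i)) = (\<Sum>r\<in>s ` space S. r * H (s -` {r} \<inter> space S))" for H :: "'e set \<Rightarrow> real"
  proof -
    have "(\<Sum>i<n. l ! i * H (F i)) = (\<Sum>i<n. l ! i * H (s -` {l ! i} \<inter> space S))"
      by (simp add: F_def n_def)
    also have "\<dots> = (\<Sum>r\<leftarrow>l. r * H (s -` {r} \<inter> space S))"
      by (simp add: sum_list_sum_nth n_def atLeast0LessThan)
    also have "\<dots> = (\<Sum>r\<in>set l. r * H (s -` {r} \<inter> space S))"
      using l(2) by (rule sum_list_distinct_conv_sum_set)
    also have "\<dots> = (\<Sum>r\<in>s ` space S. r * H (s -` {r} \<inter> space S))"
      unfolding l(1) using fin by (intro sum.mono_neutral_left) auto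
    finally show ?thesis .
  qed
  have 1: "simple_stoch_integral S C s \<omega> = (\<Sum>i<n. l ! i * C (F i) \<omega>)" for \<omega>
    unfolding simple_stoch_integral_def using sumF[of "\<lambda>A. C A \<omega>"] by simp
  have 2: "(\<Sum>i<n. l ! i * indicator (F i) e) = s e" if "e \<in> space S" for e
  proof -
    have "(\<Sum>i<n. l ! i * indicator (F i) e) = (\<Sum>r\<in>s ` space S. r * indicator (s -` {r} \<inter> space S) e)"
      by (rule sumF)
    also have "\<dots> = (\<Sum>r\<in>s ` space S. if r = s e then r else 0)"
      using that by (intro sum.cong) (auto simp: indicator_def)
    also have "\<dots> = s e" using fin that by (simp add: sum.delta')
    finally show ?thesis .
  qed
  have Cm: "C (F i) \<in> borel_measurable M" for i 
    using Ff[of i] by (intro C_meas) (simp add: finite_measure_sets_def)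
  have AE: "AE \<omega> in M. (\<Sum>i<n. l ! i * C (F i) \<omega>) = step_int xs \<omega>"
    using simple_stoch_integral_step_fun[OF assms] by (simp add: 1 s_def[symmetric])
  have "(\<integral>\<omega>. iexp (step_int xs \<omega>) \<partial>M) = (\<integral>\<omega>. iexp (\<Sum>i<n. l ! i * C (F i) \<omega>) \<partial>M)"
  proof (rule integral_cong_AE)
    note [measurable] = step_int_meas[OF assms] Cm
    show "(\<lambda>\<omega>. iexp (step_int xs \<omega>)) \<in> borel_measurable M" "(\<lambda>\<omega>. iexp (\<Sum>i<n. l ! i * C (F i) \<omega>)) \<in> borel_measurable M"
      by measurable
    show "AE \<omega> in M. iexp (step_int xs \<omega>) = iexp (\<Sum>i<n. l ! i * C (F i) \<omega>)"
      using AE by eventually_elim (simp only:)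
  qed
  also have "\<dots> = exp (\<integral>e. levy_exponent (s e) \<partial>S)"
    unfolding cf using 2 by (intro arg_cong[of _ _ exp] Bochner_Integration.integral_cong) auto
  finally show ?thesis by (simp add: s_def)
qed

end

section \<open>Independence of the noises and their joint characteristic function\<close>

lemma generated_measurable:
  fixes X :: "'i \<Rightarrow> 'w \<Rightarrow> 'b::topological_space"
  assumes "i \<in> I" 
  shows "X i \<in> measurable (generated M X I) borel"
proof (rule measurableI)
  fix B :: "'b set" assume "B \<in> sets borel"
  hence "X i -` B \<inter> space M \<in> {X i -` B \<inter> space M |i B. i \<in> I \<and> B \<in> sets borel}" using assms by blast
  thus "X i -` B \<inter> space (generated M X I) \<in> sets (generated M X I)"
    unfolding generated_def by (subst sets_measure_of) (auto simp: space_measure_of_conv intro: sigma_sets.Basic)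
qed simp

lemma space_generated [simp]: "space (generated M X I) = space M"
  by (simp add: generated_def space_measure_of_conv)

lemma subalgebra_generated:
  assumes "\<And>i. i \<in> I \<Longrightarrow> X i \<in> borel_measurable M"
  shows "sets (generated M X I) \<subseteq> sets M"
proof -
  have *: "{X i -` B \<inter> space M |i B. i \<in> I \<and> B \<in> sets borel} \<subseteq> sets M"
    using assms measurable_sets by blast
  show ?thesis unfolding generated_def 
    using sets.sigma_sets_subset[OF *] by (subst sets_measure_of) auto
qed

lemma (in prob_space) indep_var_of_indep_set:
  assumes "indep_set (sets A) (sets B)" "space A = space M" "space B = space M"
    and X: "X \<in> borel_measurable A" and Y: "Y \<in> borel_measurable B"
  shows "indep_var borel X borel Y"
proof -
  have sub: "sets A \<subseteq> events" "sets B \<subseteq> events"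
    using assms(1) unfolding indep_set_def indep_sets_def by (auto simp: UNIV_bool)
  have 1: "sigma_sets (space M) {X -` D \<inter> space M |D. D \<in> sets borel} \<subseteq> sets A"
  proof -
    have "{X -` D \<inter> space M |D. D \<in> sets borel} \<subseteq> sets A" using measurable_sets[OF X] assms(2) by auto
    from sets.sigma_sets_subset[OF this] show ?thesis using assms(2) by simp
  qed
  have 2: "sigma_sets (space M) {Y -` D \<inter> space M |D. D \<in> sets borel} \<subseteq> sets B"
  proof -
    have "{Y -` D \<inter> space M |D. D \<in> sets borel} \<subseteq> sets B" using measurable_sets[OF Y] assms(3) by auto
    from sets.sigma_sets_subset[OF this] show ?thesis using assms(3) by simp
  qed
  have "X \<in> borel_measurable M" "Y \<in> borel_measurable M"
    using X Y sub assms(2,3) by (auto simp: measurable_def)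
  moreover have "indep_set (sigma_sets (space M) {X -` D \<inter> space M |D. D \<in> sets borel})
      (sigma_sets (space M) {Y -` D \<inter> space M |D. D \<in> sets borel})"
  proof (rule indep_setI)
    fix a b assume "a \<in> sigma_sets (space M) {X -` D \<inter> space M |D. D \<in> sets borel}"
      "b \<in> sigma_sets (space M) {Y -` D \<inter> space M |D. D \<in> sets borel}"
    thus "prob (a \<inter> b) = prob a * prob b" by (intro indep_setD[OF assms(1)] subsetD[OF 1] subsetD[OF 2])
  qed (use 1 2 sub in simp_all)
  ultimately show ?thesis unfolding indep_var_eq by simp
qed

locale driving_noise = gauss: gauss_noise M S1 W + poisson: poisson_noise M S2 N
  for M :: "'w measure" and S1 :: "'e measure" and W and S2 :: "'f measure" and N +
  assumes indep: "prob_space.indep_set M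
           (sets (generated M W (finite_measure_sets S1)))
           (sets (generated M (\<lambda>A \<omega>. emeasure (N \<omega>) A) (sets S2)))"
begin

text \<open>Each step integral is measurable for the sigma-algebra generated by its own noise, so
  independence factorises the expectation.\<close>

lemma joint_cf_step:
  assumes xs: "gauss.valid xs" and ys: "poisson.valid ys"
  shows "(\<integral>\<omega>. iexp (gauss.step_int xs \<omega> + poisson.step_int ys \<omega>) \<partial>M)
    = exp ((\<integral>e. gauss_exponent (step_fun xs e) \<partial>S1) + (\<integral>e. levy_exponent (step_fun ys e) \<partial>S2))"
proof -
  have mX: "gauss.step_int xs \<in> borel_measurable (generated M W (finite_measure_sets S1))"
    using xs
  proof (induction xs)
    case (Cons p xs)
    obtain a A where p: "p = (a, A)" by (cases p)
    have "W A \<in> borel_measurable (generated M W (finite_measure_sets S1))"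
      using Cons.prems by (intro generated_measurable) (simp add: p gauss.valid_Cons)
    thus ?case using Cons unfolding p gauss.step_int_Cons[abs_def] by (auto simp: gauss.valid_Cons)
  qed simp
  have mY: "poisson.step_int ys \<in> borel_measurable (generated M (\<lambda>A \<omega>. emeasure (N \<omega>) A) (sets S2))"
    using ys
  proof (induction ys)
    case (Cons p ys)
    obtain a A where p: "p = (a, A)" by (cases p)
    have [measurable]: "(\<lambda>\<omega>. emeasure (N \<omega>) A) \<in> borel_measurable (generated M (\<lambda>A \<omega>. emeasure (N \<omega>) A) (sets S2))"
      using Cons.prems generated_measurable[of A "sets S2" "\<lambda>A \<omega>. emeasure (N \<omega>) A" M] by (simp add: p poisson.valid_Cons finite_measure_sets_def)
    have "compensated S2 N A \<in> borel_measurable (generated M (\<lambda>A \<omega>. emeasure (N \<omega>) A) (sets S2))"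
      unfolding compensated_def[abs_def] measure_def by measurable
    thus ?case using Cons unfolding p poisson.step_int_Cons[abs_def] by (auto simp: poisson.valid_Cons)
  qed simp
  have "gauss.indep_var borel (\<lambda>\<omega>. iexp (gauss.step_int xs \<omega>)) borel (\<lambda>\<omega>. iexp (poisson.step_int ys \<omega>))"
    using mX mY by (intro gauss.indep_var_of_indep_set[OF indep]) auto
  hence "(\<integral>\<omega>. iexp (gauss.step_int xs \<omega>) * iexp (poisson.step_int ys \<omega>) \<partial>M)
     = (\<integral>\<omega>. iexp (gauss.step_int xs \<omega>) \<partial>M) * (\<integral>\<omega>. iexp (poisson.step_int ys \<omega>) \<partial>M)"
    by (rule gauss.indep_var_lebesgue_integral)
       (use gauss.step_int_meas[OF xs] poisson.step_int_meas[OF ys] in \<open>auto intro!: gauss.integrable_const_bound[of _ 1]\<close>)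
  thus ?thesis by (simp add: gauss.step_cf[OF xs] poisson.step_cf[OF ys] exp_add distrib_left)
qed

text \<open>The left side is continuous under L2 convergence of the integrals and the right side
  under L2 convergence of the integrands, so the identity for step integrals passes to the
  limit.\<close>

lemma joint_cf:
  assumes X: "has_stoch_integral M S1 W f X" and Y: "has_stoch_integral M S2 (compensated S2 N) g Y"
  shows "(\<integral>\<omega>. iexp (X \<omega> + Y \<omega>) \<partial>M)
    = exp ((\<integral>e. gauss_exponent (f e) \<partial>S1) + (\<integral>e. levy_exponent (g e) \<partial>S2))"
proof -
  obtain xs where xs: "\<And>n. gauss.valid (xs n)" "(\<lambda>n. L2d S1 f (step_fun (xs n))) \<longlonglongrightarrow> 0"
    "(\<lambda>n. L2d M X (gauss.step_int (xs n))) \<longlonglongrightarrow> 0" using X unfolding gauss.has_stoch_integral_iff by blast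
  obtain ys where ys: "\<And>n. poisson.valid (ys n)" "(\<lambda>n. L2d S2 g (step_fun (ys n))) \<longlonglongrightarrow> 0"
    "(\<lambda>n. L2d M Y (poisson.step_int (ys n))) \<longlonglongrightarrow> 0" using Y unfolding poisson.has_stoch_integral_iff by blast
  note sq = gauss.has_stoch_integral_sq[OF X] poisson.has_stoch_integral_sq[OF Y]
  have m: "X \<in> borel_measurable M" "Y \<in> borel_measurable M" using sq by (auto simp: square_integrable_def)
  have "(\<lambda>n. \<integral>\<omega>. iexp (gauss.step_int (xs n) \<omega> + poisson.step_int (ys n) \<omega>) \<partial>M) \<longlonglongrightarrow> (\<integral>\<omega>. iexp (X \<omega> + Y \<omega>) \<partial>M)"
    using sq m xs ys gauss.step_int_sq[OF xs(1)] poisson.step_int_sq[OF ys(1)]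
      gauss.step_int_meas[OF xs(1)] poisson.step_int_meas[OF ys(1)]
    by (intro gauss.expectation_iexp_tendsto square_integrable_add L2d_tendsto_add) auto
  moreover have "(\<lambda>n. exp ((\<integral>e. gauss_exponent (step_fun (xs n) e) \<partial>S1) + (\<integral>e. levy_exponent (step_fun (ys n) e) \<partial>S2)))
    \<longlonglongrightarrow> exp ((\<integral>e. gauss_exponent (f e) \<partial>S1) + (\<integral>e. levy_exponent (g e) \<partial>S2))"
    using sq xs ys gauss.step_fun_sq[OF xs(1)] poisson.step_fun_sq[OF ys(1)]
    by (intro tendsto_intros quadratic_exponent_integral_tendsto quadratic_exponent_gauss quadratic_exponent_levy) auto
  ultimately show ?thesis
    unfolding joint_cf_step[OF xs(1) ys(1)] by (rule LIMSEQ_unique)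
qed

end

section \<open>The absorbing heat kernel\<close>

lemma gauss_kernel_measurable [measurable (raw)]:
  assumes [measurable]: "f \<in> borel_measurable M" "g \<in> borel_measurable M"
  shows "(\<lambda>z. gauss_kernel (f z) (g z)) \<in> borel_measurable M"
  unfolding gauss_kernel_def by measurable

lemma abm_density_measurable [measurable (raw)]:
  assumes [measurable]: "f \<in> borel_measurable M" "g \<in> borel_measurable M" "h \<in> borel_measurable M"
  shows "(\<lambda>z. abm_density (f z) (g z) (h z)) \<in> borel_measurable M"
  unfolding abm_density_def by measurable

lemma gauss_kernel_nonneg: "t \<ge> 0 \<Longrightarrow> gauss_kernel t x \<ge> 0"
  by (simp add: gauss_kernel_def)

lemma gauss_kernel_le: "t > 0 \<Longrightarrow> gauss_kernel t x \<le> 1 / sqrt (2 * pi * t)"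
  unfolding gauss_kernel_def by (intro divide_right_mono) auto

lemma gauss_kernel_minus [simp]: "gauss_kernel t (- x) = gauss_kernel t x"
  by (simp add: gauss_kernel_def)

lemma gauss_kernel_commute: "gauss_kernel t (x - y) = gauss_kernel t (y - x)"
  by (simp add: gauss_kernel_def power2_commute)

lemma gauss_kernel_normal: "t > 0 \<Longrightarrow> gauss_kernel t x = normal_density 0 (sqrt t) x"
  by (simp add: gauss_kernel_def normal_density_def)

text \<open>Convolution of centred normal densities with variances s and t.\<close>

lemma gauss_kernel_conv:
  assumes s: "s > 0" and t: "t > 0"
  shows "has_bochner_integral lborel (\<lambda>y. gauss_kernel s (x - y) * gauss_kernel t (y - z)) (gauss_kernel (s + t) (x - z))"
proof (rule has_bochner_integral_nn_integral)
  have "(\<integral>\<^sup>+ y. ennreal (gauss_kernel s (x - y) * gauss_kernel t (y - z)) \<partial>lborel)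
      = (\<integral>\<^sup>+ y. ennreal (gauss_kernel s (x - z - y) * gauss_kernel t y) \<partial>lborel)"
    by (subst nn_integral_real_affine[where c=1 and t=z]) (auto simp: algebra_simps)
  also have "\<dots> = (\<integral>\<^sup>+ y. ennreal (normal_density 0 (sqrt s) ((x - z) - y) * normal_density 0 (sqrt t) y) \<partial>lborel)"
    using s t by (simp add: gauss_kernel_normal)
  also have "\<dots> = ennreal (normal_density 0 (sqrt ((sqrt s)\<^sup>2 + (sqrt t)\<^sup>2)) (x - z))"
    using fun_cong[OF conv_normal_density_zero_mean[of "sqrt s" "sqrt t"], of "x - z"] s t by simp
  also have "\<dots> = ennreal (gauss_kernel (s + t) (x - z))"
    using s t by (simp add: gauss_kernel_normal)
  finally show "(\<integral>\<^sup>+ y. ennreal (gauss_kernel s (x - y) * gauss_kernel t (y - z)) \<partial>lborel) = ennreal (gauss_kernel (s + t) (x - z))" .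
qed (use s t gauss_kernel_nonneg in auto)

lemma abm_density_commute: "abm_density t x y = abm_density t y x"
  unfolding abm_density_def by (metis add.commute gauss_kernel_commute)

text \<open>At time 0 the denominator is sqrt 0 = 0, and division by 0 gives 0. This default value
  is met at noise times s = t.\<close>

lemma abm_density_0 [simp]: "abm_density 0 x y = 0"
  by (simp add: abm_density_def gauss_kernel_def)

lemma abm_density_odd: "abm_density t x (- y) = - abm_density t x y"
  by (simp add: abm_density_def)

lemma abm_density_nonneg:
  assumes "t > 0" "x > 0" "y > 0"
  shows "abm_density t x y \<ge> 0"
proof -
  have "(x - y)\<^sup>2 \<le> (x + y)\<^sup>2" using assms by (simp add: power2_eq_square algebra_simps)
  hence "- ((x + y)\<^sup>2 / (2 * t)) \<le> - ((x - y)\<^sup>2 / (2 * t))" using assms by (simp add: divide_right_mono)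
  hence "gauss_kernel t (x + y) \<le> gauss_kernel t (x - y)"
    unfolding gauss_kernel_def using assms by (intro divide_right_mono) auto
  thus ?thesis by (simp add: abm_density_def)
qed

lemma abm_density_abs_le: "t > 0 \<Longrightarrow> \<bar>abm_density t x y\<bar> \<le> 1 / sqrt (2 * pi * t)"
  using gauss_kernel_le[of t "x - y"] gauss_kernel_le[of t "x + y"] gauss_kernel_nonneg[of t "x - y"] gauss_kernel_nonneg[of t "x + y"]
  by (auto simp: abm_density_def)

text \<open>The product is even in y, each factor being odd, so the integral over \<open>D\<close>
  is half of that over the line. There it expands into four Gaussian convolutions, which combine to
  twice the kernel at time s + t.\<close>

lemma abm_chapman_kolmogorov:
  assumes s: "s > 0" and t: "t > 0"
  shows "integrable lambda_D (\<lambda>y. abm_density s x y * abm_density t y z)"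
    and "(\<integral>y. abm_density s x y * abm_density t y z \<partial>lambda_D) = abm_density (s + t) x z"
proof -
  define h where "h y = abm_density s x y * abm_density t y z" for y
  have [measurable]: "h \<in> borel_measurable borel" unfolding h_def by measurable
  have g2: "has_bochner_integral lborel (\<lambda>y. gauss_kernel s (x' - y) * gauss_kernel t (y - z')) (gauss_kernel (s + t) (x' - z'))" for x' z'
    by (rule gauss_kernel_conv[OF s t])
  have "has_bochner_integral lborel (\<lambda>y. (gauss_kernel s (x - y) * gauss_kernel t (y - z) - gauss_kernel s (x - y) * gauss_kernel t (y - (- z)))
     - (gauss_kernel s (- x - y) * gauss_kernel t (y - z) - gauss_kernel s (- x - y) * gauss_kernel t (y - (- z))))
     ((gauss_kernel (s + t) (x - z) - gauss_kernel (s + t) (x - (- z))) - (gauss_kernel (s + t) (- x - z) - gauss_kernel (s + t) (- x - (- z))))"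
    by (intro has_bochner_integral_diff g2)
  moreover have "gauss_kernel s (- x - y) = gauss_kernel s (x + y)" for y
    using gauss_kernel_minus[of s "x + y"] by (simp add: algebra_simps)
  moreover have "gauss_kernel (s + t) (- x - z) = gauss_kernel (s + t) (x + z)"
    using gauss_kernel_minus[of "s + t" "x + z"] by (simp add: algebra_simps)
  moreover have "gauss_kernel (s + t) (- x - (- z)) = gauss_kernel (s + t) (x - z)"
    using gauss_kernel_minus[of "s + t" "x - z"] by (simp add: algebra_simps)
  moreover have "(gauss_kernel s (x - y) * gauss_kernel t (y - z) - gauss_kernel s (x - y) * gauss_kernel t (y + z))
     - (gauss_kernel s (x + y) * gauss_kernel t (y - z) - gauss_kernel s (x + y) * gauss_kernel t (y + z)) = h y" for y
    by (simp add: h_def abm_density_def algebra_simps)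
  ultimately have "has_bochner_integral lborel h (2 * abm_density (s + t) x z)"
    by (simp add: abm_density_def)
  hence ih: "integrable lborel h" and Ih: "integral\<^sup>L lborel h = 2 * abm_density (s + t) x z"
    by (auto simp: has_bochner_integral_iff)
  have even: "h (- y) = h y" for y
    unfolding h_def abm_density_odd by (simp add: abm_density_commute[of t _ z] abm_density_odd)
  have ip: "integrable lborel (\<lambda>y. indicator {0<..} y * h y)" "integrable lborel (\<lambda>y. indicator {..<0} y * h y)"
    using integrable_mult_indicator[OF _ ih, of "{0<..}"] integrable_mult_indicator[OF _ ih, of "{..<0}"] by auto
  have neg: "(\<integral>y. indicator {..<0} y * h y \<partial>lborel) = (\<integral>y. indicator {0<..} y * h y \<partial>lborel)"
    by (subst lborel_integral_real_affine[where c="-1" and t=0]) (auto simp: even indicator_def intro!: Bochner_Integration.integral_cong)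
  have "integral\<^sup>L lborel h = (\<integral>y. indicator {0<..} y * h y + indicator {..<0} y * h y \<partial>lborel)"
  proof (rule integral_cong_AE)
    show "AE y in lborel. h y = indicator {0<..} y * h y + indicator {..<0} y * h y"
      using AE_lborel_singleton[of 0] by eventually_elim (auto simp: indicator_def)
  qed measurable
  also have "\<dots> = 2 * (\<integral>y. indicator {0<..} y * h y \<partial>lborel)" using ip neg by simp
  finally have I: "(\<integral>y. indicator {0<..} y * h y \<partial>lborel) = abm_density (s + t) x z" using Ih by simp
  show "integrable lambda_D (\<lambda>y. abm_density s x y * abm_density t y z)"
    unfolding lambda_D_def using ip(1) by (subst integrable_restrict_space) (auto simp: h_def)
  show "(\<integral>y. abm_density s x y * abm_density t y z \<partial>lambda_D) = abm_density (s + t) x z"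
    unfolding lambda_D_def using I by (subst integral_restrict_space) (auto simp: h_def)
qed

section \<open>Diagonal values and time increments of the kernel\<close>

lemma abm_density_sq: "t > 0 \<Longrightarrow> square_integrable lambda_D (abm_density t x)"
  unfolding square_integrable_def
proof
  assume t: "t > 0"
  show "abm_density t x \<in> borel_measurable lambda_D" by (rule measurable_lambda_D) measurable
  show "integrable lambda_D (\<lambda>y. (abm_density t x y)\<^sup>2)"
    using abm_chapman_kolmogorov(1)[OF t t, of x x] by (simp add: power2_eq_square abm_density_commute[of t _ x])
qed

lemma abm_density_inner:
  assumes "s > 0" "t > 0"
  shows "(\<integral>y. abm_density s x y * abm_density t x y \<partial>lambda_D) = abm_density (s + t) x x"
  using abm_chapman_kolmogorov(2)[OF assms, of x x] by (simp add: abm_density_commute[of t _ x])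

lemma abm_diag: "abm_density r x x = gauss_kernel r 0 - gauss_kernel r (2 * x)"
  by (simp add: abm_density_def)

text \<open>The diagonal value is a product of two nonnegative factors that decrease in r, namely 1
  / sqrt (2 * pi * r) and 1 - exp (- 2 * x^2 / r).\<close>

lemma abm_diag_antimono:
  assumes "0 < r" "r \<le> r'"
  shows "abm_density r' x x \<le> abm_density r x x"
proof -
  have f: "abm_density r x x = (1 / sqrt (2 * pi * r)) * (1 - exp (- (2 * x)\<^sup>2 / (2 * r)))" for r
    by (simp add: abm_diag gauss_kernel_def diff_divide_distrib[symmetric])
  have "1 / sqrt (2 * pi * r') \<le> 1 / sqrt (2 * pi * r)" using assms by (intro divide_left_mono) auto
  moreover have "(2 * x)\<^sup>2 / (2 * r') \<le> (2 * x)\<^sup>2 / (2 * r)" using assms by (intro divide_left_mono) auto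
  hence "1 - exp (- (2 * x)\<^sup>2 / (2 * r')) \<le> 1 - exp (- (2 * x)\<^sup>2 / (2 * r))" by simp
  moreover have "0 \<le> 1 - exp (- (2 * x)\<^sup>2 / (2 * r'))" using assms by simp
  ultimately show ?thesis unfolding f using assms by (intro mult_mono) auto
qed

lemma abm_diag_nonneg: "0 < r \<Longrightarrow> 0 \<le> abm_density r x x"
  by (simp add: abm_diag gauss_kernel_def divide_right_mono)

text \<open>The bound is uniform in x and integrable at r = 0; this is what makes the stochastic
  integrands square integrable.\<close>

lemma abm_diag_le: 
  assumes "0 < r" shows "abm_density (2 * r) x x \<le> r powr (-1/2)"
proof -
  have "abm_density (2 * r) x x \<le> 1 / sqrt (2 * pi * (2 * r))"
    using abm_density_abs_le[of "2 * r" x x] assms by simp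
  also have "\<dots> \<le> 1 / sqrt r"
  proof (intro divide_left_mono)
    have "1 * r \<le> (2 * pi * 2) * r" using pi_gt3 assms by (intro mult_right_mono) auto
    thus "sqrt r \<le> sqrt (2 * pi * (2 * r))" by simp
  qed (use assms in auto)
  also have "\<dots> = r powr (-1/2)" using assms by (simp add: powr_minus powr_half_sqrt field_simps)
  finally show ?thesis .
qed

lemma L2d_abm_density:
  assumes a: "a > 0" and b: "b > 0"
  shows "L2d lambda_D (abm_density a x) (abm_density b x)
    = ennreal (abm_density (2 * a) x x + abm_density (2 * b) x x - 2 * abm_density (a + b) x x)"
proof -
  note i = square_integrable_mult[OF abm_density_sq[OF a] abm_density_sq[OF a], of x x]
    square_integrable_mult[OF abm_density_sq[OF b] abm_density_sq[OF b], of x x]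
    square_integrable_mult[OF abm_density_sq[OF a] abm_density_sq[OF b], of x x]
  have "(\<integral>y. (abm_density a x y - abm_density b x y)\<^sup>2 \<partial>lambda_D)
    = (\<integral>y. (abm_density a x y * abm_density a x y + abm_density b x y * abm_density b x y) - 2 * (abm_density a x y * abm_density b x y) \<partial>lambda_D)"
    by (intro Bochner_Integration.integral_cong) (auto simp: power2_eq_square algebra_simps)
  also have "\<dots> = (abm_density (a + a) x x + abm_density (b + b) x x) - 2 * abm_density (a + b) x x"
    using i abm_density_inner[OF a a, of x] abm_density_inner[OF b b, of x] abm_density_inner[OF a b, of x] by simp
  finally show ?thesis by (simp add: L2d_eq_integral abm_density_sq a b)
qed

lemma nn_integral_inverse_sqrt:
  assumes "h \<ge> 0"
  shows "(\<integral>\<^sup>+a. ennreal (a powr (-1/2)) * indicator {0<..h} a \<partial>lborel) = ennreal (2 * sqrt h)"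
proof -
  have "((\<lambda>x. x powr (-1/2)) has_integral (h powr (-1/2+1) / (-1/2+1))) {0..h}"
    using assms by (intro has_integral_powr_from_0) auto
  hence "(\<integral>\<^sup>+ a. indicator {0..h} a * ennreal (a powr (-1/2)) \<partial>lborel) = ennreal (h powr (-1/2+1) / (-1/2+1))"
    using nn_integral_has_integral_lebesgue[of "{0..h}" "\<lambda>x. x powr (-1/2)"] 
    by (simp add: ennreal_mult'' ennreal_indicator mult.commute)
  also have "h powr (-1/2+1) / (-1/2+1) = 2 * sqrt h" using assms by (simp add: powr_half_sqrt)
  also have "(\<integral>\<^sup>+ a. indicator {0..h} a * ennreal (a powr (-1/2)) \<partial>lborel) = (\<integral>\<^sup>+a. ennreal (a powr (-1/2)) * indicator {0<..h} a \<partial>lborel)"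
    by (intro nn_integral_cong) (auto simp: indicator_def)
  finally show ?thesis .
qed

definition abm_flow :: "real \<Rightarrow> real \<Rightarrow> real \<Rightarrow> real \<Rightarrow> real" where
  "abm_flow t s x y = indicator {0..t} s * abm_density (t - s) x y"

lemma abm_flow_measurable [measurable (raw)]:
  assumes [measurable]: "f \<in> borel_measurable M" "g \<in> borel_measurable M" "h \<in> borel_measurable M"
  shows "(\<lambda>z. abm_flow t (f z) (g z) (h z)) \<in> borel_measurable M"
  unfolding abm_flow_def by measurable

lemma abm_flow_0 [simp]: "abm_flow 0 s x y = 0"
  by (auto simp: abm_flow_def indicator_def)

lemma nn_integral_time_measure: 
  "f \<in> borel_measurable borel \<Longrightarrow> (\<integral>\<^sup>+s. f s \<partial>time_measure) = (\<integral>\<^sup>+s. f s * indicator {0..} s \<partial>lborel)"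
  unfolding time_measure_def by (subst nn_integral_restrict_space) auto

lemma nn_integral_reflect:
  assumes [measurable]: "f \<in> borel_measurable borel"
  shows "(\<integral>\<^sup>+s. f (t - s) \<partial>lborel) = (\<integral>\<^sup>+a. f a \<partial>(lborel :: real measure))"
  using nn_integral_real_affine[of f "-1" t] by simp

text \<open>By Chapman--Kolmogorov the squared \<open>L\<^sup>2\<close> norm of a time increment of the kernel is a combination
  of diagonal values. These decrease in time, so the integral of their increments telescopes.\<close>

lemma abm_diag_telescope:
  assumes h: "h \<ge> 0" and t: "t \<ge> 0"
  shows "(\<integral>\<^sup>+a. ennreal (abm_density (2 * a) x x - abm_density (2 * a + h) x x) * indicator {0<..t} a \<partial>lborel) \<le> ennreal (2 * sqrt h)"
proof -
  define q where "q a = ennreal (abm_density (2 * a) x x)" for a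
  have [measurable]: "q \<in> borel_measurable borel" unfolding q_def by measurable
  define X where "X = (\<integral>\<^sup>+a. ennreal (abm_density (2 * a) x x - abm_density (2 * a + h) x x) * indicator {0<..t} a \<partial>lborel)"
  \<comment> \<open>Here \<open>q (a + h / 2)\<close> is the diagonal value at 2 * a + h, so X + Y
    is the integral of q over (0, t]. Shifting by h / 2 identifies Y with the integral of q over
    (h/2, t + h/2].\<close>
  define Y where "Y = (\<integral>\<^sup>+a. q (a + h / 2) * indicator {0<..t} a \<partial>lborel)"
  have qle: "q a * indicator {0<..r} a \<le> ennreal (a powr (-1/2)) * indicator {0<..r} a" for a r
    using abm_diag_le[of a x] by (auto simp: indicator_def q_def ennreal_leI)
  have "X + Y = (\<integral>\<^sup>+a. ennreal (abm_density (2 * a) x x - abm_density (2 * a + h) x x) * indicator {0<..t} a + q (a + h / 2) * indicator {0<..t} a \<partial>lborel)"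
    unfolding X_def Y_def by (subst nn_integral_add) auto
  also have "\<dots> = (\<integral>\<^sup>+a. q a * indicator {0<..t} a \<partial>lborel)"
  proof (intro nn_integral_cong)
    fix a
    show "ennreal (abm_density (2 * a) x x - abm_density (2 * a + h) x x) * indicator {0<..t} a + q (a + h / 2) * indicator {0<..t} a = q a * indicator {0<..t} a"
      using abm_diag_antimono[of "2 * a" "2 * a + h" x] h abm_diag_nonneg[of "2 * a + h" x]
      by (auto simp: indicator_def q_def algebra_simps simp flip: ennreal_plus)
  qed
  also have "\<dots> \<le> (\<integral>\<^sup>+a. q a * indicator {0<..h/2} a + q a * indicator {h/2<..t+h/2} a \<partial>lborel)"
    using h t by (intro nn_integral_mono) (auto simp: indicator_def)
  also have "\<dots> = (\<integral>\<^sup>+a. q a * indicator {0<..h/2} a \<partial>lborel) + (\<integral>\<^sup>+a. q a * indicator {h/2<..t+h/2} a \<partial>lborel)"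
    by (rule nn_integral_add) auto
  also have "(\<integral>\<^sup>+a. q a * indicator {h/2<..t+h/2} a \<partial>lborel) = Y"
    unfolding Y_def
    by (subst nn_integral_real_affine[where c=1 and t="h/2"]) (auto simp: indicator_def add.commute intro!: nn_integral_cong)
  also have "(\<integral>\<^sup>+a. q a * indicator {0<..h/2} a \<partial>lborel) \<le> ennreal (2 * sqrt (h/2))"
    unfolding nn_integral_inverse_sqrt[symmetric, of "h/2", OF divide_nonneg_pos[OF h zero_less_numeral]]
    by (intro nn_integral_mono qle)
  finally have "X + Y \<le> ennreal (2 * sqrt (h/2)) + Y" by (simp add: add_right_mono)
  \<comment> \<open>Finiteness allows Y to be cancelled from the inequality for X + Y.\<close>
  moreover have "Y < \<infinity>"
  proof -
    have "Y = (\<integral>\<^sup>+a. q a * indicator {h/2<..t+h/2} a \<partial>lborel)"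
      unfolding Y_def
      by (subst (2) nn_integral_real_affine[where c=1 and t="h/2"]) (auto simp: indicator_def add.commute intro!: nn_integral_cong)
    also have "\<dots> \<le> (\<integral>\<^sup>+a. ennreal (a powr (-1/2)) * indicator {0<..t+h/2} a \<partial>lborel)"
      using h by (intro nn_integral_mono order.trans[OF _ qle]) (auto simp: indicator_def)
    also have "\<dots> < \<infinity>" using h t by (subst nn_integral_inverse_sqrt) auto
    finally show ?thesis .
  qed
  ultimately have "X \<le> ennreal (2 * sqrt (h/2))"
    by (metis add.commute ennreal_add_left_cancel_le infinity_ennreal_def less_irrefl)
  also have "\<dots> \<le> ennreal (2 * sqrt h)" using h by (intro ennreal_leI) simp
  finally show ?thesis by (simp add: X_def)
qed

text \<open>Noise points before t are seen by both kernels and contribute the telescoping integral;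
  those between t and t + h are seen by the later kernel only and contribute the integral of its
  singularity. Either part is at most 2 * sqrt h, uniformly in x.\<close>

lemma abm_flow_time_continuity:
  assumes t: "0 \<le> t" and h: "0 \<le> h"
  shows "(\<integral>\<^sup>+s. L2d lambda_D (abm_flow t s x) (abm_flow (t + h) s x) \<partial>time_measure) \<le> ennreal (4 * sqrt h)"
proof -
  define G where "G a = ennreal (abm_density (2 * a) x x - abm_density (2 * a + h) x x) * indicator {0<..t} a" for a
  define H where "H b = ennreal (b powr (-1/2)) * indicator {0<..h} b" for b
  have [measurable]: "G \<in> borel_measurable borel" "H \<in> borel_measurable borel" unfolding G_def H_def by measurable
  have "L2d lambda_D (abm_flow t s x) (abm_flow (t + h) s x) \<le> G (t - s) + H (t + h - s)" if "s \<in> space time_measure" for s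
  proof -
    have s: "s \<ge> 0" using that by (simp add: time_measure_def space_restrict_space)
    consider "s < t" | "t \<le> s" "s < t + h" | "t + h \<le> s" by linarith
    thus ?thesis
    proof cases
      case 1
      have e: "abm_flow t s x = abm_density (t - s) x" "abm_flow (t + h) s x = abm_density (t + h - s) x"
        using 1 s h by (auto simp: abm_flow_def fun_eq_iff)
      have "L2d lambda_D (abm_flow t s x) (abm_flow (t + h) s x)
        = ennreal (abm_density (2 * (t - s)) x x + abm_density (2 * (t + h - s)) x x - 2 * abm_density ((t - s) + (t + h - s)) x x)"
        unfolding e using 1 h by (intro L2d_abm_density) auto
      also have "\<dots> \<le> ennreal (abm_density (2 * (t - s)) x x - abm_density (2 * (t - s) + h) x x)"
      proof (rule ennreal_leI)
        have e1: "(t - s) + (t + h - s) = 2 * (t - s) + h" by simp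
        \<comment> \<open>Monotonicity of the diagonal turns the second difference into a first
          difference.\<close>
        have m: "abm_density (2 * (t + h - s)) x x \<le> abm_density (2 * (t - s) + h) x x"
          using 1 h by (intro abm_diag_antimono) auto
        show "abm_density (2 * (t - s)) x x + abm_density (2 * (t + h - s)) x x - 2 * abm_density ((t - s) + (t + h - s)) x x
          \<le> abm_density (2 * (t - s)) x x - abm_density (2 * (t - s) + h) x x" unfolding e1 using m by linarith
      qed
      also have "\<dots> = G (t - s)" using 1 s by (simp add: G_def)
      finally show ?thesis by (simp add: add_increasing2)
    next
      case 2
      have e: "abm_flow t s x = (\<lambda>_. 0)" "abm_flow (t + h) s x = abm_density (t + h - s) x"
        using 2 s h by (auto simp: abm_flow_def fun_eq_iff indicator_def)
      have "L2d lambda_D (abm_flow t s x) (abm_flow (t + h) s x) = ennreal (\<integral>y. (abm_density (t + h - s) x y)\<^sup>2 \<partial>lambda_D)"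
        unfolding e using 2 by (subst L2d_eq_integral) (auto intro: abm_density_sq)
      also have "\<dots> = ennreal (abm_density (2 * (t + h - s)) x x)"
        using abm_density_inner[of "t + h - s" "t + h - s" x] 2 unfolding power2_eq_square mult_2 by simp
      also have "\<dots> \<le> H (t + h - s)"
        using abm_diag_le[of "t + h - s" x] 2 by (simp add: H_def ennreal_leI)
      finally show ?thesis by (simp add: add_increasing)
    next
      case 3
      have e: "abm_flow t s x = (\<lambda>_. 0)" "abm_flow (t + h) s x = (\<lambda>_. 0)"
      proof -
        have z: "s \<le> t \<Longrightarrow> t - s = 0" "s \<le> t + h \<Longrightarrow> t + h - s = 0" using 3 h by linarith+
        show "abm_flow t s x = (\<lambda>_. 0)" "abm_flow (t + h) s x = (\<lambda>_. 0)"
          by (auto simp: abm_flow_def fun_eq_iff indicator_def z)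
      qed
      show ?thesis by (simp add: e)
    qed
  qed
  hence "(\<integral>\<^sup>+s. L2d lambda_D (abm_flow t s x) (abm_flow (t + h) s x) \<partial>time_measure) \<le> (\<integral>\<^sup>+s. G (t - s) + H (t + h - s) \<partial>time_measure)"
    by (intro nn_integral_mono)
  also have "\<dots> = (\<integral>\<^sup>+s. (G (t - s) + H (t + h - s)) * indicator {0..} s \<partial>lborel)"
    by (rule nn_integral_time_measure) measurable
  also have "\<dots> \<le> (\<integral>\<^sup>+s. G (t - s) + H (t + h - s) \<partial>lborel)"
    by (intro nn_integral_mono) (auto simp: indicator_def)
  also have "\<dots> = (\<integral>\<^sup>+s. G (t - s) \<partial>lborel) + (\<integral>\<^sup>+s. H (t + h - s) \<partial>lborel)"
    by (rule nn_integral_add) auto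
  also have "\<dots> = (\<integral>\<^sup>+a. G a \<partial>lborel) + (\<integral>\<^sup>+a. H a \<partial>lborel)"
    by (simp add: nn_integral_reflect)
  also have "\<dots> \<le> ennreal (2 * sqrt h) + ennreal (2 * sqrt h)"
    unfolding G_def H_def using abm_diag_telescope[OF h t, of x] nn_integral_inverse_sqrt[OF h] by (intro add_mono) auto
  also have "\<dots> = ennreal (4 * sqrt h)" using h by (simp flip: ennreal_plus)
  finally show ?thesis .
qed

section \<open>The absorbing semigroup on square integrable functions\<close>

lemma abm_semigroup_pos: "t > 0 \<Longrightarrow> abm_semigroup t f x = (\<integral>y. abm_density t x y * f y \<partial>lambda_D)"
  by (simp add: abm_semigroup_def)

lemma abm_semigroup_0: "abm_semigroup 0 f = f"
  by (simp add: abm_semigroup_def fun_eq_iff)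

lemma abm_semigroup_integrable:
  "t > 0 \<Longrightarrow> square_integrable lambda_D f \<Longrightarrow> integrable lambda_D (\<lambda>y. abm_density t x y * f y)"
  by (intro square_integrable_mult abm_density_sq)

lemma abm_semigroup_measurable:
  assumes t: "t > 0" and f: "square_integrable lambda_D f"
  shows "abm_semigroup t f \<in> borel_measurable borel"
proof -
  have [measurable]: "f \<in> borel_measurable lambda_D" using f by (simp add: square_integrable_def)
  note [measurable] = id_measurable_lambda_D
  have "(\<lambda>x. \<integral>y. abm_density t x y * f y \<partial>lambda_D) \<in> borel_measurable borel"
    by (rule lambda_D.borel_measurable_lebesgue_integral) measurable
  thus ?thesis using t by (simp add: abm_semigroup_def[abs_def])
qed

lemma abm_density_total_le:
  assumes t: "t > 0" and x: "x > 0"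
  shows "(\<integral>\<^sup>+y. ennreal (abm_density t x y) \<partial>lambda_D) \<le> 1"
proof -
  have "(\<integral>\<^sup>+y. ennreal (abm_density t x y) \<partial>lambda_D) \<le> (\<integral>\<^sup>+y. ennreal (gauss_kernel t (x - y)) \<partial>lambda_D)"
    using t gauss_kernel_nonneg[of t] by (intro nn_integral_mono ennreal_leI) (auto simp: abm_density_def)
  also have "\<dots> = (\<integral>\<^sup>+y. ennreal (gauss_kernel t (x - y)) * indicator {0<..} y \<partial>lborel)"
    unfolding lambda_D_def by (subst nn_integral_restrict_space) auto
  also have "\<dots> \<le> (\<integral>\<^sup>+y. ennreal (gauss_kernel t (x - y)) \<partial>lborel)"
    by (intro nn_integral_mono) (auto simp: indicator_def)
  also have "\<dots> = (\<integral>\<^sup>+y. ennreal (gauss_kernel t y) \<partial>lborel)"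
    by (rule nn_integral_reflect[of "\<lambda>y. ennreal (gauss_kernel t y)"]) measurable
  also have "\<dots> = (\<integral>\<^sup>+y. ennreal (normal_density 0 (sqrt t) y) \<partial>lborel)" using t by (simp add: gauss_kernel_normal)
  also have "\<dots> = 1"
    using t integral_normal_density[of "sqrt t" 0] integrable_normal_density[of "sqrt t" 0]
    by (subst nn_integral_eq_integral) auto
  finally show ?thesis .
qed

text \<open>Jensen's inequality for a subprobability density: Cauchy-Schwarz applied to u and u * f,
  where u is the square root of the kernel and the integral of u^2 is at most 1.\<close>

lemma abm_semigroup_abs_square_le:
  assumes t: "t > 0" and x: "x > 0" and f: "square_integrable lambda_D f"
  shows "ennreal ((abm_semigroup t f x)\<^sup>2) \<le> (\<integral>\<^sup>+y. ennreal (abm_density t x y * (f y)\<^sup>2) \<partial>lambda_D)"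
proof -
  have [measurable]: "f \<in> borel_measurable lambda_D" using f by (simp add: square_integrable_def)
  have pm[measurable]: "abm_density t x \<in> borel_measurable lambda_D" using abm_density_sq[OF t] by (simp add: square_integrable_def)
  have p0: "abm_density t x y \<ge> 0" if "y \<in> space lambda_D" for y using abm_density_nonneg[OF t x] that by simp
  define u where "u y = sqrt (abm_density t x y)" for y
  have uu: "(u y)\<^sup>2 = abm_density t x y" if "y \<in> space lambda_D" for y using p0[OF that] by (simp add: u_def)
  have [measurable]: "u \<in> borel_measurable lambda_D" unfolding u_def by measurable
  have nu: "(\<integral>\<^sup>+y. ennreal ((u y)\<^sup>2) \<partial>lambda_D) \<le> 1"
  proof -
    have "(\<integral>\<^sup>+y. ennreal ((u y)\<^sup>2) \<partial>lambda_D) = (\<integral>\<^sup>+y. ennreal (abm_density t x y) \<partial>lambda_D)"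
      using uu by (intro nn_integral_cong) simp
    thus ?thesis using abm_density_total_le[OF t x] by simp
  qed
  have su: "square_integrable lambda_D u"
    using nu by (auto simp: square_integrable_iff_L2d L2d_def intro: le_less_trans)
  have i2: "integrable lambda_D (\<lambda>y. abm_density t x y * (f y)\<^sup>2)"
  proof (rule Bochner_Integration.integrable_bound)
    show "integrable lambda_D (\<lambda>y. (1 / sqrt (2 * pi * t)) * (f y)\<^sup>2)" using f by (simp add: square_integrable_def)
    show "AE y in lambda_D. norm (abm_density t x y * (f y)\<^sup>2) \<le> norm (1 / sqrt (2 * pi * t) * (f y)\<^sup>2)"
      using abm_density_abs_le[OF t, of x] t by (intro AE_I2) (simp add: abs_mult mult_right_mono del: times_divide_eq_left)
  qed measurable
  have e2: "(u y * f y)\<^sup>2 = abm_density t x y * (f y)\<^sup>2" if "y \<in> space lambda_D" for y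
    using uu[OF that] by (simp add: power_mult_distrib)
  have suf: "square_integrable lambda_D (\<lambda>y. u y * f y)"
    unfolding square_integrable_def
  proof
    show "integrable lambda_D (\<lambda>y. (u y * f y)\<^sup>2)"
      using i2 by (rule Bochner_Integration.integrable_cong[THEN iffD1, rotated -1]) (use e2 in auto)
  qed measurable
  have "abm_semigroup t f x = (\<integral>y. u y * (u y * f y) \<partial>lambda_D)"
    unfolding abm_semigroup_pos[OF t] using uu
    by (intro Bochner_Integration.integral_cong) (auto simp: power2_eq_square mult.assoc[symmetric])
  also have "\<dots> = inner (L2_class u) (L2_class (\<lambda>y. u y * f y))" by (simp add: inner_L2_class su suf)
  finally have "(abm_semigroup t f x)\<^sup>2 \<le> inner (L2_class u) (L2_class u) * inner (L2_class (\<lambda>y. u y * f y)) (L2_class (\<lambda>y. u y * f y))"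
    using Cauchy_Schwarz_ineq by simp
  also have "inner (L2_class u) (L2_class u) \<le> 1"
  proof -
    have "ennreal (inner (L2_class u) (L2_class u)) = (\<integral>\<^sup>+y. ennreal ((u y)\<^sup>2) \<partial>lambda_D)"
      using su by (subst nn_integral_eq_integral) (auto simp: inner_L2_class square_integrable_def power2_eq_square)
    thus ?thesis using nu by (metis ennreal_le_1)
  qed
  also have "1 * inner (L2_class (\<lambda>y. u y * f y)) (L2_class (\<lambda>y. u y * f y)) = (\<integral>y. (u y * f y)\<^sup>2 \<partial>lambda_D)"
    by (simp add: inner_L2_class suf power2_eq_square)
  also have "\<dots> = (\<integral>y. abm_density t x y * (f y)\<^sup>2 \<partial>lambda_D)" using e2 by (intro Bochner_Integration.integral_cong) auto
  finally have "ennreal ((abm_semigroup t f x)\<^sup>2) \<le> ennreal (\<integral>y. abm_density t x y * (f y)\<^sup>2 \<partial>lambda_D)"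
    by (intro ennreal_leI) (simp add: mult_right_mono)
  also have "\<dots> = (\<integral>\<^sup>+y. ennreal (abm_density t x y * (f y)\<^sup>2) \<partial>lambda_D)"
    using i2 p0 by (intro nn_integral_eq_integral[symmetric]) auto
  finally show ?thesis .
qed

text \<open>The second bound is total mass at most 1; the first follows from it by Tonelli and the
  symmetry of the kernel.\<close>

lemma abm_double_integral_le:
  assumes t: "t > 0" and f: "square_integrable lambda_D f"
  shows "(\<integral>\<^sup>+x. (\<integral>\<^sup>+y. ennreal (abm_density t x y * (f y)\<^sup>2) \<partial>lambda_D) \<partial>lambda_D) \<le> L2d lambda_D f (\<lambda>_. 0)"
    and "(\<integral>\<^sup>+x. (\<integral>\<^sup>+y. ennreal (abm_density t x y * (f x)\<^sup>2) \<partial>lambda_D) \<partial>lambda_D) \<le> L2d lambda_D f (\<lambda>_. 0)"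
proof -
  have [measurable]: "f \<in> borel_measurable lambda_D" using f by (simp add: square_integrable_def)
  note [measurable] = id_measurable_lambda_D
  interpret P: pair_sigma_finite lambda_D lambda_D by (simp add: pair_sigma_finite_def sigma_finite_lambda_D)
  have "(\<integral>\<^sup>+x. (\<integral>\<^sup>+y. ennreal (abm_density t x y * (f x)\<^sup>2) \<partial>lambda_D) \<partial>lambda_D)
     \<le> (\<integral>\<^sup>+x. ennreal ((f x)\<^sup>2) \<partial>lambda_D)"
  proof (rule nn_integral_mono)
    fix x assume x: "x \<in> space lambda_D"
    have [measurable]: "abm_density t x \<in> borel_measurable lambda_D" by (rule measurable_lambda_D) measurable
    have "(\<integral>\<^sup>+y. ennreal (abm_density t x y * (f x)\<^sup>2) \<partial>lambda_D) = (\<integral>\<^sup>+y. ennreal (abm_density t x y) \<partial>lambda_D) * ennreal ((f x)\<^sup>2)"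
      by (subst nn_integral_multc[symmetric]) (auto simp: ennreal_mult'')
    also have "\<dots> \<le> 1 * ennreal ((f x)\<^sup>2)" using abm_density_total_le[OF t] x by (intro mult_right_mono) auto
    finally show "(\<integral>\<^sup>+y. ennreal (abm_density t x y * (f x)\<^sup>2) \<partial>lambda_D) \<le> ennreal ((f x)\<^sup>2)" by simp
  qed
  also have "\<dots> = L2d lambda_D f (\<lambda>_. 0)" by (simp add: L2d_def)
  finally show 1: "(\<integral>\<^sup>+x. (\<integral>\<^sup>+y. ennreal (abm_density t x y * (f x)\<^sup>2) \<partial>lambda_D) \<partial>lambda_D) \<le> L2d lambda_D f (\<lambda>_. 0)" .
  have "(\<integral>\<^sup>+x. (\<integral>\<^sup>+y. ennreal (abm_density t x y * (f y)\<^sup>2) \<partial>lambda_D) \<partial>lambda_D)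
    = (\<integral>\<^sup>+y. (\<integral>\<^sup>+x. ennreal (abm_density t x y * (f y)\<^sup>2) \<partial>lambda_D) \<partial>lambda_D)"
    using P.Fubini[of "\<lambda>(x, y). ennreal (abm_density t x y * (f y)\<^sup>2)"] by simp
  also have "\<dots> \<le> L2d lambda_D f (\<lambda>_. 0)" using 1 by (simp add: abm_density_commute[of t])
  finally show "(\<integral>\<^sup>+x. (\<integral>\<^sup>+y. ennreal (abm_density t x y * (f y)\<^sup>2) \<partial>lambda_D) \<partial>lambda_D) \<le> L2d lambda_D f (\<lambda>_. 0)" .
qed

lemma abm_semigroup_sq:
  assumes t: "t \<ge> 0" and f: "square_integrable lambda_D f"
  shows "square_integrable lambda_D (abm_semigroup t f)"
proof (cases "t = 0")
  case False
  hence t: "t > 0" using t by simp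
  have "abm_semigroup t f \<in> borel_measurable lambda_D"
    by (rule measurable_lambda_D[OF abm_semigroup_measurable[OF t f]])
  moreover have "L2d lambda_D (abm_semigroup t f) (\<lambda>_. 0) \<le> (\<integral>\<^sup>+x. (\<integral>\<^sup>+y. ennreal (abm_density t x y * (f y)\<^sup>2) \<partial>lambda_D) \<partial>lambda_D)"
    unfolding L2d_def using abm_semigroup_abs_square_le[OF t _ f] by (intro nn_integral_mono) simp
  moreover have "\<dots> \<le> L2d lambda_D f (\<lambda>_. 0)" by (rule abm_double_integral_le(1)[OF t f])
  moreover have "\<dots> < \<infinity>" using f by (simp add: square_integrable_iff_L2d)
  ultimately show ?thesis unfolding square_integrable_iff_L2d by (meson le_less_trans order_trans)
qed (use f in \<open>simp add: abm_semigroup_0\<close>)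

text \<open>Symmetry of the kernel and Fubini; integrability comes from |g| |f| \<le> g^2 + f^2 and
  the two double integral bounds.\<close>

lemma abm_semigroup_symmetric:
  assumes t: "t \<ge> 0" and f: "square_integrable lambda_D f" and g: "square_integrable lambda_D g"
  shows "inner (L2_class (abm_semigroup t g)) (L2_class f) = inner (L2_class g) (L2_class (abm_semigroup t f))"
proof (cases "t = 0")
  case False
  hence t: "t > 0" using t by simp
  have [measurable]: "f \<in> borel_measurable lambda_D" "g \<in> borel_measurable lambda_D" using f g by (simp_all add: square_integrable_def)
  note [measurable] = id_measurable_lambda_D
  interpret P: pair_sigma_finite lambda_D lambda_D by (simp add: pair_sigma_finite_def sigma_finite_lambda_D)
  have i: "integrable (lambda_D \<Otimes>\<^sub>M lambda_D) (\<lambda>(x, y). abm_density t x y * g y * f x)"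
  proof (rule integrableI_bounded)
    show "(\<lambda>(x, y). abm_density t x y * g y * f x) \<in> borel_measurable (lambda_D \<Otimes>\<^sub>M lambda_D)" by measurable
    have "(\<integral>\<^sup>+p. ennreal (norm (case p of (x, y) \<Rightarrow> abm_density t x y * g y * f x)) \<partial>(lambda_D \<Otimes>\<^sub>M lambda_D))
       \<le> (\<integral>\<^sup>+p. (case p of (x, y) \<Rightarrow> ennreal (abm_density t x y * (g y)\<^sup>2) + ennreal (abm_density t x y * (f x)\<^sup>2)) \<partial>(lambda_D \<Otimes>\<^sub>M lambda_D))"
    proof (intro nn_integral_mono)
      fix p assume "p \<in> space (lambda_D \<Otimes>\<^sub>M lambda_D)"
      then obtain x y where p: "p = (x, y)" "x > 0" "y > 0" by (auto simp: space_pair_measure)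
      have p0: "abm_density t x y \<ge> 0" by (rule abm_density_nonneg[OF t p(2,3)])
      have "0 \<le> (\<bar>g y\<bar> - \<bar>f x\<bar>)\<^sup>2" by simp
      hence "2 * (\<bar>g y\<bar> * \<bar>f x\<bar>) \<le> (g y)\<^sup>2 + (f x)\<^sup>2" by (simp add: power2_diff)
      hence "\<bar>g y\<bar> * \<bar>f x\<bar> \<le> (g y)\<^sup>2 + (f x)\<^sup>2"
        using mult_nonneg_nonneg[of "\<bar>g y\<bar>" "\<bar>f x\<bar>"] by linarith
      hence "abm_density t x y * (\<bar>g y\<bar> * \<bar>f x\<bar>) \<le> abm_density t x y * ((g y)\<^sup>2 + (f x)\<^sup>2)" by (intro mult_left_mono p0)
      hence "norm (abm_density t x y * g y * f x) \<le> abm_density t x y * (g y)\<^sup>2 + abm_density t x y * (f x)\<^sup>2"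
        using p0 by (simp add: abs_mult distrib_left mult.assoc)
      thus "ennreal (norm (case p of (x, y) \<Rightarrow> abm_density t x y * g y * f x))
        \<le> (case p of (x, y) \<Rightarrow> ennreal (abm_density t x y * (g y)\<^sup>2) + ennreal (abm_density t x y * (f x)\<^sup>2))"
        using p0 by (simp add: p ennreal_leI flip: ennreal_plus)
    qed
    also have "\<dots> = (\<integral>\<^sup>+x. (\<integral>\<^sup>+y. ennreal (abm_density t x y * (g y)\<^sup>2) + ennreal (abm_density t x y * (f x)\<^sup>2) \<partial>lambda_D) \<partial>lambda_D)"
      by (subst lambda_D.nn_integral_fst[symmetric]) auto
    also have "\<dots> = (\<integral>\<^sup>+x. (\<integral>\<^sup>+y. ennreal (abm_density t x y * (g y)\<^sup>2) \<partial>lambda_D) + (\<integral>\<^sup>+y. ennreal (abm_density t x y * (f x)\<^sup>2) \<partial>lambda_D) \<partial>lambda_D)"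
    proof (intro nn_integral_cong nn_integral_add)
      fix x
      have [measurable]: "abm_density t x \<in> borel_measurable lambda_D" by (rule measurable_lambda_D) measurable
      show "(\<lambda>y. ennreal (abm_density t x y * (g y)\<^sup>2)) \<in> borel_measurable lambda_D" 
        "(\<lambda>y. ennreal (abm_density t x y * (f x)\<^sup>2)) \<in> borel_measurable lambda_D" by measurable
    qed
    also have "\<dots> = (\<integral>\<^sup>+x. (\<integral>\<^sup>+y. ennreal (abm_density t x y * (g y)\<^sup>2) \<partial>lambda_D) \<partial>lambda_D) + (\<integral>\<^sup>+x. (\<integral>\<^sup>+y. ennreal (abm_density t x y * (f x)\<^sup>2) \<partial>lambda_D) \<partial>lambda_D)"
      by (intro nn_integral_add lambda_D.borel_measurable_nn_integral) measurable
    also have "\<dots> \<le> L2d lambda_D g (\<lambda>_. 0) + L2d lambda_D f (\<lambda>_. 0)"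
      by (intro add_mono abm_double_integral_le t f g)
    also have "\<dots> < \<infinity>" using f g by (simp add: square_integrable_iff_L2d)
    finally show "(\<integral>\<^sup>+p. ennreal (norm (case p of (x, y) \<Rightarrow> abm_density t x y * g y * f x)) \<partial>(lambda_D \<Otimes>\<^sub>M lambda_D)) < \<infinity>" .
  qed
  have "inner (L2_class (abm_semigroup t g)) (L2_class f) = (\<integral>x. (\<integral>y. abm_density t x y * g y * f x \<partial>lambda_D) \<partial>lambda_D)"
    using t by (simp add: inner_L2_class f abm_semigroup_sq[OF less_imp_le[OF t] g] abm_semigroup_pos)
  also have "\<dots> = (\<integral>y. (\<integral>x. abm_density t x y * g y * f x \<partial>lambda_D) \<partial>lambda_D)"
    using P.Fubini_integral[of "\<lambda>x y. abm_density t x y * g y * f x"] i by simp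
  also have "\<dots> = (\<integral>y. g y * abm_semigroup t f y \<partial>lambda_D)"
  proof (intro Bochner_Integration.integral_cong refl)
    fix y
    have "(\<integral>x. abm_density t x y * g y * f x \<partial>lambda_D) = (\<integral>x. g y * (abm_density t y x * f x) \<partial>lambda_D)"
      by (intro Bochner_Integration.integral_cong) (auto simp: abm_density_commute[of t _ y])
    thus "(\<integral>x. abm_density t x y * g y * f x \<partial>lambda_D) = g y * abm_semigroup t f y"
      using t by (simp add: abm_semigroup_pos)
  qed
  also have "\<dots> = inner (L2_class g) (L2_class (abm_semigroup t f))"
    by (simp add: inner_L2_class g abm_semigroup_sq[OF less_imp_le[OF t] f])
  finally show ?thesis .
qed (simp add: abm_semigroup_0)

text \<open>For positive x both kernels are nonnegative on \<open>D\<close>, so Chapman-Kolmogorov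
  also computes the integral of the absolute value and thereby justifies Fubini.\<close>

lemma abm_semigroup_add:
  assumes s: "s \<ge> 0" and t: "t \<ge> 0" and f: "square_integrable lambda_D f" and x: "x > 0"
  shows "abm_semigroup s (abm_semigroup t f) x = abm_semigroup (s + t) f x"
proof -
  consider "s = 0" | "t = 0" | "s > 0" "t > 0" using s t by linarith
  thus ?thesis
  proof cases
    case 3
    note s = 3(1) and t = 3(2)
    have [measurable]: "f \<in> borel_measurable lambda_D" using f by (simp add: square_integrable_def)
    note [measurable] = id_measurable_lambda_D
    interpret P: pair_sigma_finite lambda_D lambda_D by (simp add: pair_sigma_finite_def sigma_finite_lambda_D)
    have i: "integrable (lambda_D \<Otimes>\<^sub>M lambda_D) (\<lambda>(y, z). abm_density s x y * abm_density t y z * f z)"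
    proof (rule integrableI_bounded)
      show "(\<lambda>(y, z). abm_density s x y * abm_density t y z * f z) \<in> borel_measurable (lambda_D \<Otimes>\<^sub>M lambda_D)" by measurable
      have "(\<integral>\<^sup>+p. ennreal (norm (case p of (y, z) \<Rightarrow> abm_density s x y * abm_density t y z * f z)) \<partial>(lambda_D \<Otimes>\<^sub>M lambda_D))
        = (\<integral>\<^sup>+z. (\<integral>\<^sup>+y. ennreal (norm (abm_density s x y * abm_density t y z * f z)) \<partial>lambda_D) \<partial>lambda_D)"
        by (subst P.nn_integral_snd[symmetric]) (auto simp: case_prod_beta')
      also have "\<dots> = (\<integral>\<^sup>+z. ennreal (norm (abm_density (s + t) x z * f z)) \<partial>lambda_D)"
      proof (rule nn_integral_cong)
        fix z assume "z \<in> space lambda_D"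
        hence z: "z > 0" by simp
        note ck = abm_chapman_kolmogorov[OF s t, of x z]
        have "(\<integral>\<^sup>+y. ennreal (norm (abm_density s x y * abm_density t y z * f z)) \<partial>lambda_D)
          = (\<integral>\<^sup>+y. ennreal (\<bar>f z\<bar> * (abm_density s x y * abm_density t y z)) \<partial>lambda_D)"
          using abm_density_nonneg[OF s x] abm_density_nonneg[OF t _ z]
          by (intro nn_integral_cong) (auto simp: abs_mult mult_ac)
        also have "\<dots> = ennreal (\<integral>y. \<bar>f z\<bar> * (abm_density s x y * abm_density t y z) \<partial>lambda_D)"
          using ck abm_density_nonneg[OF s x] abm_density_nonneg[OF t _ z]
          by (intro nn_integral_eq_integral integrable_mult_right AE_I2) auto
        also have "\<dots> = ennreal (norm (abm_density (s + t) x z * f z))"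
          using ck(2) abm_density_nonneg[of "s + t" x z] x z s t by (simp add: abs_mult mult.commute)
        finally show "(\<integral>\<^sup>+y. ennreal (norm (abm_density s x y * abm_density t y z * f z)) \<partial>lambda_D) = ennreal (norm (abm_density (s + t) x z * f z))" .
      qed
      also have "\<dots> < \<infinity>"
        using abm_semigroup_integrable[of "s + t" f x] s t f by (simp add: integrable_iff_bounded)
      finally show "(\<integral>\<^sup>+p. ennreal (norm (case p of (y, z) \<Rightarrow> abm_density s x y * abm_density t y z * f z)) \<partial>(lambda_D \<Otimes>\<^sub>M lambda_D)) < \<infinity>" .
    qed
    have "abm_semigroup s (abm_semigroup t f) x = (\<integral>y. (\<integral>z. abm_density s x y * abm_density t y z * f z \<partial>lambda_D) \<partial>lambda_D)"
      using s t by (simp add: abm_semigroup_pos mult.assoc)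
    also have "\<dots> = (\<integral>z. (\<integral>y. abm_density s x y * abm_density t y z * f z \<partial>lambda_D) \<partial>lambda_D)"
      using P.Fubini_integral[of "\<lambda>y z. abm_density s x y * abm_density t y z * f z"] i by simp
    also have "\<dots> = (\<integral>z. abm_density (s + t) x z * f z \<partial>lambda_D)"
      using abm_chapman_kolmogorov[OF s t] by simp
    finally show ?thesis using s t by (simp add: abm_semigroup_pos)
  qed (simp_all add: abm_semigroup_0)
qed

section \<open>The intensity measures\<close>

lemma sigma_finite_time_measure: "sigma_finite_measure time_measure"
  unfolding time_measure_def by (rule sigma_finite_measure_restrict_space) (auto intro: lborel.sigma_finite_measure_axioms)

interpretation time_measure: sigma_finite_measure time_measure by (rule sigma_finite_time_measure)

lemma space_time_measure [simp]: "space time_measure = {0..}"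
  by (simp add: time_measure_def space_restrict_space)

lemma id_measurable_time_measure: "(\<lambda>s. s) \<in> borel_measurable time_measure"
  by (simp add: time_measure_def measurable_restrict_space1)

text \<open>An identity for iterated integrals of nonnegative functions extends to integrable ones
  by positive and negative parts. Through the complex form it serves the jump intensity, whose
  kernel measures may be infinite, as well as measures composed by \<open>bind\<close>;
  integrability of every section is assumed in place of finiteness of the kernel.\<close>

lemma has_integral_kernel_real:
  fixes h :: "'q \<Rightarrow> real"
  assumes nn: "\<And>g. g \<in> borel_measurable Q \<Longrightarrow> (\<integral>\<^sup>+q. g q \<partial>J) = (\<integral>\<^sup>+p. (\<integral>\<^sup>+u. g (k p u) \<partial>\<mu> p) \<partial>P)"
    and meas: "\<And>g. g \<in> borel_measurable Q \<Longrightarrow> (\<lambda>p. \<integral>\<^sup>+u. g (k p u) \<partial>\<mu> p) \<in> borel_measurable P"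
    and J: "sets J = sets Q" and h: "integrable J h" and sec: "\<And>p. p \<in> space P \<Longrightarrow> integrable (\<mu> p) (\<lambda>u. h (k p u))"
  shows "integrable P (\<lambda>p. \<integral>u. h (k p u) \<partial>\<mu> p)" "(\<integral>q. h q \<partial>J) = (\<integral>p. (\<integral>u. h (k p u) \<partial>\<mu> p) \<partial>P)"
proof -
  have hm: "h \<in> borel_measurable Q" using h measurable_cong_sets[OF J refl] by blast
  have key: "integrable P (\<lambda>p. enn2real (\<integral>\<^sup>+u. ennreal (g (k p u)) \<partial>\<mu> p))
     \<and> (\<integral>p. enn2real (\<integral>\<^sup>+u. ennreal (g (k p u)) \<partial>\<mu> p) \<partial>P) = enn2real (\<integral>\<^sup>+q. ennreal (g q) \<partial>J)"
    if g[measurable]: "g \<in> borel_measurable Q" and gi: "integrable J g" and gs: "\<And>p. p \<in> space P \<Longrightarrow> integrable (\<mu> p) (\<lambda>u. g (k p u))" for g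
  proof -
    have gm: "(\<lambda>q. ennreal (g q)) \<in> borel_measurable Q" by measurable
    have "(\<integral>\<^sup>+u. ennreal (g (k p u)) \<partial>\<mu> p) < \<infinity>" if "p \<in> space P" for p
      using gs[OF that] by (simp add: real_integrable_def less_top)
    hence e: "(\<integral>\<^sup>+p. ennreal (enn2real (\<integral>\<^sup>+u. ennreal (g (k p u)) \<partial>\<mu> p)) \<partial>P) = (\<integral>\<^sup>+q. ennreal (g q) \<partial>J)"
      unfolding nn[OF gm] by (intro nn_integral_cong) auto
    have fin: "(\<integral>\<^sup>+q. ennreal (g q) \<partial>J) < \<infinity>" using gi by (simp add: real_integrable_def less_top)
    have m: "(\<lambda>p. enn2real (\<integral>\<^sup>+u. ennreal (g (k p u)) \<partial>\<mu> p)) \<in> borel_measurable P"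
      using meas[OF gm] by (rule borel_measurable_enn2real)
    show ?thesis
      using m e fin by (auto simp: integral_eq_nn_integral intro!: integrableI_nonneg)
  qed
  have 1: "(\<integral>u. h (k p u) \<partial>\<mu> p) = enn2real (\<integral>\<^sup>+u. ennreal (h (k p u)) \<partial>\<mu> p) - enn2real (\<integral>\<^sup>+u. ennreal (- h (k p u)) \<partial>\<mu> p)"
    if "p \<in> space P" for p by (rule real_lebesgue_integral_def[OF sec[OF that]])
  have k1: "integrable P (\<lambda>p. enn2real (\<integral>\<^sup>+u. ennreal (h (k p u)) \<partial>\<mu> p))"
    "(\<integral>p. enn2real (\<integral>\<^sup>+u. ennreal (h (k p u)) \<partial>\<mu> p) \<partial>P) = enn2real (\<integral>\<^sup>+q. ennreal (h q) \<partial>J)"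
    using key[OF hm h sec] by auto
  have k2: "integrable P (\<lambda>p. enn2real (\<integral>\<^sup>+u. ennreal (- h (k p u)) \<partial>\<mu> p))"
    "(\<integral>p. enn2real (\<integral>\<^sup>+u. ennreal (- h (k p u)) \<partial>\<mu> p) \<partial>P) = enn2real (\<integral>\<^sup>+q. ennreal (- h q) \<partial>J)"
    using key[of "\<lambda>q. - h q"] hm h sec by auto
  show "integrable P (\<lambda>p. \<integral>u. h (k p u) \<partial>\<mu> p)"
    using Bochner_Integration.integrable_diff[OF k1(1) k2(1)] by (subst Bochner_Integration.integrable_cong[OF refl 1])
  have "(\<integral>p. (\<integral>u. h (k p u) \<partial>\<mu> p) \<partial>P) = (\<integral>p. enn2real (\<integral>\<^sup>+u. ennreal (h (k p u)) \<partial>\<mu> p) - enn2real (\<integral>\<^sup>+u. ennreal (- h (k p u)) \<partial>\<mu> p) \<partial>P)"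
    by (intro Bochner_Integration.integral_cong 1 refl)
  also have "\<dots> = (\<integral>q. h q \<partial>J)"
    using k1 k2 by (simp add: real_lebesgue_integral_def[OF h])
  finally show "(\<integral>q. h q \<partial>J) = (\<integral>p. (\<integral>u. h (k p u) \<partial>\<mu> p) \<partial>P)" by simp
qed

lemma has_integral_kernel_complex:
  fixes h :: "'q \<Rightarrow> complex"
  assumes nn: "\<And>g. g \<in> borel_measurable Q \<Longrightarrow> (\<integral>\<^sup>+q. g q \<partial>J) = (\<integral>\<^sup>+p. (\<integral>\<^sup>+u. g (k p u) \<partial>\<mu> p) \<partial>P)"
    and meas: "\<And>g. g \<in> borel_measurable Q \<Longrightarrow> (\<lambda>p. \<integral>\<^sup>+u. g (k p u) \<partial>\<mu> p) \<in> borel_measurable P"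
    and J: "sets J = sets Q" and h: "integrable J h" and sec: "\<And>p. p \<in> space P \<Longrightarrow> integrable (\<mu> p) (\<lambda>u. h (k p u))"
  shows "integrable P (\<lambda>p. \<integral>u. h (k p u) \<partial>\<mu> p)" "(\<integral>q. h q \<partial>J) = (\<integral>p. (\<integral>u. h (k p u) \<partial>\<mu> p) \<partial>P)"
proof -
  note R = has_integral_kernel_real[where Q=Q and J=J and k=k and \<mu>=\<mu> and P=P and h="\<lambda>q. Re (h q)", OF nn meas J]
  note I = has_integral_kernel_real[where Q=Q and J=J and k=k and \<mu>=\<mu> and P=P and h="\<lambda>q. Im (h q)", OF nn meas J]
  have r: "integrable P (\<lambda>p. Re (\<integral>u. h (k p u) \<partial>\<mu> p))" "(\<integral>q. Re (h q) \<partial>J) = (\<integral>p. Re (\<integral>u. h (k p u) \<partial>\<mu> p) \<partial>P)"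
  proof -
    have e: "Re (\<integral>u. h (k p u) \<partial>\<mu> p) = (\<integral>u. Re (h (k p u)) \<partial>\<mu> p)" if "p \<in> space P" for p
      using sec[OF that] by simp
    have ii: "integrable P (\<lambda>p. \<integral>u. Re (h (k p u)) \<partial>\<mu> p)" "(\<integral>q. Re (h q) \<partial>J) = (\<integral>p. (\<integral>u. Re (h (k p u)) \<partial>\<mu> p) \<partial>P)"
      by (rule R, assumption, assumption, rule integrable_Re[OF h], erule integrable_Re[OF sec])+
    show "integrable P (\<lambda>p. Re (\<integral>u. h (k p u) \<partial>\<mu> p))"
      using ii(1) by (rule Bochner_Integration.integrable_cong[OF refl, THEN iffD1, rotated -1]) (simp only: e)
    show "(\<integral>q. Re (h q) \<partial>J) = (\<integral>p. Re (\<integral>u. h (k p u) \<partial>\<mu> p) \<partial>P)"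
      unfolding ii(2) by (rule Bochner_Integration.integral_cong[OF refl]) (simp only: e)
  qed
  have i: "integrable P (\<lambda>p. Im (\<integral>u. h (k p u) \<partial>\<mu> p))" "(\<integral>q. Im (h q) \<partial>J) = (\<integral>p. Im (\<integral>u. h (k p u) \<partial>\<mu> p) \<partial>P)"
  proof -
    have e: "Im (\<integral>u. h (k p u) \<partial>\<mu> p) = (\<integral>u. Im (h (k p u)) \<partial>\<mu> p)" if "p \<in> space P" for p
      using sec[OF that] by simp
    have ii: "integrable P (\<lambda>p. \<integral>u. Im (h (k p u)) \<partial>\<mu> p)" "(\<integral>q. Im (h q) \<partial>J) = (\<integral>p. (\<integral>u. Im (h (k p u)) \<partial>\<mu> p) \<partial>P)"
      by (rule I, assumption, assumption, rule integrable_Im[OF h], erule integrable_Im[OF sec])+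
    show "integrable P (\<lambda>p. Im (\<integral>u. h (k p u) \<partial>\<mu> p))"
      using ii(1) by (rule Bochner_Integration.integrable_cong[OF refl, THEN iffD1, rotated -1]) (simp only: e)
    show "(\<integral>q. Im (h q) \<partial>J) = (\<integral>p. Im (\<integral>u. h (k p u) \<partial>\<mu> p) \<partial>P)"
      unfolding ii(2) by (rule Bochner_Integration.integral_cong[OF refl]) (simp only: e)
  qed
  show int: "integrable P (\<lambda>p. \<integral>u. h (k p u) \<partial>\<mu> p)"
  proof -
    have "integrable P (\<lambda>p. complex_of_real (Re (\<integral>u. h (k p u) \<partial>\<mu> p)) + \<i> * complex_of_real (Im (\<integral>u. h (k p u) \<partial>\<mu> p)))"
      using r(1) i(1) by (intro Bochner_Integration.integrable_add integrable_mult_right integrable_of_real)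
    thus ?thesis by (simp flip: complex_eq)
  qed
  show "(\<integral>q. h q \<partial>J) = (\<integral>p. (\<integral>u. h (k p u) \<partial>\<mu> p) \<partial>P)"
    using r(2) i(2) h int by (intro complex_eqI) simp_all
qed

section \<open>The kernel m and the two control measures\<close>

locale coefficients =
  fixes \<eta> :: "real measure" and c :: "real \<Rightarrow> real" and m :: "real \<Rightarrow> real measure"
  assumes sets_eta: "sets \<eta> = sets (restrict_space borel {0<..})" and finite_eta: "finite_measure \<eta>"
    and c_meas: "c \<in> borel_measurable (restrict_space borel {0<..})"
    and c_nonneg: "\<And>x. x > 0 \<Longrightarrow> c x \<ge> 0" and c_bound: "\<exists>K. \<forall>x>0. c x \<le> K"
    and kernel: "square_bounded_kernel m"
begin

abbreviation U :: "real measure" where "U \<equiv> restrict_space borel (- {0})"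

abbreviation TE :: "(real \<times> real) measure" where "TE \<equiv> time_measure \<Otimes>\<^sub>M \<eta>"

abbreviation Q :: "(real \<times> real \<times> real) measure" where "Q \<equiv> time_measure \<Otimes>\<^sub>M (U \<Otimes>\<^sub>M \<eta>)"

abbreviation S1 where "S1 \<equiv> noise_covariance c \<eta>"

abbreviation S2 where "S2 \<equiv> jump_intensity m \<eta>"

sublocale eta: finite_measure \<eta> by (rule finite_eta)

sublocale TE: pair_sigma_finite time_measure \<eta>
  by (simp add: pair_sigma_finite_def sigma_finite_time_measure eta.sigma_finite_measure_axioms)

lemma space_eta [simp]: "space \<eta> = {0<..}"
  using sets_eq_imp_space_eq[OF sets_eta] by (simp add: space_restrict_space)

lemma c_meas_eta [measurable]: "c \<in> borel_measurable \<eta>"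
  using c_meas measurable_cong_sets[OF sets_eta refl] by blast

lemma id_measurable_eta [measurable]: "(\<lambda>x. x) \<in> borel_measurable \<eta>"
  unfolding measurable_cong_sets[OF sets_eta refl] by (rule measurable_restrict_space1) simp

lemma id_measurable_U [measurable]: "(\<lambda>x. x) \<in> borel_measurable U"
  by (rule measurable_restrict_space1) simp

lemma space_U [simp]: "space U = - {0}" by (simp add: space_restrict_space)

lemma sets_m: "x > 0 \<Longrightarrow> sets (m x) = sets U"
  using kernel by (simp add: square_bounded_kernel_def)

lemma space_m: "x > 0 \<Longrightarrow> space (m x) = - {0}"
  using sets_eq_imp_space_eq[OF sets_m] by simp

lemma m_kernel: "B \<in> sets U \<Longrightarrow> (\<lambda>x. emeasure (m x) B) \<in> borel_measurable \<eta>"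
  unfolding measurable_cong_sets[OF sets_eta refl] using kernel by (simp add: square_bounded_kernel_def)

text \<open>The maximum with 1 makes \<open>K\<close> positive, as needed to divide by it in the
  normalised kernel \<kappa>.\<close>

definition K :: real where
  "K = max 1 (SOME K. \<forall>x>0. (\<integral>\<^sup>+u. ennreal (u\<^sup>2) \<partial>m x) \<le> ennreal K)"

lemma K: "K \<ge> 1" "x > 0 \<Longrightarrow> (\<integral>\<^sup>+u. ennreal (u\<^sup>2) \<partial>m x) \<le> ennreal K"
proof -
  have "\<exists>K. \<forall>x>0. (\<integral>\<^sup>+u. ennreal (u\<^sup>2) \<partial>m x) \<le> ennreal K"
    using kernel by (simp add: square_bounded_kernel_def)
  from someI_ex[OF this] show "x > 0 \<Longrightarrow> (\<integral>\<^sup>+u. ennreal (u\<^sup>2) \<partial>m x) \<le> ennreal K"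
    unfolding K_def by (meson ennreal_leI max.cobounded2 order_trans)
qed (simp add: K_def)

definition Kc :: real where "Kc = max 1 (SOME K. \<forall>x>0. c x \<le> K)"

lemma Kc: "Kc \<ge> 1" "x > 0 \<Longrightarrow> c x \<le> Kc"
  using someI_ex[OF c_bound] unfolding Kc_def by (auto simp: le_max_iff_disj)

lemma m_meas: "x > 0 \<Longrightarrow> f \<in> borel_measurable U \<Longrightarrow> f \<in> borel_measurable (m x)"
  by (simp only: measurable_cong_sets[OF sets_m refl])

lemma square_measurable_m: "x > 0 \<Longrightarrow> (\<lambda>u. ennreal (u\<^sup>2)) \<in> borel_measurable (m x)"
  by (rule m_meas) measurable

lemma eta_cong:
  assumes "\<And>x. x > 0 \<Longrightarrow> f x = g x" "g \<in> borel_measurable \<eta>"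
  shows "f \<in> borel_measurable \<eta>"
proof -
  show ?thesis using assms(2)
    by (rule measurable_cong[THEN iffD1, rotated -1]) (simp add: assms(1))
qed

text \<open>A direct monotone class argument, since m x may be infinite and then does not belong to
  \<open>subprob_algebra\<close>.\<close>

lemma m_nn_measurable:
  assumes "g \<in> borel_measurable U"
  shows "(\<lambda>x. \<integral>\<^sup>+u. g u \<partial>m x) \<in> borel_measurable \<eta>"
  using assms
proof (induct rule: borel_measurable_induct)
  case (cong f g)
  show ?case
    by (rule eta_cong[OF _ cong(4)]) (use cong(3) in \<open>auto intro!: nn_integral_cong simp: space_m\<close>)
next
  case (set A)
  show ?case
    by (rule eta_cong[OF _ m_kernel[OF set]]) (use set in \<open>simp add: sets_m\<close>)
next
  case (mult f a)
  show ?case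
    by (rule eta_cong[where g="\<lambda>x. a * (\<integral>\<^sup>+u. f u \<partial>m x)"])
       (use mult in \<open>auto intro!: nn_integral_cmult m_meas\<close>)
next
  case (add f g)
  show ?case
    by (rule eta_cong[where g="\<lambda>x. (\<integral>\<^sup>+u. g u \<partial>m x) + (\<integral>\<^sup>+u. f u \<partial>m x)"])
       (use add in \<open>auto intro!: nn_integral_add m_meas\<close>)
next
  case (seq F)
  show ?case
  proof (rule eta_cong[where g="\<lambda>x. SUP i. \<integral>\<^sup>+u. F i u \<partial>m x"])
    fix x :: real assume "x > 0"
    thus "(\<integral>\<^sup>+u. (SUP i. F i) u \<partial>m x) = (SUP i. \<integral>\<^sup>+u. F i u \<partial>m x)"
      unfolding SUP_apply using seq by (intro nn_integral_monotone_convergence_SUP m_meas) auto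
  qed (use seq in \<open>intro borel_measurable_SUP, auto\<close>)
qed

text \<open>The measures \<open>m x\<close> may be infinite; \<open>\<kappa>\<close> is an equivalent subprobability kernel, to which the
  measurability theorems for kernels apply.\<close>

definition \<kappa> :: "real \<Rightarrow> real measure" where
  "\<kappa> x = density (m x) (\<lambda>u. ennreal (u\<^sup>2 / K))"

lemma \<kappa>_nn:
  assumes x: "x > 0" and [measurable]: "g \<in> borel_measurable U"
  shows "(\<integral>\<^sup>+u. g u \<partial>\<kappa> x) = (\<integral>\<^sup>+u. ennreal (u\<^sup>2 / K) * g u \<partial>m x)"
  unfolding \<kappa>_def by (rule nn_integral_density; rule m_meas[OF x]) measurable

lemma m_nn_kappa:
  assumes x: "x > 0" and g[measurable]: "g \<in> borel_measurable U"
  shows "(\<integral>\<^sup>+u. g u \<partial>m x) = (\<integral>\<^sup>+u. ennreal (K / u\<^sup>2) * g u \<partial>\<kappa> x)"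
proof -
  have "(\<integral>\<^sup>+u. ennreal (K / u\<^sup>2) * g u \<partial>\<kappa> x) = (\<integral>\<^sup>+u. ennreal (u\<^sup>2 / K) * (ennreal (K / u\<^sup>2) * g u) \<partial>m x)"
    by (rule \<kappa>_nn[OF x]) measurable
  also have "\<dots> = (\<integral>\<^sup>+u. g u \<partial>m x)"
  proof (rule nn_integral_cong)
    fix u assume "u \<in> space (m x)"
    hence "u \<noteq> 0" using x by (simp add: space_m)
    hence "ennreal (u\<^sup>2 / K) * ennreal (K / u\<^sup>2) = 1" using K(1) by (simp flip: ennreal_mult'')
    thus "ennreal (u\<^sup>2 / K) * (ennreal (K / u\<^sup>2) * g u) = g u" by (simp flip: mult.assoc)
  qed
  finally show ?thesis by simp
qed

lemma \<kappa>_measurable [measurable]: "\<kappa> \<in> measurable \<eta> (subprob_algebra U)"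
proof (rule measurable_subprob_algebra)
  fix x assume "x \<in> space \<eta>"
  hence x: "x > 0" by simp
  show s: "sets (\<kappa> x) = sets U" using x by (simp add: \<kappa>_def sets_m)
  show "subprob_space (\<kappa> x)"
  proof (rule subprob_spaceI)
    have "emeasure (\<kappa> x) (space (\<kappa> x)) = (\<integral>\<^sup>+u. 1 \<partial>\<kappa> x)" by simp
    also have "\<dots> = (\<integral>\<^sup>+u. ennreal (1 / K) * ennreal (u\<^sup>2) \<partial>m x)"
      using K(1) by (subst \<kappa>_nn[OF x]) (auto simp flip: ennreal_mult'')
    also have "\<dots> = ennreal (1 / K) * (\<integral>\<^sup>+u. ennreal (u\<^sup>2) \<partial>m x)"
      by (rule nn_integral_cmult[OF square_measurable_m[OF x]])
    also have "\<dots> \<le> ennreal (1 / K) * ennreal K" using K(2)[OF x] by (intro mult_left_mono) auto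
    also have "\<dots> = 1" using K(1) by (simp flip: ennreal_mult'')
    finally show "emeasure (\<kappa> x) (space (\<kappa> x)) \<le> 1" .
    show "space (\<kappa> x) \<noteq> {}" using x by (auto simp: \<kappa>_def space_m intro!: exI[of _ "1::real"])
  qed
next
  fix A assume A[measurable]: "A \<in> sets U"
  have e: "emeasure (\<kappa> x) A = (\<integral>\<^sup>+u. ennreal (u\<^sup>2 / K) * indicator A u \<partial>m x)" if "x > 0" for x
    using \<kappa>_nn[of x "indicator A"] that A by (simp add: \<kappa>_def sets_m)
  have "(\<lambda>x. \<integral>\<^sup>+u. ennreal (u\<^sup>2 / K) * indicator A u \<partial>m x) \<in> borel_measurable \<eta>"
    by (rule m_nn_measurable) measurable
  thus "(\<lambda>x. emeasure (\<kappa> x) A) \<in> borel_measurable \<eta>" by (rule eta_cong[rotated]) (rule e)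
qed

text \<open>The density K / u^2 recovers m from \<kappa>, which reduces the claim to a
  subprobability kernel.\<close>

lemma m_param_measurable:
  assumes h[measurable]: "(\<lambda>(p, u). h p u) \<in> borel_measurable (L \<Otimes>\<^sub>M U)" and k[measurable]: "k \<in> measurable L \<eta>"
  shows "(\<lambda>p. \<integral>\<^sup>+u. h p u \<partial>m (k p)) \<in> borel_measurable L"
proof -
  have 1: "(\<lambda>p. \<integral>\<^sup>+u. ennreal (K / u\<^sup>2) * h p u \<partial>\<kappa> (k p)) \<in> borel_measurable L"
    by (rule nn_integral_measurable_subprob_algebra2[where N=U]) measurable
  have e: "(\<integral>\<^sup>+u. h p u \<partial>m (k p)) = (\<integral>\<^sup>+u. ennreal (K / u\<^sup>2) * h p u \<partial>\<kappa> (k p))" if "p \<in> space L" for p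
    using measurable_space[OF k that] measurable_Pair2[OF h that] by (intro m_nn_kappa) auto
  from 1 show ?thesis
    by (rule measurable_cong[THEN iffD1, rotated -1]) (simp add: e)
qed

text \<open>Chebyshev's inequality, uniform in x. The bands exhaust the punctured line and serve the
  sigma-finiteness of both m x and \<open>S2\<close>.\<close>

lemma m_band_finite:
  assumes x: "x > 0"
  shows "emeasure (m x) {u \<in> space U. u\<^sup>2 \<ge> 1 / real (Suc n)} \<le> ennreal (real (Suc n) * K)"
proof -
  let ?A = "{u \<in> space U. u\<^sup>2 \<ge> 1 / real (Suc n)}"
  have A[measurable]: "?A \<in> sets U" by measurable
  hence "emeasure (m x) ?A = (\<integral>\<^sup>+u. indicator ?A u \<partial>m x)" using x by (simp add: sets_m)
  also have "\<dots> \<le> (\<integral>\<^sup>+u. ennreal (real (Suc n)) * ennreal (u\<^sup>2) \<partial>m x)"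
  proof (rule nn_integral_mono)
    fix u
    show "indicator ?A u \<le> ennreal (real (Suc n)) * ennreal (u\<^sup>2)"
      by (auto simp: indicator_def field_simps ennreal_mult''[symmetric] simp del: of_nat_Suc)
  qed
  also have "\<dots> = ennreal (real (Suc n)) * (\<integral>\<^sup>+u. ennreal (u\<^sup>2) \<partial>m x)"
    by (rule nn_integral_cmult[OF square_measurable_m[OF x]])
  also have "\<dots> \<le> ennreal (real (Suc n)) * ennreal K" using K(2)[OF x] by (intro mult_left_mono) auto
  finally show ?thesis using K(1) by (simp add: ennreal_mult'' del: of_nat_Suc)
qed

lemma band_cover:
  assumes "u \<noteq> (0::real)" shows "\<exists>n. u\<^sup>2 \<ge> 1 / real (Suc n)"
proof -
  have "u\<^sup>2 > 0" using assms by simp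
  then obtain n where "1 / real (Suc n) < u\<^sup>2" using nat_approx_posE by blast
  thus ?thesis by (auto intro: less_imp_le)
qed

lemma sigma_finite_m:
  assumes x: "x > 0" shows "sigma_finite_measure (m x)"
proof
  show "\<exists>A. countable A \<and> A \<subseteq> sets (m x) \<and> \<Union>A = space (m x) \<and> (\<forall>a\<in>A. emeasure (m x) a \<noteq> \<infinity>)"
  proof (intro exI[of _ "range (\<lambda>n. {u \<in> space U. u\<^sup>2 \<ge> 1 / real (Suc n)})"] conjI)
    show "range (\<lambda>n. {u \<in> space U. u\<^sup>2 \<ge> 1 / real (Suc n)}) \<subseteq> sets (m x)"
      unfolding sets_m[OF x] by (rule image_subsetI) measurable
    show "\<Union>(range (\<lambda>n. {u \<in> space U. u\<^sup>2 \<ge> 1 / real (Suc n)})) = space (m x)"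
      using band_cover by (auto simp: space_m[OF x] simp del: of_nat_Suc)
    have "emeasure (m x) {u \<in> space U. u\<^sup>2 \<ge> 1 / real (Suc n)} \<noteq> \<infinity>" for n
    proof -
      have "emeasure (m x) {u \<in> space U. u\<^sup>2 \<ge> 1 / real (Suc n)} < \<infinity>"
        using m_band_finite[OF x, of n] by (rule le_less_trans) simp
      thus ?thesis by simp
    qed
    thus "\<forall>a\<in>range (\<lambda>n. {u \<in> space U. u\<^sup>2 \<ge> 1 / real (Suc n)}). emeasure (m x) a \<noteq> \<infinity>" by blast
  qed auto
qed

text \<open>The iterated integral in the order used by \<open>jump_intensity\<close>. It is studied
  as a functional first, because \<open>measure_of\<close> yields the intended measure only once
  countable additivity is known.\<close>

definition jump_nn_integral :: "(real \<times> real \<times> real \<Rightarrow> ennreal) \<Rightarrow> ennreal" where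
  "jump_nn_integral h = (\<integral>\<^sup>+x. (\<integral>\<^sup>+u. (\<integral>\<^sup>+s. h (s, u, x) \<partial>time_measure) \<partial>m x) \<partial>\<eta>)"

lemma jump_nn_integral_measurable:
  assumes [measurable]: "h \<in> borel_measurable Q"
  shows "x > 0 \<Longrightarrow> u \<noteq> 0 \<Longrightarrow> (\<lambda>s. h (s, u, x)) \<in> borel_measurable time_measure"
    and "x > 0 \<Longrightarrow> (\<lambda>u. \<integral>\<^sup>+s. h (s, u, x) \<partial>time_measure) \<in> borel_measurable (m x)"
    and "(\<lambda>x. \<integral>\<^sup>+u. (\<integral>\<^sup>+s. h (s, u, x) \<partial>time_measure) \<partial>m x) \<in> borel_measurable \<eta>"
    and "x > 0 \<Longrightarrow> (\<lambda>(s, u). h (s, u, x)) \<in> borel_measurable (time_measure \<Otimes>\<^sub>M U)"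
proof -
  { assume "x > 0"
    hence x: "x \<in> space \<eta>" by simp
    have "(\<lambda>(s, u). h (s, u, x)) \<in> borel_measurable (time_measure \<Otimes>\<^sub>M U)" using x by measurable
  } note 1 = this
  thus "x > 0 \<Longrightarrow> (\<lambda>(s, u). h (s, u, x)) \<in> borel_measurable (time_measure \<Otimes>\<^sub>M U)" .
  show "(\<lambda>s. h (s, u, x)) \<in> borel_measurable time_measure" if "x > 0" "u \<noteq> 0"
  proof -
    have "x \<in> space \<eta>" "u \<in> space U" using that by simp_all
    thus ?thesis by measurable
  qed
  have 2: "(\<lambda>(x, u). \<integral>\<^sup>+s. h (s, u, x) \<partial>time_measure) \<in> borel_measurable (\<eta> \<Otimes>\<^sub>M U)"
    unfolding case_prod_beta' by (rule time_measure.borel_measurable_nn_integral) measurable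
  show "x > 0 \<Longrightarrow> (\<lambda>u. \<integral>\<^sup>+s. h (s, u, x) \<partial>time_measure) \<in> borel_measurable (m x)"
    using measurable_Pair2[OF 2, of x] by (intro m_meas) auto
  show "(\<lambda>x. \<integral>\<^sup>+u. (\<integral>\<^sup>+s. h (s, u, x) \<partial>time_measure) \<partial>m x) \<in> borel_measurable \<eta>"
    by (rule m_param_measurable[OF 2]) simp
qed

lemma jump_nn_integral_cong:
  assumes "\<And>q. q \<in> space Q \<Longrightarrow> f q = g q"
  shows "jump_nn_integral f = jump_nn_integral g"
  unfolding jump_nn_integral_def
proof (intro nn_integral_cong)
  fix x u s assume "x \<in> space \<eta>" "u \<in> space (m x)" "s \<in> space time_measure"
  thus "f (s, u, x) = g (s, u, x)" by (intro assms) (auto simp: space_pair_measure space_m)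
qed

lemma jump_nn_integral_suminf:
  assumes [measurable]: "\<And>i. h i \<in> borel_measurable Q"
  shows "jump_nn_integral (\<lambda>q. \<Sum>i. h i q) = (\<Sum>i. jump_nn_integral (h i))"
proof -
  note M = jump_nn_integral_measurable[OF assms]
  have "jump_nn_integral (\<lambda>q. \<Sum>i. h i q) = (\<integral>\<^sup>+x. (\<integral>\<^sup>+u. (\<Sum>i. \<integral>\<^sup>+s. h i (s, u, x) \<partial>time_measure) \<partial>m x) \<partial>\<eta>)"
    unfolding jump_nn_integral_def using M(1) by (intro nn_integral_cong nn_integral_suminf) (auto simp: space_m)
  also have "\<dots> = (\<integral>\<^sup>+x. (\<Sum>i. \<integral>\<^sup>+u. (\<integral>\<^sup>+s. h i (s, u, x) \<partial>time_measure) \<partial>m x) \<partial>\<eta>)"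
    using M(2) by (intro nn_integral_cong nn_integral_suminf) auto
  also have "\<dots> = (\<Sum>i. jump_nn_integral (h i))"
    unfolding jump_nn_integral_def using M(3) by (intro nn_integral_suminf) auto
  finally show ?thesis .
qed

lemma sets_Q: "sets Q = sets (time_measure \<Otimes>\<^sub>M (U \<Otimes>\<^sub>M restrict_space borel {0<..}))"
  by (intro sets_pair_measure_cong refl sets_eta)

lemma space_Q: "space Q = {0..} \<times> (- {0}) \<times> {0<..}"
  by (simp add: space_pair_measure)

lemma jump_intensity_Q: "S2 = measure_of (space Q) (sets Q) (\<lambda>A. jump_nn_integral (indicator A))"
  unfolding jump_intensity_def space_Q sets_Q[symmetric] jump_nn_integral_def ..

lemma sets_S2: "sets S2 = sets Q"
  unfolding jump_intensity_Q by (simp add: sets.space_closed sets.sigma_sets_eq)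

lemma S2_meas: "f \<in> borel_measurable Q \<Longrightarrow> f \<in> borel_measurable S2"
  by (simp only: measurable_cong_sets[OF sets_S2 refl])

lemma emeasure_S2:
  assumes A: "A \<in> sets Q" shows "emeasure S2 A = jump_nn_integral (indicator A)"
proof (rule emeasure_measure_of[OF jump_intensity_Q sets.space_closed])
  show "positive (sets S2) (\<lambda>A. jump_nn_integral (indicator A))" by (simp add: positive_def jump_nn_integral_def)
  show "countably_additive (sets S2) (\<lambda>A. jump_nn_integral (indicator A))"
  proof (rule countably_additiveI)
    fix A :: "nat \<Rightarrow> (real \<times> real \<times> real) set"
    assume A: "range A \<subseteq> sets S2" "disjoint_family A" "\<Union>(range A) \<in> sets S2"
    have "(\<Sum>i. jump_nn_integral (indicator (A i))) = jump_nn_integral (\<lambda>q. \<Sum>i. indicator (A i) q)"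
      using A(1) by (intro jump_nn_integral_suminf[symmetric] borel_measurable_indicator) (auto simp: sets_S2)
    also have "(\<lambda>q. \<Sum>i. indicator (A i) q :: ennreal) = indicator (\<Union>(range A))"
      using suminf_indicator[OF A(2)] by (simp add: fun_eq_iff)
    finally show "(\<Sum>i. jump_nn_integral (indicator (A i))) = jump_nn_integral (indicator (\<Union>(range A)))" .
  qed
qed (simp add: A sets_S2)

lemma nn_integral_S2:
  assumes "h \<in> borel_measurable Q"
  shows "(\<integral>\<^sup>+q. h q \<partial>S2) = jump_nn_integral h"
  using assms
proof (induct rule: borel_measurable_induct)
  case (cong f g)
  have "(\<integral>\<^sup>+q. f q \<partial>S2) = (\<integral>\<^sup>+q. g q \<partial>S2)"
    using cong(3) sets_eq_imp_space_eq[OF sets_S2] by (intro nn_integral_cong) auto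
  thus ?case using cong(4) jump_nn_integral_cong[of f g] cong(3) by simp
next
  case (set A)
  thus ?case by (simp add: emeasure_S2 sets_S2)
next
  case (mult f a)
  note M = jump_nn_integral_measurable[OF mult(2)]
  have "jump_nn_integral (\<lambda>q. a * f q) = (\<integral>\<^sup>+x. (\<integral>\<^sup>+u. a * (\<integral>\<^sup>+s. f (s, u, x) \<partial>time_measure) \<partial>m x) \<partial>\<eta>)"
    unfolding jump_nn_integral_def using M(1) by (intro nn_integral_cong nn_integral_cmult) (auto simp: space_m)
  also have "\<dots> = (\<integral>\<^sup>+x. a * (\<integral>\<^sup>+u. (\<integral>\<^sup>+s. f (s, u, x) \<partial>time_measure) \<partial>m x) \<partial>\<eta>)"
    using M(2) by (intro nn_integral_cong nn_integral_cmult) auto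
  also have "\<dots> = a * jump_nn_integral f"
    unfolding jump_nn_integral_def by (rule nn_integral_cmult[OF M(3)])
  finally show ?case using nn_integral_cmult[OF S2_meas[OF mult(2)], of a] mult by simp
next
  case (add f g)
  note Mf = jump_nn_integral_measurable[OF add(1)] and Mg = jump_nn_integral_measurable[OF add(4)]
  have "jump_nn_integral (\<lambda>q. g q + f q) = (\<integral>\<^sup>+x. (\<integral>\<^sup>+u. (\<integral>\<^sup>+s. g (s, u, x) \<partial>time_measure) + (\<integral>\<^sup>+s. f (s, u, x) \<partial>time_measure) \<partial>m x) \<partial>\<eta>)"
    unfolding jump_nn_integral_def using Mf(1) Mg(1) by (intro nn_integral_cong nn_integral_add) (auto simp: space_m)
  also have "\<dots> = (\<integral>\<^sup>+x. (\<integral>\<^sup>+u. (\<integral>\<^sup>+s. g (s, u, x) \<partial>time_measure) \<partial>m x) + (\<integral>\<^sup>+u. (\<integral>\<^sup>+s. f (s, u, x) \<partial>time_measure) \<partial>m x) \<partial>\<eta>)"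
    using Mf(2) Mg(2) by (intro nn_integral_cong nn_integral_add) auto
  also have "\<dots> = jump_nn_integral g + jump_nn_integral f"
    unfolding jump_nn_integral_def by (rule nn_integral_add[OF Mg(3) Mf(3)])
  finally show ?case using nn_integral_add[OF S2_meas[OF add(4)] S2_meas[OF add(1)]] add by simp
next
  case (seq F)
  note M = jump_nn_integral_measurable[OF seq(1)]
  have inc: "F i q \<le> F j q" if "i \<le> j" for i j q
    using incseqD[OF \<open>incseq F\<close> that] by (rule le_funD)
  have le: "incseq f" if "\<And>i j q. i \<le> j \<Longrightarrow> f i q \<le> f j q" for f :: "nat \<Rightarrow> real \<Rightarrow> ennreal"
    using that by (intro monoI le_funI) auto
  have 1: "(\<integral>\<^sup>+s. (SUP i. F i (s, u, x)) \<partial>time_measure) = (SUP i. \<integral>\<^sup>+s. F i (s, u, x) \<partial>time_measure)"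
    if "x > 0" "u \<noteq> 0" for u x
    by (rule nn_integral_monotone_convergence_SUP[OF le M(1)[OF that]]) (rule inc)
  have 2: "(\<integral>\<^sup>+u. (SUP i. \<integral>\<^sup>+s. F i (s, u, x) \<partial>time_measure) \<partial>m x) = (SUP i. \<integral>\<^sup>+u. (\<integral>\<^sup>+s. F i (s, u, x) \<partial>time_measure) \<partial>m x)"
    if "x > 0" for x
    by (rule nn_integral_monotone_convergence_SUP[OF le M(2)[OF that]]) (intro nn_integral_mono inc)
  have 3: "(\<integral>\<^sup>+x. (SUP i. \<integral>\<^sup>+u. (\<integral>\<^sup>+s. F i (s, u, x) \<partial>time_measure) \<partial>m x) \<partial>\<eta>) = (SUP i. jump_nn_integral (F i))"
    unfolding jump_nn_integral_def by (rule nn_integral_monotone_convergence_SUP[OF le M(3)]) (intro nn_integral_mono inc)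
  have "jump_nn_integral (SUP i. F i) = (\<integral>\<^sup>+x. (\<integral>\<^sup>+u. (SUP i. \<integral>\<^sup>+s. F i (s, u, x) \<partial>time_measure) \<partial>m x) \<partial>\<eta>)"
    unfolding jump_nn_integral_def SUP_apply by (intro nn_integral_cong 1) (auto simp: space_m)
  also have "\<dots> = (SUP i. jump_nn_integral (F i))"
    unfolding 3[symmetric] by (intro nn_integral_cong 2) simp
  finally show ?case 
    using nn_integral_monotone_convergence_SUP[OF \<open>incseq F\<close> S2_meas[OF seq(1)]] seq unfolding SUP_apply by simp
qed

lemma TE_section_measurable:
  assumes [measurable]: "h \<in> borel_measurable Q"
  shows "(\<lambda>p. \<integral>\<^sup>+u. h (fst p, u, snd p) \<partial>m (snd p)) \<in> borel_measurable TE"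
proof (rule m_param_measurable[where k=snd and h="\<lambda>p u. h (fst p, u, snd p)"])
  have "(\<lambda>z. (fst (fst z), snd z, snd (fst z))) \<in> measurable (TE \<Otimes>\<^sub>M U) Q"
    by (rule measurable_Pair[OF measurable_compose[OF measurable_fst measurable_fst]
        measurable_Pair[OF measurable_snd measurable_compose[OF measurable_fst measurable_snd]]])
  from measurable_compose[OF this assms] show "(\<lambda>(p, u). h (fst p, u, snd p)) \<in> borel_measurable (TE \<Otimes>\<^sub>M U)"
    by (simp add: case_prod_beta')
qed (rule measurable_snd)

text \<open>Exchanges the time and jump integrals, as m x is sigma-finite. The jump intensity is
  thus disintegrated over the same pairs (s, x) on which the Gaussian noise lives.\<close>

lemma nn_integral_S2_TE:
  assumes h[measurable]: "h \<in> borel_measurable Q"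
  shows "(\<integral>\<^sup>+q. h q \<partial>S2) = (\<integral>\<^sup>+p. (\<integral>\<^sup>+u. h (fst p, u, snd p) \<partial>m (snd p)) \<partial>TE)"
proof -
  have "jump_nn_integral h = (\<integral>\<^sup>+x. (\<integral>\<^sup>+s. (\<integral>\<^sup>+u. h (s, u, x) \<partial>m x) \<partial>time_measure) \<partial>\<eta>)"
    unfolding jump_nn_integral_def
  proof (rule nn_integral_cong)
    fix x assume "x \<in> space \<eta>"
    hence x: "x > 0" by simp
    interpret P: pair_sigma_finite time_measure "m x"
      using sigma_finite_m[OF x] by (simp add: pair_sigma_finite_def sigma_finite_time_measure)
    have "(\<lambda>(s, u). h (s, u, x)) \<in> borel_measurable (time_measure \<Otimes>\<^sub>M m x)"
      using jump_nn_integral_measurable(4)[OF h x]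
      by (simp only: measurable_cong_sets[OF sets_pair_measure_cong[OF refl sets_m[OF x]] refl])
    from P.Fubini[OF this] show "(\<integral>\<^sup>+u. (\<integral>\<^sup>+s. h (s, u, x) \<partial>time_measure) \<partial>m x) = (\<integral>\<^sup>+s. (\<integral>\<^sup>+u. h (s, u, x) \<partial>m x) \<partial>time_measure)"
      by simp
  qed
  also have "\<dots> = (\<integral>\<^sup>+p. (\<integral>\<^sup>+u. h (fst p, u, snd p) \<partial>m (snd p)) \<partial>TE)"
    using TE.nn_integral_snd[OF TE_section_measurable[OF h]] by simp
  finally show ?thesis by (simp add: nn_integral_S2)
qed

lemma sigma_finite_S2: "sigma_finite_measure S2"
proof
  \<comment> \<open>Time horizon and jump band both grow with n; the intensity of \<open>B n\<close>
    is at most n * (n + 1) * K times the total mass of \<eta>.\<close>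
  define B where "B n = {0..real n} \<times> {u \<in> space U. u\<^sup>2 \<ge> 1 / real (Suc n)} \<times> {(0::real)<..}" for n :: nat
  have Bm: "B n \<in> sets Q" for n
  proof -
    have "{0..real n} \<in> sets time_measure"
      by (auto simp: time_measure_def sets_restrict_space intro!: image_eqI[of _ _ "{0..real n}"])
    moreover have "{u \<in> space U. u\<^sup>2 \<ge> 1 / real (Suc n)} \<in> sets U" by measurable
    moreover have "{0<..} \<in> sets \<eta>" using sets.top[of \<eta>] by simp
    ultimately show ?thesis unfolding B_def by (intro pair_measureI)
  qed
  have fin: "emeasure S2 (B n) < \<infinity>" for n
  proof -
    have "emeasure S2 (B n) = jump_nn_integral (indicator (B n))" by (rule emeasure_S2[OF Bm])
    also have "\<dots> \<le> (\<integral>\<^sup>+x. ennreal (real n) * ennreal (real (Suc n) * K) \<partial>\<eta>)"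
      unfolding jump_nn_integral_def
    proof (rule nn_integral_mono)
      fix x assume "x \<in> space \<eta>"
      hence x: "x > 0" by simp
      have [measurable]: "{u \<in> space U. u\<^sup>2 \<ge> 1 / real (Suc n)} \<in> sets (m x)" unfolding sets_m[OF x] by measurable
      have "(\<integral>\<^sup>+u. (\<integral>\<^sup>+s. indicator (B n) (s, u, x) \<partial>time_measure) \<partial>m x)
          \<le> (\<integral>\<^sup>+u. ennreal (real n) * indicator {u \<in> space U. u\<^sup>2 \<ge> 1 / real (Suc n)} u \<partial>m x)"
      proof (rule nn_integral_mono)
        fix u
        have "(\<integral>\<^sup>+s. indicator (B n) (s, u, x) \<partial>time_measure)
          \<le> (\<integral>\<^sup>+s. indicator {0..real n} s * indicator {u \<in> space U. u\<^sup>2 \<ge> 1 / real (Suc n)} u \<partial>time_measure)"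
          by (intro nn_integral_mono) (auto simp: B_def indicator_def simp del: of_nat_Suc)
        also have "\<dots> = (\<integral>\<^sup>+s. indicator {0..real n} s * indicator {u \<in> space U. u\<^sup>2 \<ge> 1 / real (Suc n)} u * indicator {0..} s \<partial>lborel)"
          by (rule nn_integral_time_measure) measurable
        also have "\<dots> = (\<integral>\<^sup>+s. indicator {u \<in> space U. u\<^sup>2 \<ge> 1 / real (Suc n)} u * indicator {0..real n} s \<partial>lborel)"
          by (intro nn_integral_cong) (auto simp: indicator_def)
        also have "\<dots> = indicator {u \<in> space U. u\<^sup>2 \<ge> 1 / real (Suc n)} u * emeasure lborel {0..real n}"
          by (rule nn_integral_cmult_indicator) simp
        finally show "(\<integral>\<^sup>+s. indicator (B n) (s, u, x) \<partial>time_measure) \<le> ennreal (real n) * indicator {u \<in> space U. u\<^sup>2 \<ge> 1 / real (Suc n)} u"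
          by (simp add: mult.commute)
      qed
      also have "\<dots> = ennreal (real n) * emeasure (m x) {u \<in> space U. u\<^sup>2 \<ge> 1 / real (Suc n)}"
        by (rule nn_integral_cmult_indicator) measurable
      also have "\<dots> \<le> ennreal (real n) * ennreal (real (Suc n) * K)"
        using m_band_finite[OF x, of n] by (intro mult_left_mono) auto
      finally show "(\<integral>\<^sup>+u. (\<integral>\<^sup>+s. indicator (B n) (s, u, x) \<partial>time_measure) \<partial>m x) \<le> ennreal (real n) * ennreal (real (Suc n) * K)" .
    qed
    also have "\<dots> < \<infinity>"
      using eta.emeasure_finite[of "{0<..}"] by (simp add: ennreal_mult_less_top less_top[symmetric] ennreal_mult_eq_top_iff)
    finally show ?thesis .
  qed
  show "\<exists>A. countable A \<and> A \<subseteq> sets S2 \<and> \<Union>A = space S2 \<and> (\<forall>a\<in>A. emeasure S2 a \<noteq> \<infinity>)"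
  proof (intro exI[of _ "range B"] conjI)
    show "range B \<subseteq> sets S2" using Bm by (auto simp: sets_S2)

    show "\<Union>(range B) = space S2"
      unfolding sets_eq_imp_space_eq[OF sets_S2] space_Q
    proof (intro set_eqI iffI)
      fix q :: "real \<times> real \<times> real" assume "q \<in> {0..} \<times> (- {0}) \<times> {0<..}"
      then obtain s u x :: real where q: "q = (s, u, x)" "s \<ge> 0" "u \<noteq> 0" "x > 0" by auto
      obtain i :: nat where i: "s \<le> real i" using real_arch_simple by blast
      obtain j where j: "u\<^sup>2 \<ge> 1 / real (Suc j)" using band_cover[OF q(3)] by blast
      define k where "k = max i j"
      have "1 / real (Suc k) \<le> 1 / real (Suc j)" by (intro divide_left_mono) (auto simp: k_def)
      hence "q \<in> B k" using q i j by (auto simp: B_def k_def simp del: of_nat_Suc)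
      thus "q \<in> \<Union>(range B)" by blast
    qed (auto simp: B_def)
    show "\<forall>a\<in>range B. emeasure S2 a \<noteq> \<infinity>" using fin by (auto simp: less_top)
  qed auto
qed

lemma S1_density: "S1 = density TE (\<lambda>p. ennreal (2 * c (snd p)))"
  unfolding noise_covariance_def by (rule arg_cong[of _ _ "density TE"]) (auto simp: fun_eq_iff)

lemma sets_S1 [simp]: "sets S1 = sets TE" and space_S1 [simp]: "space S1 = space TE"
  by (simp_all add: S1_density)

lemma sigma_finite_S1: "sigma_finite_measure S1"
proof -
  have "(\<lambda>p. ennreal (2 * c (snd p))) \<in> borel_measurable TE" by measurable
  thus ?thesis unfolding S1_density by (subst TE.sigma_finite_iff_density_finite) auto
qed

lemma nn_integral_S1:
  "h \<in> borel_measurable TE \<Longrightarrow> (\<integral>\<^sup>+p. h p \<partial>S1) = (\<integral>\<^sup>+p. ennreal (2 * c (snd p)) * h p \<partial>TE)"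
  unfolding S1_density by (rule nn_integral_density) measurable

lemma nn_integral_S1_le:
  assumes "h \<in> borel_measurable TE"
  shows "(\<integral>\<^sup>+p. h p \<partial>S1) \<le> ennreal (2 * Kc) * (\<integral>\<^sup>+p. h p \<partial>TE)"
proof -
  have "(\<integral>\<^sup>+p. h p \<partial>S1) \<le> (\<integral>\<^sup>+p. ennreal (2 * Kc) * h p \<partial>TE)"
    unfolding nn_integral_S1[OF assms] using Kc by (intro nn_integral_mono mult_right_mono ennreal_leI) (auto simp: space_pair_measure)
  thus ?thesis using assms by (simp add: nn_integral_cmult)
qed

lemma Q_measurable:
  assumes [measurable]: "h \<in> borel_measurable TE"
  shows "(\<lambda>(s, u, x). ennreal (u\<^sup>2) * h (s, x)) \<in> borel_measurable Q"
  by measurable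

text \<open>Integrating out u with the bound \<open>K\<close> on the second moment of m x reduces
  jump estimates to the measure \<open>TE\<close>, where they coincide up to a constant with those
  for the Gaussian noise.\<close>

lemma nn_integral_S2_le:
  assumes h[measurable]: "h \<in> borel_measurable TE"
  shows "(\<integral>\<^sup>+(s, u, x). ennreal (u\<^sup>2) * h (s, x) \<partial>S2) \<le> ennreal K * (\<integral>\<^sup>+p. h p \<partial>TE)"
proof -
  have "(\<integral>\<^sup>+(s, u, x). ennreal (u\<^sup>2) * h (s, x) \<partial>S2) = (\<integral>\<^sup>+p. (\<integral>\<^sup>+u. ennreal (u\<^sup>2) * h p \<partial>m (snd p)) \<partial>TE)"
    using nn_integral_S2_TE[OF Q_measurable[OF h]] by simp
  also have "\<dots> \<le> (\<integral>\<^sup>+p. ennreal K * h p \<partial>TE)"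
  proof (rule nn_integral_mono)
    fix p assume "p \<in> space TE"
    hence x: "snd p > 0" by (auto simp: space_pair_measure)
    have "(\<integral>\<^sup>+u. ennreal (u\<^sup>2) * h p \<partial>m (snd p)) = (\<integral>\<^sup>+u. ennreal (u\<^sup>2) \<partial>m (snd p)) * h p"
      by (rule nn_integral_multc[OF square_measurable_m[OF x]])
    also have "\<dots> \<le> ennreal K * h p" using K(2)[OF x] by (intro mult_right_mono) auto
    finally show "(\<integral>\<^sup>+u. ennreal (u\<^sup>2) * h p \<partial>m (snd p)) \<le> ennreal K * h p" .
  qed
  also have "\<dots> = ennreal K * (\<integral>\<^sup>+p. h p \<partial>TE)" by (rule nn_integral_cmult[OF h])
  finally show ?thesis .
qed

lemma jump_meas:
  assumes [measurable]: "\<Phi> \<in> borel_measurable TE"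
  shows "(\<lambda>(s, u, x). u * \<Phi> (s, x)) \<in> borel_measurable S2"
  by (rule S2_meas) measurable

lemma square_integrable_S1:
  assumes "square_integrable TE \<Phi>" shows "square_integrable S1 \<Phi>"
proof -
  have [measurable]: "\<Phi> \<in> borel_measurable TE" using assms by (simp add: square_integrable_def)
  have "L2d S1 \<Phi> (\<lambda>_. 0) \<le> ennreal (2 * Kc) * L2d TE \<Phi> (\<lambda>_. 0)"
    unfolding L2d_def by (rule nn_integral_S1_le) measurable
  also have "\<dots> < \<infinity>" using assms by (simp add: square_integrable_iff_L2d ennreal_mult_less_top)
  finally have "L2d S1 \<Phi> (\<lambda>_. 0) < \<infinity>" .
  moreover have "\<Phi> \<in> borel_measurable S1" unfolding measurable_cong_sets[OF sets_S1 refl] by measurable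
  ultimately show ?thesis by (simp add: square_integrable_iff_L2d)
qed

lemma square_integrable_S2:
  assumes "square_integrable TE \<Phi>" shows "square_integrable S2 (\<lambda>(s, u, x). u * \<Phi> (s, x))"
proof -
  have [measurable]: "\<Phi> \<in> borel_measurable TE" using assms by (simp add: square_integrable_def)
  have "L2d S2 (\<lambda>(s, u, x). u * \<Phi> (s, x)) (\<lambda>_. 0) = (\<integral>\<^sup>+(s, u, x). ennreal (u\<^sup>2) * ennreal ((\<Phi> (s, x))\<^sup>2) \<partial>S2)"
    unfolding L2d_def by (intro nn_integral_cong) (auto simp: power_mult_distrib ennreal_mult)
  also have "\<dots> \<le> ennreal K * (\<integral>\<^sup>+p. ennreal ((\<Phi> p)\<^sup>2) \<partial>TE)"
    by (rule nn_integral_S2_le) measurable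
  also have "\<dots> < \<infinity>" using assms by (simp add: square_integrable_iff_L2d L2d_def ennreal_mult_less_top)
  finally show ?thesis using jump_meas[of \<Phi>] by (simp add: square_integrable_iff_L2d)
qed

lemma levy_sq_m:
  assumes "x > 0" shows "square_integrable (m x) (\<lambda>u. u * z)"
proof -
  have "L2d (m x) (\<lambda>u. u * z) (\<lambda>_. 0) = (\<integral>\<^sup>+u. ennreal (u\<^sup>2) * ennreal (z\<^sup>2) \<partial>m x)"
    unfolding L2d_def by (intro nn_integral_cong) (simp add: power_mult_distrib ennreal_mult)
  also have "\<dots> = (\<integral>\<^sup>+u. ennreal (u\<^sup>2) \<partial>m x) * ennreal (z\<^sup>2)"
    by (rule nn_integral_multc[OF square_measurable_m[OF assms]])
  also have "\<dots> \<le> ennreal K * ennreal (z\<^sup>2)" using K(2)[OF assms] by (intro mult_right_mono) auto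
  also have "\<dots> < \<infinity>" by (simp add: ennreal_mult_less_top)
  finally have "L2d (m x) (\<lambda>u. u * z) (\<lambda>_. 0) < \<infinity>" .
  moreover have "(\<lambda>u. u * z) \<in> borel_measurable (m x)"
    by (rule m_meas[OF assms]) measurable
  ultimately show ?thesis by (simp add: square_integrable_iff_L2d)
qed

lemma phi_alt: "phi c m x z = - complex_of_real (c x * z\<^sup>2) + (\<integral>u. levy_exponent (u * z) \<partial>m x)"
  by (simp add: phi_def levy_exponent_def mult.commute)

lemma phi_0 [simp]: "phi c m x 0 = 0"
  by (simp add: phi_def)

text \<open>The density 2 c turns \<open>gauss_exponent\<close> into - c z^2, and integrating
  \<open>levy_exponent\<close> over m x gives the jump part of \<open>phi\<close>; both are then
  integrals over \<open>TE\<close>.\<close>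

lemma exponent_phi:
  assumes \<Phi>: "square_integrable TE \<Phi>"
  shows "integrable TE (\<lambda>p. phi c m (snd p) (\<Phi> p))"
    and "(\<integral>p. gauss_exponent (\<Phi> p) \<partial>S1) + (\<integral>q. levy_exponent ((\<lambda>(s, u, x). u * \<Phi> (s, x)) q) \<partial>S2)
       = (\<integral>p. phi c m (snd p) (\<Phi> p) \<partial>TE)"
proof -
  have [measurable]: "\<Phi> \<in> borel_measurable TE" using \<Phi> by (simp add: square_integrable_def)
  have [measurable]: "gauss_exponent \<in> borel_measurable borel" "levy_exponent \<in> borel_measurable borel"
    using quadratic_exponent_gauss quadratic_exponent_levy by (auto simp: quadratic_exponent_def)
  have i1: "integrable S1 (\<lambda>p. gauss_exponent (\<Phi> p))"
    by (rule quadratic_exponent_integrable[OF quadratic_exponent_gauss square_integrable_S1[OF \<Phi>]])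
  have i2: "integrable S2 (\<lambda>q. levy_exponent ((\<lambda>(s, u, x). u * \<Phi> (s, x)) q))"
    by (rule quadratic_exponent_integrable[OF quadratic_exponent_levy square_integrable_S2[OF \<Phi>]])
  have c0: "AE p in TE. 0 \<le> 2 * c (snd p)" using c_nonneg by (intro AE_I2) (auto simp: space_pair_measure)
  have e: "(2 * c (snd p)) *\<^sub>R gauss_exponent (\<Phi> p) = - complex_of_real (c (snd p) * (\<Phi> p)\<^sup>2)" for p
    by (simp add: gauss_exponent_def scaleR_conv_of_real)
  have g: "integrable TE (\<lambda>p. - complex_of_real (c (snd p) * (\<Phi> p)\<^sup>2))"
    "(\<integral>p. gauss_exponent (\<Phi> p) \<partial>S1) = (\<integral>p. - complex_of_real (c (snd p) * (\<Phi> p)\<^sup>2) \<partial>TE)"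
  proof -
    have m1: "(\<lambda>p. gauss_exponent (\<Phi> p)) \<in> borel_measurable TE" by measurable
    have m2: "(\<lambda>p. 2 * c (snd p)) \<in> borel_measurable TE" by measurable
    show "integrable TE (\<lambda>p. - complex_of_real (c (snd p) * (\<Phi> p)\<^sup>2))"
      using i1 unfolding S1_density integrable_density[OF m1 m2 c0] e .
    show "(\<integral>p. gauss_exponent (\<Phi> p) \<partial>S1) = (\<integral>p. - complex_of_real (c (snd p) * (\<Phi> p)\<^sup>2) \<partial>TE)"
      unfolding S1_density integral_density[OF m1 m2 c0] e ..
  qed
  define h where "h q = levy_exponent ((\<lambda>(s, u, x). u * \<Phi> (s, x)) q)" for q
  have sec: "integrable (m (snd p)) (\<lambda>u. h (fst p, u, snd p))" if "p \<in> space TE" for p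
    using quadratic_exponent_integrable[OF quadratic_exponent_levy levy_sq_m[of "snd p" "\<Phi> p"]] that
    by (auto simp: h_def space_pair_measure)
  have "integrable TE (\<lambda>p. \<integral>u. h (fst p, u, snd p) \<partial>m (snd p))"
    "(\<integral>q. h q \<partial>S2) = (\<integral>p. (\<integral>u. h (fst p, u, snd p) \<partial>m (snd p)) \<partial>TE)"
    by (rule has_integral_kernel_complex[where Q=Q and k="\<lambda>p u. (fst p, u, snd p)" and J=S2],
        erule nn_integral_S2_TE, erule TE_section_measurable, rule sets_S2, rule i2[folded h_def], erule sec)+
  hence D': "integrable TE (\<lambda>p. \<integral>u. levy_exponent (u * \<Phi> p) \<partial>m (snd p))"
    "(\<integral>q. h q \<partial>S2) = (\<integral>p. (\<integral>u. levy_exponent (u * \<Phi> p) \<partial>m (snd p)) \<partial>TE)"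
    by (simp_all add: h_def)
  show "integrable TE (\<lambda>p. phi c m (snd p) (\<Phi> p))"
    unfolding phi_alt using g(1) D'(1) by (rule Bochner_Integration.integrable_add)
  show "(\<integral>p. gauss_exponent (\<Phi> p) \<partial>S1) + (\<integral>q. levy_exponent ((\<lambda>(s, u, x). u * \<Phi> (s, x)) q) \<partial>S2)
       = (\<integral>p. phi c m (snd p) (\<Phi> p) \<partial>TE)"
    unfolding phi_alt g(2) D'(2)[unfolded h_def] using g(1) D'(1) by (rule Bochner_Integration.integral_add[symmetric])
qed

end

section \<open>The field \<open>Z\<^sup>0\<close>\<close>

text \<open>Either side says that the squared distance on the product vanishes, computed by Tonelli
  in one or the other order.\<close>

lemma AE_pair_lambda_D:
  fixes z z' :: "'a \<times> real \<Rightarrow> real"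
  assumes N: "sigma_finite_measure N" and z: "z \<in> borel_measurable (N \<Otimes>\<^sub>M lambda_D)" "z' \<in> borel_measurable (N \<Otimes>\<^sub>M lambda_D)"
  shows "(AE p in N \<Otimes>\<^sub>M lambda_D. z p = z' p) \<longleftrightarrow> (AE y in lambda_D. AE \<omega> in N. z (\<omega>, y) = z' (\<omega>, y))"
    and "(AE p in N \<Otimes>\<^sub>M lambda_D. z p = z' p) \<longleftrightarrow> (AE \<omega> in N. AE y in lambda_D. z (\<omega>, y) = z' (\<omega>, y))"
proof -
  note L = L2d_pair[OF N z]
  have "(AE p in N \<Otimes>\<^sub>M lambda_D. z p = z' p) \<longleftrightarrow> L2d (N \<Otimes>\<^sub>M lambda_D) z z' = 0"
    using L2d_eq_0_iff[OF z] by simp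
  also have "\<dots> \<longleftrightarrow> (AE y in lambda_D. L2d N (\<lambda>e. z (e, y)) (\<lambda>e. z' (e, y)) = 0)"
    unfolding L(1) by (rule nn_integral_0_iff_AE[OF L(3)])
  also have "\<dots> \<longleftrightarrow> (AE y in lambda_D. AE \<omega> in N. z (\<omega>, y) = z' (\<omega>, y))"
    by (intro AE_cong L2d_eq_0_iff measurable_Pair1[OF z(1)] measurable_Pair1[OF z(2)])
  finally show "(AE p in N \<Otimes>\<^sub>M lambda_D. z p = z' p) \<longleftrightarrow> (AE y in lambda_D. AE \<omega> in N. z (\<omega>, y) = z' (\<omega>, y))" .
  have "(AE p in N \<Otimes>\<^sub>M lambda_D. z p = z' p) \<longleftrightarrow> L2d (N \<Otimes>\<^sub>M lambda_D) z z' = 0"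
    using L2d_eq_0_iff[OF z] by simp
  also have "\<dots> \<longleftrightarrow> (AE \<omega> in N. L2d lambda_D (\<lambda>y. z (\<omega>, y)) (\<lambda>y. z' (\<omega>, y)) = 0)"
    unfolding L(2) by (rule nn_integral_0_iff_AE[OF L(4)])
  also have "\<dots> \<longleftrightarrow> (AE \<omega> in N. AE y in lambda_D. z (\<omega>, y) = z' (\<omega>, y))"
    by (intro AE_cong L2d_eq_0_iff measurable_Pair2[OF z(1)] measurable_Pair2[OF z(2)])
  finally show "(AE p in N \<Otimes>\<^sub>M lambda_D. z p = z' p) \<longleftrightarrow> (AE \<omega> in N. AE y in lambda_D. z (\<omega>, y) = z' (\<omega>, y))" .
qed

context coefficients
begin

definition gauss_integrand :: "real \<Rightarrow> (real \<times> real) \<times> real \<Rightarrow> real" where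
  "gauss_integrand t = (\<lambda>((s, x), y). abm_flow t s x y)"

definition jump_integrand :: "real \<Rightarrow> (real \<times> real \<times> real) \<times> real \<Rightarrow> real" where
  "jump_integrand t = (\<lambda>((s, u, x), y). u * abm_flow t s x y)"

lemma fst_snd_TE_measurable:
  "(\<lambda>q. fst (fst q)) \<in> borel_measurable (TE \<Otimes>\<^sub>M lambda_D)"
  "(\<lambda>q. snd (fst q)) \<in> borel_measurable (TE \<Otimes>\<^sub>M lambda_D)"
  "(\<lambda>q. snd q) \<in> borel_measurable (TE \<Otimes>\<^sub>M lambda_D)"
  by (rule measurable_compose[OF measurable_compose[OF measurable_fst measurable_fst] id_measurable_time_measure],
      rule measurable_compose[OF measurable_compose[OF measurable_fst measurable_snd] id_measurable_eta],
      rule measurable_compose[OF measurable_snd id_measurable_lambda_D])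

lemma gauss_integrand_measurable: "gauss_integrand t \<in> borel_measurable (TE \<Otimes>\<^sub>M lambda_D)"
proof -
  have "(\<lambda>q. abm_flow t (fst (fst q)) (snd (fst q)) (snd q)) \<in> borel_measurable (TE \<Otimes>\<^sub>M lambda_D)"
    by (intro abm_flow_measurable fst_snd_TE_measurable)
  thus ?thesis by (simp add: gauss_integrand_def case_prod_beta')
qed

lemma jump_integrand_measurable: "jump_integrand t \<in> borel_measurable (Q \<Otimes>\<^sub>M lambda_D)"
proof -
  have "(\<lambda>q. fst (snd (fst q)) * abm_flow t (fst (fst q)) (snd (snd (fst q))) (snd q)) \<in> borel_measurable (Q \<Otimes>\<^sub>M lambda_D)"
  proof (intro borel_measurable_times abm_flow_measurable)
    show "(\<lambda>q. fst (snd (fst q))) \<in> borel_measurable (Q \<Otimes>\<^sub>M lambda_D)"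
      by (rule measurable_compose[OF _ id_measurable_U]) measurable
    show "(\<lambda>q. fst (fst q)) \<in> borel_measurable (Q \<Otimes>\<^sub>M lambda_D)"
      by (rule measurable_compose[OF _ id_measurable_time_measure]) measurable
    show "(\<lambda>q. snd (snd (fst q))) \<in> borel_measurable (Q \<Otimes>\<^sub>M lambda_D)"
      by (rule measurable_compose[OF _ id_measurable_eta]) measurable
    show "(\<lambda>q. snd q) \<in> borel_measurable (Q \<Otimes>\<^sub>M lambda_D)"
      by (rule measurable_compose[OF _ id_measurable_lambda_D]) measurable
  qed
  thus ?thesis by (simp add: jump_integrand_def case_prod_beta')
qed

text \<open>The factor 4 is that of the time continuity of the kernel, integrated over
  \<eta>.\<close>

definition CE :: real where "CE = 4 * measure \<eta> {0<..}"

lemma L2d_abm_flow_integral: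
  assumes "0 \<le> t" "t \<le> t'"
  shows "L2d (TE \<Otimes>\<^sub>M lambda_D) (gauss_integrand t) (gauss_integrand t') \<le> ennreal (CE * sqrt (t' - t))"
proof -
  define H where "H p = L2d lambda_D (abm_flow t (fst p) (snd p)) (abm_flow t' (fst p) (snd p))" for p
  have e: "(\<lambda>y. gauss_integrand r (p, y)) = abm_flow r (fst p) (snd p)" for r p by (simp add: gauss_integrand_def case_prod_beta')
  note L = L2d_pair[OF TE.sigma_finite_measure_axioms gauss_integrand_measurable gauss_integrand_measurable, of t t']
  have Hm: "H \<in> borel_measurable TE" using L(4) unfolding e H_def[abs_def] .
  have "L2d (TE \<Otimes>\<^sub>M lambda_D) (gauss_integrand t) (gauss_integrand t') = (\<integral>\<^sup>+p. H p \<partial>TE)" unfolding L(2) e H_def ..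
  also have "\<dots> = (\<integral>\<^sup>+x. (\<integral>\<^sup>+s. H (s, x) \<partial>time_measure) \<partial>\<eta>)"
    using TE.nn_integral_snd[OF Hm] by simp
  also have "\<dots> \<le> (\<integral>\<^sup>+x. ennreal (4 * sqrt (t' - t)) \<partial>\<eta>)"
    using abm_flow_time_continuity[of t "t' - t"] assms by (intro nn_integral_mono) (simp add: H_def)
  also have "\<dots> = ennreal (CE * sqrt (t' - t))"
    using assms by (simp add: CE_def eta.emeasure_eq_measure mult_ac flip: ennreal_mult)
  finally show ?thesis .
qed

lemma L2d_gauss_integrand:
  assumes "0 \<le> t" "t \<le> t'"
  shows "L2d (S1 \<Otimes>\<^sub>M lambda_D) (gauss_integrand t) (gauss_integrand t') \<le> ennreal (2 * Kc) * ennreal (CE * sqrt (t' - t))"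
proof -
  have m: "gauss_integrand r \<in> borel_measurable (S1 \<Otimes>\<^sub>M lambda_D)" for r
    using gauss_integrand_measurable by (simp only: measurable_cong_sets[OF sets_pair_measure_cong[OF sets_S1 refl] refl])
  note L0 = L2d_pair[OF TE.sigma_finite_measure_axioms gauss_integrand_measurable gauss_integrand_measurable, of t t']
  have "L2d (S1 \<Otimes>\<^sub>M lambda_D) (gauss_integrand t) (gauss_integrand t') \<le> ennreal (2 * Kc) * L2d (TE \<Otimes>\<^sub>M lambda_D) (gauss_integrand t) (gauss_integrand t')"
    unfolding L2d_pair(2)[OF sigma_finite_S1 m m] L0(2) by (rule nn_integral_S1_le[OF L0(4)])
  also have "\<dots> \<le> ennreal (2 * Kc) * ennreal (CE * sqrt (t' - t))"
    using L2d_abm_flow_integral[OF assms] by (intro mult_left_mono) auto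
  finally show ?thesis .
qed

lemma L2d_jump_integrand:
  assumes "0 \<le> t" "t \<le> t'"
  shows "L2d (S2 \<Otimes>\<^sub>M lambda_D) (jump_integrand t) (jump_integrand t') \<le> ennreal K * ennreal (CE * sqrt (t' - t))"
proof -
  have m: "jump_integrand r \<in> borel_measurable (S2 \<Otimes>\<^sub>M lambda_D)" for r
    using jump_integrand_measurable by (simp only: measurable_cong_sets[OF sets_pair_measure_cong[OF sets_S2 refl] refl])
  note L0 = L2d_pair[OF TE.sigma_finite_measure_axioms gauss_integrand_measurable gauss_integrand_measurable, of t t']
  have "L2d (S2 \<Otimes>\<^sub>M lambda_D) (jump_integrand t) (jump_integrand t') = (\<integral>\<^sup>+q. L2d lambda_D (\<lambda>y. jump_integrand t (q, y)) (\<lambda>y. jump_integrand t' (q, y)) \<partial>S2)"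
    by (rule L2d_pair(2)[OF sigma_finite_S2 m m])
  also have "\<dots> = (\<integral>\<^sup>+(s, u, x). ennreal (u\<^sup>2) * L2d lambda_D (\<lambda>y. gauss_integrand t ((s, x), y)) (\<lambda>y. gauss_integrand t' ((s, x), y)) \<partial>S2)"
  proof (rule nn_integral_cong)
    fix q :: "real \<times> real \<times> real"
    obtain s u x where q: "q = (s, u, x)" by (cases q)
    have fm: "abm_flow r s x \<in> borel_measurable lambda_D" for r
      by (rule measurable_lambda_D) measurable
    show "L2d lambda_D (\<lambda>y. jump_integrand t (q, y)) (\<lambda>y. jump_integrand t' (q, y))
      = (case q of (s, u, x) \<Rightarrow> ennreal (u\<^sup>2) * L2d lambda_D (\<lambda>y. gauss_integrand t ((s, x), y)) (\<lambda>y. gauss_integrand t' ((s, x), y)))"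
      using L2d_scale[OF fm fm, of u t t'] by (simp add: q jump_integrand_def gauss_integrand_def)
  qed
  also have "\<dots> \<le> ennreal K * L2d (TE \<Otimes>\<^sub>M lambda_D) (gauss_integrand t) (gauss_integrand t')"
    unfolding L0(2) by (rule nn_integral_S2_le[OF L0(4)])
  also have "\<dots> \<le> ennreal K * ennreal (CE * sqrt (t' - t))"
    using L2d_abm_flow_integral[OF assms] by (intro mult_left_mono) auto
  finally show ?thesis .
qed

lemma integrand_at_0: "gauss_integrand 0 = (\<lambda>_. 0)" "jump_integrand 0 = (\<lambda>_. 0)"
  by (auto simp: gauss_integrand_def jump_integrand_def)

text \<open>The integrands vanish at time 0, so the continuity estimate between 0 and t is at the
  same time a bound on the norm at time t.\<close>

lemma square_integrable_integrand:
  assumes t: "0 \<le> t"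
  shows "square_integrable (TE \<Otimes>\<^sub>M lambda_D) (gauss_integrand t)"
    and "square_integrable (S1 \<Otimes>\<^sub>M lambda_D) (gauss_integrand t)"
    and "square_integrable (S2 \<Otimes>\<^sub>M lambda_D) (jump_integrand t)"
proof -
  have "L2d (TE \<Otimes>\<^sub>M lambda_D) (gauss_integrand t) (\<lambda>_. 0) < \<infinity>"
    using L2d_abm_flow_integral[OF order_refl t] by (auto simp: integrand_at_0 L2d_commute intro: le_less_trans)
  thus "square_integrable (TE \<Otimes>\<^sub>M lambda_D) (gauss_integrand t)" by (simp add: square_integrable_iff_L2d gauss_integrand_measurable)
  have "L2d (S1 \<Otimes>\<^sub>M lambda_D) (gauss_integrand t) (\<lambda>_. 0) < \<infinity>"
    using L2d_gauss_integrand[OF order_refl t] by (auto simp: integrand_at_0 L2d_commute ennreal_mult_less_top intro: le_less_trans)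
  moreover have "gauss_integrand t \<in> borel_measurable (S1 \<Otimes>\<^sub>M lambda_D)"
    using gauss_integrand_measurable by (simp only: measurable_cong_sets[OF sets_pair_measure_cong[OF sets_S1 refl] refl])
  ultimately show "square_integrable (S1 \<Otimes>\<^sub>M lambda_D) (gauss_integrand t)" by (simp add: square_integrable_iff_L2d)
  have "L2d (S2 \<Otimes>\<^sub>M lambda_D) (jump_integrand t) (\<lambda>_. 0) < \<infinity>"
    using L2d_jump_integrand[OF order_refl t] by (auto simp: integrand_at_0 L2d_commute ennreal_mult_less_top intro: le_less_trans)
  moreover have "jump_integrand t \<in> borel_measurable (S2 \<Otimes>\<^sub>M lambda_D)"
    using jump_integrand_measurable by (simp only: measurable_cong_sets[OF sets_pair_measure_cong[OF sets_S2 refl] refl])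
  ultimately show "square_integrable (S2 \<Otimes>\<^sub>M lambda_D) (jump_integrand t)" by (simp add: square_integrable_iff_L2d)
qed

section \<open>Characteristic exponents of the paired integrands\<close>

definition projected_flow :: "real \<Rightarrow> (real \<Rightarrow> real) \<Rightarrow> real \<times> real \<Rightarrow> real" where
  "projected_flow t f p = (\<integral>y. gauss_integrand t (p, y) * f y \<partial>lambda_D)"

text \<open>At s = t the value is 0 and not f, because the kernel at time 0 is 0 by convention;
  hence the strict inequality.\<close>

lemma projected_flow_eq:
  assumes "s \<ge> 0"
  shows "projected_flow t f (s, x) = (if s < t then abm_semigroup (t - s) f x else 0)"
proof -
  consider "s < t" | "s = t" | "s > t" by linarith
  thus ?thesis
    by cases (use assms in \<open>auto simp: projected_flow_def gauss_integrand_def abm_flow_def abm_semigroup_def\<close>)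
qed

lemma projected_flow_sq: "0 \<le> t \<Longrightarrow> square_integrable lambda_D f \<Longrightarrow> square_integrable TE (projected_flow t f)"
  unfolding projected_flow_def[abs_def]
  by (rule square_integrable_project[OF TE.sigma_finite_measure_axioms square_integrable_integrand(1)])

lemma jump_integrand_project: "(\<integral>y. jump_integrand t (q, y) * f y \<partial>lambda_D) = (\<lambda>(s, u, x). u * projected_flow t f (s, x)) q"
proof -
  obtain s u x where q: "q = (s, u, x)" by (cases q)
  have "(\<integral>y. u * (gauss_integrand t ((s, x), y) * f y) \<partial>lambda_D) = u * (\<integral>y. gauss_integrand t ((s, x), y) * f y \<partial>lambda_D)"
    by (rule integral_mult_right_zero)
  thus ?thesis by (simp add: q projected_flow_def jump_integrand_def gauss_integrand_def mult.assoc)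
qed

text \<open>For square integrable \<Phi>, an exponent of the characteristic function of the sum of
  the two stochastic integrals with integrands \<Phi> (s, x) and u * \<Phi> (s, x).\<close>

definition noise_exponent :: "(real \<times> real \<Rightarrow> real) \<Rightarrow> complex" where
  "noise_exponent \<Phi> = (\<integral>p. phi c m (snd p) (\<Phi> p) \<partial>TE)"

definition transition_exponent :: "real \<Rightarrow> (real \<Rightarrow> real) \<Rightarrow> complex" where
  "transition_exponent t f = (LINT s:{0..t}|lborel. (\<integral>x. phi c m x (abm_semigroup s f x) \<partial>\<eta>))"

text \<open>The cutoff keeps the noise on [s, t], and the substitution r = t - a turns the semigroup
  at times t - r into the semigroup at times a in [0, t - s].\<close>

lemma noise_exponent_tail:
  assumes s: "0 \<le> s" "s \<le> t" and f: "square_integrable lambda_D f"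
  shows "square_integrable TE (\<lambda>p. indicator {s..} (fst p) * projected_flow t f p)"
    and "noise_exponent (\<lambda>p. indicator {s..} (fst p) * projected_flow t f p) = transition_exponent (t - s) f"
proof -
  let ?\<Phi> = "\<lambda>p. indicator {s..} (fst p) * projected_flow t f p"
  have P: "square_integrable TE (projected_flow t f)" using s f by (intro projected_flow_sq) auto
  have [measurable]: "projected_flow t f \<in> borel_measurable TE" using P by (simp add: square_integrable_def)
  have "(\<lambda>p. indicator {s..} (fst p) :: real) \<in> borel_measurable TE"
    by (rule measurable_compose[OF measurable_compose[OF measurable_fst id_measurable_time_measure]]) measurable
  hence m: "?\<Phi> \<in> borel_measurable TE" by (intro borel_measurable_times) auto
  have "L2d TE ?\<Phi> (\<lambda>_. 0) \<le> L2d TE (projected_flow t f) (\<lambda>_. 0)"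
    unfolding L2d_def by (intro nn_integral_mono) (auto simp: indicator_def)
  thus sq: "square_integrable TE ?\<Phi>"
    using P m by (auto simp: square_integrable_iff_L2d intro: le_less_trans)
  define G where "G r = (\<integral>x. phi c m x (?\<Phi> (r, x)) \<partial>\<eta>)" for r
  define H where "H r = (if s \<le> r \<and> r < t then \<integral>x. phi c m x (abm_semigroup (t - r) f x) \<partial>\<eta> else 0)" for r
  note I = exponent_phi(1)[OF sq]
  have Gi: "integrable time_measure G" and GI: "(\<integral>r. G r \<partial>time_measure) = noise_exponent ?\<Phi>"
    using TE.integrable_fst'[OF I] TE.integral_fst'[OF I] by (simp_all add: G_def[abs_def] noise_exponent_def)
  have GH: "G r = H r" if "r \<ge> 0" for r
    using that s by (auto simp: G_def H_def projected_flow_eq indicator_def)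
  have H0: "indicator {0..} r *\<^sub>R H r = H r" for r using s by (auto simp: H_def indicator_def)
  have Hi: "integrable time_measure H"
    using Gi by (rule Bochner_Integration.integrable_cong[OF refl, THEN iffD1, rotated -1]) (simp add: GH)
  have "integrable lborel (\<lambda>r. indicator {0..} r *\<^sub>R H r)"
    using Hi unfolding time_measure_def by (subst (asm) integrable_restrict_space) auto
  hence Hl: "integrable lborel H" unfolding H0 .
  have Hm[measurable]: "H \<in> borel_measurable borel" using borel_measurable_integrable[OF Hl] by simp
  have "noise_exponent ?\<Phi> = (\<integral>r. H r \<partial>time_measure)"
    unfolding GI[symmetric] by (intro Bochner_Integration.integral_cong) (auto simp: GH)
  also have "\<dots> = (\<integral>r. indicator {0..} r *\<^sub>R H r \<partial>lborel)"
    unfolding time_measure_def by (subst integral_restrict_space) auto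
  also have "\<dots> = (\<integral>a. H (t - a) \<partial>lborel)"
    unfolding H0 using lborel_integral_real_affine[of "-1" H t] by simp
  also have "\<dots> = (\<integral>a. indicator {0..t - s} a *\<^sub>R (\<integral>x. phi c m x (abm_semigroup a f x) \<partial>\<eta>) \<partial>lborel)"
  proof (rule integral_cong_AE)
    let ?R = "\<lambda>a. indicator {0..t - s} a *\<^sub>R (\<integral>x. phi c m x (abm_semigroup a f x) \<partial>\<eta>)"
    \<comment> \<open>The two integrands can differ only at a = 0, where the flow vanishes but P_0 f
      = f. Measurability of the right-hand side follows by changing the left-hand side at this
      point.\<close>
    define R0 where "R0 = ?R 0"
    have R: "?R = (\<lambda>a. if a = 0 then R0 else H (t - a))" 
      using s by (auto simp: fun_eq_iff H_def indicator_def R0_def)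
    have "(\<lambda>a. t - a) \<in> borel_measurable lborel" by simp
    from measurable_compose[OF this Hm] show Ht: "(\<lambda>a. H (t - a)) \<in> borel_measurable lborel" .
    hence "(\<lambda>a. if a = 0 then R0 else H (t - a)) \<in> borel_measurable lborel" by (intro measurable_If) simp_all
    thus "?R \<in> borel_measurable lborel" by (subst R)
    show "AE a in lborel. H (t - a) = ?R a"
      using AE_lborel_singleton[of 0] by eventually_elim (use s in \<open>auto simp: H_def indicator_def\<close>)
  qed
  also have "\<dots> = transition_exponent (t - s) f" by (simp add: transition_exponent_def set_lebesgue_integral_def)
  finally show "noise_exponent ?\<Phi> = transition_exponent (t - s) f" .
qed

lemma noise_exponent_projected_flow:
  assumes "0 \<le> t" "square_integrable lambda_D f"
  shows "noise_exponent (projected_flow t f) = transition_exponent t f"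
proof -
  have "noise_exponent (projected_flow t f) = noise_exponent (\<lambda>p. indicator {0..} (fst p) * projected_flow t f p)"
    unfolding noise_exponent_def by (intro Bochner_Integration.integral_cong) (auto simp: space_pair_measure)
  thus ?thesis using noise_exponent_tail(2)[of 0 t f] assms by simp
qed

text \<open>On \<open>[0, s)\<close> the semigroup property gives \<open>P\<^bsub>t - r\<^esub> g = P\<^bsub>s - r\<^esub> (P\<^bsub>t - s\<^esub> g)\<close>; only \<open>P\<^bsub>t - r\<^esub> g\<close>
  survives on \<open>[s, t]\<close>, which is where the additional term comes from.\<close>

lemma noise_exponent_markov:
  assumes T: "finite T" "T \<subseteq> {0..s}" and f: "\<And>r. r \<in> T \<Longrightarrow> square_integrable lambda_D (f r)"
    and s: "0 \<le> s" "s \<le> t" and g: "square_integrable lambda_D g"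
  shows "noise_exponent (\<lambda>p. (\<Sum>r\<in>T. projected_flow r (f r) p) + projected_flow t g p)
    = noise_exponent (\<lambda>p. (\<Sum>r\<in>T. projected_flow r (f r) p) + projected_flow s (abm_semigroup (t - s) g) p) + transition_exponent (t - s) g"
proof -
  let ?A = "\<lambda>p. (\<Sum>r\<in>T. projected_flow r (f r) p) + projected_flow s (abm_semigroup (t - s) g) p"
  let ?B = "\<lambda>p. indicator {s..} (fst p) * projected_flow t g p"
  have sg: "square_integrable lambda_D (abm_semigroup (t - s) g)" using s g by (intro abm_semigroup_sq) auto
  have sumsq: "square_integrable TE (\<lambda>p. \<Sum>r\<in>T. projected_flow r (f r) p)"
    using T(1) T(2) f
  proof (induction T rule: finite_induct)
    case (insert a T)
    thus ?case by (auto intro!: square_integrable_add projected_flow_sq)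
  qed simp
  have A: "square_integrable TE ?A" using sumsq s sg by (intro square_integrable_add projected_flow_sq) auto
  note B = noise_exponent_tail[OF s g]
  \<comment> \<open>\<open>phi\<close> is additive here although it is not linear: before s the
    second summand vanishes, from s on the first one does, and \<open>phi\<close> vanishes at
    0.\<close>
  have "phi c m (snd p) ((\<Sum>r\<in>T. projected_flow r (f r) p) + projected_flow t g p) = phi c m (snd p) (?A p) + phi c m (snd p) (?B p)"
    if P: "p \<in> space TE" for p
  proof -
    obtain r x where p: "p = (r, x)" "r \<ge> 0" "x > 0" using P by (cases p) (auto simp: space_pair_measure)
    show ?thesis
    proof (cases "r < s")
      case True
      have "projected_flow t g p = projected_flow s (abm_semigroup (t - s) g) p"
      proof -
        have "abm_semigroup (s - r) (abm_semigroup (t - s) g) x = abm_semigroup ((s - r) + (t - s)) g x"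
          using True s g p by (intro abm_semigroup_add) auto
        thus ?thesis using True s p by (simp add: projected_flow_eq)
      qed
      thus ?thesis using True by (simp add: p)
    next
      case False
      have "projected_flow q (f q) p = 0" if "q \<in> T" for q using T(2) that False p by (auto simp: projected_flow_eq)
      hence "?A p = 0" "(\<Sum>q\<in>T. projected_flow q (f q) p) = 0" using False p by (auto simp: projected_flow_eq)
      thus ?thesis using False by (simp add: p)
    qed
  qed
  hence "noise_exponent (\<lambda>p. (\<Sum>r\<in>T. projected_flow r (f r) p) + projected_flow t g p) = (\<integral>p. phi c m (snd p) (?A p) + phi c m (snd p) (?B p) \<partial>TE)"
    unfolding noise_exponent_def by (intro Bochner_Integration.integral_cong) auto
  also have "\<dots> = noise_exponent ?A + noise_exponent ?B"
    unfolding noise_exponent_def using exponent_phi(1)[OF A] exponent_phi(1)[OF B(1)] by simp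
  finally show ?thesis unfolding B(2) .
qed

text \<open>The case of an empty past.\<close>

lemma transition_exponent_add:
  assumes "0 \<le> s" "0 \<le> t" "square_integrable lambda_D f"
  shows "transition_exponent (s + t) f = transition_exponent s (abm_semigroup t f) + transition_exponent t f"
  using noise_exponent_markov[of "{}" s "\<lambda>_ _. 0" "s + t" f] assms abm_semigroup_sq[of t f] by (simp add: noise_exponent_projected_flow)

end

section \<open>Versions of the field, their time continuity and their joint law\<close>

locale abm_noise = coefficients \<eta> c m +
  driving_noise M "noise_covariance c \<eta>" W "jump_intensity m \<eta>" N
  for M :: "'w measure" and \<eta> c m W N
begin

abbreviation "NI \<equiv> compensated (jump_intensity m \<eta>) N"

text \<open>The last conjunct is a stochastic Fubini theorem: integrating the field against \<open>f\<close> gives the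
  stochastic integral of the integrated integrand.\<close>

definition is_zW :: "real \<Rightarrow> ('w \<times> real \<Rightarrow> real) \<Rightarrow> bool" where
  "is_zW t z \<longleftrightarrow> square_integrable (M \<Otimes>\<^sub>M lambda_D) z
    \<and> (AE y in lambda_D. has_stoch_integral M S1 W (\<lambda>e. gauss_integrand t (e, y)) (\<lambda>\<omega>. z (\<omega>, y)))
    \<and> (\<forall>f. square_integrable lambda_D f \<longrightarrow>
        has_stoch_integral M S1 W (\<lambda>e. \<integral>y. gauss_integrand t (e, y) * f y \<partial>lambda_D) (\<lambda>\<omega>. \<integral>y. z (\<omega>, y) * f y \<partial>lambda_D))"

definition is_zN :: "real \<Rightarrow> ('w \<times> real \<Rightarrow> real) \<Rightarrow> bool" where
  "is_zN t z \<longleftrightarrow> square_integrable (M \<Otimes>\<^sub>M lambda_D) z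
    \<and> (AE y in lambda_D. has_stoch_integral M S2 NI (\<lambda>e. jump_integrand t (e, y)) (\<lambda>\<omega>. z (\<omega>, y)))
    \<and> (\<forall>f. square_integrable lambda_D f \<longrightarrow>
        has_stoch_integral M S2 NI (\<lambda>e. \<integral>y. jump_integrand t (e, y) * f y \<partial>lambda_D) (\<lambda>\<omega>. \<integral>y. z (\<omega>, y) * f y \<partial>lambda_D))"

definition "zW t = (SOME z. is_zW t z)"
definition "zN t = (SOME z. is_zN t z)"
definition "Z0 t p = zW t p + zN t p"

lemma zW: assumes "0 \<le> t" shows "is_zW t (zW t)"
proof -
  have "\<exists>z. is_zW t z" unfolding is_zW_def
    by (rule gauss.param_stoch_integral_exists[OF square_integrable_integrand(2)[OF assms]])
  thus ?thesis unfolding zW_def by (rule someI_ex)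
qed

lemma zN: assumes "0 \<le> t" shows "is_zN t (zN t)"
proof -
  have "\<exists>z. is_zN t z" unfolding is_zN_def
    by (rule poisson.param_stoch_integral_exists[OF square_integrable_integrand(3)[OF assms]])
  thus ?thesis unfolding zN_def by (rule someI_ex)
qed

lemma is_Z0_F:
  "is_Z0 M \<eta> c m W N t z \<longleftrightarrow>
    square_integrable (M \<Otimes>\<^sub>M lambda_D) z \<and>
    (AE y in lambda_D. \<exists>X Y. has_stoch_integral M S1 W (\<lambda>e. gauss_integrand t (e, y)) X
      \<and> has_stoch_integral M S2 NI (\<lambda>e. jump_integrand t (e, y)) Y \<and> (AE \<omega> in M. z (\<omega>, y) = X \<omega> + Y \<omega>))"
proof -
  have 1: "(\<lambda>(s, x). indicator {0..t} s * abm_density (t - s) x y) = (\<lambda>e. gauss_integrand t (e, y))" for y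
    by (auto simp: gauss_integrand_def abm_flow_def)
  have 2: "(\<lambda>(s, u, x). indicator {0..t} s * (u * abm_density (t - s) x y)) = (\<lambda>e. jump_integrand t (e, y))" for y
    by (auto simp: jump_integrand_def abm_flow_def)
  show ?thesis unfolding is_Z0_def 1 2 ..
qed

lemma is_Z0_Z0:
  assumes "0 \<le> t" shows "is_Z0 M \<eta> c m W N t (Z0 t)"
  unfolding is_Z0_F
proof
  note w = zW[OF assms, unfolded is_zW_def] and n = zN[OF assms, unfolded is_zN_def]
  show "square_integrable (M \<Otimes>\<^sub>M lambda_D) (Z0 t)" unfolding Z0_def[abs_def] using w n by auto
  show "AE y in lambda_D. \<exists>X Y. has_stoch_integral M S1 W (\<lambda>e. gauss_integrand t (e, y)) X
      \<and> has_stoch_integral M S2 NI (\<lambda>e. jump_integrand t (e, y)) Y \<and> (AE \<omega> in M. Z0 t (\<omega>, y) = X \<omega> + Y \<omega>)"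
    using w[THEN conjunct2, THEN conjunct1] n[THEN conjunct2, THEN conjunct1]
  proof eventually_elim
    case (elim y)
    thus ?case by (intro exI[of _ "\<lambda>\<omega>. zW t (\<omega>, y)"] exI[of _ "\<lambda>\<omega>. zN t (\<omega>, y)"]) (simp add: Z0_def)
  qed
qed

lemma is_Z0_sq: "is_Z0 M \<eta> c m W N t z \<Longrightarrow> square_integrable (M \<Otimes>\<^sub>M lambda_D) z"
  and is_Z0_meas: "is_Z0 M \<eta> c m W N t z \<Longrightarrow> z \<in> borel_measurable (M \<Otimes>\<^sub>M lambda_D)"
  by (simp_all add: is_Z0_def square_integrable_def)

lemma is_Z0_unique:
  assumes z: "is_Z0 M \<eta> c m W N t z" and z': "is_Z0 M \<eta> c m W N t z'"
  shows "AE p in M \<Otimes>\<^sub>M lambda_D. z p = z' p"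
proof -
  have "AE y in lambda_D. AE \<omega> in M. z (\<omega>, y) = z' (\<omega>, y)"
    using z[unfolded is_Z0_F, THEN conjunct2] z'[unfolded is_Z0_F, THEN conjunct2]
  proof eventually_elim
    case (elim y)
    then obtain X Y X' Y' where
      X: "has_stoch_integral M S1 W (\<lambda>e. gauss_integrand t (e, y)) X" "has_stoch_integral M S1 W (\<lambda>e. gauss_integrand t (e, y)) X'"
      and Y: "has_stoch_integral M S2 NI (\<lambda>e. jump_integrand t (e, y)) Y" "has_stoch_integral M S2 NI (\<lambda>e. jump_integrand t (e, y)) Y'"
      and e: "AE \<omega> in M. z (\<omega>, y) = X \<omega> + Y \<omega>" "AE \<omega> in M. z' (\<omega>, y) = X' \<omega> + Y' \<omega>" by blast
    have "AE \<omega> in M. X \<omega> = X' \<omega>" by (rule gauss.has_stoch_integral_unique[OF X]) simp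
    moreover have "AE \<omega> in M. Y \<omega> = Y' \<omega>" by (rule poisson.has_stoch_integral_unique[OF Y]) simp
    ultimately show ?case using e by eventually_elim simp
  qed
  thus ?thesis
    using AE_pair_lambda_D(1)[OF gauss.sigma_finite_measure_axioms is_Z0_meas[OF z] is_Z0_meas[OF z']] by simp
qed

text \<open>Functions equal almost everywhere on the product have, for almost every y, almost surely
  equal sections, which is all that the representation demands. This admits the jointly measurable
  version as a field.\<close>

lemma is_Z0_cong:
  assumes z: "is_Z0 M \<eta> c m W N t z" and z': "z' \<in> borel_measurable (M \<Otimes>\<^sub>M lambda_D)"
    and e: "AE p in M \<Otimes>\<^sub>M lambda_D. z p = z' p"
  shows "is_Z0 M \<eta> c m W N t z'"
  unfolding is_Z0_F
proof
  show "square_integrable (M \<Otimes>\<^sub>M lambda_D) z'"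
    by (rule square_integrable_cong_AE[OF is_Z0_sq[OF z] z' e])
  have "AE y in lambda_D. AE \<omega> in M. z (\<omega>, y) = z' (\<omega>, y)"
    using e AE_pair_lambda_D(1)[OF gauss.sigma_finite_measure_axioms is_Z0_meas[OF z] z'] by simp
  with z[unfolded is_Z0_F, THEN conjunct2]
  show "AE y in lambda_D. \<exists>X Y. has_stoch_integral M S1 W (\<lambda>e. gauss_integrand t (e, y)) X
      \<and> has_stoch_integral M S2 NI (\<lambda>e. jump_integrand t (e, y)) Y \<and> (AE \<omega> in M. z' (\<omega>, y) = X \<omega> + Y \<omega>)"
  proof eventually_elim
    case (elim y)
    then obtain X Y where X: "has_stoch_integral M S1 W (\<lambda>e. gauss_integrand t (e, y)) X"
      and Y: "has_stoch_integral M S2 NI (\<lambda>e. jump_integrand t (e, y)) Y" and e: "AE \<omega> in M. z (\<omega>, y) = X \<omega> + Y \<omega>" by blast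
    have "AE \<omega> in M. z' (\<omega>, y) = X \<omega> + Y \<omega>" using elim(2) e by eventually_elim simp
    thus ?case using X Y by blast
  qed
qed

lemma is_Z0_0: "is_Z0 M \<eta> c m W N 0 (\<lambda>_. 0)"
  unfolding is_Z0_F integrand_at_0
  by (auto intro!: AE_I2 exI[of _ "\<lambda>_. 0"] gauss.has_stoch_integral_zero poisson.has_stoch_integral_zero)

text \<open>Allows laws to be computed for one chosen version and transferred to any other.\<close>

lemma is_Z0_L2_class:
  assumes z: "is_Z0 M \<eta> c m W N t z" and z': "is_Z0 M \<eta> c m W N t z'"
  shows "AE \<omega> in M. L2_class (\<lambda>y. z (\<omega>, y)) = L2_class (\<lambda>y. z' (\<omega>, y))"
proof -
  have "AE \<omega> in M. AE y in lambda_D. z (\<omega>, y) = z' (\<omega>, y)"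
    using is_Z0_unique[OF z z'] AE_pair_lambda_D(2)[OF gauss.sigma_finite_measure_axioms is_Z0_meas[OF z] is_Z0_meas[OF z']] by simp
  with square_integrable_sections(1)[OF gauss.sigma_finite_measure_axioms is_Z0_sq[OF z]]
    square_integrable_sections(1)[OF gauss.sigma_finite_measure_axioms is_Z0_sq[OF z']]
  show ?thesis by eventually_elim (simp add: L2_class_eq_iff)
qed

text \<open>The factor 16 comes from the bound on stochastic integrals and one factor 2 from adding
  the two parts of the field; the remaining 2 is slack.\<close>

definition CZ :: real where "CZ = 64 * (2 * Kc + K) * CE"

lemma CZ_nonneg: "CZ \<ge> 0"
  using K(1) Kc(1) by (simp add: CZ_def CE_def)

text \<open>For almost every y the distance of the sections is bounded by that of the integrands;
  integrating over y leads back to the continuity of the integrands.\<close>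

lemma Z0_continuity:
  assumes t: "0 \<le> t" "t \<le> t'"
  shows "L2d (M \<Otimes>\<^sub>M lambda_D) (Z0 t) (Z0 t') \<le> ennreal (CZ * sqrt (t' - t))"
proof -
  have t': "0 \<le> t'" using t by simp
  note w = zW[OF t(1), unfolded is_zW_def] zW[OF t', unfolded is_zW_def]
  note n = zN[OF t(1), unfolded is_zN_def] zN[OF t', unfolded is_zN_def]
  have m: "zW t \<in> borel_measurable (M \<Otimes>\<^sub>M lambda_D)" "zW t' \<in> borel_measurable (M \<Otimes>\<^sub>M lambda_D)"
    "zN t \<in> borel_measurable (M \<Otimes>\<^sub>M lambda_D)" "zN t' \<in> borel_measurable (M \<Otimes>\<^sub>M lambda_D)"
    using w n by (auto simp: square_integrable_def)
  have mF: "gauss_integrand r \<in> borel_measurable (S1 \<Otimes>\<^sub>M lambda_D)" "jump_integrand r \<in> borel_measurable (S2 \<Otimes>\<^sub>M lambda_D)" if "0 \<le> r" for r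
    using square_integrable_integrand(2,3)[OF that] by (auto simp: square_integrable_def)
  note sM = gauss.sigma_finite_measure_axioms
  have "L2d (M \<Otimes>\<^sub>M lambda_D) (zW t) (zW t') \<le> (\<integral>\<^sup>+y. 16 * L2d S1 (\<lambda>e. gauss_integrand t (e, y)) (\<lambda>e. gauss_integrand t' (e, y)) \<partial>lambda_D)"
    unfolding L2d_pair(1)[OF sM m(1,2)]
  proof (rule nn_integral_mono_AE)
    show "AE y in lambda_D. L2d M (\<lambda>e. zW t (e, y)) (\<lambda>e. zW t' (e, y)) \<le> 16 * L2d S1 (\<lambda>e. gauss_integrand t (e, y)) (\<lambda>e. gauss_integrand t' (e, y))"
      using w(1)[THEN conjunct2, THEN conjunct1] w(2)[THEN conjunct2, THEN conjunct1]
      by eventually_elim (rule gauss.has_stoch_integral_bound)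
  qed
  also have "\<dots> = 16 * L2d (S1 \<Otimes>\<^sub>M lambda_D) (gauss_integrand t) (gauss_integrand t')"
    using L2d_pair(1,3)[OF sigma_finite_S1 mF(1)[OF t(1)] mF(1)[OF t']] by (simp add: nn_integral_cmult)
  also have "\<dots> \<le> 16 * (ennreal (2 * Kc) * ennreal (CE * sqrt (t' - t)))"
    by (intro mult_left_mono L2d_gauss_integrand t) simp
  finally have W: "L2d (M \<Otimes>\<^sub>M lambda_D) (zW t) (zW t') \<le> 16 * (ennreal (2 * Kc) * ennreal (CE * sqrt (t' - t)))" .
  have "L2d (M \<Otimes>\<^sub>M lambda_D) (zN t) (zN t') \<le> (\<integral>\<^sup>+y. 16 * L2d S2 (\<lambda>e. jump_integrand t (e, y)) (\<lambda>e. jump_integrand t' (e, y)) \<partial>lambda_D)"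
    unfolding L2d_pair(1)[OF sM m(3,4)]
  proof (rule nn_integral_mono_AE)
    show "AE y in lambda_D. L2d M (\<lambda>e. zN t (e, y)) (\<lambda>e. zN t' (e, y)) \<le> 16 * L2d S2 (\<lambda>e. jump_integrand t (e, y)) (\<lambda>e. jump_integrand t' (e, y))"
      using n(1)[THEN conjunct2, THEN conjunct1] n(2)[THEN conjunct2, THEN conjunct1]
      by eventually_elim (rule poisson.has_stoch_integral_bound)
  qed
  also have "\<dots> = 16 * L2d (S2 \<Otimes>\<^sub>M lambda_D) (jump_integrand t) (jump_integrand t')"
    using L2d_pair(1,3)[OF sigma_finite_S2 mF(2)[OF t(1)] mF(2)[OF t']] by (simp add: nn_integral_cmult)
  also have "\<dots> \<le> 16 * (ennreal K * ennreal (CE * sqrt (t' - t)))"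
    by (intro mult_left_mono L2d_jump_integrand t) simp
  finally have N: "L2d (M \<Otimes>\<^sub>M lambda_D) (zN t) (zN t') \<le> 16 * (ennreal K * ennreal (CE * sqrt (t' - t)))" .
  have "L2d (M \<Otimes>\<^sub>M lambda_D) (Z0 t) (Z0 t') \<le> 2 * L2d (M \<Otimes>\<^sub>M lambda_D) (zW t) (zW t') + 2 * L2d (M \<Otimes>\<^sub>M lambda_D) (zN t) (zN t')"
    unfolding Z0_def[abs_def] by (rule L2d_add[OF m(1,2,3,4)])
  also have "\<dots> \<le> 2 * (16 * (ennreal (2 * Kc) * ennreal (CE * sqrt (t' - t)))) + 2 * (16 * (ennreal K * ennreal (CE * sqrt (t' - t))))"
    by (intro add_mono mult_left_mono W N) auto
  also have "\<dots> = ennreal (32 * (2 * Kc * (CE * sqrt (t' - t))) + 32 * (K * (CE * sqrt (t' - t))))"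
  proof -
    define b where "b = CE * sqrt (t' - t)"
    have b: "b \<ge> 0" using t by (simp add: b_def CE_def)
    have e: "2 * (16 * (ennreal a * ennreal b)) = ennreal (32 * (a * b))" if "a \<ge> 0" for a
    proof -
      have "2 * (16 * (ennreal a * ennreal b)) = ennreal 32 * (ennreal a * ennreal b)"
        by (simp add: mult.assoc[symmetric])
      also have "\<dots> = ennreal (32 * (a * b))" using that b by (simp only: ennreal_mult'[symmetric] mult_nonneg_nonneg)
      finally show ?thesis .
    qed
    show ?thesis using b K(1) Kc(1) unfolding b_def[symmetric] by (simp only: e) (simp add: e flip: ennreal_plus)
  qed
  also have "\<dots> \<le> ennreal (CZ * sqrt (t' - t))"
  proof (rule ennreal_leI)
    have "CE * sqrt (t' - t) \<ge> 0" using t by (simp add: CE_def)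
    hence "32 * ((2 * Kc + K) * (CE * sqrt (t' - t))) \<le> 64 * ((2 * Kc + K) * (CE * sqrt (t' - t)))"
      using K(1) Kc(1) by (intro mult_right_mono) auto
    thus "32 * (2 * Kc * (CE * sqrt (t' - t))) + 32 * (K * (CE * sqrt (t' - t))) \<le> CZ * sqrt (t' - t)"
      by (simp add: CZ_def algebra_simps)
  qed
  finally show ?thesis .
qed

lemma Z0_inner:
  assumes t: "0 \<le> t" and f: "square_integrable lambda_D f"
  shows "AE \<omega> in M. inner (L2_class (\<lambda>y. Z0 t (\<omega>, y))) (L2_class f)
    = (\<integral>y. zW t (\<omega>, y) * f y \<partial>lambda_D) + (\<integral>y. zN t (\<omega>, y) * f y \<partial>lambda_D)"
proof -
  note w = zW[OF t, unfolded is_zW_def] and n = zN[OF t, unfolded is_zN_def]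
  show ?thesis
    using square_integrable_sections(1)[OF gauss.sigma_finite_measure_axioms w[THEN conjunct1]]
      square_integrable_sections(1)[OF gauss.sigma_finite_measure_axioms n[THEN conjunct1]]
  proof eventually_elim
    case (elim \<omega>)
    have "inner (L2_class (\<lambda>y. Z0 t (\<omega>, y))) (L2_class f) = (\<integral>y. zW t (\<omega>, y) * f y + zN t (\<omega>, y) * f y \<partial>lambda_D)"
      using inner_L2_class[OF square_integrable_add[OF elim] f] by (simp add: Z0_def distrib_right)
    thus ?case using square_integrable_mult[OF elim(1) f] square_integrable_mult[OF elim(2) f] by simp
  qed
qed

text \<open>Each pairing is almost surely a sum of stochastic integrals of a projected flow. By
  linearity the whole sum is one integral against each noise, and the joint characteristic function
  of these is known. Times may repeat, as they are indexed by I.\<close>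

lemma joint_cf_Z:
  assumes Z: "\<And>t. 0 \<le> t \<Longrightarrow> is_Z0 M \<eta> c m W N t (Z t)"
    and I: "finite I" and \<tau>: "\<And>i. i \<in> I \<Longrightarrow> 0 \<le> \<tau> i" and f: "\<And>i. i \<in> I \<Longrightarrow> square_integrable lambda_D (f i)"
  shows "(\<integral>\<omega>. iexp (\<Sum>i\<in>I. inner (L2_class (\<lambda>y. Z (\<tau> i) (\<omega>, y))) (L2_class (f i))) \<partial>M)
    = exp (noise_exponent (\<lambda>p. \<Sum>i\<in>I. projected_flow (\<tau> i) (f i) p))"
proof -
  define X where "X i \<omega> = (\<integral>y. zW (\<tau> i) (\<omega>, y) * f i y \<partial>lambda_D)" for i \<omega>
  define Y where "Y i \<omega> = (\<integral>y. zN (\<tau> i) (\<omega>, y) * f i y \<partial>lambda_D)" for i \<omega>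
  let ?\<Phi> = "\<lambda>p. \<Sum>i\<in>I. projected_flow (\<tau> i) (f i) p"
  have hX: "has_stoch_integral M S1 W (projected_flow (\<tau> i) (f i)) (X i)" if "i \<in> I" for i
    using zW[OF \<tau>[OF that]] f[OF that] unfolding is_zW_def projected_flow_def[abs_def] X_def[abs_def] by blast
  have hY: "has_stoch_integral M S2 NI (\<lambda>(s, u, x). u * projected_flow (\<tau> i) (f i) (s, x)) (Y i)" if "i \<in> I" for i
    using zN[OF \<tau>[OF that]] f[OF that] unfolding is_zN_def jump_integrand_project Y_def[abs_def] by auto
  have sX: "has_stoch_integral M S1 W ?\<Phi> (\<lambda>\<omega>. \<Sum>i\<in>I. X i \<omega>)"
    by (rule gauss.has_stoch_integral_sum[OF I hX])
  have "has_stoch_integral M S2 NI (\<lambda>e. \<Sum>i\<in>I. (\<lambda>(s, u, x). u * projected_flow (\<tau> i) (f i) (s, x)) e) (\<lambda>\<omega>. \<Sum>i\<in>I. Y i \<omega>)"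
    by (rule poisson.has_stoch_integral_sum[OF I hY])
  moreover have "(\<lambda>e. \<Sum>i\<in>I. (\<lambda>(s, u, x). u * projected_flow (\<tau> i) (f i) (s, x)) e) = (\<lambda>(s, u, x). u * ?\<Phi> (s, x))"
    by (auto simp: sum_distrib_left)
  ultimately have sY: "has_stoch_integral M S2 NI (\<lambda>(s, u, x). u * ?\<Phi> (s, x)) (\<lambda>\<omega>. \<Sum>i\<in>I. Y i \<omega>)" by simp
  have \<Phi>: "square_integrable TE ?\<Phi>"
    using I \<tau> f by (induction I rule: finite_induct) (auto intro!: square_integrable_add projected_flow_sq)
  have AE: "AE \<omega> in M. \<forall>i\<in>I. inner (L2_class (\<lambda>y. Z (\<tau> i) (\<omega>, y))) (L2_class (f i)) = X i \<omega> + Y i \<omega>"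
  proof (rule AE_finite_allI[OF I])
    fix i assume i: "i \<in> I"
    show "AE \<omega> in M. inner (L2_class (\<lambda>y. Z (\<tau> i) (\<omega>, y))) (L2_class (f i)) = X i \<omega> + Y i \<omega>"
      using is_Z0_L2_class[OF Z[OF \<tau>[OF i]] is_Z0_Z0[OF \<tau>[OF i]]] Z0_inner[OF \<tau>[OF i] f[OF i]]
      by eventually_elim (simp add: X_def Y_def)
  qed
  have XY: "X i \<in> borel_measurable M" "Y i \<in> borel_measurable M" if "i \<in> I" for i
    using gauss.has_stoch_integral_sq(2)[OF hX[OF that]] poisson.has_stoch_integral_sq(2)[OF hY[OF that]]
    by (simp_all add: square_integrable_def)
  have Lm: "(\<lambda>\<omega>. L2_class (\<lambda>y. Z (\<tau> i) (\<omega>, y))) \<in> borel_measurable M" if "i \<in> I" for i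
    by (rule borel_measurable_L2_class[OF is_Z0_meas[OF Z[OF \<tau>[OF that]]]])
  have "(\<integral>\<omega>. iexp (\<Sum>i\<in>I. inner (L2_class (\<lambda>y. Z (\<tau> i) (\<omega>, y))) (L2_class (f i))) \<partial>M)
    = (\<integral>\<omega>. iexp ((\<Sum>i\<in>I. X i \<omega>) + (\<Sum>i\<in>I. Y i \<omega>)) \<partial>M)"
  proof (rule integral_cong_AE)
    have 1: "(\<lambda>\<omega>. \<Sum>i\<in>I. inner (L2_class (\<lambda>y. Z (\<tau> i) (\<omega>, y))) (L2_class (f i))) \<in> borel_measurable M"
      by (intro borel_measurable_sum borel_measurable_inner Lm borel_measurable_const)
    show "(\<lambda>\<omega>. iexp (\<Sum>i\<in>I. inner (L2_class (\<lambda>y. Z (\<tau> i) (\<omega>, y))) (L2_class (f i)))) \<in> borel_measurable M"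
      by (rule measurable_compose[OF 1]) measurable
    have 2: "(\<lambda>\<omega>. (\<Sum>i\<in>I. X i \<omega>) + (\<Sum>i\<in>I. Y i \<omega>)) \<in> borel_measurable M"
      by (intro borel_measurable_sum borel_measurable_add XY)
    show "(\<lambda>\<omega>. iexp ((\<Sum>i\<in>I. X i \<omega>) + (\<Sum>i\<in>I. Y i \<omega>))) \<in> borel_measurable M"
      by (rule measurable_compose[OF 2]) measurable
    show "AE \<omega> in M. iexp (\<Sum>i\<in>I. inner (L2_class (\<lambda>y. Z (\<tau> i) (\<omega>, y))) (L2_class (f i)))
      = iexp ((\<Sum>i\<in>I. X i \<omega>) + (\<Sum>i\<in>I. Y i \<omega>))"
      using AE
    proof eventually_elim
      case (elim \<omega>)
      have "(\<Sum>i\<in>I. inner (L2_class (\<lambda>y. Z (\<tau> i) (\<omega>, y))) (L2_class (f i))) = (\<Sum>i\<in>I. X i \<omega> + Y i \<omega>)"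
        using elim by (intro sum.cong) auto
      thus ?case by (simp only: sum.distrib)
    qed
  qed
  also have "\<dots> = exp ((\<integral>e. gauss_exponent (?\<Phi> e) \<partial>S1) + (\<integral>e. levy_exponent ((\<lambda>(s, u, x). u * ?\<Phi> (s, x)) e) \<partial>S2))"
    by (rule joint_cf[OF sX sY])
  also have "\<dots> = exp (noise_exponent ?\<Phi>)" unfolding exponent_phi(2)[OF \<Phi>] noise_exponent_def ..
  finally show ?thesis .
qed

end

section \<open>The transition semigroup and the Markov property\<close>

lemma sets_generated:
  "sets (generated M X I) = sigma_sets (space M) {X i -` B \<inter> space M |i B. i \<in> I \<and> B \<in> sets borel}"
  unfolding generated_def by (rule sets_measure_of) auto

text \<open>Borel and weak sigma-algebra coincide by separability; this supplies the generator with
  which characteristic functionals determine finite measures on \<open>L2D\<close>.\<close>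

lemma sets_borel_L2D:
  "sets (borel :: L2D measure) = sigma_sets UNIV {k -` B \<inter> UNIV |k B. k \<in> range (\<lambda>f h. inner h f) \<and> B \<in> sets (borel :: real measure)}"
proof -
  let ?K = "range (\<lambda>f h :: L2D. inner h f)"
  let ?N = "generated borel (\<lambda>k. k) ?K :: L2D measure"
  have k: "(\<lambda>h :: L2D. inner h f) \<in> borel_measurable borel" for f
    by (intro borel_measurable_inner measurable_ident_sets borel_measurable_const) simp
  have "sets ?N \<subseteq> sets borel" by (rule subalgebra_generated) (use k in auto)
  moreover have "sets borel \<subseteq> sets ?N"
  proof
    fix A :: "L2D set" assume A: "A \<in> sets borel"
    have "(\<lambda>h. h) \<in> measurable ?N borel"
      by (rule borel_measurable_L2D_I) (rule generated_measurable[of _ ?K "\<lambda>k. k"], auto)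
    from measurable_sets[OF this A] show "A \<in> sets ?N" by simp
  qed
  ultimately have "sets borel = sets ?N" by blast
  thus ?thesis by (simp only: sets_generated space_borel)
qed

lemma L2D_measure_eqI:
  fixes \<mu> \<nu> :: "L2D measure"
  assumes "finite_measure \<mu>" "finite_measure \<nu>" and s: "sets \<mu> = sets borel" "sets \<nu> = sets borel"
    and cf: "\<And>f. square_integrable lambda_D f \<Longrightarrow> (\<integral>h. iexp (inner h (L2_class f)) \<partial>\<mu>) = (\<integral>h. iexp (inner h (L2_class f)) \<partial>\<nu>)"
  shows "\<mu> = \<nu>"
proof (rule measure_eqI_characteristic_functional[OF assms(1,2), where LL="range (\<lambda>f h. inner h f)" and K="range (\<lambda>f h. inner h f)" and \<Omega>=UNIV])
  show "sets \<mu> = sets \<nu>" using s by simp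
  show "sets \<mu> = sigma_sets UNIV {k -` B \<inter> UNIV |k B. k \<in> range (\<lambda>f h. inner h f) \<and> B \<in> sets borel}"
    unfolding s by (rule sets_borel_L2D)
  fix k :: "L2D \<Rightarrow> real" assume "k \<in> range (\<lambda>f h. inner h f)"
  then obtain f where k: "k = (\<lambda>h. inner h f)" by auto
  have "k \<in> borel_measurable borel" unfolding k
    by (intro borel_measurable_inner measurable_ident_sets borel_measurable_const) simp
  thus "k \<in> borel_measurable \<mu>" using measurable_cong_sets[OF s(1) refl] by blast
  show "(\<lambda>x. r * k x) \<in> range (\<lambda>f h. inner h f)" for r
    by (rule image_eqI[of _ _ "r *\<^sub>R f"]) (auto simp: k)
  obtain f' where "square_integrable lambda_D f'" "L2_class f' = f" by (rule L2_class_obtain)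
  thus "(\<integral>x. iexp (k x) \<partial>\<mu>) = (\<integral>x. iexp (k x) \<partial>\<nu>)" using cf[of f'] by (simp add: k)
  fix k' :: "L2D \<Rightarrow> real" assume "k' \<in> range (\<lambda>f h. inner h f)"
  then obtain f'' where k': "k' = (\<lambda>h. inner h f'')" by auto
  show "(\<lambda>x. k x + k' x) \<in> range (\<lambda>f h. inner h f)"
    by (rule image_eqI[of _ _ "f + f''"]) (auto simp: k k' inner_add_right)
next
  show "(\<lambda>_. 0) \<in> range (\<lambda>f h :: L2D. inner h f)" by (rule image_eqI[of _ _ 0]) auto
qed simp

text \<open>P_t acting on classes. For t \<ge> 0 the result does not depend on the representative,
  since \<open>abm_operator_inner\<close> determines all its inner products.\<close>

definition abm_operator :: "real \<Rightarrow> L2D \<Rightarrow> L2D" where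
  "abm_operator t g = L2_class (abm_semigroup t (SOME f. square_integrable lambda_D f \<and> L2_class f = g))"

lemma abm_operator_inner:
  assumes "0 \<le> t" "square_integrable lambda_D f"
  shows "inner (abm_operator t g) (L2_class f) = inner g (L2_class (abm_semigroup t f))"
proof -
  let ?g = "SOME f. square_integrable lambda_D f \<and> L2_class f = g"
  have "square_integrable lambda_D ?g \<and> L2_class ?g = g" by (rule someI_ex[OF L2_class_surj[of g]])
  thus ?thesis using abm_semigroup_symmetric[OF assms(1,2), of ?g] by (simp add: abm_operator_def)
qed

lemma abm_operator_0: "abm_operator 0 g = g"
proof -
  let ?g = "SOME f. square_integrable lambda_D f \<and> L2_class f = g"
  have "square_integrable lambda_D ?g \<and> L2_class ?g = g" by (rule someI_ex[OF L2_class_surj[of g]])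
  thus ?thesis by (simp add: abm_operator_def abm_semigroup_0)
qed

lemma abm_operator_measurable:
  assumes "0 \<le> t" shows "abm_operator t \<in> borel_measurable borel"
proof (rule borel_measurable_L2D_I)
  fix f assume f: "square_integrable lambda_D f"
  have "(\<lambda>g. inner g (L2_class (abm_semigroup t f))) \<in> borel_measurable borel"
    by (intro borel_measurable_inner measurable_ident_sets borel_measurable_const) simp
  thus "(\<lambda>g. inner (abm_operator t g) (L2_class f)) \<in> borel_measurable borel"
    using abm_operator_inner[OF assms f] by simp
qed

section \<open>The kernels \<open>R\<close> and their semigroup law\<close>

context abm_noise
begin

definition V :: "real \<Rightarrow> 'w \<Rightarrow> L2D" where
  "V t \<omega> = L2_class (\<lambda>y. Z0 t (\<omega>, y))"

definition R :: "real \<Rightarrow> L2D \<Rightarrow> L2D measure" where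
  "R t g = distr M borel (\<lambda>\<omega>. abm_operator t g + V t \<omega>)"

lemma V_measurable: "0 \<le> t \<Longrightarrow> V t \<in> borel_measurable M"
  unfolding V_def[abs_def] by (rule borel_measurable_L2_class[OF is_Z0_meas[OF is_Z0_Z0]])

lemma shifted_measurable: "0 \<le> t \<Longrightarrow> (\<lambda>\<omega>. abm_operator t g + V t \<omega>) \<in> borel_measurable M"
  by (intro borel_measurable_add V_measurable borel_measurable_const)

lemma prob_space_R: "0 \<le> t \<Longrightarrow> prob_space (R t g)"
  unfolding R_def by (rule gauss.prob_space_distr[OF shifted_measurable])

lemma sets_R [simp]: "sets (R t g) = sets borel" and space_R [simp]: "space (R t g) = UNIV"
  by (simp_all add: R_def)

lemma R_kernel: 
  assumes t: "0 \<le> t" shows "R t \<in> borel \<rightarrow>\<^sub>M prob_algebra borel"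
proof (rule measurable_prob_algebraI[OF prob_space_R[OF t]])
  have "(\<lambda>g. distr M borel (\<lambda>\<omega>. abm_operator t g + V t \<omega>)) \<in> borel \<rightarrow>\<^sub>M subprob_algebra borel"
  proof (rule measurable_distr2[where M=M])
    have "(\<lambda>p. abm_operator t (fst p) + V t (snd p)) \<in> borel_measurable (borel \<Otimes>\<^sub>M M)"
      by (intro borel_measurable_add measurable_compose[OF measurable_fst abm_operator_measurable[OF t]]
          measurable_compose[OF measurable_snd V_measurable[OF t]])
    thus "(\<lambda>(g, \<omega>). abm_operator t g + V t \<omega>) \<in> borel_measurable (borel \<Otimes>\<^sub>M M)" by (simp add: case_prod_beta')
    show "(\<lambda>g. M) \<in> borel \<rightarrow>\<^sub>M subprob_algebra M"
      by (rule measurable_const) (simp add: space_subprob_algebra prob_space_imp_subprob_space gauss.prob_space_axioms)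
  qed
  thus "R t \<in> borel \<rightarrow>\<^sub>M subprob_algebra borel" by (simp add: R_def[abs_def])
qed

lemma R_subprob: "0 \<le> t \<Longrightarrow> R t \<in> borel \<rightarrow>\<^sub>M subprob_algebra borel"
  by (rule measurable_prob_algebraD[OF R_kernel])

lemma V_cf:
  assumes "0 \<le> t" "square_integrable lambda_D f"
  shows "(\<integral>\<omega>. iexp (inner (V t \<omega>) (L2_class f)) \<partial>M) = exp (transition_exponent t f)"
  using joint_cf_Z[of Z0 "{()}" "\<lambda>_. t" "\<lambda>_. f"] is_Z0_Z0 assms by (simp add: V_def noise_exponent_projected_flow)

lemma R_cf:
  assumes t: "0 \<le> t" and f: "square_integrable lambda_D f"
  shows "(\<integral>h. iexp (inner h (L2_class f)) \<partial>R t g)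
    = exp (\<i> * complex_of_real (inner g (L2_class (abm_semigroup t f))) + transition_exponent t f)"
proof -
  have im: "(\<lambda>h :: L2D. iexp (inner h (L2_class f))) \<in> borel_measurable borel"
    by (rule measurable_compose[of "\<lambda>h. inner h (L2_class f)" _ borel])
       (intro borel_measurable_inner measurable_ident_sets borel_measurable_const, simp, measurable)
  have "(\<integral>h. iexp (inner h (L2_class f)) \<partial>R t g) = (\<integral>\<omega>. iexp (inner (abm_operator t g + V t \<omega>) (L2_class f)) \<partial>M)"
    unfolding R_def by (rule integral_distr[OF shifted_measurable[OF t] im])
  also have "\<dots> = (\<integral>\<omega>. iexp (inner (abm_operator t g) (L2_class f)) * iexp (inner (V t \<omega>) (L2_class f)) \<partial>M)"
    by (simp only: inner_add_left iexp_add)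
  also have "\<dots> = iexp (inner (abm_operator t g) (L2_class f)) * exp (transition_exponent t f)"
    by (simp add: V_cf[OF t f])
  finally show ?thesis by (simp add: abm_operator_inner[OF t f] exp_add)
qed

lemma R_cf_integrable:
  assumes "0 \<le> t"
  shows "integrable (R t g) (\<lambda>h. iexp (inner h k))"
proof -
  interpret prob_space "R t g" by (rule prob_space_R[OF assms])
  have "(\<lambda>h :: L2D. iexp (inner h k)) \<in> borel_measurable borel"
    by (rule measurable_compose[of "\<lambda>h. inner h k" _ borel])
       (intro borel_measurable_inner measurable_ident_sets borel_measurable_const, simp, measurable)
  hence "(\<lambda>h. iexp (inner h k)) \<in> borel_measurable (R t g)" by (simp add: R_def)
  thus ?thesis by (intro integrable_const_bound[of _ 1]) auto
qed

lemma R_0: "R 0 g = return borel g"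
proof -
  have "AE \<omega> in M. V 0 \<omega> = L2_class (\<lambda>y. 0)"
    unfolding V_def by (rule is_Z0_L2_class[OF is_Z0_Z0 is_Z0_0]) simp
  hence AE: "AE \<omega> in M. abm_operator 0 g + V 0 \<omega> = g" by (simp add: abm_operator_0)
  have "R 0 g = distr M borel (\<lambda>_. g)"
  proof (rule measure_eqI)
    fix A assume "A \<in> sets (R 0 g)"
    hence A: "A \<in> sets borel" by simp
    have "emeasure M ((\<lambda>\<omega>. abm_operator 0 g + V 0 \<omega>) -` A \<inter> space M) = emeasure M ((\<lambda>_. g) -` A \<inter> space M)"
      using AE measurable_sets[OF shifted_measurable[of 0 g] A] measurable_sets[of "\<lambda>_. g" M borel A] A
      by (intro emeasure_eq_AE) auto
    thus "emeasure (R 0 g) A = emeasure (distr M borel (\<lambda>_. g)) A"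
      unfolding R_def emeasure_distr[OF shifted_measurable[OF order_refl] A]
      by (subst emeasure_distr) (use A in simp_all)
  qed simp
  thus ?thesis by simp
qed

text \<open>Integrating out the second step leaves the characteristic functional of the first step
  at P_t f and a constant factor; the exponents then add up by
  \<open>transition_exponent_add\<close>.\<close>

lemma R_semigroup:
  assumes s: "0 \<le> s" and t: "0 \<le> t"
  shows "R (s + t) g = R s g \<bind> R t"
proof (rule L2D_measure_eqI)
  note Rt = R_subprob[OF t]
  have st: "0 \<le> s + t" using s t by simp
  show "finite_measure (R (s + t) g)" using prob_space_R[OF st] by (rule prob_space.finite_measure)
  have Rsp: "R s g \<in> space (prob_algebra borel)" using prob_space_R[OF s] by (simp add: space_prob_algebra)
  show "finite_measure (R s g \<bind> R t)" using prob_space_bind'[OF Rsp R_kernel[OF t]] by (rule prob_space.finite_measure)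
  show sb: "sets (R s g \<bind> R t) = sets borel" by (rule sets_bind'[OF Rsp R_kernel[OF t]])
  show "sets (R (s + t) g) = sets borel" by simp
  fix f assume f: "square_integrable lambda_D f"
  have tf: "square_integrable lambda_D (abm_semigroup t f)" by (rule abm_semigroup_sq[OF t f])
  have Rts: "R t \<in> R s g \<rightarrow>\<^sub>M subprob_algebra borel" using Rt by (simp add: R_def[of s])
  have im: "(\<lambda>h :: L2D. iexp (inner h (L2_class f))) \<in> borel_measurable borel"
    by (rule measurable_compose[of "\<lambda>h. inner h (L2_class f)" _ borel])
       (intro borel_measurable_inner measurable_ident_sets borel_measurable_const, simp, measurable)
  have ib: "integrable (R s g \<bind> R t) (\<lambda>h. iexp (inner h (L2_class f)))"
  proof -
    interpret B: prob_space "R s g \<bind> R t" by (rule prob_space_bind'[OF Rsp R_kernel[OF t]])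
    show ?thesis using im by (intro B.integrable_const_bound[of _ 1]) (auto simp: measurable_cong_sets[OF sb refl])
  qed
  have "(\<integral>h. iexp (inner h (L2_class f)) \<partial>(R s g \<bind> R t)) = (\<integral>g'. (\<integral>h. iexp (inner h (L2_class f)) \<partial>R t g') \<partial>R s g)"
  proof (rule has_integral_kernel_complex(2)[where Q=borel and k="\<lambda>_ h. h"])
    fix q :: "L2D \<Rightarrow> ennreal" assume q: "q \<in> borel_measurable borel"
    show "(\<integral>\<^sup>+h. q h \<partial>(R s g \<bind> R t)) = (\<integral>\<^sup>+g'. (\<integral>\<^sup>+h. q h \<partial>R t g') \<partial>R s g)"
      by (rule nn_integral_bind[OF q Rts])
    show "(\<lambda>g'. \<integral>\<^sup>+h. q h \<partial>R t g') \<in> borel_measurable (R s g)"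
      by (rule measurable_compose[OF Rts nn_integral_measurable_subprob_algebra[OF q]])
  next
    show "integrable (R t p) (\<lambda>u. iexp (inner u (L2_class f)))" for p
      by (rule R_cf_integrable[OF t])
  qed (use sb ib in auto)
  also have "\<dots> = (\<integral>g'. exp (transition_exponent t f) * iexp (inner g' (L2_class (abm_semigroup t f))) \<partial>R s g)"
    unfolding R_cf[OF t f] exp_add by (simp add: mult.commute)
  also have "\<dots> = exp (transition_exponent t f) * (\<integral>g'. iexp (inner g' (L2_class (abm_semigroup t f))) \<partial>R s g)"
    by (rule integral_mult_right_zero)
  also have "\<dots> = exp (transition_exponent t f) * exp (\<i> * complex_of_real (inner g (L2_class (abm_semigroup s (abm_semigroup t f)))) + transition_exponent s (abm_semigroup t f))"
    by (simp add: R_cf[OF s tf])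
  also have "L2_class (abm_semigroup s (abm_semigroup t f)) = L2_class (abm_semigroup (s + t) f)"
    using abm_semigroup_add[OF s t f] by (subst L2_class_eq_iff) (auto intro!: abm_semigroup_sq s t f st AE_I2 simp: add_nonneg_nonneg)
  also have "exp (transition_exponent t f) * exp (\<i> * complex_of_real (inner g (L2_class (abm_semigroup (s + t) f))) + transition_exponent s (abm_semigroup t f))
    = exp (\<i> * complex_of_real (inner g (L2_class (abm_semigroup (s + t) f))) + transition_exponent (s + t) f)"
    unfolding exp_add[symmetric] transition_exponent_add[OF s t f] by (simp add: add_ac)
  also have "\<dots> = (\<integral>h. iexp (inner h (L2_class f)) \<partial>R (s + t) g)" by (rule R_cf[OF st f, symmetric])
  finally show "(\<integral>h. iexp (inner h (L2_class f)) \<partial>R (s + t) g) = (\<integral>h. iexp (inner h (L2_class f)) \<partial>(R s g \<bind> R t))" by simp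
qed

lemma transition_semigroup_R: "transition_semigroup R"
  unfolding transition_semigroup_def using R_kernel R_0 R_semigroup by auto

section \<open>The Markov property of an arbitrary family of versions\<close>

context
  fixes Z :: "real \<Rightarrow> 'w \<times> real \<Rightarrow> real" and X :: "real \<Rightarrow> 'w \<Rightarrow> L2D"
  assumes Z: "\<And>t. 0 \<le> t \<Longrightarrow> is_Z0 M \<eta> c m W N t (Z t)"
  defines "X t \<omega> \<equiv> L2_class (\<lambda>y. Z t (\<omega>, y))"
begin

lemma X_measurable: "0 \<le> t \<Longrightarrow> X t \<in> borel_measurable M"
  unfolding X_def[abs_def] by (rule borel_measurable_L2_class[OF is_Z0_meas[OF Z]])

text \<open>The inner integral over the kernel is explicit: it replaces the value at time t by the
  present value paired with P_(t-s) g, up to a deterministic factor. The exponents of both sides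
  then agree by \<open>noise_exponent_markov\<close>.\<close>

lemma past_future_cf:
  assumes T: "finite T" "T \<subseteq> {0..s}" and st: "0 \<le> s" "s \<le> t"
  shows "(\<integral>\<omega>. iexp ((\<Sum>r\<in>T. inner (X r \<omega>) (\<phi> r)) + inner (X t \<omega>) \<gamma>) \<partial>M)
    = (\<integral>\<omega>. (\<integral>h. iexp ((\<Sum>r\<in>T. inner (X r \<omega>) (\<phi> r)) + inner h \<gamma>) \<partial>R (t - s) (X s \<omega>)) \<partial>M)"
proof -
  obtain f where f: "\<And>r. square_integrable lambda_D (f r)" "\<And>r. L2_class (f r) = \<phi> r"
  proof -
    have "\<forall>r. \<exists>f. square_integrable lambda_D f \<and> L2_class f = \<phi> r" using L2_class_surj by blast
    from choice[OF this] show ?thesis using that by blast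
  qed
  obtain g where g: "square_integrable lambda_D g" "L2_class g = \<gamma>" by (rule L2_class_obtain)
  have ts: "0 \<le> t - s" and t: "0 \<le> t" using st by auto
  have sg: "square_integrable lambda_D (abm_semigroup (t - s) g)" by (rule abm_semigroup_sq[OF ts g(1)])
  have J: "(\<integral>\<omega>. iexp ((\<Sum>r\<in>T. inner (X r \<omega>) (\<phi> r)) + inner (X q \<omega>) (L2_class k)) \<partial>M)
      = exp (noise_exponent (\<lambda>p. (\<Sum>r\<in>T. projected_flow r (f r) p) + projected_flow q k p))"
    if q: "0 \<le> q" and k: "square_integrable lambda_D k" for q k
  proof -
    \<comment> \<open>The time q may itself belong to T with a different functional, so it gets the
      separate index \<open>None\<close>.\<close>
    define I where "I = Some ` T \<union> {None}"
    define \<tau> where "\<tau> i = (case i of Some r \<Rightarrow> r | None \<Rightarrow> q)" for i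
    define F where "F i = (case i of Some r \<Rightarrow> f r | None \<Rightarrow> k)" for i
    have I: "finite I" using T by (simp add: I_def)
    have sumI: "(\<Sum>i\<in>I. H i) = (\<Sum>r\<in>T. H (Some r)) + H None" for H :: "real option \<Rightarrow> real"
      unfolding I_def using T(1) by (simp add: sum.reindex add.commute)
    have "(\<integral>\<omega>. iexp (\<Sum>i\<in>I. inner (L2_class (\<lambda>y. Z (\<tau> i) (\<omega>, y))) (L2_class (F i))) \<partial>M)
      = exp (noise_exponent (\<lambda>p. \<Sum>i\<in>I. projected_flow (\<tau> i) (F i) p))"
      by (rule joint_cf_Z[OF Z I]) (use T(2) q k f(1) in \<open>auto simp: I_def \<tau>_def F_def\<close>)
    thus ?thesis unfolding sumI by (simp only: \<tau>_def F_def option.case X_def f(2))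
  qed
  have "(\<integral>\<omega>. (\<integral>h. iexp ((\<Sum>r\<in>T. inner (X r \<omega>) (\<phi> r)) + inner h \<gamma>) \<partial>R (t - s) (X s \<omega>)) \<partial>M)
    = (\<integral>\<omega>. exp (transition_exponent (t - s) g) * iexp ((\<Sum>r\<in>T. inner (X r \<omega>) (\<phi> r)) + inner (X s \<omega>) (L2_class (abm_semigroup (t - s) g))) \<partial>M)"
  proof (rule Bochner_Integration.integral_cong[OF refl])
    fix \<omega>
    define S where "S = (\<Sum>r\<in>T. inner (X r \<omega>) (\<phi> r))"
    have "(\<integral>h. iexp (S + inner h \<gamma>) \<partial>R (t - s) (X s \<omega>)) = iexp S * (\<integral>h. iexp (inner h (L2_class g)) \<partial>R (t - s) (X s \<omega>))"
      unfolding iexp_add g(2) by (rule integral_mult_right_zero)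
    also have "\<dots> = exp (transition_exponent (t - s) g) * iexp (S + inner (X s \<omega>) (L2_class (abm_semigroup (t - s) g)))"
      unfolding R_cf[OF ts g(1)] iexp_add exp_add by (simp only: mult_ac)
    finally show "(\<integral>h. iexp (S + inner h \<gamma>) \<partial>R (t - s) (X s \<omega>))
      = exp (transition_exponent (t - s) g) * iexp (S + inner (X s \<omega>) (L2_class (abm_semigroup (t - s) g)))" .
  qed
  also have "\<dots> = exp (transition_exponent (t - s) g) * exp (noise_exponent (\<lambda>p. (\<Sum>r\<in>T. projected_flow r (f r) p) + projected_flow s (abm_semigroup (t - s) g) p))"
    unfolding J[OF st(1) sg, symmetric] by (rule integral_mult_right_zero)
  also have "\<dots> = exp (noise_exponent (\<lambda>p. (\<Sum>r\<in>T. projected_flow r (f r) p) + projected_flow t g p))"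
    unfolding noise_exponent_markov[OF T f(1) st g(1)] exp_add by (rule mult.commute)
  also have "\<dots> = (\<integral>\<omega>. iexp ((\<Sum>r\<in>T. inner (X r \<omega>) (\<phi> r)) + inner (X t \<omega>) \<gamma>) \<partial>M)"
    unfolding g(2)[symmetric] by (rule J[OF t g(1), symmetric])
  finally show ?thesis by simp
qed

text \<open>Supplies the generator that the uniqueness theorem requires: inner products with the
  values X r generate the past in the first coordinate, inner products generate the Borel sets in
  the second.\<close>

lemma sets_past_pair:
  fixes s :: real
  defines "G \<equiv> generated M X {0..s}"
  assumes s: "0 \<le> s"
  shows "sets (G \<Otimes>\<^sub>M (borel :: L2D measure)) = sigma_sets (space M \<times> UNIV)
    {k -` B \<inter> (space M \<times> UNIV) |k B. k \<in> {\<lambda>p. inner (X r (fst p)) \<phi> |r \<phi>. r \<in> {0..s}} \<union> {\<lambda>p. inner (snd p) \<gamma> |\<gamma>. True} \<and> B \<in> sets (borel :: real measure)}"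
proof -
  let ?K = "{\<lambda>p. inner (X r (fst p)) \<phi> |r \<phi>. r \<in> {0..s}} \<union> {\<lambda>p. inner (snd p) \<gamma> |\<gamma>. True} :: ('w \<times> L2D \<Rightarrow> real) set"
  let ?P = "G \<Otimes>\<^sub>M (borel :: L2D measure)"
  let ?N = "generated ?P (\<lambda>k. k) ?K"
  have sp: "space ?P = space M \<times> UNIV" by (simp add: space_pair_measure G_def)
  have XG: "X r \<in> borel_measurable G" if "r \<in> {0..s}" for r
    unfolding G_def by (rule generated_measurable[OF that])
  have "sets ?N \<subseteq> sets ?P"
  proof (rule subalgebra_generated)
    fix k assume "k \<in> ?K"
    then consider r \<phi> where "r \<in> {0..s}" "k = (\<lambda>p. inner (X r (fst p)) \<phi>)" | \<gamma> where "k = (\<lambda>p. inner (snd p) \<gamma>)" by blast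
    thus "k \<in> borel_measurable ?P"
    proof cases
      case 1
      thus ?thesis by (auto intro!: borel_measurable_inner measurable_compose[OF measurable_fst XG] borel_measurable_const)
    next
      case 2
      thus ?thesis by (auto intro!: borel_measurable_inner measurable_snd borel_measurable_const)
    qed
  qed
  moreover have "sets ?P \<subseteq> sets ?N"
  proof
    fix A assume A: "A \<in> sets ?P"
    have kN: "k \<in> borel_measurable ?N" if "k \<in> ?K" for k
      using generated_measurable[OF that, of "\<lambda>k. k" ?P] .
    have XN: "(\<lambda>p. X r (fst p)) \<in> borel_measurable ?N" if "r \<in> {0..s}" for r
      by (rule borel_measurable_L2D_I) (rule kN, use that in blast)
    have spN: "space ?N = space M \<times> UNIV" by (simp add: space_generated sp)
    have f1: "fst \<in> measurable ?N G"
    proof (rule measurable_sigma_sets[where \<Omega>="space M"])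
      show "sets G = sigma_sets (space M) {X i -` B \<inter> space M |i B. i \<in> {0..s} \<and> B \<in> sets borel}"
        unfolding G_def by (rule sets_generated)
      show "fst \<in> space ?N \<rightarrow> space M" unfolding spN by auto
      fix Y assume "Y \<in> {X i -` B \<inter> space M |i B. i \<in> {0..s} \<and> B \<in> sets borel}"
      then obtain r B where Y: "Y = X r -` B \<inter> space M" "r \<in> {0..s}" "B \<in> sets borel" by blast
      have "fst -` Y \<inter> space ?N = (\<lambda>p. X r (fst p)) -` B \<inter> space ?N" unfolding spN by (auto simp: Y)
      also have "\<dots> \<in> sets ?N" by (rule measurable_sets[OF XN[OF Y(2)] Y(3)])
      finally show "fst -` Y \<inter> space ?N \<in> sets ?N" .
    qed auto
    have f2: "snd \<in> borel_measurable ?N"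
      by (rule borel_measurable_L2D_I) (rule kN, blast)
    have "(\<lambda>p. (fst p, snd p)) \<in> measurable ?N ?P" by (rule measurable_Pair[OF f1 f2])
    from measurable_sets[OF this A] show "A \<in> sets ?N"
      using sets.sets_into_space[OF A] by (simp add: space_generated Int_absorb2)
  qed
  ultimately have "sets ?P = sets ?N" by blast
  thus ?thesis unfolding sets_generated sp .
qed

text \<open>The first coordinate is \<omega> itself, but with the past sigma-algebra
  \<open>G\<close> only. Equality of the two measures on the product contains the Markov property
  for all past events at once, instead of for finitely many past times.\<close>

lemma past_future_law:
  fixes s t :: real
  defines "G \<equiv> generated M X {0..s}"
  assumes st: "0 \<le> s" "s \<le> t"
  shows "distr M (G \<Otimes>\<^sub>M borel) (\<lambda>\<omega>. (\<omega>, X t \<omega>))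
    = M \<bind> (\<lambda>\<omega>. distr (R (t - s) (X s \<omega>)) (G \<Otimes>\<^sub>M borel) (\<lambda>h. (\<omega>, h)))"
    and "(\<lambda>\<omega>. distr (R (t - s) (X s \<omega>)) (G \<Otimes>\<^sub>M borel) (\<lambda>h. (\<omega>, h))) \<in> M \<rightarrow>\<^sub>M subprob_algebra (G \<Otimes>\<^sub>M borel)"
    and "(\<lambda>\<omega>. (\<omega>, X t \<omega>)) \<in> M \<rightarrow>\<^sub>M G \<Otimes>\<^sub>M borel"
proof -
  let ?P = "G \<Otimes>\<^sub>M (borel :: L2D measure)"
  have ts: "0 \<le> t - s" and t: "0 \<le> t" using st by auto
  have spG: "space G = space M" by (simp add: G_def)
  have sub: "sets G \<subseteq> sets M" unfolding G_def by (rule subalgebra_generated) (auto intro: X_measurable)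
  have idG: "(\<lambda>\<omega>. \<omega>) \<in> measurable M G"
  proof (rule measurableI)
    fix A assume A: "A \<in> sets G"
    have "(\<lambda>\<omega>. \<omega>) -` A \<inter> space M = A" using sets.sets_into_space[OF A] by (auto simp: spG)
    thus "(\<lambda>\<omega>. \<omega>) -` A \<inter> space M \<in> sets M" using sub A by auto
  qed (simp add: spG)
  define \<kappa> where "\<kappa> \<omega> = R (t - s) (X s \<omega>)" for \<omega>
  have \<kappa>: "\<kappa> \<in> M \<rightarrow>\<^sub>M subprob_algebra borel"
    unfolding \<kappa>_def[abs_def] by (rule measurable_compose[OF X_measurable[OF st(1)] R_subprob[OF ts]])
  have p\<kappa>: "prob_space (\<kappa> \<omega>)" "sets (\<kappa> \<omega>) = sets borel" for \<omega>
    unfolding \<kappa>_def using prob_space_R[OF ts] by auto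
  show pair: "(\<lambda>\<omega>. (\<omega>, X t \<omega>)) \<in> M \<rightarrow>\<^sub>M ?P" by (rule measurable_Pair[OF idG X_measurable[OF t]])
  have inM: "(\<lambda>h. (\<omega>, h)) \<in> measurable (\<kappa> \<omega>) ?P" if "\<omega> \<in> space M" for \<omega>
  proof -
    have "(\<lambda>h. (\<omega>, h)) \<in> measurable borel ?P"
      by (rule measurable_Pair1') (use that in \<open>simp add: spG\<close>)
    thus ?thesis by (simp only: measurable_cong_sets[OF p\<kappa>(2) refl])
  qed
  have prodM: "(\<lambda>(\<omega>, h). (\<omega>, h)) \<in> measurable (M \<Otimes>\<^sub>M borel) ?P"
    unfolding case_prod_beta' by (rule measurable_Pair[OF measurable_compose[OF measurable_fst idG] measurable_snd])
  let ?k = "\<lambda>\<omega>. distr (\<kappa> \<omega>) ?P (\<lambda>h. (\<omega>, h))"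
  have k: "?k \<in> M \<rightarrow>\<^sub>M subprob_algebra ?P"
    by (rule measurable_distr2[where M=borel, OF prodM \<kappa>])
  show "(\<lambda>\<omega>. distr (R (t - s) (X s \<omega>)) ?P (\<lambda>h. (\<omega>, h))) \<in> M \<rightarrow>\<^sub>M subprob_algebra ?P"
    using k unfolding \<kappa>_def .
  have kp: "?k \<in> M \<rightarrow>\<^sub>M prob_algebra ?P"
    by (rule measurable_prob_algebraI[OF _ k]) (rule prob_space.prob_space_distr[OF p\<kappa>(1) inM])
  have Mp: "M \<in> space (prob_algebra M)" by (simp add: space_prob_algebra gauss.prob_space_axioms)
  let ?\<mu> = "distr M ?P (\<lambda>\<omega>. (\<omega>, X t \<omega>))" and ?\<nu> = "M \<bind> ?k"
  have p\<nu>: "prob_space ?\<nu>" and s\<nu>: "sets ?\<nu> = sets ?P"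
    using prob_space_bind'[OF Mp kp] sets_bind'[OF Mp kp] by auto
  have p\<mu>: "prob_space ?\<mu>" by (rule gauss.prob_space_distr[OF pair])
  have nn: "(\<integral>\<^sup>+p. q p \<partial>?\<nu>) = (\<integral>\<^sup>+\<omega>. (\<integral>\<^sup>+h. q (\<omega>, h) \<partial>\<kappa> \<omega>) \<partial>M)" if q: "q \<in> borel_measurable ?P" for q
    unfolding nn_integral_bind[OF q k] using inM q by (intro nn_integral_cong nn_integral_distr) auto
  have nnm: "(\<lambda>\<omega>. \<integral>\<^sup>+h. q (\<omega>, h) \<partial>\<kappa> \<omega>) \<in> borel_measurable M" if q: "q \<in> borel_measurable ?P" for q
    by (rule nn_integral_measurable_subprob_algebra2[OF _ \<kappa>])
       (use measurable_compose[OF prodM q] in \<open>simp add: case_prod_beta'\<close>)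
  \<comment> \<open>Finite sums of past functionals plus one functional of the future form a vector
    space, since the index sets of two sums can be joined.\<close>
  define LL :: "('w \<times> L2D \<Rightarrow> real) set"
    where "LL = {\<lambda>p. (\<Sum>r\<in>T. inner (X r (fst p)) (\<phi> r)) + inner (snd p) \<gamma> |T \<phi> \<gamma>. finite T \<and> T \<subseteq> {0..s}}"
  let ?K = "{\<lambda>p. inner (X r (fst p)) \<phi> |r \<phi>. r \<in> {0..s}} \<union> {\<lambda>p. inner (snd p) \<gamma> |\<gamma>. True} :: ('w \<times> L2D \<Rightarrow> real) set"
  have LLI: "(\<lambda>p. (\<Sum>r\<in>T. inner (X r (fst p)) (\<phi> r)) + inner (snd p) \<gamma>) \<in> LL" if "finite T" "T \<subseteq> {0..s}" for T \<phi> \<gamma>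
    unfolding LL_def using that by blast
  have LLm: "l \<in> borel_measurable ?P" if lL: "l \<in> LL" for l
  proof -
    obtain T \<phi> \<gamma> where l: "l = (\<lambda>p. (\<Sum>r\<in>T. inner (X r (fst p)) (\<phi> r)) + inner (snd p) \<gamma>)" "T \<subseteq> {0..s}"
      using lL unfolding LL_def by blast
    have "X r \<in> borel_measurable G" if "r \<in> T" for r
      unfolding G_def by (rule generated_measurable) (use that l(2) in blast)
    thus ?thesis unfolding l(1)
      by (intro borel_measurable_add borel_measurable_sum borel_measurable_inner borel_measurable_const
          measurable_snd measurable_compose[OF measurable_fst]) auto
  qed
  have "?\<mu> = ?\<nu>"
  proof (rule measure_eqI_characteristic_functional[where LL=LL and \<Omega>="space M \<times> UNIV" and K="?K"])
    show "finite_measure ?\<mu>" using p\<mu> by (rule prob_space.finite_measure)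
    show "finite_measure ?\<nu>" using p\<nu> by (rule prob_space.finite_measure)
    show "sets ?\<mu> = sets ?\<nu>" by (simp add: s\<nu>)
    show "sets ?\<mu> = sigma_sets (space M \<times> UNIV) {k -` B \<inter> (space M \<times> UNIV) |k B. k \<in> ?K \<and> B \<in> sets borel}"
      using sets_past_pair[OF st(1)] unfolding G_def by simp
    show "?K \<subseteq> LL"
    proof
      fix k assume "k \<in> ?K"
      then consider r \<phi> where "r \<in> {0..s}" "k = (\<lambda>p. inner (X r (fst p)) \<phi>)" | \<gamma> where "k = (\<lambda>p. inner (snd p) \<gamma>)" by blast
      thus "k \<in> LL"
      proof cases
        case 1
        thus ?thesis using LLI[of "{r}" "\<lambda>_. \<phi>" 0] by simp
      next
        case 2
        thus ?thesis using LLI[of "{}" undefined \<gamma>] by simp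
      qed
    qed
    show "(\<lambda>_. 0) \<in> LL" using LLI[of "{}" undefined 0] by simp
    fix l assume l: "l \<in> LL"
    show "l \<in> borel_measurable ?\<mu>" using LLm[OF l] by simp
    obtain T \<phi> \<gamma> where le: "l = (\<lambda>p. (\<Sum>r\<in>T. inner (X r (fst p)) (\<phi> r)) + inner (snd p) \<gamma>)" and T: "finite T" "T \<subseteq> {0..s}"
      using l unfolding LL_def by blast
    show "(\<lambda>x. a * l x) \<in> LL" for a
    proof -
      have "(\<lambda>x. a * l x) = (\<lambda>p. (\<Sum>r\<in>T. inner (X r (fst p)) (a *\<^sub>R \<phi> r)) + inner (snd p) (a *\<^sub>R \<gamma>))"
        by (simp add: le distrib_left sum_distrib_left)
      thus ?thesis by (simp only: LLI[OF T])
    qed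
    have im: "(\<lambda>p. iexp (l p)) \<in> borel_measurable ?P"
      by (rule measurable_compose[OF LLm[OF l]]) measurable
    have "(\<integral>p. iexp (l p) \<partial>?\<mu>) = (\<integral>\<omega>. iexp ((\<Sum>r\<in>T. inner (X r \<omega>) (\<phi> r)) + inner (X t \<omega>) \<gamma>) \<partial>M)"
      using integral_distr[OF pair im] by (simp only: le fst_conv snd_conv)
    also have "\<dots> = (\<integral>\<omega>. (\<integral>h. iexp (l (\<omega>, h)) \<partial>\<kappa> \<omega>) \<partial>M)"
      unfolding \<kappa>_def le fst_conv snd_conv by (rule past_future_cf[OF T st])
    also have "\<dots> = (\<integral>p. iexp (l p) \<partial>?\<nu>)"
    proof (rule has_integral_kernel_complex(2)[where Q="?P" and k="\<lambda>\<omega> h. (\<omega>, h)", symmetric])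
      show "integrable ?\<nu> (\<lambda>p. iexp (l p))"
      proof -
        interpret B: prob_space ?\<nu> by (rule p\<nu>)
        show ?thesis using im by (intro B.integrable_const_bound[of _ 1]) (auto simp: measurable_cong_sets[OF s\<nu> refl])
      qed
      fix \<omega> assume \<omega>: "\<omega> \<in> space M"
      interpret B: prob_space "\<kappa> \<omega>" by (rule p\<kappa>)
      show "integrable (\<kappa> \<omega>) (\<lambda>u. iexp (l (\<omega>, u)))"
        by (intro B.integrable_const_bound[of _ 1] measurable_compose[OF inM[OF \<omega>] im]) auto
    qed (use nn nnm s\<nu> in auto)
    finally show "(\<integral>p. iexp (l p) \<partial>?\<mu>) = (\<integral>p. iexp (l p) \<partial>?\<nu>)" .
    fix l' assume "l' \<in> LL"
    then obtain T' \<phi>' \<gamma>' where le': "l' = (\<lambda>p. (\<Sum>r\<in>T'. inner (X r (fst p)) (\<phi>' r)) + inner (snd p) \<gamma>')" and T': "finite T'" "T' \<subseteq> {0..s}"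
      unfolding LL_def by blast
    show "(\<lambda>x. l x + l' x) \<in> LL"
    proof -
      \<comment> \<open>Coefficients are extended by 0 to the union of the two index sets and
        added.\<close>
      define \<psi> where "\<psi> r = (if r \<in> T then \<phi> r else 0) + (if r \<in> T' then \<phi>' r else 0)" for r

      have e1: "(\<Sum>r\<in>T \<union> T'. inner (X r w) (if r \<in> T then \<phi> r else 0)) = (\<Sum>r\<in>T. inner (X r w) (\<phi> r))" for w
        using T(1) T'(1) by (intro sum.mono_neutral_cong_right) auto
      have e2: "(\<Sum>r\<in>T \<union> T'. inner (X r w) (if r \<in> T' then \<phi>' r else 0)) = (\<Sum>r\<in>T'. inner (X r w) (\<phi>' r))" for w
        using T(1) T'(1) by (intro sum.mono_neutral_cong_right) auto
      have "(\<lambda>x. l x + l' x) = (\<lambda>p. (\<Sum>r\<in>T \<union> T'. inner (X r (fst p)) (\<psi> r)) + inner (snd p) (\<gamma> + \<gamma>'))"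
        by (simp add: le le' \<psi>_def inner_add_right sum.distrib e1 e2 add_ac)
      thus ?thesis using LLI[of "T \<union> T'" \<psi> "\<gamma> + \<gamma>'"] T T' by (simp only: finite_Un Un_least)
    qed
  qed
  thus "distr M ?P (\<lambda>\<omega>. (\<omega>, X t \<omega>)) = M \<bind> (\<lambda>\<omega>. distr (R (t - s) (X s \<omega>)) ?P (\<lambda>h. (\<omega>, h)))"
    unfolding \<kappa>_def .
qed

text \<open>A conditional expectation is characterised by its integrals over past events A;
  evaluating the identity of laws on the rectangle A \<times> B yields exactly these.\<close>

lemma markov_process_X: "markov_process M R X"
  unfolding markov_process_def
proof (intro conjI allI impI ballI)
  fix t :: real assume "0 \<le> t" thus "X t \<in> M \<rightarrow>\<^sub>M borel" by (rule X_measurable)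
next
  fix s t :: real and B :: "L2D set"
  assume s: "0 \<le> s" and t: "s \<le> t" and B: "B \<in> sets borel"
  define G where "G = generated M X {0..s}"
  note law = past_future_law[OF s t, folded G_def]
  have ts: "0 \<le> t - s" and t0: "0 \<le> t" using s t by auto
  have spG: "space G = space M" by (simp add: G_def)
  have sub: "sets G \<subseteq> sets M" unfolding G_def by (rule subalgebra_generated) (auto intro: X_measurable)
  interpret GM: finite_measure_subalgebra M G
    by unfold_locales (use sub spG in \<open>simp add: subalgebra_def\<close>)
  have XG: "X s \<in> borel_measurable G" unfolding G_def by (rule generated_measurable) (use s in auto)
  have emG: "(\<lambda>\<omega>. emeasure (R (t - s) (X s \<omega>)) B) \<in> borel_measurable G"
    by (rule measurable_compose[OF measurable_compose[OF XG R_subprob[OF ts]] measurable_emeasure_subprob_algebra[OF B]])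
  have gG: "(\<lambda>\<omega>. measure (R (t - s) (X s \<omega>)) B) \<in> borel_measurable G"
    unfolding measure_def by (rule borel_measurable_enn2real[OF emG])
  have gM: "(\<lambda>\<omega>. measure (R (t - s) (X s \<omega>)) B) \<in> borel_measurable M"
    by (rule measurable_from_subalg[OF GM.subalg gG])
  have fM: "(\<lambda>\<omega>. indicator B (X t \<omega>) :: real) \<in> borel_measurable M"
    by (rule measurable_compose[OF X_measurable[OF t0]]) (use B in simp)
  have pR: "prob_space (R (t - s) g)" for g by (rule prob_space_R[OF ts])
  have le1: "measure (R (t - s) g) B \<le> 1" for g by (rule prob_space.prob_le_1[OF pR])
  have fi: "integrable M (\<lambda>\<omega>. indicator B (X t \<omega>) :: real)"
    by (rule gauss.integrable_const_bound[of _ 1]) (use fM in \<open>auto simp: indicator_def\<close>)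
  have gi: "integrable M (\<lambda>\<omega>. measure (R (t - s) (X s \<omega>)) B)"
    by (rule gauss.integrable_const_bound[of _ 1]) (use gM le1 in auto)
  show "AE \<omega> in M. real_cond_exp M (generated M X {0..s}) (\<lambda>\<omega>. indicator B (X t \<omega>)) \<omega> = measure (R (t - s) (X s \<omega>)) B"
    unfolding G_def[symmetric]
  proof (rule GM.real_cond_exp_charact[OF _ fi gi gG])
    fix A assume A: "A \<in> sets G"
    have AM: "A \<in> sets M" using A sub by auto
    have AB: "A \<times> B \<in> sets (G \<Otimes>\<^sub>M borel)" using A B by (rule pair_measureI)
    have Asp: "A \<subseteq> space M" using sets.sets_into_space[OF AM] .
    have "emeasure M (A \<inter> (X t -` B \<inter> space M)) = emeasure (distr M (G \<Otimes>\<^sub>M borel) (\<lambda>\<omega>. (\<omega>, X t \<omega>))) (A \<times> B)"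
      unfolding emeasure_distr[OF law(3) AB] by (rule arg_cong[of _ _ "emeasure M"]) (use Asp in auto)
    also have "\<dots> = (\<integral>\<^sup>+\<omega>. emeasure (distr (R (t - s) (X s \<omega>)) (G \<Otimes>\<^sub>M borel) (\<lambda>h. (\<omega>, h))) (A \<times> B) \<partial>M)"
      unfolding law(1) by (rule emeasure_bind[OF gauss.not_empty law(2) AB])
    also have "\<dots> = (\<integral>\<^sup>+\<omega>. ennreal (indicator A \<omega> * measure (R (t - s) (X s \<omega>)) B) \<partial>M)"
    proof (rule nn_integral_cong)
      fix \<omega> assume \<omega>: "\<omega> \<in> space M"
      interpret r: prob_space "R (t - s) (X s \<omega>)" by (rule pR)
      have "(\<lambda>h. (\<omega>, h)) \<in> measurable borel (G \<Otimes>\<^sub>M borel)"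
        by (rule measurable_Pair1') (use \<omega> in \<open>simp add: spG\<close>)
      hence "(\<lambda>h. (\<omega>, h)) \<in> measurable (R (t - s) (X s \<omega>)) (G \<Otimes>\<^sub>M borel)"
        by (simp only: measurable_cong_sets[OF sets_R refl])
      from emeasure_distr[OF this AB]
      have "emeasure (distr (R (t - s) (X s \<omega>)) (G \<Otimes>\<^sub>M borel) (\<lambda>h. (\<omega>, h))) (A \<times> B)
        = emeasure (R (t - s) (X s \<omega>)) ((\<lambda>h. (\<omega>, h)) -` (A \<times> B) \<inter> UNIV)" by simp
      also have "\<dots> = ennreal (indicator A \<omega> * measure (R (t - s) (X s \<omega>)) B)"
        by (cases "\<omega> \<in> A") (auto simp: vimage_def r.emeasure_eq_measure)
      finally show "emeasure (distr (R (t - s) (X s \<omega>)) (G \<Otimes>\<^sub>M borel) (\<lambda>h. (\<omega>, h))) (A \<times> B)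
        = ennreal (indicator A \<omega> * measure (R (t - s) (X s \<omega>)) B)" .
    qed
    finally have e: "emeasure M (A \<inter> (X t -` B \<inter> space M)) = (\<integral>\<^sup>+\<omega>. ennreal (indicator A \<omega> * measure (R (t - s) (X s \<omega>)) B) \<partial>M)" .
    have gAm: "(\<lambda>\<omega>. indicator A \<omega> * measure (R (t - s) (X s \<omega>)) B) \<in> borel_measurable M"
      using gM AM by (intro borel_measurable_times) auto
    have "(\<integral>\<omega>\<in>A. measure (R (t - s) (X s \<omega>)) B \<partial>M) = enn2real (emeasure M (A \<inter> (X t -` B \<inter> space M)))"
      unfolding e set_lebesgue_integral_def using gAm by (simp add: integral_eq_nn_integral)
    also have "\<dots> = (\<integral>\<omega>. indicator (A \<inter> (X t -` B \<inter> space M)) \<omega> \<partial>M)"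
      using Asp by (simp add: measure_def Int_absorb2 le_infI1)
    also have "\<dots> = (\<integral>\<omega>\<in>A. indicator B (X t \<omega>) \<partial>M)"
      unfolding set_lebesgue_integral_def by (intro Bochner_Integration.integral_cong) (auto simp: indicator_def)
    finally show "(\<integral>\<omega>\<in>A. indicator B (X t \<omega>) \<partial>M) = (\<integral>\<omega>\<in>A. measure (R (t - s) (X s \<omega>)) B \<partial>M)" by simp
  qed
qed

lemma X_0: "AE \<omega> in M. X 0 \<omega> = 0"
  using is_Z0_L2_class[OF Z[OF order_refl] is_Z0_0] by (simp add: X_def)

end

section \<open>Joint measurability\<close>

text \<open>By \<open>Z0_continuity\<close> the fields at the times \<open>dyadic k t\<close> have squared \<open>L\<^sup>2\<close> distance \<open>O(1 / 4 ^ k)\<close> from the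
  field at time \<open>t\<close>, hence they converge to it almost everywhere.\<close>

definition dyadic :: "nat \<Rightarrow> real \<Rightarrow> real" where
  "dyadic k t = real (nat \<lfloor>t * 16 ^ k\<rfloor>) / 16 ^ k"

lemma dyadic:
  assumes "0 \<le> t" shows "0 \<le> dyadic k t" "dyadic k t \<le> t" "t - dyadic k t \<le> (1/16) ^ k"
proof -
  have n: "real (nat \<lfloor>t * 16 ^ k\<rfloor>) = of_int \<lfloor>t * 16 ^ k\<rfloor>" using assms by simp
  have "of_int \<lfloor>t * 16 ^ k\<rfloor> \<le> t * 16 ^ k" "t * 16 ^ k - of_int \<lfloor>t * 16 ^ k\<rfloor> \<le> 1" by linarith+
  thus "0 \<le> dyadic k t" "dyadic k t \<le> t" "t - dyadic k t \<le> (1/16) ^ k"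
    unfolding atomize_conj
  proof -
    let ?n = "of_int \<lfloor>t * 16 ^ k\<rfloor> :: real"
    assume n1: "?n \<le> t * 16 ^ k" and n2: "t * 16 ^ k - ?n \<le> 1"
    have "?n / 16 ^ k \<le> t" using n1 by (simp add: pos_divide_le_eq)
    moreover have "t \<le> (?n + 1) / 16 ^ k" using n2 by (simp add: pos_le_divide_eq)
    hence "t - ?n / 16 ^ k \<le> (1/16) ^ k" by (simp add: add_divide_distrib power_one_over)
    moreover have "0 \<le> ?n / 16 ^ k" using assms by simp
    ultimately show "0 \<le> dyadic k t \<and> dyadic k t \<le> t \<and> t - dyadic k t \<le> (1/16) ^ k"
      unfolding dyadic_def n by simp
  qed
qed

text \<open>The versions \<open>Z0 t\<close> are chosen separately for each t and carry no
  measurability in t. The limit uses them only at the countably many grid times.\<close>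

definition Z0_joint :: "real \<Rightarrow> 'w \<times> real \<Rightarrow> real" where
  "Z0_joint t p = lim (\<lambda>k. Z0 (dyadic k t) p)"

lemma Z0_measurable: "0 \<le> t \<Longrightarrow> Z0 t \<in> borel_measurable (M \<Otimes>\<^sub>M lambda_D)"
  by (rule is_Z0_meas[OF is_Z0_Z0])

lemma Z0_joint_AE:
  assumes t: "0 \<le> t"
  shows "AE p in M \<Otimes>\<^sub>M lambda_D. Z0 t p = Z0_joint t p"
proof -
  note m = Z0_measurable[OF t] Z0_measurable[OF dyadic(1)[OF t]]
  have "AE p in M \<Otimes>\<^sub>M lambda_D. (\<lambda>k. ennreal ((Z0 t p - Z0 (dyadic k t) p)\<^sup>2)) \<longlonglongrightarrow> 0"
  proof (rule L2d_geometric_AE_tendsto[where C="ennreal CZ"])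
    fix k
    have "(\<integral>\<^sup>+p. ennreal ((Z0 t p - Z0 (dyadic k t) p)\<^sup>2) \<partial>(M \<Otimes>\<^sub>M lambda_D)) = L2d (M \<Otimes>\<^sub>M lambda_D) (Z0 (dyadic k t)) (Z0 t)"
      by (simp add: L2d_def power2_commute)
    also have "\<dots> \<le> ennreal (CZ * sqrt (t - dyadic k t))" by (rule Z0_continuity[OF dyadic(1,2)[OF t]])
    \<comment> \<open>The mesh 1 / 16 ^ k is chosen to leave the summable rate 1 / 4 ^ k after the
      square root.\<close>
    also have "\<dots> \<le> ennreal (CZ * (1/4) ^ k)"
    proof (intro ennreal_leI mult_left_mono CZ_nonneg)
      have "sqrt (t - dyadic k t) \<le> sqrt ((1/16) ^ k)" using dyadic(3)[OF t] by simp
      also have "(1/16 :: real) ^ k = ((1/4) ^ k)\<^sup>2" by (simp add: power_mult[symmetric] mult.commute[of k 2] power_mult power_divide)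
      also have "sqrt (((1/4 :: real) ^ k)\<^sup>2) = (1/4) ^ k" by simp
      finally show "sqrt (t - dyadic k t) \<le> (1/4) ^ k" .
    qed
    also have "\<dots> = ennreal CZ * ennreal ((1/4) ^ k)" using CZ_nonneg by (simp add: ennreal_mult)
    finally show "(\<integral>\<^sup>+p. ennreal ((Z0 t p - Z0 (dyadic k t) p)\<^sup>2) \<partial>(M \<Otimes>\<^sub>M lambda_D)) \<le> ennreal CZ * ennreal ((1/4) ^ k)" .
  next
    fix k show "(\<lambda>p. ennreal ((Z0 t p - Z0 (dyadic k t) p)\<^sup>2)) \<in> borel_measurable (M \<Otimes>\<^sub>M lambda_D)"
      using m(1) m(2)[of k] by measurable
  qed simp
  thus ?thesis
  proof eventually_elim
    case (elim p)
    have "(\<lambda>k. (Z0 t p - Z0 (dyadic k t) p)\<^sup>2) \<longlonglongrightarrow> 0"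
      using elim by (simp add: tendsto_ennreal_iff flip: ennreal_0)
    hence "(\<lambda>k. sqrt ((Z0 t p - Z0 (dyadic k t) p)\<^sup>2)) \<longlonglongrightarrow> sqrt 0" by (intro tendsto_intros)
    hence "(\<lambda>k. \<bar>Z0 t p - Z0 (dyadic k t) p\<bar>) \<longlonglongrightarrow> 0" by simp
    hence "(\<lambda>k. Z0 t p - Z0 (dyadic k t) p) \<longlonglongrightarrow> 0" by (rule tendsto_rabs_zero_cancel)
    hence "(\<lambda>k. Z0 t p - (Z0 t p - Z0 (dyadic k t) p)) \<longlonglongrightarrow> Z0 t p - 0" by (intro tendsto_intros)
    hence "(\<lambda>k. Z0 (dyadic k t) p) \<longlonglongrightarrow> Z0 t p" by simp
    thus ?case unfolding Z0_joint_def by (rule limI[symmetric])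
  qed
qed

lemma is_Z0_joint:
  assumes t: "0 \<le> t" shows "is_Z0 M \<eta> c m W N t (Z0_joint t)"
proof (rule is_Z0_cong[OF is_Z0_Z0[OF t] _ Z0_joint_AE[OF t]])
  show "Z0_joint t \<in> borel_measurable (M \<Otimes>\<^sub>M lambda_D)"
    unfolding Z0_joint_def[abs_def] by (rule borel_measurable_lim_metric) (rule Z0_measurable[OF dyadic(1)[OF t]])
qed

text \<open>For fixed k the approximant is piecewise constant in t with countably many values, hence
  jointly measurable. The squared norm at time t is the squared distance from the field at time 0,
  which vanishes, and is therefore at most CZ * sqrt T.\<close>

lemma Z0_joint_joint:
  "square_integrable (restrict_space lborel {0..T} \<Otimes>\<^sub>M (M \<Otimes>\<^sub>M lambda_D)) (\<lambda>(t, \<omega>, y). Z0_joint t (\<omega>, y))"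
proof -
  let ?L = "restrict_space lborel {0..T}" and ?P = "M \<Otimes>\<^sub>M lambda_D"
  interpret P: pair_sigma_finite M lambda_D by (rule pair_sigma_finite_lambda_D[OF gauss.sigma_finite_measure_axioms])

  have idL: "(\<lambda>t. t) \<in> borel_measurable ?L" by (rule measurable_restrict_space1) simp
  have mk: "(\<lambda>q. Z0 (dyadic k (fst q)) (snd q)) \<in> borel_measurable (?L \<Otimes>\<^sub>M ?P)" for k
  proof -
    have z: "(\<lambda>q. Z0 (real i / 16 ^ k) (snd q)) \<in> borel_measurable (?L \<Otimes>\<^sub>M ?P)" for i :: nat
      by (rule measurable_compose[OF measurable_snd Z0_measurable]) simp
    have "(\<lambda>q. fst q) \<in> borel_measurable (?L \<Otimes>\<^sub>M ?P)" by (rule measurable_compose[OF measurable_fst idL])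
    moreover have "(\<lambda>t :: real. nat \<lfloor>t * 16 ^ k\<rfloor>) \<in> measurable borel (count_space UNIV)" by measurable
    ultimately have "(\<lambda>q. nat \<lfloor>fst q * 16 ^ k\<rfloor>) \<in> measurable (?L \<Otimes>\<^sub>M ?P) (count_space UNIV)"
      by (rule measurable_compose)
    from measurable_compose_countable[of "\<lambda>i q. Z0 (real i / 16 ^ k) (snd q)", OF z this]
    show ?thesis by (simp add: dyadic_def)
  qed
  have m: "(\<lambda>q. Z0_joint (fst q) (snd q)) \<in> borel_measurable (?L \<Otimes>\<^sub>M ?P)"
    unfolding Z0_joint_def by (rule borel_measurable_lim_metric[OF mk])
  have "L2d (?L \<Otimes>\<^sub>M ?P) (\<lambda>q. Z0_joint (fst q) (snd q)) (\<lambda>_. 0) = (\<integral>\<^sup>+t. (\<integral>\<^sup>+p. ennreal ((Z0_joint t p)\<^sup>2) \<partial>?P) \<partial>?L)"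
    unfolding L2d_def using sigma_finite_measure.nn_integral_fst[OF P.sigma_finite_measure_axioms, of "\<lambda>q. ennreal ((Z0_joint (fst q) (snd q))\<^sup>2)" ?L] m by simp
  also have "\<dots> \<le> (\<integral>\<^sup>+t. ennreal (CZ * sqrt T) \<partial>?L)"
  proof (rule nn_integral_mono)
    fix t assume "t \<in> space ?L"
    hence t: "0 \<le> t" "t \<le> T" by (auto simp: space_restrict_space)
    have z0: "AE p in ?P. Z0 0 p = 0" using is_Z0_unique[OF is_Z0_Z0 is_Z0_0] by simp
    have "(\<integral>\<^sup>+p. ennreal ((Z0_joint t p)\<^sup>2) \<partial>?P) = L2d ?P (Z0 0) (Z0 t)"
      unfolding L2d_def using z0 Z0_joint_AE[OF t(1)] by (intro nn_integral_cong_AE) (auto elim!: eventually_elim2)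
    also have "\<dots> \<le> ennreal (CZ * sqrt (t - 0))" by (rule Z0_continuity) (use t in auto)
    also have "\<dots> \<le> ennreal (CZ * sqrt T)" using t CZ_nonneg by (intro ennreal_leI mult_left_mono) auto
    finally show "(\<integral>\<^sup>+p. ennreal ((Z0_joint t p)\<^sup>2) \<partial>?P) \<le> ennreal (CZ * sqrt T)" .
  qed
  also have "\<dots> < \<infinity>"
    by (simp add: emeasure_restrict_space space_restrict_space ennreal_mult_less_top emeasure_lborel_Icc_eq)
  finally show ?thesis using m by (simp add: square_integrable_iff_L2d case_prod_beta')
qed

end

theorem theorem4p1:
  fixes M :: "'w measure"
    and \<eta> :: "real measure"
    and c :: "real \<Rightarrow> real"
    and m :: "real \<Rightarrow> real measure"
    and W :: "(real \<times> real) set \<Rightarrow> 'w \<Rightarrow> real"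
    and N :: "'w \<Rightarrow> (real \<times> real \<times> real) measure"
  assumes "prob_space M" and "complete_measure M"
    and "sets \<eta> = sets (restrict_space borel {0<..})" and "finite_measure \<eta>"
    and "c \<in> borel_measurable (restrict_space borel {0<..})"
    and "\<And>x. x > 0 \<Longrightarrow> c x \<ge> 0" and "\<exists>K. \<forall>x>0. c x \<le> K"
    and "square_bounded_kernel m"
    and "white_noise M (noise_covariance c \<eta>) W"
    and "poisson_random_measure M (jump_intensity m \<eta>) N"
    and "prob_space.indep_set M
           (sets (generated M W (finite_measure_sets (noise_covariance c \<eta>))))
           (sets (generated M (\<lambda>A \<omega>. emeasure (N \<omega>) A) (sets (jump_intensity m \<eta>))))"
  shows
    "(\<forall>t\<ge>0. \<exists>z. is_Z0 M \<eta> c m W N t z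
        \<and> (\<forall>z'. is_Z0 M \<eta> c m W N t z' \<longrightarrow> (AE p in M \<Otimes>\<^sub>M lambda_D. z' p = z p)))
     \<and> (\<exists>R :: real \<Rightarrow> L2D \<Rightarrow> L2D measure.
          transition_semigroup R
        \<and> (\<forall>t\<ge>0. \<forall>g f. square_integrable lambda_D f \<longrightarrow>
             (\<integral>h. iexp (inner h (L2_class f)) \<partial>R t g)
             = exp (\<i> * complex_of_real (inner g (L2_class (abm_semigroup t f)))
                    + (LINT s:{0..t}|lborel. (\<integral>x. phi c m x (abm_semigroup s f x) \<partial>\<eta>))))
        \<and> (\<forall>Z. (\<forall>t\<ge>0. is_Z0 M \<eta> c m W N t (Z t)) \<longrightarrow>
             markov_process M R (\<lambda>t \<omega>. L2_class (\<lambda>y. Z t (\<omega>, y)))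
           \<and> (AE \<omega> in M. L2_class (\<lambda>y. Z 0 (\<omega>, y)) = 0)))
     \<and> (\<exists>Z. (\<forall>t\<ge>0. is_Z0 M \<eta> c m W N t (Z t))
          \<and> (\<forall>T>0. square_integrable (restrict_space lborel {0..T} \<Otimes>\<^sub>M (M \<Otimes>\<^sub>M lambda_D))
               (\<lambda>(t, \<omega>, y). Z t (\<omega>, y))))"
proof -
  interpret C: coefficients \<eta> c m
    by (intro coefficients.intro) (use assms in auto)
  have "gauss_noise M (noise_covariance c \<eta>) W"
    by (intro gauss_noise.intro gauss_noise_axioms.intro assms C.sigma_finite_S1)
  moreover have "poisson_noise M (jump_intensity m \<eta>) N"
    by (intro poisson_noise.intro poisson_noise_axioms.intro assms C.sigma_finite_S2)
  ultimately have "driving_noise M (noise_covariance c \<eta>) W (jump_intensity m \<eta>) N"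
    by (rule driving_noise.intro) (intro driving_noise_axioms.intro assms)
  then interpret A: abm_noise M \<eta> c m W N
    by (intro abm_noise.intro C.coefficients_axioms)
  show ?thesis
  \<comment> \<open>\<open>A.R\<close> is built from one chosen version of the field but serves
    every family Z; the jointly measurable family is a second choice of versions.\<close>
  proof (intro conjI allI impI exI[of _ A.R] exI[of _ A.Z0_joint])
    fix t :: real assume "0 \<le> t"
    thus "\<exists>z. is_Z0 M \<eta> c m W N t z \<and> (\<forall>z'. is_Z0 M \<eta> c m W N t z' \<longrightarrow> (AE p in M \<Otimes>\<^sub>M lambda_D. z' p = z p))"
      using A.is_Z0_Z0 A.is_Z0_unique by blast
  next
    show "transition_semigroup A.R" by (rule A.transition_semigroup_R)
  next
    fix t :: real and g f assume "0 \<le> t" "square_integrable lambda_D f"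
    thus "(\<integral>h. iexp (inner h (L2_class f)) \<partial>A.R t g)
             = exp (\<i> * complex_of_real (inner g (L2_class (abm_semigroup t f)))
                    + (LINT s:{0..t}|lborel. (\<integral>x. phi c m x (abm_semigroup s f x) \<partial>\<eta>)))"
      using A.R_cf[of t f g] by (simp add: C.transition_exponent_def)
  next
    fix Z assume Z: "\<forall>t\<ge>0. is_Z0 M \<eta> c m W N t (Z t)"
    show "markov_process M A.R (\<lambda>t \<omega>. L2_class (\<lambda>y. Z t (\<omega>, y)))" by (rule A.markov_process_X) (use Z in blast)
    show "AE \<omega> in M. L2_class (\<lambda>y. Z 0 (\<omega>, y)) = 0" by (rule A.X_0) (use Z in blast)
  next
    fix t :: real assume "0 \<le> t" thus "is_Z0 M \<eta> c m W N t (A.Z0_joint t)" by (rule A.is_Z0_joint)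
  next
    fix T :: real
    show "square_integrable (restrict_space lborel {0..T} \<Otimes>\<^sub>M (M \<Otimes>\<^sub>M lambda_D)) (\<lambda>(t, \<omega>, y). A.Z0_joint t (\<omega>, y))"
      by (rule A.Z0_joint_joint)
  qed
qed

end
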